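(* Let $\varphi\in C^1(\Gamma^b)^3$ be a tangential field satisfying $\varphi=0$ on $\partial\Gamma^b$. Then, for $j=1,2$, the hyper-singular operator $\widetilde N_j$ can be expressed as $$\widetilde N_j(\varphi)(x)=k_j^2\,\nu_x\times\mathbb{B}(x)\int_{\Gamma^b}\widetilde\Phi(k_j,x,y)\mathbb{B}(y)\varphi(y)\,ds_y+\overrightarrow{\mathrm{curl}}_\Gamma\int_{\Gamma^b}\widetilde\Phi(k_j,x,y)\,\mathrm{div}_\Gamma\varphi(y)\,ds_y,\qquad x\in\Gamma^b,$$ where, for a scalar function $u$ and a vector function $v$, $\overrightarrow{\mathrm{curl}}_\Gamma u=\nu\times\nabla_\Gamma u$ and $\mathrm{div}_\Gamma v=\mathrm{div}\,v-\nu\cdot\partial_\nu v$, with surface gradient $\nabla_\Gamma u=\nabla u-\nu\,\partial_\nu u$. The analogous identity (with $j=1$ and $\Gamma^b$ replaced by $\Gamma_*^b$) holds for $\widetilde N_{01}$.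
   Context: Geometry. $\mathbb{R}^3$ is split by a smooth interface $\Gamma$ into an upper layer $\Omega_1$ and a lower layer $\Omega_2$. $\Gamma$ is a local perturbation of a horizontal plane $\Pi=\{x_3=\text{const}\}$. The unit normal $\nu$ on $\Gamma$ points from $\Omega_1$ into $\Omega_2$, so $\nu=(0,0,-1)^\top$ on the flat part. Let $a_l,T_l>0$ ($l=1,2,3$), $B_a=\prod_{l=1}^3(-a_l,a_l)$, $B_{a,T}=\prod_{l=1}^3(-a_l-T_l,a_l+T_l)$, $\Gamma^b=\Gamma\cap B_{a,T}$ with edge $\partial\Gamma^b$. The defect (the non-flat part of $\Gamma$) lies in $B_a$ : there are $0<c_1<a_1$, $0<c_2<a_2$ with $\nu_x=(0,0,-1)^\top$ for all $x\in\Gamma^b$ with $|x_1|>c_1$ or $|x_2|>c_2$, and $|x_3|<a_3$ on $\Gamma^b$. The wavenumbers are $k_j=\omega\sqrt{\mu_j\epsilon_j}>0$. For the half-space problems, $U_0$ is a bounded obstacle with smooth boundary and $\Gamma_*^b=\partial U_0\cup\Gamma^b$. $C^1(\Gamma^b)$ means continuously differentiable up to the edge. Complex stretching. $\widetilde x=(\widetilde x_1,\widetilde x_2,\widetilde x_3)$, $\widetilde x_l=x_l+i\int_0^{x_l}\sigma_l(t)\,dt$, where, for a constant $S>0$ and an integer $P\ge2$, $\sigma_l$ is the even function with $\sigma_l(t)=0$ for $|t|<a_l$, $\sigma_l(t)=S$ for $t>a_l+T_l$, and $\sigma_l(t)=\frac{2Sf_1^P}{f_1^P+f_2^P}$ for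 $a_l\le t\le a_l+T_l$, with $f_1=(\frac12-\frac1P)\bar t^3+\frac{\bar t}{P}+\frac12$, $f_2=1-f_1$, $\bar t=\frac{t-(a_l+T_l)}{T_l}$. Set $\alpha_l(x_l)=1+i\sigma_l(x_l)$, $\mathbb{B}=\mathrm{diag}\{\alpha_1,\alpha_2,\alpha_3\}$, $J=\alpha_1\alpha_2\alpha_3$, $\mathbb{A}=J^{-1}\mathbb{B}^2$. Stretched operators: $\widetilde\nabla v=\mathbb{B}^{-1}\nabla v$, $\widetilde\nabla\times u=J^{-1}\mathbb{B}\,\mathrm{curl}(\mathbb{B}u)$, $\widetilde\nabla\cdot u=J^{-1}\mathrm{div}(J\mathbb{B}^{-1}u)$, $\widetilde\Delta v=J^{-1}\mathrm{div}(\mathbb{A}^{-1}\nabla v)$. The stretched fundamental solution is $$\widetilde\Phi(k,x,y)=\frac{\exp(ik\rho(\widetilde x,\widetilde y))}{4\pi\rho(\widetilde x,\widetilde y)},\qquad \rho(\widetilde x,\widetilde y)=\Big(\sum_{l=1}^3(\widetilde x_l-\widetilde y_l)^2\Big)^{1/2},$$ with the square root branch of nonnegative real part on $\mathbb{C}\setminus(-\infty,0]$. The hyper-singular operator is $$\widetilde N_j(\varphi)(x)=\nu_x\times\mathbb{B}(x)\widetilde\nabla_x\times\widetilde\nabla_x\times\int_{\Gamma^b}\widetilde\Phi(k_j,x,y)\mathbb{B}(y)\varphi(y)\,ds_y,\quad x\in\Gamma^b,$$ and $\widetilde N_{01}$ is defined by the same formula with $j=1$ and $\Gamma^b$ replaced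 by $\Gamma_*^b$. It is understood by writing $\widetilde\nabla\times\widetilde\nabla\times=-\widetilde\Delta+\widetilde\nabla\widetilde\nabla\cdot$ with $-\widetilde\Delta_x\widetilde\Phi(k_j,x,y)=k_j^2\widetilde\Phi(k_j,x,y)$ for $x\neq y$, taking $\widetilde\nabla_x\cdot$ of the integral as a Cauchy principal value integral on the surface, and noting that $\nu_x\times\mathbb{B}(x)\widetilde\nabla_x=\nu_x\times\nabla_x$ involves only tangential derivatives. *)

theory Defs
  imports "HOL-Analysis.Analysis"
begin

section \<open>Smooth surfaces in three-space\<close>

text \<open>
  C^n on an open set \<open>U\<close>: for \<open>Suc n\<close>, the function is differentiable and all its partial
  derivatives are C^n.
\<close>

primrec Ck_on :: "nat \<Rightarrow> 'a::euclidean_space set \<Rightarrow> ('a \<Rightarrow> 'b::real_normed_vector) \<Rightarrow> bool" where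
  "Ck_on 0 U f \<longleftrightarrow> continuous_on U f"
| "Ck_on (Suc n) U f \<longleftrightarrow>
     (\<forall>x\<in>U. f differentiable (at x)) \<and>
     (\<forall>b\<in>Basis. Ck_on n U (\<lambda>x. frechet_derivative f (at x) b))"

definition smooth_on :: "'a::euclidean_space set \<Rightarrow> ('a \<Rightarrow> 'b::real_normed_vector) \<Rightarrow> bool" where
  "smooth_on U f \<longleftrightarrow> (\<forall>n. Ck_on n U f)"

definition param_pd :: "2 \<Rightarrow> (real^2 \<Rightarrow> real^3) \<Rightarrow> real^2 \<Rightarrow> real^3" where
  "param_pd i r u = frechet_derivative r (at u) (axis i 1)"

definition local_param :: "(real^3) set \<Rightarrow> (real^2) set \<Rightarrow> (real^2 \<Rightarrow> real^3) \<Rightarrow> bool" where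
  "local_param S W r \<longleftrightarrow>
     open W \<and> smooth_on W r \<and> openin (top_of_set S) (r ` W) \<and>
     (\<exists>g. homeomorphism W (r ` W) r g) \<and>
     (\<forall>u\<in>W. cross3 (param_pd 1 r u) (param_pd 2 r u) \<noteq> 0)"

definition smooth_surface :: "(real^3) set \<Rightarrow> bool" where
  "smooth_surface S \<longleftrightarrow> (\<forall>x\<in>S. \<exists>W r. local_param S W r \<and> x \<in> r ` W)"

definition unit_normal :: "(real^3) set \<Rightarrow> (real^3 \<Rightarrow> real^3) \<Rightarrow> bool" where
  "unit_normal S \<nu> \<longleftrightarrow>
     (\<forall>x\<in>S. norm (\<nu> x) = 1) \<and>
     (\<forall>W r. local_param S W r \<longrightarrow> (\<forall>u\<in>W. \<forall>i. \<nu> (r u) \<bullet> param_pd i r u = 0))"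

text \<open>
  The surface measure \<open>ds\<close>: the Borel measure that vanishes off \<open>S\<close> and is given in every local
  parametrization by the area element.  On a smooth surface, area elements of overlapping
  parametrizations agree and countably many parametrizations cover \<open>S\<close>, so there is exactly one
  such measure.
\<close>

definition is_surface_measure :: "(real^3) set \<Rightarrow> (real^3) measure \<Rightarrow> bool" where
  "is_surface_measure S M \<longleftrightarrow>
     sets M = sets borel \<and> emeasure M (- S) = 0 \<and>
     (\<forall>W r. local_param S W r \<longrightarrow>
        (\<forall>E\<in>sets borel. E \<subseteq> r ` W \<longrightarrow>
           emeasure M E =
             (\<integral>\<^sup>+u. ennreal (norm (cross3 (param_pd 1 r u) (param_pd 2 r u)))
                 * indicator {u\<in>W. r u \<in> E} u \<partial>lborel)))"

definition surface_measure :: "(real^3) set \<Rightarrow> (real^3) measure" where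
  "surface_measure S = (THE M. is_surface_measure S M)"

text \<open>
  Boundary points missing from a relatively open piece of a closed surface.
\<close>

definition edge :: "(real^3) set \<Rightarrow> (real^3) set" where
  "edge S = closure S - S"

text \<open>
  Continuously differentiable up to the edge: restriction to \<open>closure S\<close> of a C^1 field defined
  near \<open>closure S\<close>.
\<close>

definition C1_up_to_edge :: "(real^3) set \<Rightarrow> (real^3 \<Rightarrow> complex^3) \<Rightarrow> bool" where
  "C1_up_to_edge S \<phi> \<longleftrightarrow>
     (\<exists>U F. open U \<and> closure S \<subseteq> U \<and> Ck_on 1 U F \<and> (\<forall>x\<in>closure S. F x = \<phi> x))"


section \<open>Complex vectors and surface differential operators\<close>

definition cvec :: "real^3 \<Rightarrow> complex^3" where
  "cvec v = (\<chi> l. complex_of_real (v $ l))"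

text \<open>Bilinear, without complex conjugation.\<close>

definition cdot :: "complex^3 \<Rightarrow> complex^3 \<Rightarrow> complex" where
  "cdot v w = (\<Sum>l\<in>UNIV. v $ l * w $ l)"

definition ccross :: "complex^3 \<Rightarrow> complex^3 \<Rightarrow> complex^3" where
  "ccross v w = vector [v $ 2 * w $ 3 - v $ 3 * w $ 2,
                        v $ 3 * w $ 1 - v $ 1 * w $ 3,
                        v $ 1 * w $ 2 - v $ 2 * w $ 1]"

definition tangential :: "(real^3) set \<Rightarrow> (real^3 \<Rightarrow> real^3) \<Rightarrow> (real^3 \<Rightarrow> complex^3) \<Rightarrow> bool" where
  "tangential S \<nu> \<phi> \<longleftrightarrow> (\<forall>x\<in>S. cdot (cvec (\<nu> x)) (\<phi> x) = 0)"

text \<open>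
  Functions on a surface are differentiated within the surface.  A derivative at \<open>x\<close> within \<open>S\<close> is
  determined only on the tangent plane, and choosing one amounts to choosing an extension off \<open>S\<close>.
  Neither the surface gradient and surface divergence below nor \<open>\<nu> \<times> \<nabla>u\<close> depend on this choice.
\<close>

definition grad_on :: "(real^3) set \<Rightarrow> (real^3 \<Rightarrow> complex) \<Rightarrow> real^3 \<Rightarrow> complex^3" where
  "grad_on S u x = (\<chi> l. frechet_derivative u (at x within S) (axis l 1))"

definition surf_grad ::
  "(real^3) set \<Rightarrow> (real^3 \<Rightarrow> real^3) \<Rightarrow> (real^3 \<Rightarrow> complex) \<Rightarrow> real^3 \<Rightarrow> complex^3" where
  "surf_grad S \<nu> u x =
     grad_on S u x - frechet_derivative u (at x within S) (\<nu> x) *s cvec (\<nu> x)"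

definition surf_curl ::
  "(real^3) set \<Rightarrow> (real^3 \<Rightarrow> real^3) \<Rightarrow> (real^3 \<Rightarrow> complex) \<Rightarrow> real^3 \<Rightarrow> complex^3" where
  "surf_curl S \<nu> u x = ccross (cvec (\<nu> x)) (surf_grad S \<nu> u x)"

definition surf_div ::
  "(real^3) set \<Rightarrow> (real^3 \<Rightarrow> real^3) \<Rightarrow> (real^3 \<Rightarrow> complex^3) \<Rightarrow> real^3 \<Rightarrow> complex" where
  "surf_div S \<nu> v x =
     (\<Sum>l\<in>UNIV. frechet_derivative v (at x within S) (axis l 1) $ l)
     - cdot (cvec (\<nu> x)) (frechet_derivative v (at x within S) (\<nu> x))"


section \<open>Complex stretching\<close>

definition pml_f1 :: "nat \<Rightarrow> real \<Rightarrow> real" where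
  "pml_f1 P s = (1/2 - 1 / real P) * s ^ 3 + s / real P + 1/2"

definition pml_sigma :: "real \<Rightarrow> real \<Rightarrow> real \<Rightarrow> nat \<Rightarrow> real \<Rightarrow> real" where
  "pml_sigma a T S P t =
     (if \<bar>t\<bar> < a then 0
      else if \<bar>t\<bar> \<le> a + T then
        (let f1 = pml_f1 P ((\<bar>t\<bar> - (a + T)) / T); f2 = 1 - f1
         in 2 * S * f1 ^ P / (f1 ^ P + f2 ^ P))
      else S)"

text \<open>
  The stretched objects take the family of profiles \<open>\<sigma> l\<close>, \<open>l = 1,2,3\<close>, as a parameter.  The
  interval integral below is oriented, hence negative of the integral over \<open>[x\<^sub>l, 0]\<close> if \<open>x\<^sub>l < 0\<close>.
\<close>

definition stretch :: "(3 \<Rightarrow> real \<Rightarrow> real) \<Rightarrow> real^3 \<Rightarrow> complex^3" where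
  "stretch \<sigma> x =
     (\<chi> l. complex_of_real (x $ l)
          + \<i> * complex_of_real (interval_lebesgue_integral lborel 0 (ereal (x $ l)) (\<sigma> l)))"

definition alpha :: "(3 \<Rightarrow> real \<Rightarrow> real) \<Rightarrow> 3 \<Rightarrow> real^3 \<Rightarrow> complex" where
  "alpha \<sigma> l x = 1 + \<i> * complex_of_real (\<sigma> l (x $ l))"

definition Bmat :: "(3 \<Rightarrow> real \<Rightarrow> real) \<Rightarrow> real^3 \<Rightarrow> complex^3^3" where
  "Bmat \<sigma> x = (\<chi> i j. if i = j then alpha \<sigma> i x else 0)"

definition Jac :: "(3 \<Rightarrow> real \<Rightarrow> real) \<Rightarrow> real^3 \<Rightarrow> complex" where
  "Jac \<sigma> x = alpha \<sigma> 1 x * alpha \<sigma> 2 x * alpha \<sigma> 3 x"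

definition Amat :: "(3 \<Rightarrow> real \<Rightarrow> real) \<Rightarrow> real^3 \<Rightarrow> complex^3^3" where
  "Amat \<sigma> x = mat (inverse (Jac \<sigma> x)) ** (Bmat \<sigma> x ** Bmat \<sigma> x)"

definition pd :: "3 \<Rightarrow> (real^3 \<Rightarrow> complex) \<Rightarrow> real^3 \<Rightarrow> complex" where
  "pd l f x = vector_derivative (\<lambda>t. f (x + t *\<^sub>R axis l 1)) (at 0)"

definition grad :: "(real^3 \<Rightarrow> complex) \<Rightarrow> real^3 \<Rightarrow> complex^3" where
  "grad f x = (\<chi> l. pd l f x)"

definition div3 :: "(real^3 \<Rightarrow> complex^3) \<Rightarrow> real^3 \<Rightarrow> complex" where
  "div3 F x = (\<Sum>l\<in>UNIV. pd l (\<lambda>z. F z $ l) x)"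

definition sdiv :: "(3 \<Rightarrow> real \<Rightarrow> real) \<Rightarrow> (real^3 \<Rightarrow> complex^3) \<Rightarrow> real^3 \<Rightarrow> complex" where
  "sdiv \<sigma> u x =
     inverse (Jac \<sigma> x) * div3 (\<lambda>z. Jac \<sigma> z *s (matrix_inv (Bmat \<sigma> z) *v u z)) x"

definition slap :: "(3 \<Rightarrow> real \<Rightarrow> real) \<Rightarrow> (real^3 \<Rightarrow> complex) \<Rightarrow> real^3 \<Rightarrow> complex" where
  "slap \<sigma> v x =
     inverse (Jac \<sigma> x) * div3 (\<lambda>z. matrix_inv (Amat \<sigma> z) *v grad v z) x"

definition sgrad_on ::
  "(3 \<Rightarrow> real \<Rightarrow> real) \<Rightarrow> (real^3) set \<Rightarrow> (real^3 \<Rightarrow> complex) \<Rightarrow> real^3 \<Rightarrow> complex^3" where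
  "sgrad_on \<sigma> S u x = matrix_inv (Bmat \<sigma> x) *v grad_on S u x"

definition rho :: "complex^3 \<Rightarrow> complex^3 \<Rightarrow> complex" where
  "rho X Y = csqrt (\<Sum>l\<in>UNIV. (X $ l - Y $ l)\<^sup>2)"

definition Phi :: "(3 \<Rightarrow> real \<Rightarrow> real) \<Rightarrow> real \<Rightarrow> real^3 \<Rightarrow> real^3 \<Rightarrow> complex" where
  "Phi \<sigma> k x y =
     exp (\<i> * complex_of_real k * rho (stretch \<sigma> x) (stretch \<sigma> y))
     / (4 * complex_of_real pi * rho (stretch \<sigma> x) (stretch \<sigma> y))"


section \<open>The hyper-singular operator\<close>

text \<open>
  Write \<open>V(x) = \<integral> \<Phi>(k,x,y) B(y) \<phi>(y) ds\<^sub>y\<close>.  The expression \<open>\<nu> \<times> B (curl curl V)\<close>, with stretched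
  curls, is read on the surface through \<open>curl curl = - \<Delta> + grad div\<close> (all stretched): the
  Laplacian acts on the weakly singular kernel for \<open>x \<noteq> y\<close>, the divergence is taken under the
  integral as a Cauchy principal value, and the remaining gradient, which occurs only in the
  tangential combination \<open>\<nu> \<times> \<nabla>\<close>, is taken along the surface.
\<close>

definition lap_kernel ::
  "(3 \<Rightarrow> real \<Rightarrow> real) \<Rightarrow> real \<Rightarrow> (real^3 \<Rightarrow> complex^3) \<Rightarrow> real^3 \<Rightarrow> real^3 \<Rightarrow> complex^3" where
  "lap_kernel \<sigma> k \<phi> x y = slap \<sigma> (\<lambda>z. Phi \<sigma> k z y) x *s (Bmat \<sigma> y *v \<phi> y)"

definition div_kernel ::
  "(3 \<Rightarrow> real \<Rightarrow> real) \<Rightarrow> real \<Rightarrow> (real^3 \<Rightarrow> complex^3) \<Rightarrow> real^3 \<Rightarrow> real^3 \<Rightarrow> complex" where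
  "div_kernel \<sigma> k \<phi> x y = sdiv \<sigma> (\<lambda>z. Phi \<sigma> k z y *s (Bmat \<sigma> y *v \<phi> y)) x"

definition has_pv_integral ::
  "(real^3) set \<Rightarrow> (real^3 \<Rightarrow> complex) \<Rightarrow> real^3 \<Rightarrow> complex \<Rightarrow> bool" where
  "has_pv_integral S f x L \<longleftrightarrow>
     (\<forall>\<epsilon>>0. set_integrable (surface_measure S) (S - ball x \<epsilon>) f) \<and>
     ((\<lambda>\<epsilon>. LINT y:(S - ball x \<epsilon>)|surface_measure S. f y) \<longlongrightarrow> L) (at_right 0)"

definition pv_integral :: "(real^3) set \<Rightarrow> (real^3 \<Rightarrow> complex) \<Rightarrow> real^3 \<Rightarrow> complex" where
  "pv_integral S f x = (THE L. has_pv_integral S f x L)"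

definition pv_div ::
  "(3 \<Rightarrow> real \<Rightarrow> real) \<Rightarrow> real \<Rightarrow> (real^3) set \<Rightarrow> (real^3 \<Rightarrow> complex^3) \<Rightarrow> real^3 \<Rightarrow> complex" where
  "pv_div \<sigma> k S \<phi> x = pv_integral S (div_kernel \<sigma> k \<phi> x) x"

definition hypersing ::
  "(3 \<Rightarrow> real \<Rightarrow> real) \<Rightarrow> real \<Rightarrow> (real^3) set \<Rightarrow> (real^3 \<Rightarrow> real^3) \<Rightarrow> (real^3 \<Rightarrow> complex^3)
    \<Rightarrow> real^3 \<Rightarrow> complex^3" where
  "hypersing \<sigma> k S \<nu> \<phi> x =
     ccross (cvec (\<nu> x))
       (Bmat \<sigma> x *v
          (- (LINT y:S|surface_measure S. lap_kernel \<sigma> k \<phi> x y)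
           + sgrad_on \<sigma> S (pv_div \<sigma> k S \<phi>) x))"

text \<open>
  Everything in \<open>hypersing\<close> is defined at \<open>x\<close>, except possibly the outer surface derivative.
\<close>

definition hypersing_converges ::
  "(3 \<Rightarrow> real \<Rightarrow> real) \<Rightarrow> real \<Rightarrow> (real^3) set \<Rightarrow> (real^3 \<Rightarrow> complex^3) \<Rightarrow> real^3 \<Rightarrow> bool" where
  "hypersing_converges \<sigma> k S \<phi> x \<longleftrightarrow>
     set_integrable (surface_measure S) S (lap_kernel \<sigma> k \<phi> x) \<and>
     (\<exists>L. has_pv_integral S (div_kernel \<sigma> k \<phi> x) x L)"

definition vec_layer ::
  "(3 \<Rightarrow> real \<Rightarrow> real) \<Rightarrow> real \<Rightarrow> (real^3) set \<Rightarrow> (real^3 \<Rightarrow> complex^3) \<Rightarrow> real^3 \<Rightarrow> complex^3" where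
  "vec_layer \<sigma> k S \<phi> x = (LINT y:S|surface_measure S. Phi \<sigma> k x y *s (Bmat \<sigma> y *v \<phi> y))"

definition scal_layer ::
  "(3 \<Rightarrow> real \<Rightarrow> real) \<Rightarrow> real \<Rightarrow> (real^3) set \<Rightarrow> (real^3 \<Rightarrow> complex) \<Rightarrow> real^3 \<Rightarrow> complex" where
  "scal_layer \<sigma> k S \<psi> x = (LINT y:S|surface_measure S. Phi \<sigma> k x y * \<psi> y)"

definition layers_converge ::
  "(3 \<Rightarrow> real \<Rightarrow> real) \<Rightarrow> real \<Rightarrow> (real^3) set \<Rightarrow> (real^3 \<Rightarrow> real^3) \<Rightarrow> (real^3 \<Rightarrow> complex^3)
    \<Rightarrow> real^3 \<Rightarrow> bool" where
  "layers_converge \<sigma> k S \<nu> \<phi> x \<longleftrightarrow>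
     set_integrable (surface_measure S) S (\<lambda>y. Phi \<sigma> k x y *s (Bmat \<sigma> y *v \<phi> y)) \<and>
     set_integrable (surface_measure S) S (\<lambda>y. Phi \<sigma> k x y * surf_div S \<nu> \<phi> y)"


section \<open>Geometry\<close>

definition plane :: "real \<Rightarrow> (real^3) set" where
  "plane h = {x. x $ 3 = h}"

text \<open>
  The interface \<open>\<Gamma>\<close> separates the upper layer \<open>\<Omega>1\<close> from the lower layer \<open>\<Omega>2\<close> and coincides with
  the plane at height \<open>h\<close> outside the open box with half-lengths \<open>a\<close>.
\<close>

definition layered ::
  "real^3 \<Rightarrow> real \<Rightarrow> (real^3) set \<Rightarrow> (real^3) set \<Rightarrow> (real^3) set \<Rightarrow> bool" where
  "layered a h \<Gamma> \<Omega>1 \<Omega>2 \<longleftrightarrow>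
     smooth_surface \<Gamma> \<and> open \<Omega>1 \<and> open \<Omega>2 \<and>
     \<Omega>1 \<inter> \<Omega>2 = {} \<and> \<Omega>1 \<union> \<Omega>2 = - \<Gamma> \<and> frontier \<Omega>1 = \<Gamma> \<and> frontier \<Omega>2 = \<Gamma> \<and>
     (\<exists>R. {x. x $ 3 > R} \<subseteq> \<Omega>1 \<and> {x. x $ 3 < - R} \<subseteq> \<Omega>2) \<and>
     \<Gamma> - box (- a) a = plane h - box (- a) a"

definition points_into ::
  "(real^3) set \<Rightarrow> (real^3) set \<Rightarrow> (real^3) set \<Rightarrow> (real^3 \<Rightarrow> real^3) \<Rightarrow> bool" where
  "points_into \<Gamma> \<Omega>1 \<Omega>2 \<nu> \<longleftrightarrow>
     (\<forall>x\<in>\<Gamma>. \<forall>\<^sub>F t in at_right 0. x - t *\<^sub>R \<nu> x \<in> \<Omega>1 \<and> x + t *\<^sub>R \<nu> x \<in> \<Omega>2)"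

end

theory Submission
  imports Defs
begin

text \<open>
  Let \<open>X\<close> and \<open>Y\<close> be the stretched images of \<open>x\<close> and \<open>y\<close>.  The kernel \<open>\<Phi>\<close> is a function of
  \<open>Q = \<Sum>l (X\<^sub>l - Y\<^sub>l)\<^sup>2\<close> alone, and \<open>X\<^sub>l\<close> depends on \<open>x\<^sub>l\<close> only, with derivative \<open>\<alpha>\<^sub>l(x)\<close>.  Therefore
  \<open>(1/\<alpha>\<^sub>l(x)) \<partial>\<Phi>/\<partial>x\<^sub>l = - (1/\<alpha>\<^sub>l(y)) \<partial>\<Phi>/\<partial>y\<^sub>l\<close>.  In the stretched variables \<open>\<Phi>\<close> is the radial solution
  of the Helmholtz equation, so minus the stretched Laplacian of \<open>\<Phi>\<close> is \<open>k\<^sup>2 \<Phi>\<close> (\<open>slap_Phi\<close>); this is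
  the first term of the formula.  In the stretched divergence of \<open>\<Phi>(x,y) B(y) \<phi>(y)\<close> the factors
  \<open>\<alpha>\<^sub>l(y)\<close> of \<open>B(y)\<close> cancel, and what remains is \<open>- \<nabla>\<^sub>y \<Phi> \<bullet> \<phi>(y)\<close> (\<open>div_kernel_eq\<close>).

  What is left is an integration by parts on the surface: the principal value of the integral of
  \<open>- \<nabla>\<^sub>y \<Phi> \<bullet> \<phi>\<close> is the integral of \<open>\<Phi> div \<phi>\<close>, with the surface divergence (\<open>pv_eq_scal_layer\<close>).
  Multiply \<open>\<Phi>\<close> by a smooth cutoff that removes the ball of radius \<open>e\<close> about \<open>x\<close> and apply the
  divergence theorem on the surface (\<open>pv_identity\<close>).  Since \<open>\<Phi>\<close> is \<open>O(1/|x - y|)\<close>, the main term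
  converges to the scalar layer.  The two error terms, one from the gradient of the cutoff and one
  from replacing the smooth cutoff by the sharp one, are integrals over an annulus of radius
  comparable to \<open>e\<close> of functions whose leading part at \<open>x\<close> is odd and homogeneous of degree
  \<open>-2\<close>; they tend to zero by symmetry (\<open>annulus_integral_vanishes\<close>).  At the edge of the surface
  no boundary term appears, because \<open>\<phi>\<close> vanishes there at least linearly while the gradients of the
  cutoffs near the edge grow only like the inverse width of the strip (\<open>weak_div_\<Gamma>b\<close>); the boundary of the
  obstacle is compact and has no edge (\<open>weak_div_compact\<close>).

  Consequently the principal value and the scalar layer are one and the same function on the
  surface.  Their derivatives along the surface exist at the same points and agree, and the
  cancellations \<open>B B\<^sup>-\<^sup>1 = 1\<close> and \<open>\<nu> \<times> \<nu> = 0\<close> give the theorem (\<open>hypersingular_identity\<close>).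

  Two foundations carry this argument.  The surface measure is given by a description, so it must
  be shown that exactly one such measure exists; this rests on the change of variables between
  charts (\<open>chart_measures_agree\<close>, \<open>is_surface_measure_ex1\<close>).  In a chart, the area element times the
  surface divergence of a tangential field is an ordinary two-dimensional divergence
  (\<open>chart_divergence\<close>), and cutting the field into pieces supported in charts yields the
  divergence theorem (\<open>divergence_theorem\<close>).
\<close>

section \<open>Calculus in local parametrizations\<close>

lemma bounded_bilinear_cross3: "bounded_bilinear cross3"
proof -
  have "bilinear cross3" by (rule bilinear_cross)
  then show ?thesis by (simp add: bilinear_conv_bounded_bilinear)
qed

lemmas has_derivative_cross3 = bounded_bilinear.FDERIV[OF bounded_bilinear_cross3]

lemma real2_eq: "h = h $ 1 *\<^sub>R axis 1 1 + h $ 2 *\<^sub>R axis 2 (1::real)" for h :: "real^2"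
  by (simp add: vec_eq_iff forall_2 axis_def)

lemma Ck_on_1D:
  assumes "Ck_on 1 U F"
  shows "x \<in> U \<Longrightarrow> (F has_derivative frechet_derivative F (at x)) (at x)"
    and "b \<in> Basis \<Longrightarrow> continuous_on U (\<lambda>x. frechet_derivative F (at x) b)"
  using assms frechet_derivative_works by auto

lemma smooth_on_Ck: "smooth_on W r \<Longrightarrow> Ck_on n W r"
  by (simp add: smooth_on_def)

lemma smooth_on_pd: "smooth_on W r \<Longrightarrow> smooth_on W (param_pd i r)"
  unfolding smooth_on_def param_pd_def[abs_def]
  by (metis Ck_on.simps(2) axis_in_Basis_iff Basis_real_def insertI1)

lemma smooth_on_has_derivative:
  fixes r :: "real^2 \<Rightarrow> real^3"
  assumes "smooth_on W r" "u \<in> W"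
  shows "(r has_derivative (\<lambda>h. h $ 1 *\<^sub>R param_pd 1 r u + h $ 2 *\<^sub>R param_pd 2 r u)) (at u)"
proof -
  have "r differentiable (at u)" using smooth_on_Ck[OF assms(1), of 1] assms(2) by auto
  then have d: "(r has_derivative frechet_derivative r (at u)) (at u)"
    by (simp add: frechet_derivative_works)
  then have lin: "linear (frechet_derivative r (at u))"
    by (simp add: has_derivative_linear)
  have "frechet_derivative r (at u) h = h $ 1 *\<^sub>R param_pd 1 r u + h $ 2 *\<^sub>R param_pd 2 r u" for h
    unfolding param_pd_def
    by (subst real2_eq[of h]) (simp only: linear_add[OF lin] linear_cmul[OF lin])
  then have "frechet_derivative r (at u) = (\<lambda>h. h $ 1 *\<^sub>R param_pd 1 r u + h $ 2 *\<^sub>R param_pd 2 r u)"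
    by blast
  with d show ?thesis by simp
qed

lemma smooth_on_continuous: "smooth_on W r \<Longrightarrow> continuous_on W r"
  using smooth_on_Ck[of W r 0] by simp

text \<open>
  The second difference of \<open>g\<close> over a small square is, by two applications of the mean value
  theorem in either order, the squared side length times \<open>g12\<close> at one point of the square and times
  \<open>g21\<close> at another; continuity then forces the values at \<open>u\<close> to coincide.
\<close>

lemma symmetric_second_partials:
  fixes g g1 g2 :: "real^2 \<Rightarrow> real"
  assumes W: "open W" "u \<in> W"
    and g: "\<And>w. w \<in> W \<Longrightarrow> (g has_derivative (\<lambda>h. h $ 1 * g1 w + h $ 2 * g2 w)) (at w)"
    and g1: "\<And>w. w \<in> W \<Longrightarrow> (g1 has_derivative (\<lambda>h. h $ 1 * g11 w + h $ 2 * g12 w)) (at w)"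
    and g2: "\<And>w. w \<in> W \<Longrightarrow> (g2 has_derivative (\<lambda>h. h $ 1 * g21 w + h $ 2 * g22 w)) (at w)"
    and c: "continuous_on W g12" "continuous_on W g21"
  shows "g12 u = g21 u"
proof (rule ccontr)
  assume ne: "g12 u \<noteq> g21 u"
  define e where "e = \<bar>g12 u - g21 u\<bar> / 2"
  have e: "e > 0" using ne by (simp add: e_def)
  have "isCont g12 u" "isCont g21 u" using c W by (auto simp: continuous_on_eq_continuous_at)
  then obtain d1 d2 where d: "d1 > 0" "\<And>w. dist w u < d1 \<Longrightarrow> dist (g12 w) (g12 u) < e"
      "d2 > 0" "\<And>w. dist w u < d2 \<Longrightarrow> dist (g21 w) (g21 u) < e"
    using e unfolding continuous_at by (metis continuous_at_eps_delta e isCont_def continuous_at)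
  obtain d3 where d3: "d3 > 0" "ball u d3 \<subseteq> W" using W open_contains_ball by blast
  \<comment> \<open>Keeps the far corner of the square, at distance at most \<open>2 * s\<close>, inside all three balls.\<close>
  define s where "s = min d1 (min d2 d3) / 4"
  have s: "s > 0" using d d3 by (simp add: s_def)
  define pt where "pt = (\<lambda>a b. u + a *\<^sub>R axis 1 1 + b *\<^sub>R axis 2 (1::real))"
  have near: "dist (pt a b) u < 4 * s" if "\<bar>a\<bar> \<le> s" "\<bar>b\<bar> \<le> s" for a b
  proof -
    have "dist (pt a b) u = norm (a *\<^sub>R axis 1 1 + b *\<^sub>R axis 2 (1::real) :: real^2)"
      by (simp add: pt_def dist_norm algebra_simps)
    also have "\<dots> \<le> \<bar>a\<bar> + \<bar>b\<bar>"
      by (rule order_trans[OF norm_triangle_ineq]) simp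
    finally show ?thesis using that s by linarith
  qed
  have inW: "pt a b \<in> W" if "\<bar>a\<bar> \<le> s" "\<bar>b\<bar> \<le> s" for a b
    using near[OF that] d3 by (auto simp: s_def dist_commute subset_iff)
  have da: "((\<lambda>a. f (pt a b)) has_real_derivative f1) (at a)"
    if "(f has_derivative (\<lambda>h. h $ 1 * f1 + h $ 2 * f2)) (at (pt a b))" for f f1 f2 a b
  proof -
    have "((\<lambda>a. pt a b) has_derivative (\<lambda>h. h *\<^sub>R axis 1 1)) (at a)"
      unfolding pt_def by (auto intro!: derivative_eq_intros)
    from has_derivative_compose[OF this that]
    show ?thesis by (simp add: has_field_derivative_def axis_def mult_commute_abs)
  qed
  have db: "((\<lambda>b. f (pt a b)) has_real_derivative f2) (at b)"
    if "(f has_derivative (\<lambda>h. h $ 1 * f1 + h $ 2 * f2)) (at (pt a b))" for f f1 f2 a b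
  proof -
    have "((\<lambda>b. pt a b) has_derivative (\<lambda>h. h *\<^sub>R axis 2 1)) (at b)"
      unfolding pt_def by (auto intro!: derivative_eq_intros)
    from has_derivative_compose[OF this that]
    show ?thesis by (simp add: has_field_derivative_def axis_def mult_commute_abs)
  qed
  have "\<exists>a>0. a < s \<and> (g (pt s s) - g (pt s 0)) - (g (pt 0 s) - g (pt 0 0)) = (s - 0) * (g1 (pt a s) - g1 (pt a 0))"
    by (rule MVT2) (use s in \<open>auto intro!: derivative_eq_intros da[OF g] inW\<close>)
  then obtain a where a: "0 < a" "a < s" "(g (pt s s) - g (pt s 0)) - (g (pt 0 s) - g (pt 0 0)) = s * (g1 (pt a s) - g1 (pt a 0))"
    by auto
  have "\<exists>b>0. b < s \<and> g1 (pt a s) - g1 (pt a 0) = (s - 0) * g12 (pt a b)"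
    by (rule MVT2) (use s a in \<open>auto intro!: derivative_eq_intros db[OF g1] inW\<close>)
  then obtain b where b: "0 < b" "b < s" "g1 (pt a s) - g1 (pt a 0) = s * g12 (pt a b)"
    by auto
  have "\<exists>b>0. b < s \<and> (g (pt s s) - g (pt 0 s)) - (g (pt s 0) - g (pt 0 0)) = (s - 0) * (g2 (pt s b) - g2 (pt 0 b))"
    by (rule MVT2) (use s in \<open>auto intro!: derivative_eq_intros db[OF g] inW\<close>)
  then obtain b' where b': "0 < b'" "b' < s" "(g (pt s s) - g (pt 0 s)) - (g (pt s 0) - g (pt 0 0)) = s * (g2 (pt s b') - g2 (pt 0 b'))"
    by auto
  have "\<exists>a>0. a < s \<and> g2 (pt s b') - g2 (pt 0 b') = (s - 0) * g21 (pt a b')"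
    by (rule MVT2) (use s b' in \<open>auto intro!: derivative_eq_intros da[OF g2] inW\<close>)
  then obtain a' where a': "0 < a'" "a' < s" "g2 (pt s b') - g2 (pt 0 b') = s * g21 (pt a' b')"
    by auto
  have "s * (s * g12 (pt a b)) = s * (s * g21 (pt a' b'))"
    using a(3) b(3) a'(3) b'(3) by (simp add: algebra_simps)
  then have eq: "g12 (pt a b) = g21 (pt a' b')" using s by simp
  have "dist (g12 (pt a b)) (g12 u) < e"
    using near[of a b] a b by (intro d) (auto simp: s_def)
  moreover have "dist (g21 (pt a' b')) (g21 u) < e"
    using near[of a' b'] a' b' by (intro d) (auto simp: s_def)
  ultimately have "\<bar>g12 u - g21 u\<bar> < 2 * e"
    using eq by (simp add: dist_real_def)
  then show False by (simp add: e_def)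
qed

lemma param_pd_commute:
  assumes "open W" "smooth_on W r" "u \<in> W"
  shows "param_pd 1 (param_pd 2 r) u = param_pd 2 (param_pd 1 r) u"
proof -
  have "param_pd 2 (param_pd 1 r) u $ l = param_pd 1 (param_pd 2 r) u $ l" for l
  proof (rule symmetric_second_partials[OF assms(1,3)])
    have comp: "((\<lambda>w. q w $ l) has_derivative (\<lambda>h. h $ 1 * param_pd 1 q w $ l + h $ 2 * param_pd 2 q w $ l)) (at w)"
      if "smooth_on W q" "w \<in> W" for q w
      using bounded_linear.has_derivative[OF bounded_linear_vec_nth smooth_on_has_derivative[OF that]]
      by (simp add: o_def)
    note sp = smooth_on_pd[OF assms(2)]
    show "((\<lambda>w. r w $ l) has_derivative (\<lambda>h. h $ 1 * param_pd 1 r w $ l + h $ 2 * param_pd 2 r w $ l)) (at w)"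
      if "w \<in> W" for w using comp[OF assms(2) that] .
    show "((\<lambda>w. param_pd 1 r w $ l) has_derivative (\<lambda>h. h $ 1 * param_pd 1 (param_pd 1 r) w $ l + h $ 2 * param_pd 2 (param_pd 1 r) w $ l)) (at w)"
      if "w \<in> W" for w using comp[OF sp that] .
    show "((\<lambda>w. param_pd 2 r w $ l) has_derivative (\<lambda>h. h $ 1 * param_pd 1 (param_pd 2 r) w $ l + h $ 2 * param_pd 2 (param_pd 2 r) w $ l)) (at w)"
      if "w \<in> W" for w using comp[OF sp that] .
    show "continuous_on W (\<lambda>w. param_pd 2 (param_pd 1 r) w $ l)" "continuous_on W (\<lambda>w. param_pd 1 (param_pd 2 r) w $ l)"
      using smooth_on_continuous[OF smooth_on_pd[OF sp]] by (auto intro!: continuous_intros)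
  qed
  then show ?thesis by (simp add: vec_eq_iff)
qed

definition chart_D :: "(real^2 \<Rightarrow> real^3) \<Rightarrow> real^2 \<Rightarrow> real^2 \<Rightarrow> real^3" where
  "chart_D r u h = h $ 1 *\<^sub>R param_pd 1 r u + h $ 2 *\<^sub>R param_pd 2 r u"

definition area_elt :: "(real^2 \<Rightarrow> real^3) \<Rightarrow> real^2 \<Rightarrow> real" where
  "area_elt r u = norm (cross3 (param_pd 1 r u) (param_pd 2 r u))"

lemma local_paramD:
  assumes "local_param S W r"
  shows "open W" "smooth_on W r" "openin (top_of_set S) (r ` W)" "inj_on r W" "continuous_on W r"
    "r ` W \<subseteq> S" "u \<in> W \<Longrightarrow> cross3 (param_pd 1 r u) (param_pd 2 r u) \<noteq> 0"
    "u \<in> W \<Longrightarrow> area_elt r u > 0"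
    "u \<in> W \<Longrightarrow> (r has_derivative chart_D r u) (at u)"
    "continuous_on W (param_pd i r)" "continuous_on W (area_elt r)"
proof -
  note d = assms[unfolded local_param_def]
  show sm: "open W" "smooth_on W r" "openin (top_of_set S) (r ` W)" using d by auto
  show "continuous_on W r" using smooth_on_continuous[OF sm(2)] .
  show "r ` W \<subseteq> S" using openin_imp_subset[OF sm(3)] .
  obtain g where "homeomorphism W (r ` W) r g" using d by blast
  then show "inj_on r W" unfolding homeomorphism_def by (metis inj_onI)
  show nz: "cross3 (param_pd 1 r u) (param_pd 2 r u) \<noteq> 0" if "u \<in> W" using d that by blast
  show "area_elt r u > 0" if "u \<in> W" using nz[OF that] by (simp add: area_elt_def)
  show "(r has_derivative chart_D r u) (at u)" if "u \<in> W"
    using smooth_on_has_derivative[OF sm(2) that] by (simp add: chart_D_def[abs_def])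
  show cp: "continuous_on W (param_pd i r)" for i
    using smooth_on_continuous[OF smooth_on_pd[OF sm(2)]] .
  show "continuous_on W (area_elt r)"
    unfolding area_elt_def[abs_def] by (intro continuous_on_norm continuous_on_cross cp)
qed

lemma local_param_inv:
  assumes "local_param S W r"
  obtains g where "homeomorphism W (r ` W) r g"
  using assms unfolding local_param_def by blast

lemma chart_D_linear: "linear (chart_D r u)"
  by (auto simp: chart_D_def linear_iff algebra_simps)

lemma chart_D_inj:
  assumes "local_param S W r" "u \<in> W"
  shows "inj (chart_D r u)"
proof -
  have "h = 0" if "chart_D r u h = 0" for h
  proof -
    have "h $ 1 *\<^sub>R cross3 (param_pd 1 r u) (param_pd 2 r u) = cross3 (chart_D r u h) (param_pd 2 r u)"
      "h $ 2 *\<^sub>R cross3 (param_pd 1 r u) (param_pd 2 r u) = cross3 (param_pd 1 r u) (chart_D r u h)"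
      by (simp_all add: chart_D_def cross_add_left cross_add_right cross_mult_left cross_mult_right)
    then have "h $ 1 = 0" "h $ 2 = 0"
      using that local_paramD(7)[OF assms] by auto
    then show ?thesis by (simp add: vec_eq_iff forall_2)
  qed
  then show ?thesis by (simp add: linear_injective_0[OF chart_D_linear])
qed

text \<open>
  The injective derivative is bounded below, and near \<open>u\<close> the remainder takes away at most half
  of that bound.
\<close>

lemma chart_expands:
  assumes "local_param S W r" "u \<in> W"
  obtains c d where "c > 0" "d > 0" "ball u d \<subseteq> W" "\<And>w. w \<in> ball u d \<Longrightarrow> c * norm (w - u) \<le> norm (r w - r u)"
proof -
  obtain B where B: "B > 0" "\<And>h. B * norm h \<le> norm (chart_D r u h)"
    using linear_inj_bounded_below_pos[OF chart_D_linear chart_D_inj[OF assms]] by blast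
  obtain d1 where d1: "d1 > 0" "ball u d1 \<subseteq> W" using local_paramD(1)[OF assms(1)] assms(2) open_contains_ball by blast
  have "\<exists>d>0. \<forall>y. norm (y - u) < d \<longrightarrow> norm (r y - r u - chart_D r u (y - u)) \<le> (B/2) * norm (y - u)"
    using local_paramD(9)[OF assms] B(1) unfolding has_derivative_at_alt
    by (meson half_gt_zero)
  then obtain d2 where d2: "d2 > 0" "\<And>y. norm (y - u) < d2 \<Longrightarrow> norm (r y - r u - chart_D r u (y - u)) \<le> (B/2) * norm (y - u)"
    by blast
  show ?thesis
  proof (rule that[of "B/2" "min d1 d2"])
    show "B/2 * norm (w - u) \<le> norm (r w - r u)" if "w \<in> ball u (min d1 d2)" for w
    proof -
      have "norm (w - u) < d2" using that by (simp add: dist_norm norm_minus_commute)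
      from d2(2)[OF this] B(2)[of "w - u"]
      show ?thesis using norm_triangle_ineq2[of "chart_D r u (w - u)" "r w - r u"]
        by (simp add: norm_minus_commute)
    qed
  qed (use d1 d2 B in auto)
qed

text \<open>
  A chart has a continuous inverse by definition, so no inverse function theorem is involved:
  every left inverse \<open>L\<close> of the derivative is a derivative of \<open>g\<close> within the surface, because the error of
  \<open>g\<close> is \<open>L\<close> applied to the error of \<open>r\<close> and \<open>chart_expands\<close> bounds distances in the parameter
  domain by distances on the surface.
\<close>

lemma chart_inverse_derivative:
  assumes "local_param S W r" "u \<in> W" "homeomorphism W (r ` W) r g"
    and L: "linear L" "\<And>h. L (chart_D r u h) = h"
  shows "(g has_derivative L) (at (r u) within r ` W)"
proof -
  have gr: "g (r w) = w" if "w \<in> W" for w using assms(3) that by (simp add: homeomorphism_def)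
  have L': "bounded_linear L" using L(1) by (simp add: linear_linear)
  obtain c d where cd: "c > 0" "d > 0" "ball u d \<subseteq> W" "\<And>w. w \<in> ball u d \<Longrightarrow> c * norm (w - u) \<le> norm (r w - r u)"
    using chart_expands[OF assms(1,2)] by blast
  obtain K where K: "K > 0" "\<And>z. norm (L z) \<le> norm z * K"
    using bounded_linear.pos_bounded[OF L'] by blast
  show ?thesis unfolding has_derivative_within_alt
  proof (intro conjI L' allI impI)
    fix e :: real assume e: "e > 0"
    have "\<exists>d>0. \<forall>y. norm (y - u) < d \<longrightarrow> norm (r y - r u - chart_D r u (y - u)) \<le> (e * c / K) * norm (y - u)"
      using conjunct2[OF local_paramD(9)[OF assms(1,2), unfolded has_derivative_at_alt], rule_format, of "e * c / K"]
        e cd(1) K(1) by simp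
    then obtain d2 where d2: "d2 > 0" "\<And>y. norm (y - u) < d2 \<Longrightarrow> norm (r y - r u - chart_D r u (y - u)) \<le> (e * c / K) * norm (y - u)"
      by blast
    have "continuous_on (r ` W) g" using assms(3) by (simp add: homeomorphism_def)
    then obtain d3 where d3: "d3 > 0" "\<And>y. y \<in> r ` W \<Longrightarrow> dist y (r u) < d3 \<Longrightarrow> dist (g y) (g (r u)) < min d d2"
      unfolding continuous_on_iff using assms(2) cd(2) d2(1) by (metis image_eqI min_less_iff_conj)
    show "\<exists>d>0. \<forall>y\<in>r ` W. norm (y - r u) < d \<longrightarrow> norm (g y - g (r u) - L (y - r u)) \<le> e * norm (y - r u)"
    proof (intro exI[of _ d3] conjI ballI impI d3(1))
      fix y assume y: "y \<in> r ` W" "norm (y - r u) < d3"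
      then obtain w where w: "w \<in> W" "y = r w" by blast
      have nw: "norm (w - u) < d" "norm (w - u) < d2"
        using d3(2)[OF y(1)] y(2) w assms(2) by (auto simp: gr dist_norm)
      have "g y - g (r u) - L (y - r u) = - L (r w - r u - chart_D r u (w - u))"
        using w assms(2) by (simp add: gr linear_diff[OF L(1)] L(2))
      then have "norm (g y - g (r u) - L (y - r u)) \<le> norm (r w - r u - chart_D r u (w - u)) * K"
        using K(2) by simp
      also have "\<dots> \<le> (e * c / K) * norm (w - u) * K"
        using d2(2)[OF nw(2)] K(1) by (intro mult_right_mono) auto
      also have "\<dots> = e * (c * norm (w - u))" using K(1) by simp
      also have "\<dots> \<le> e * norm (r w - r u)"
        using cd(4)[of w] nw(1) e by (simp add: dist_norm norm_minus_commute)
      finally show "norm (g y - g (r u) - L (y - r u)) \<le> e * norm (y - r u)" using w by simp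
    qed
  qed
qed

text \<open>
  By the chain rule the tangent vectors of \<open>r1\<close> are those of \<open>r2\<close> transformed by the derivative
  \<open>T\<close> of the transition map, and a cross product picks up the determinant of \<open>T\<close>.
\<close>

lemma transition_derivative:
  assumes p1: "local_param S W1 r1" and p2: "local_param S W2 r2" and h: "homeomorphism W2 (r2 ` W2) r2 g"
    and D: "D = {w \<in> W1. r1 w \<in> r2 ` W2}"
  shows "open D"
    and "u \<in> D \<Longrightarrow> \<exists>T. ((\<lambda>w. g (r1 w)) has_derivative T) (at u) \<and>
    area_elt r1 u = \<bar>det (matrix T)\<bar> * area_elt r2 (g (r1 u))"
proof -
  show oD: "open D"
  proof -
    obtain O2 where O2: "open O2" "r2 ` W2 = S \<inter> O2"
      using local_paramD(3)[OF p2] by (auto simp: openin_open)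
    have "D = W1 \<inter> r1 -` O2" using D O2 local_paramD(6)[OF p1] by auto
    then show ?thesis using continuous_open_preimage[OF local_paramD(5,1)[OF p1] O2(1)] by simp
  qed
  assume u: "u \<in> D"
  have uW: "u \<in> W1" using D u by blast
  have r2g: "g (r1 w) \<in> W2 \<and> r2 (g (r1 w)) = r1 w" if "w \<in> D" for w
    using h that unfolding homeomorphism_def D by auto
  define v where "v = g (r1 u)"
  have v: "v \<in> W2" "r2 v = r1 u" using r2g[OF u] unfolding v_def by auto
  obtain L where L: "linear L" "L \<circ> chart_D r2 v = id"
    using linear_injective_left_inverse[OF chart_D_linear chart_D_inj[OF p2 v(1)]] by blast
  have dg: "(g has_derivative L) (at (r1 u) within r2 ` W2)"
    using chart_inverse_derivative[OF p2 v(1) h L(1)] L(2) by (simp add: v(2) fun_eq_iff)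
  have dr: "(r1 has_derivative chart_D r1 u) (at u)"
    using local_paramD(9)[OF p1 uW] .
  define T where "T = (\<lambda>h. L (chart_D r1 u h))"
  have "((\<lambda>w. g (r1 w)) has_derivative T) (at u within D)"
    unfolding T_def
  proof (rule has_derivative_in_compose[OF has_derivative_at_withinI[OF dr]])
    show "(g has_derivative L) (at (r1 u) within r1 ` D)"
      by (rule has_derivative_subset[OF dg]) (auto simp: D)
  qed
  then have dT: "((\<lambda>w. g (r1 w)) has_derivative T) (at u)"
    using at_within_open[OF u oD] by simp
  have "((\<lambda>w. r2 (g (r1 w))) has_derivative (\<lambda>h. chart_D r2 v (T h))) (at u)"
    using has_derivative_compose[OF dT] local_paramD(9)[OF p2 v(1)] by (simp add: v_def)
  then have "(r1 has_derivative (\<lambda>h. chart_D r2 v (T h))) (at u)"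
    by (rule has_derivative_transform_within_open[OF _ oD u]) (use r2g in auto)
  then have T: "chart_D r1 u = (\<lambda>h. chart_D r2 v (T h))"
    using dr has_derivative_unique by blast
  have t: "param_pd 1 r1 u = chart_D r2 v (T (axis 1 1))" "param_pd 2 r1 u = chart_D r2 v (T (axis 2 1))"
    using fun_cong[OF T, of "axis 1 1"] fun_cong[OF T, of "axis 2 1"]
    by (simp_all add: chart_D_def axis_def)
  have "cross3 (param_pd 1 r1 u) (param_pd 2 r1 u) = det (matrix T) *\<^sub>R cross3 (param_pd 1 r2 v) (param_pd 2 r2 v)"
    unfolding t chart_D_def
    by (simp add: det_2 matrix_def cross_add_left cross_add_right cross_mult_left cross_mult_right
        cross_skew[of "param_pd 2 r2 v" "param_pd 1 r2 v"] algebra_simps)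
  then show "\<exists>T. ((\<lambda>w. g (r1 w)) has_derivative T) (at u) \<and>
    area_elt r1 u = \<bar>det (matrix T)\<bar> * area_elt r2 (g (r1 u))"
    using dT by (intro exI[of _ T]) (simp add: area_elt_def v_def)
qed

text \<open>
  The change of variables formula is available for functions with values in \<open>real^'n\<close>; a real
  function is regarded as one with values in \<open>real^1\<close>.
\<close>

lemma abs_change_of_variables_real:
  fixes f :: "real^2 \<Rightarrow> real" and g :: "real^2 \<Rightarrow> real^2"
  assumes S: "S \<in> sets lebesgue"
    and der_g: "\<And>x. x \<in> S \<Longrightarrow> (g has_derivative g' x) (at x within S)"
    and inj: "inj_on g S"
  shows "(\<lambda>x. \<bar>det (matrix (g' x))\<bar> * f (g x)) absolutely_integrable_on S \<and>
           integral S (\<lambda>x. \<bar>det (matrix (g' x))\<bar> * f (g x)) = b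
     \<longleftrightarrow> f absolutely_integrable_on (g ` S) \<and> integral (g ` S) f = b"
proof -
  have wrap: "(h absolutely_integrable_on A \<and> integral A h = b) \<longleftrightarrow>
    ((\<lambda>x. vec (h x) :: real^1) absolutely_integrable_on A \<and> integral A (\<lambda>x. vec (h x) :: real^1) = vec b)"
    for h :: "real^2 \<Rightarrow> real" and A
  proof -
    have l1: "bounded_linear (\<lambda>x::real. vec x :: real^1)"
      by (auto intro!: linear_conv_bounded_linear[THEN iffD1] simp: linear_iff vec_eq_iff)
    have l2: "bounded_linear (\<lambda>x::real^1. x $ 1)" by (rule bounded_linear_vec_nth)
    have a: "h absolutely_integrable_on A \<longleftrightarrow> (\<lambda>x. vec (h x) :: real^1) absolutely_integrable_on A"
      using absolutely_integrable_linear[OF _ l1, where f=h]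
        absolutely_integrable_linear[OF _ l2, where f="\<lambda>x. vec (h x) :: real^1"] by (auto simp: o_def)
    have "integral A (\<lambda>x. vec (h x) :: real^1) = vec (integral A h)" if "h absolutely_integrable_on A"
      using integral_linear[OF set_lebesgue_integral_eq_integral(1)[OF that] l1] by (simp add: o_def)
    then show ?thesis using a by (auto simp: vec_eq_iff)
  qed
  show ?thesis
    unfolding wrap
    using has_absolute_integral_change_of_variables[OF S der_g inj, where f="\<lambda>x. vec (f x) :: real^1" and b="vec b"]
    by (simp add: vec_eq_iff scaleR_vec_def vec_def)
qed

text \<open>
  Bridges the two integrals in play: the surface measure is written with nonnegative integrals,
  the change of variables with absolutely integrable functions.
\<close>

lemma nn_integral_eq_integral_on:
  fixes f :: "'a::euclidean_space \<Rightarrow> real"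
  assumes m: "(\<lambda>x. indicator D x *\<^sub>R f x) \<in> borel_measurable borel" and nn: "\<And>x. x \<in> D \<Longrightarrow> f x \<ge> 0"
  shows "(\<integral>\<^sup>+x. ennreal (indicator D x *\<^sub>R f x) \<partial>lborel) =
    (if f absolutely_integrable_on D then ennreal (integral D f) else \<infinity>)"
proof -
  have m': "(\<lambda>x. indicator D x *\<^sub>R f x) \<in> borel_measurable lborel" using m by simp
  have nn': "AE x in lborel. indicator D x *\<^sub>R f x \<ge> 0" using nn by (auto simp: indicator_def)
  have ai: "f absolutely_integrable_on D \<longleftrightarrow> integrable lborel (\<lambda>x. indicator D x *\<^sub>R f x)"
    unfolding set_integrable_def using m' by (simp add: integrable_completion)
  show ?thesis
  proof (cases "f absolutely_integrable_on D")
    case True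
    have "(\<integral>\<^sup>+x. ennreal (indicator D x *\<^sub>R f x) \<partial>lborel) = ennreal (LINT x|lborel. indicator D x *\<^sub>R f x)"
      using True ai nn' by (intro nn_integral_eq_integral) auto
    also have "(LINT x|lborel. indicator D x *\<^sub>R f x) = integral D f"
      using set_lebesgue_integral_eq_integral(2)[OF True] m'
      by (simp add: set_lebesgue_integral_def integral_completion)
    finally show ?thesis using True by simp
  next
    case False
    then have "\<not> integrable lborel (\<lambda>x. indicator D x *\<^sub>R f x)" using ai by simp
    then have "\<not> (\<integral>\<^sup>+x. ennreal (norm (indicator D x *\<^sub>R f x)) \<partial>lborel) < \<infinity>"
      using m' by (simp add: integrable_iff_bounded)
    moreover have "(\<integral>\<^sup>+x. ennreal (norm (indicator D x *\<^sub>R f x)) \<partial>lborel) = (\<integral>\<^sup>+x. ennreal (indicator D x *\<^sub>R f x) \<partial>lborel)"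
      using nn by (intro nn_integral_cong) (auto simp: indicator_def)
    ultimately have "\<not> (\<integral>\<^sup>+x. ennreal (indicator D x *\<^sub>R f x) \<partial>lborel) < top"
      by simp
    then show ?thesis using False by (simp only: less_top[symmetric] if_False infinity_ennreal_def not_not)
  qed
qed

section \<open>The surface measure\<close>

text \<open>
  Extending a chart and its area element by zero makes them Borel functions on the whole plane,
  so that the measure of a chart can be formed by a density and an image.
\<close>

definition chart_ext :: "(real^2) set \<Rightarrow> (real^2 \<Rightarrow> real^3) \<Rightarrow> real^2 \<Rightarrow> real^3" where
  "chart_ext W r u = indicator W u *\<^sub>R r u"

definition chart_dens :: "(real^2) set \<Rightarrow> (real^2 \<Rightarrow> real^3) \<Rightarrow> real^2 \<Rightarrow> real" where
  "chart_dens W r u = indicator W u *\<^sub>R area_elt r u"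

definition chart_measure :: "(real^2) set \<Rightarrow> (real^2 \<Rightarrow> real^3) \<Rightarrow> (real^3) measure" where
  "chart_measure W r = distr (density lborel (\<lambda>u. ennreal (chart_dens W r u))) borel (chart_ext W r)"

lemma chart_measurable:
  assumes "local_param S W r"
  shows "chart_ext W r \<in> borel_measurable borel" "chart_dens W r \<in> borel_measurable borel" "W \<in> sets borel"
    "chart_dens W r u \<ge> 0"
  using borel_measurable_continuous_on_indicator[of W r] borel_measurable_continuous_on_indicator[of W "area_elt r"]
    local_paramD[OF assms] by (auto simp: chart_ext_def[abs_def] chart_dens_def[abs_def] area_elt_def)

lemma sets_chart_measure [simp]: "sets (chart_measure W r) = sets borel" "space (chart_measure W r) = UNIV"
  by (simp_all add: chart_measure_def)

lemma emeasure_chart_measure: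
  assumes "local_param S W r" "E \<in> sets borel"
  shows "emeasure (chart_measure W r) E =
    (\<integral>\<^sup>+u. ennreal (chart_dens W r u) * indicator E (chart_ext W r u) \<partial>lborel)"
proof -
  note [measurable] = chart_measurable[OF assms(1)] assms(2)
  have "emeasure (chart_measure W r) E = emeasure (density lborel (\<lambda>u. ennreal (chart_dens W r u))) (chart_ext W r -` E)"
    unfolding chart_measure_def by (subst emeasure_distr) auto
  also have "\<dots> = (\<integral>\<^sup>+u. ennreal (chart_dens W r u) * indicator (chart_ext W r -` E) u \<partial>lborel)"
    using measurable_sets_borel[OF chart_measurable(1)[OF assms(1)] assms(2)]
    by (subst emeasure_density) auto
  finally show ?thesis by (simp add: indicator_def)
qed

lemma is_surface_measure_iff:
  "is_surface_measure S M \<longleftrightarrow> sets M = sets borel \<and> emeasure M (- S) = 0 \<and>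
     (\<forall>W r. local_param S W r \<longrightarrow> (\<forall>E\<in>sets borel. E \<subseteq> r ` W \<longrightarrow> emeasure M E = emeasure (chart_measure W r) E))"
proof -
  have "emeasure (chart_measure W r) E =
    (\<integral>\<^sup>+u. ennreal (norm (cross3 (param_pd 1 r u) (param_pd 2 r u))) * indicator {u\<in>W. r u \<in> E} u \<partial>lborel)"
    if "local_param S W r" "E \<in> sets borel" for W r E
    unfolding emeasure_chart_measure[OF that]
    by (rule nn_integral_cong) (simp add: chart_dens_def chart_ext_def area_elt_def indicator_def)
  then show ?thesis unfolding is_surface_measure_def by simp
qed

lemma chart_image_borel:
  assumes "S \<in> sets borel" "local_param S W r"
  shows "r ` W \<in> sets borel"
proof -
  obtain T where "open T" "r ` W = S \<inter> T" using local_paramD(3)[OF assms(2)] by (auto simp: openin_open)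
  then show ?thesis using assms(1) by simp
qed

text \<open>
  The transition map carries one preimage of \<open>E\<close> onto the other and, by \<open>transition_derivative\<close>, one
  area element into the other.  The change of variables is an equivalence between integrability
  with a given value on both sides, so the case of infinite measure needs no separate treatment.
\<close>

lemma chart_measures_agree:
  assumes p1: "local_param S W1 r1" and p2: "local_param S W2 r2"
    and E: "E \<in> sets borel" "E \<subseteq> r1 ` W1" "E \<subseteq> r2 ` W2"
  shows "emeasure (chart_measure W1 r1) E = emeasure (chart_measure W2 r2) E"
proof -
  obtain g where g: "homeomorphism W2 (r2 ` W2) r2 g" using local_param_inv[OF p2] .
  define D where "D = {w \<in> W1. r1 w \<in> r2 ` W2}"
  note td = transition_derivative[OF p1 p2 g D_def]
  define D1 where "D1 = {u \<in> W1. r1 u \<in> E}"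
  define D2 where "D2 = {u \<in> W2. r2 u \<in> E}"
  have pre: "{u \<in> W. r u \<in> E} \<in> sets borel" if "local_param S W r" for W r
  proof -
    note [measurable] = chart_measurable[OF that] E(1)
    have "{u \<in> W. r u \<in> E} = W \<inter> (chart_ext W r -` E)" by (auto simp: chart_ext_def)
    then show ?thesis by (auto simp: measurable_sets_borel)
  qed
  have D12: "D1 \<in> sets borel" "D2 \<in> sets borel" using pre[OF p1] pre[OF p2] by (simp_all add: D1_def D2_def)
  have sub: "D1 \<subseteq> D" using E by (auto simp: D1_def D_def)
  define T where "T = (\<lambda>u. SOME T. ((\<lambda>w. g (r1 w)) has_derivative T) (at u) \<and>
    area_elt r1 u = \<bar>det (matrix T)\<bar> * area_elt r2 (g (r1 u)))"
  have T: "((\<lambda>w. g (r1 w)) has_derivative T u) (at u)" "area_elt r1 u = \<bar>det (matrix (T u))\<bar> * area_elt r2 (g (r1 u))"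
    if "u \<in> D1" for u
    using someI_ex[OF td(2)[of u]] that sub unfolding T_def by auto
  have gr: "g (r2 v) = v" if "v \<in> W2" for v using g that by (simp add: homeomorphism_def)
  have rg: "r2 (g y) = y \<and> g y \<in> W2" if "y \<in> r2 ` W2" for y using g that by (auto simp: homeomorphism_def)
  have inj: "inj_on (\<lambda>w. g (r1 w)) D1"
  proof (rule inj_onI)
    fix x y assume xy: "x \<in> D1" "y \<in> D1" "g (r1 x) = g (r1 y)"
    then have "r1 x \<in> r2 ` W2" "r1 y \<in> r2 ` W2" using sub unfolding D_def by auto
    then have "r1 x = r1 y" using rg xy(3) by metis
    then show "x = y" using local_paramD(4)[OF p1] xy by (auto simp: D1_def inj_on_def)
  qed
  have im: "(\<lambda>w. g (r1 w)) ` D1 = D2"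
  proof (intro equalityI subsetI)
    fix v assume "v \<in> (\<lambda>w. g (r1 w)) ` D1"
    then show "v \<in> D2" using rg sub by (auto simp: D2_def D1_def D_def)
  next
    fix v assume v: "v \<in> D2"
    then obtain u where u: "u \<in> W1" "r1 u = r2 v" using E(2) by (auto simp: D2_def)
    then have "u \<in> D1" "v = g (r1 u)" using v gr by (auto simp: D1_def D2_def)
    then show "v \<in> (\<lambda>w. g (r1 w)) ` D1" by blast
  qed
  have cv: "(\<lambda>x. \<bar>det (matrix (T x))\<bar> * area_elt r2 (g (r1 x))) absolutely_integrable_on D1 \<and>
           integral D1 (\<lambda>x. \<bar>det (matrix (T x))\<bar> * area_elt r2 (g (r1 x))) = b
     \<longleftrightarrow> area_elt r2 absolutely_integrable_on D2 \<and> integral D2 (area_elt r2) = b" for b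
    unfolding im[symmetric]
  proof (rule abs_change_of_variables_real[OF _ _ inj])
    show "D1 \<in> sets lebesgue" using D12(1) by simp
    show "((\<lambda>w. g (r1 w)) has_derivative T x) (at x within D1)" if "x \<in> D1" for x
      by (rule has_derivative_at_withinI[OF T(1)[OF that]])
  qed
  have e1: "(\<lambda>x. \<bar>det (matrix (T x))\<bar> * area_elt r2 (g (r1 x))) absolutely_integrable_on D1 \<longleftrightarrow> area_elt r1 absolutely_integrable_on D1"
    unfolding set_integrable_def by (rule Bochner_Integration.integrable_cong) (auto simp: T(2) indicator_def)
  have e2: "integral D1 (\<lambda>x. \<bar>det (matrix (T x))\<bar> * area_elt r2 (g (r1 x))) = integral D1 (area_elt r1)"
    by (rule Henstock_Kurzweil_Integration.integral_cong) (simp add: T(2))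
  have em: "emeasure (chart_measure W r) E = (if area_elt r absolutely_integrable_on {u \<in> W. r u \<in> E}
      then ennreal (integral {u \<in> W. r u \<in> E} (area_elt r)) else \<infinity>)" if p: "local_param S W r" for W r
  proof -
    have "emeasure (chart_measure W r) E = (\<integral>\<^sup>+u. ennreal (indicator {u \<in> W. r u \<in> E} u *\<^sub>R area_elt r u) \<partial>lborel)"
      unfolding emeasure_chart_measure[OF p E(1)]
      by (rule nn_integral_cong) (simp add: chart_dens_def chart_ext_def indicator_def)
    also have "\<dots> = (if area_elt r absolutely_integrable_on {u \<in> W. r u \<in> E}
      then ennreal (integral {u \<in> W. r u \<in> E} (area_elt r)) else \<infinity>)"
    proof (rule nn_integral_eq_integral_on)
      show "(\<lambda>u. indicator {u \<in> W. r u \<in> E} u *\<^sub>R area_elt r u) \<in> borel_measurable borel"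
        by (rule borel_measurable_continuous_on_indicator[OF pre[OF p] continuous_on_subset[OF local_paramD(11)[OF p]]]) auto
    qed (simp add: area_elt_def)
    finally show ?thesis .
  qed
  show ?thesis
    unfolding em[OF p1] em[OF p2] D1_def[symmetric] D2_def[symmetric]
    using cv[of "integral D2 (area_elt r2)"] cv[of "integral D1 (area_elt r1)"] e1 e2 by auto
qed

text \<open>
  Adding the empty chart to a countable cover makes the cover nonempty, so that it can be enumerated
  even if the surface is empty.
\<close>

lemma local_param_empty: "local_param S {} r"
proof -
  have "Ck_on n {} (f :: real^2 \<Rightarrow> real^3)" for n f
    by (induction n arbitrary: f) auto
  then have "smooth_on {} r" by (simp add: smooth_on_def)
  then show ?thesis
    unfolding local_param_def by (auto simp: homeomorphism_def)
qed

lemma smooth_surfaceE: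
  assumes "smooth_surface S" "p \<in> S"
  obtains W r u where "local_param S W r" "u \<in> W" "p = r u"
proof -
  obtain W r where W: "local_param S W r" "p \<in> r ` W" using assms unfolding smooth_surface_def by blast
  from W(2) obtain u where "u \<in> W" "p = r u" by (elim imageE)
  then show ?thesis using that W(1) by simp
qed

lemma countable_chart_cover:
  assumes "smooth_surface S"
  obtains W :: "nat \<Rightarrow> (real^2) set" and r :: "nat \<Rightarrow> real^2 \<Rightarrow> real^3"
  where "\<And>n. local_param S (W n) (r n)" "S = (\<Union>n. r n ` W n)"
proof -
  define F where "F = {T. open T \<and> (\<exists>W r. local_param S W r \<and> r ` W = S \<inter> T)}"
  obtain F' where F': "F' \<subseteq> F" "countable F'" "\<Union>F' = \<Union>F"
    using Lindelof[of F] by (auto simp: F_def)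
  have cov: "S \<subseteq> \<Union>F"
  proof
    fix x assume x: "x \<in> S"
    then obtain W r where W: "local_param S W r" "x \<in> r ` W" using assms by (auto simp: smooth_surface_def)
    then obtain T where "open T" "r ` W = S \<inter> T" using local_paramD(3)[OF W(1)] by (auto simp: openin_open)
    then show "x \<in> \<Union>F" using W unfolding F_def by blast
  qed
  have "{} \<in> F" using local_param_empty[of S] by (auto simp: F_def intro!: exI[of _ "{}"])
  then have ins: "insert {} F' \<subseteq> F" using F' by blast
  obtain T :: "nat \<Rightarrow> (real^3) set" where T: "range T = insert {} F'"
    using range_from_nat_into[of "insert {} F'"] F'(2) by (metis countable_insert insert_not_empty)
  have "\<exists>W r. local_param S W r \<and> r ` W = S \<inter> T n" for n
  proof -
    have "T n \<in> range T" by simp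
    then have "T n \<in> F" using T ins by auto
    then show ?thesis by (simp add: F_def)
  qed
  then obtain W r where Wr: "\<And>n::nat. local_param S (W n) (r n) \<and> r n ` W n = S \<inter> T n" by metis
  show ?thesis
  proof (rule that)
    have "S \<subseteq> (\<Union>n. T n)" using cov F' T by auto
    then show "S = (\<Union>n. r n ` W n)" using Wr by auto
  qed (use Wr in auto)
qed

text \<open>
  Make a countable cover by charts disjoint and measure each piece in its own chart.
  \<open>chart_measures_agree\<close> shows that the sum has the correct value in every chart; uniqueness
  holds because every candidate is determined on the pieces and vanishes off the surface.
\<close>

lemma is_surface_measure_ex1:
  assumes S: "S \<in> sets borel" "smooth_surface S"
  shows "\<exists>!M. is_surface_measure S M"
proof -
  obtain W :: "nat \<Rightarrow> (real^2) set" and r where Wr: "\<And>n. local_param S (W n) (r n)" "S = (\<Union>n. r n ` W n)"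
    using countable_chart_cover[OF S(2)] by blast
  define A where "A = disjointed (\<lambda>n. r n ` W n)"
  have rW: "r n ` W n \<in> sets borel" for n using chart_image_borel[OF S(1) Wr(1)] .
  have Ab: "A n \<in> sets borel" for n
    unfolding A_def using rW sets.range_disjointed_sets[of "\<lambda>n. r n ` W n" borel] by auto
  have Ad: "disjoint_family A" unfolding A_def by (rule disjoint_family_disjointed)
  have dA: "disjoint_family (\<lambda>n. E \<inter> A n)" for E
    using Ad unfolding disjoint_family_on_def by blast
  have AU: "(\<Union>n. A n) = S" unfolding A_def UN_disjointed_eq Wr(2)[symmetric] ..
  have As: "A n \<subseteq> r n ` W n" for n unfolding A_def by (rule disjointed_subset)
  define \<mu> where "\<mu> = (\<lambda>E. \<Sum>n. emeasure (chart_measure (W n) (r n)) (E \<inter> A n))"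
  define M where "M = measure_of UNIV (sets borel) \<mu>"
  have ca: "countably_additive (sets borel) \<mu>"
  proof (rule countably_additiveI)
    fix E :: "nat \<Rightarrow> (real^3) set"
    assume E: "range E \<subseteq> sets borel" "disjoint_family E" "(\<Union>i. E i) \<in> sets borel"
    have "(\<Sum>i. emeasure (chart_measure (W n) (r n)) (E i \<inter> A n)) = emeasure (chart_measure (W n) (r n)) ((\<Union>i. E i) \<inter> A n)" for n
    proof -
      have "(\<Sum>i. emeasure (chart_measure (W n) (r n)) (E i \<inter> A n)) = emeasure (chart_measure (W n) (r n)) (\<Union>i. E i \<inter> A n)"
        using E Ab by (intro suminf_emeasure) (auto simp: disjoint_family_on_def)
      then show ?thesis by simp
    qed
    \<comment> \<open>The double series is exchanged as an iterated integral over counting measures.\<close>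
    moreover have "(\<Sum>i. \<mu> (E i)) = (\<Sum>n. \<Sum>i. emeasure (chart_measure (W n) (r n)) (E i \<inter> A n))"
      unfolding \<mu>_def
      using pair_sigma_finite.Fubini[of "count_space (UNIV::nat set)" "count_space (UNIV::nat set)"
          "\<lambda>(i,n). emeasure (chart_measure (W n) (r n)) (E i \<inter> A n)"]
      by (simp add: nn_integral_count_space_nat pair_sigma_finite_def sigma_finite_measure_count_space)
    ultimately show "(\<Sum>i. \<mu> (E i)) = \<mu> (\<Union>i. E i)" by (simp add: \<mu>_def)
  qed
  have pos: "positive (sets borel) \<mu>" by (simp add: positive_def \<mu>_def)
  have eM: "emeasure M E = \<mu> E" if "E \<in> sets borel" for E
    unfolding M_def using ca pos that
    by (intro emeasure_measure_of_sigma) (auto intro: sets.sigma_algebra_axioms[of "borel::(real^3) measure", simplified])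
  have sM: "sets M = sets borel"
    unfolding M_def using sets.sets_measure_of_eq[of "borel::(real^3) measure"] by simp
  have isM: "is_surface_measure S M"
    unfolding is_surface_measure_iff
  proof (intro conjI sM allI impI ballI)
    have "(- S) \<inter> A n = {}" for n using AU by blast
    then show "emeasure M (- S) = 0" using S(1) by (simp add: eM \<mu>_def)
  next
    fix W' r' E assume p: "local_param S W' r'" and E: "E \<in> sets borel" "E \<subseteq> r' ` W'"
    have "emeasure M E = (\<Sum>n. emeasure (chart_measure (W n) (r n)) (E \<inter> A n))"
      using E by (simp add: eM \<mu>_def)
    also have "\<dots> = (\<Sum>n. emeasure (chart_measure W' r') (E \<inter> A n))"
      by (rule suminf_cong, rule chart_measures_agree[OF Wr(1) p]) (use E As Ab in auto)
    also have "\<dots> = emeasure (chart_measure W' r') (\<Union>n. E \<inter> A n)"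
      using E Ab dA[of E] by (intro suminf_emeasure) auto
    also have "(\<Union>n. E \<inter> A n) = E"
    proof -
      have "E \<subseteq> S" using E(2) local_paramD(6)[OF p] by simp
      then show ?thesis unfolding Int_UN_distrib[symmetric] AU by (rule Int_absorb2)
    qed
    finally show "emeasure M E = emeasure (chart_measure W' r') E" .
  qed
  show ?thesis
  proof (rule ex1I[where a=M])
    show "is_surface_measure S M" by (rule isM)
  next
    fix N assume N: "is_surface_measure S N"
    show "N = M"
    proof (rule measure_eqI)
      show "sets N = sets M" using N sM by (simp add: is_surface_measure_iff)
      fix E assume "E \<in> sets N"
      then have E: "E \<in> sets borel" using N by (simp add: is_surface_measure_iff)
      have sN: "sets N = sets borel" using N by (simp add: is_surface_measure_iff)
      have "emeasure N E = emeasure N (E \<inter> S)"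
      proof -
        have "emeasure N E = emeasure N (E \<inter> S) + emeasure N (E - S)"
          using E S(1) by (subst plus_emeasure) (auto simp: sN Int_Diff_Un)
        moreover have "emeasure N (E - S) \<le> emeasure N (- S)"
          using E S(1) by (intro emeasure_mono) (auto simp: sN)
        ultimately show ?thesis using N by (simp add: is_surface_measure_iff)
      qed
      also have "E \<inter> S = (\<Union>n. E \<inter> A n)" unfolding AU[symmetric] by (rule Int_UN_distrib)
      also have "emeasure N \<dots> = (\<Sum>n. emeasure N (E \<inter> A n))"
          using E Ab dA[of E] by (intro suminf_emeasure[symmetric]) (auto simp: sN)
      also have "\<dots> = (\<Sum>n. emeasure (chart_measure (W n) (r n)) (E \<inter> A n))"
      proof (rule suminf_cong)
        fix n
        have "E \<inter> A n \<subseteq> r n ` W n" "E \<inter> A n \<in> sets borel" using As E Ab by blast+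
        then show "emeasure N (E \<inter> A n) = emeasure (chart_measure (W n) (r n)) (E \<inter> A n)"
          using N Wr(1) by (simp add: is_surface_measure_iff)
      qed
      finally show "emeasure N E = emeasure M E" using E by (simp add: eM \<mu>_def)
    qed
  qed
qed

lemma surface_measure:
  assumes "S \<in> sets borel" "smooth_surface S"
  shows "is_surface_measure S (surface_measure S)"
  unfolding surface_measure_def by (rule theI'[OF is_surface_measure_ex1[OF assms]])

lemma sets_surface_measure:
  assumes "S \<in> sets borel" "smooth_surface S"
  shows "sets (surface_measure S) = sets borel" "space (surface_measure S) = UNIV"
    "emeasure (surface_measure S) (- S) = 0"
  using surface_measure[OF assms] sets_eq_imp_space_eq[of "surface_measure S" borel]
  by (auto simp: is_surface_measure_iff)

lemma measurable_surface_measure: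
  assumes "S \<in> sets borel" "smooth_surface S"
  shows "measurable (surface_measure S) N = measurable borel N"
  by (rule measurable_cong_sets) (simp_all add: sets_surface_measure[OF assms])

text \<open>
  Integrals over a chart domain thereby become integrals over the plane.
\<close>

lemma surface_measure_chart:
  assumes "S \<in> sets borel" "smooth_surface S" "local_param S W r"
  shows "density (surface_measure S) (indicator (r ` W)) = chart_measure W r"
proof (rule measure_eqI)
  note s = sets_surface_measure[OF assms(1,2)]
  note rW = chart_image_borel[OF assms(1,3)]
  show "sets (density (surface_measure S) (indicator (r ` W))) = sets (chart_measure W r)" by (simp add: s)
  fix E assume "E \<in> sets (density (surface_measure S) (indicator (r ` W)))"
  then have E: "E \<in> sets borel" by (simp add: s)
  have "emeasure (density (surface_measure S) (indicator (r ` W))) E = emeasure (surface_measure S) (r ` W \<inter> E)"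
  proof -
    have "emeasure (density (surface_measure S) (indicator (r ` W))) E = (\<integral>\<^sup>+ x. indicator (r ` W) x * indicator E x \<partial>surface_measure S)"
      using E rW by (subst emeasure_density) (auto simp: s measurable_surface_measure[OF assms(1,2)])
    also have "\<dots> = (\<integral>\<^sup>+ x. indicator (r ` W \<inter> E) x \<partial>surface_measure S)"
      by (rule nn_integral_cong) (simp add: indicator_def)
    finally show ?thesis using E rW by (simp add: s)
  qed
  also have "\<dots> = emeasure (chart_measure W r) (r ` W \<inter> E)"
    using surface_measure[OF assms(1,2)] assms(3) E rW by (simp add: is_surface_measure_iff)
  also have "\<dots> = emeasure (chart_measure W r) E"
    unfolding emeasure_chart_measure[OF assms(3) E] using E rW
    by (subst emeasure_chart_measure[OF assms(3)]) (auto intro!: nn_integral_cong simp: chart_ext_def chart_dens_def indicator_def)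
  finally show "emeasure (density (surface_measure S) (indicator (r ` W))) E = emeasure (chart_measure W r) E" .
qed

lemma nn_integral_chart:
  assumes S: "S \<in> sets borel" "smooth_surface S" and p: "local_param S W r" and f: "f \<in> borel_measurable borel"
  shows "(\<integral>\<^sup>+y. indicator (r ` W) y * f y \<partial>surface_measure S) = (\<integral>\<^sup>+u. ennreal (chart_dens W r u) * f (chart_ext W r u) \<partial>lborel)"
proof -
  note s = sets_surface_measure[OF S]
  note [measurable] = chart_measurable[OF p] f chart_image_borel[OF S(1) p]
  have "(\<integral>\<^sup>+y. indicator (r ` W) y * f y \<partial>surface_measure S) = (\<integral>\<^sup>+y. f y \<partial>density (surface_measure S) (indicator (r ` W)))"
    by (rule nn_integral_density[symmetric]) (auto simp: measurable_surface_measure[OF S])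
  also have "\<dots> = (\<integral>\<^sup>+y. f y \<partial>chart_measure W r)" by (simp add: surface_measure_chart[OF S p])
  also have "\<dots> = (\<integral>\<^sup>+u. ennreal (chart_dens W r u) * f (chart_ext W r u) \<partial>lborel)"
    unfolding chart_measure_def by (subst nn_integral_distr, simp, simp, subst nn_integral_density) auto
  finally show ?thesis .
qed

lemma integral_chart:
  fixes f :: "real^3 \<Rightarrow> 'b::{banach, second_countable_topology}"
  assumes S: "S \<in> sets borel" "smooth_surface S" and p: "local_param S W r" and f: "f \<in> borel_measurable borel"
  shows "set_integrable (surface_measure S) (r ` W) f \<longleftrightarrow> integrable lborel (\<lambda>u. chart_dens W r u *\<^sub>R f (chart_ext W r u))"
    "(LINT y:r ` W|surface_measure S. f y) = (LINT u|lborel. chart_dens W r u *\<^sub>R f (chart_ext W r u))"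
proof -
  note s = sets_surface_measure[OF S]
  note [measurable] = chart_measurable(1-3)[OF p] f chart_image_borel[OF S(1) p]
  note ms = measurable_surface_measure[OF S]
  have d: "density (surface_measure S) (\<lambda>y. ennreal (indicator (r ` W) y)) = chart_measure W r"
    using surface_measure_chart[OF S p] by (simp add: ennreal_indicator)
  have "set_integrable (surface_measure S) (r ` W) f \<longleftrightarrow> integrable (density (surface_measure S) (\<lambda>y. ennreal (indicator (r ` W) y))) f"
    unfolding set_integrable_def by (subst integrable_density) (auto simp: ms)
  also have "\<dots> \<longleftrightarrow> integrable (chart_measure W r) f" by (simp add: d)
  also have "\<dots> \<longleftrightarrow> integrable lborel (\<lambda>u. chart_dens W r u *\<^sub>R f (chart_ext W r u))"
    unfolding chart_measure_def
    by (subst integrable_distr_eq, simp, simp, subst integrable_density) (auto simp: chart_measurable[OF p])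
  finally show "set_integrable (surface_measure S) (r ` W) f \<longleftrightarrow> integrable lborel (\<lambda>u. chart_dens W r u *\<^sub>R f (chart_ext W r u))" .
  have "(LINT y:r ` W|surface_measure S. f y) = (LINT y|density (surface_measure S) (\<lambda>y. ennreal (indicator (r ` W) y)). f y)"
    unfolding set_lebesgue_integral_def by (subst integral_density) (auto simp: ms)
  also have "\<dots> = (LINT y|chart_measure W r. f y)" by (simp add: d)
  also have "\<dots> = (LINT u|lborel. chart_dens W r u *\<^sub>R f (chart_ext W r u))"
    unfolding chart_measure_def
    by (subst integral_distr, simp, simp, subst integral_density) (auto simp: chart_measurable[OF p])
  finally show "(LINT y:r ` W|surface_measure S. f y) = (LINT u|lborel. chart_dens W r u *\<^sub>R f (chart_ext W r u))" .
qed

text \<open>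
  Charts are open maps onto the surface, so small parameter balls parametrize neighbourhoods.
\<close>

lemma chart_ball_open:
  assumes p: "local_param S W r" and u: "u \<in> W" and d: "d > 0" "cball u d \<subseteq> W"
  obtains T where "open T" "r u \<in> T" "r ` ball u d = S \<inter> T"
proof -
  have bW: "ball u d \<subseteq> W" using d(2) ball_subset_cball[of u d] by (rule order_trans[rotated])
  obtain g where g: "homeomorphism W (r ` W) r g" using local_param_inv[OF p] .
  have "openin (top_of_set (r ` W)) (r ` ball u d)"
    by (rule homeomorphism_imp_open_map[OF g open_subset[OF bW open_ball]])
  then have "openin (top_of_set S) (r ` ball u d)" using local_paramD(3)[OF p] by (rule openin_trans)
  then obtain T where T: "open T" "r ` ball u d = S \<inter> T" by (auto simp: openin_open)
  have "r u \<in> r ` ball u d" using d(1) by simp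
  then have "r u \<in> T" unfolding T(2) by simp
  with T that show ?thesis by blast
qed

lemma area_elt_bounded:
  assumes p: "local_param S W r" and d: "cball u d \<subseteq> W"
  obtains B where "B > 0" "\<And>w. w \<in> cball u d \<Longrightarrow> area_elt r w \<le> B"
proof -
  have "bounded (area_elt r ` cball u d)"
    by (intro compact_imp_bounded compact_continuous_image compact_cball continuous_on_subset[OF local_paramD(11)[OF p] d])
  then obtain B where B: "B > 0" "\<And>x. x \<in> area_elt r ` cball u d \<Longrightarrow> norm x \<le> B"
    unfolding bounded_pos by blast
  have "area_elt r w \<le> B" if "w \<in> cball u d" for w
    using B(2)[of "area_elt r w"] that by simp
  with B(1) that show ?thesis by blast
qed

text \<open>
  Near each point the measure is at most the area of a parameter disc times a bound of the area
  element; compactness leaves finitely many points.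
\<close>

lemma emeasure_compact_finite:
  assumes S: "S \<in> sets borel" "smooth_surface S" and K: "compact K" "K \<subseteq> S"
  shows "emeasure (surface_measure S) K < \<infinity>"
proof -
  note s = sets_surface_measure[OF S]
  have "\<exists>T. open T \<and> p \<in> T \<and> emeasure (surface_measure S) (S \<inter> T) < \<infinity>" if pS: "p \<in> S" for p
  proof -
    obtain W r u where p: "local_param S W r" "u \<in> W" "p = r u" using smooth_surfaceE[OF S(2) pS] .
    obtain d where d: "d > 0" "cball u d \<subseteq> W" using local_paramD(1)[OF p(1)] p(2) open_contains_cball by blast
    obtain T where T: "open T" "r ` ball u d = S \<inter> T" and pT: "p \<in> T"
      using chart_ball_open[OF p(1,2) d] p(3) by metis
    obtain B where B: "B > 0" "\<And>w. w \<in> cball u d \<Longrightarrow> area_elt r w \<le> B"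
      using area_elt_bounded[OF p(1) d(2)] by blast
    have E: "S \<inter> T \<in> sets borel" using T S(1) by simp
    have bW: "ball u d \<subseteq> W" using d(2) ball_subset_cball[of u d] by (rule order_trans[rotated])
    have sub: "S \<inter> T \<subseteq> r ` W" unfolding T(2)[symmetric] using bW by (rule image_mono)
    have "emeasure (surface_measure S) (S \<inter> T) = emeasure (chart_measure W r) (S \<inter> T)"
      using surface_measure[OF S] p(1) E sub by (simp add: is_surface_measure_iff)
    also have "\<dots> = (\<integral>\<^sup>+u. ennreal (chart_dens W r u) * indicator (S \<inter> T) (chart_ext W r u) \<partial>lborel)"
      by (rule emeasure_chart_measure[OF p(1) E])
    also have "\<dots> \<le> (\<integral>\<^sup>+w. ennreal B * indicator (cball u d) w \<partial>lborel)"
    proof (rule nn_integral_mono)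
      fix w
      show "ennreal (chart_dens W r w) * indicator (S \<inter> T) (chart_ext W r w) \<le> ennreal B * indicator (cball u d) w"
      proof (cases "w \<in> W \<and> r w \<in> S \<inter> T")
        case True
        then have "r w \<in> r ` ball u d" unfolding T(2) by simp
        then have "w \<in> ball u d" using inj_on_image_mem_iff[OF local_paramD(4)[OF p(1)] _ bW] True by simp
        then show ?thesis using True B(2)[of w] by (simp add: chart_dens_def chart_ext_def ennreal_leI)
      qed (cases "w \<in> W"; auto simp: chart_dens_def chart_ext_def)
    qed
    also have "\<dots> = ennreal B * emeasure lborel (cball u d)" by (subst nn_integral_cmult_indicator) auto
    also have "\<dots> < \<infinity>" using emeasure_bounded_finite[OF bounded_cball, of u d] by (simp add: ennreal_mult_less_top)
    finally have "emeasure (surface_measure S) (S \<inter> T) < \<infinity>" .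
    then show ?thesis using T(1) pT by (intro exI[of _ T]) simp
  qed
  then obtain T where T: "\<And>p. p \<in> S \<Longrightarrow> open (T p) \<and> p \<in> T p \<and> emeasure (surface_measure S) (S \<inter> T p) < \<infinity>"
    by metis
  obtain C where C: "C \<subseteq> K" "finite C" "K \<subseteq> (\<Union>p\<in>C. T p)"
  proof (rule compactE_image[OF K(1), of K T])
    show "open (T p)" if "p \<in> K" for p using T K(2) that by blast
    show "K \<subseteq> (\<Union>p\<in>K. T p)"
    proof
      fix p assume "p \<in> K"
      then show "p \<in> (\<Union>p\<in>K. T p)" using T[of p] K(2) by (intro UN_I[of p]) auto
    qed
  qed
  have Ts: "S \<inter> T p \<in> sets (surface_measure S)" if "p \<in> C" for p using T[of p] C K that S(1) by (auto simp: s)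
  have "emeasure (surface_measure S) K \<le> emeasure (surface_measure S) (\<Union>p\<in>C. S \<inter> T p)"
  proof (rule emeasure_mono)
    show "K \<subseteq> (\<Union>p\<in>C. S \<inter> T p)" using C(3) K(2) by auto
    show "(\<Union>p\<in>C. S \<inter> T p) \<in> sets (surface_measure S)" by (rule sets.finite_UN[OF C(2) Ts])
  qed
  also have "\<dots> \<le> (\<Sum>p\<in>C. emeasure (surface_measure S) (S \<inter> T p))"
    using Ts by (intro emeasure_subadditive_finite C(2)) auto
  also have "\<dots> < \<infinity>" using C T K by (simp add: ennreal_sum_less_top subset_iff)
  finally show ?thesis .
qed

lemma emeasure_surface_singleton:
  assumes S: "S \<in> sets borel" "smooth_surface S"
  shows "emeasure (surface_measure S) {p} = 0"
proof (cases "p \<in> S")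
  case True
  obtain W r u where p: "local_param S W r" "u \<in> W" "p = r u" using smooth_surfaceE[OF S(2) True] .
  have "emeasure (surface_measure S) {p} = emeasure (chart_measure W r) {p}"
    using surface_measure[OF S] p by (simp add: is_surface_measure_iff)
  also have "\<dots> = (\<integral>\<^sup>+w. ennreal (chart_dens W r w) * indicator {p} (chart_ext W r w) \<partial>lborel)"
    by (rule emeasure_chart_measure[OF p(1)]) simp
  also have "\<dots> = (\<integral>\<^sup>+w. 0 \<partial>(lborel :: (real^2) measure))"
  proof (rule nn_integral_cong_AE)
    have "AE w in lborel. w \<noteq> u" by (rule AE_lborel_singleton)
    then show "AE w in lborel. ennreal (chart_dens W r w) * indicator {p} (chart_ext W r w) = 0"
      by eventually_elim (use p local_paramD(4)[OF p(1)] in \<open>auto simp: chart_dens_def chart_ext_def indicator_def inj_on_def\<close>)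
  qed
  finally show ?thesis by simp
next
  case False
  note s = sets_surface_measure[OF S]
  have "emeasure (surface_measure S) {p} \<le> emeasure (surface_measure S) (- S)"
    using False S(1) by (intro emeasure_mono) (auto simp: s)
  then show ?thesis using s by simp
qed

lemma local_param_openin:
  assumes "openin (top_of_set S) S'" "local_param S' W r"
  shows "local_param S W r"
proof -
  have "openin (top_of_set S) (r ` W)"
    using assms(2) openin_trans[OF _ assms(1)] by (simp add: local_param_def)
  with assms(2) show ?thesis by (simp add: local_param_def)
qed

text \<open>
  Charts of an open piece are charts of the whole surface, so the restricted measure has the
  defining property, which determines it.
\<close>

lemma surface_measure_openin:
  assumes S: "S \<in> sets borel" "smooth_surface S" and S': "S' \<in> sets borel" "smooth_surface S'"
    and o: "openin (top_of_set S) S'"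
  shows "surface_measure S' = density (surface_measure S) (indicator S')"
proof -
  note s = sets_surface_measure[OF S]
  have em: "emeasure (density (surface_measure S) (indicator S')) E = emeasure (surface_measure S) (S' \<inter> E)" if "E \<in> sets borel" for E
  proof -
    have "emeasure (density (surface_measure S) (indicator S')) E = (\<integral>\<^sup>+ x. indicator S' x * indicator E x \<partial>surface_measure S)"
      using that S' by (subst emeasure_density) (auto simp: s measurable_surface_measure[OF S])
    also have "\<dots> = (\<integral>\<^sup>+ x. indicator (S' \<inter> E) x \<partial>surface_measure S)"
      by (rule nn_integral_cong) (simp add: indicator_def)
    finally show ?thesis using that S' by (simp add: s)
  qed
  have "is_surface_measure S' (density (surface_measure S) (indicator S'))"
    unfolding is_surface_measure_iff
  proof (intro conjI allI impI ballI)
    show "emeasure (density (surface_measure S) (indicator S')) (- S') = 0" using S' by (simp add: em)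
    fix W r E assume p: "local_param S' W r" and E: "E \<in> sets borel" "E \<subseteq> r ` W"
    then have "S' \<inter> E = E" using local_paramD(6)[OF p] by blast
    then show "emeasure (density (surface_measure S) (indicator S')) E = emeasure (chart_measure W r) E"
      using surface_measure[OF S] local_param_openin[OF o p] E by (simp add: em is_surface_measure_iff)
  qed (simp add: s)
  then show ?thesis
    using is_surface_measure_ex1[OF S'] surface_measure[OF S'] by (elim ex1E) metis
qed

lemma local_param_restrict:
  assumes p: "local_param S W r" and S': "openin (top_of_set S) S'"
  shows "local_param S' {w\<in>W. r w \<in> S'} r" 
proof -
  obtain T where T: "open T" "S' = S \<inter> T" using S' by (auto simp: openin_open)
  have eq: "{w\<in>W. r w \<in> S'} = W \<inter> r -` T" using T local_paramD(6)[OF p] by auto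
  obtain V where V: "open V" "r ` W = S \<inter> V" using local_paramD(3)[OF p] by (auto simp: openin_open)
  have Ck: "Ck_on n A f" if "Ck_on n B f" "A \<subseteq> B" for n A B and f :: "real^2 \<Rightarrow> real^3"
    using that by (induction n arbitrary: f) (auto intro: continuous_on_subset)
  obtain g where g: "homeomorphism W (r ` W) r g" using local_param_inv[OF p] .
  show ?thesis unfolding local_param_def
  proof (intro conjI)
    show "open {w\<in>W. r w \<in> S'}" unfolding eq
      using continuous_open_preimage[OF local_paramD(5,1)[OF p] T(1)] by simp
    show "smooth_on {w\<in>W. r w \<in> S'} r" using local_paramD(2)[OF p] Ck[of _ W r "{w\<in>W. r w \<in> S'}"] by (auto simp: smooth_on_def)
    have "r ` {w\<in>W. r w \<in> S'} = S' \<inter> V" using V T by auto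
    then show "openin (top_of_set S') (r ` {w\<in>W. r w \<in> S'})" using V(1) by (auto simp: openin_open)
    show "\<exists>g. homeomorphism {w\<in>W. r w \<in> S'} (r ` {w\<in>W. r w \<in> S'}) r g"
      by (rule exI[of _ g], rule homeomorphism_of_subsets[OF g]) auto
    show "\<forall>u\<in>{w\<in>W. r w \<in> S'}. cross3 (param_pd 1 r u) (param_pd 2 r u) \<noteq> 0" using local_paramD(7)[OF p] by blast
  qed
qed

lemma smooth_surface_openin:
  assumes "smooth_surface S" "openin (top_of_set S) S'"
  shows "smooth_surface S'"
  unfolding smooth_surface_def
proof
  fix x assume x: "x \<in> S'"
  then have "x \<in> S" using openin_imp_subset[OF assms(2)] by blast
  then obtain W r u where W: "local_param S W r" "u \<in> W" "x = r u"
    by (rule smooth_surfaceE[OF assms(1)])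
  show "\<exists>W r. local_param S' W r \<and> x \<in> r ` W"
    by (intro exI[of _ "{w\<in>W. r w \<in> S'}"] exI[of _ r] conjI local_param_restrict[OF W(1) assms(2)])
      (use W x in auto)
qed

section \<open>Functions differentiable along a surface\<close>

text \<open>
  Continuity of the derivative is required only along \<open>S\<close>, but the derivative is the one in the
  ambient space: a field on a surface is studied through an extension to a neighbourhood.
\<close>

definition C1_along :: "'a::real_normed_vector set \<Rightarrow> ('a \<Rightarrow> 'b::real_normed_vector) \<Rightarrow> ('a \<Rightarrow> 'a \<Rightarrow> 'b) \<Rightarrow> bool" where
  "C1_along S f f' \<longleftrightarrow> (\<forall>y\<in>S. (f has_derivative f' y) (at y)) \<and> (\<forall>v. continuous_on S (\<lambda>y. f' y v))"

lemma C1_alongD: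
  assumes "C1_along S f f'"
  shows "y \<in> S \<Longrightarrow> (f has_derivative f' y) (at y)" "continuous_on S (\<lambda>y. f' y v)" "continuous_on S f"
    "y \<in> S \<Longrightarrow> linear (f' y)"
proof -
  note d = assms[unfolded C1_along_def]
  show f': "(f has_derivative f' y) (at y)" if "y \<in> S" for y using d that by blast
  show "continuous_on S (\<lambda>y. f' y v)" using d by blast
  show "continuous_on S f" using f' by (rule has_derivative_continuous_on[OF has_derivative_at_withinI])
  show "linear (f' y)" if "y \<in> S" using f'[OF that] by (rule has_derivative_linear)
qed

lemma C1_along_subset: "C1_along S f f' \<Longrightarrow> T \<subseteq> S \<Longrightarrow> C1_along T f f'"
  unfolding C1_along_def by (auto intro: continuous_on_subset)

lemma C1_along_linear:
  assumes "bounded_linear h" "C1_along S f f'"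
  shows "C1_along S (\<lambda>y. h (f y)) (\<lambda>y v. h (f' y v))"
  using assms(2) unfolding C1_along_def
  by (auto intro!: bounded_linear.has_derivative[OF assms(1)] bounded_linear.continuous_on[OF assms(1)])

lemma C1_along_scaleR:
  assumes "C1_along S \<beta> \<beta>'" "C1_along S \<psi> \<psi>'"
  shows "C1_along S (\<lambda>y. \<beta> y *\<^sub>R \<psi> y) (\<lambda>y v. \<beta> y *\<^sub>R \<psi>' y v + \<beta>' y v *\<^sub>R \<psi> y)"
  unfolding C1_along_def
proof (intro conjI ballI allI)
  fix y assume "y \<in> S"
  then show "((\<lambda>y. \<beta> y *\<^sub>R \<psi> y) has_derivative (\<lambda>v. \<beta> y *\<^sub>R \<psi>' y v + \<beta>' y v *\<^sub>R \<psi> y)) (at y)"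
    by (intro has_derivative_scaleR C1_alongD(1)[OF assms(1)] C1_alongD(1)[OF assms(2)])
next
  fix v
  show "continuous_on S (\<lambda>y. \<beta> y *\<^sub>R \<psi>' y v + \<beta>' y v *\<^sub>R \<psi> y)"
    by (intro continuous_intros C1_alongD(2)[OF assms(1)] C1_alongD(2)[OF assms(2)]
        C1_alongD(3)[OF assms(1)] C1_alongD(3)[OF assms(2)])
qed

lemma linear_sum_axis:
  fixes L :: "real^3 \<Rightarrow> 'b::real_vector"
  assumes "linear L"
  shows "L v = (\<Sum>l\<in>UNIV. v $ l *\<^sub>R L (axis l 1))"
proof -
  have "v = (\<Sum>l\<in>UNIV. v $ l *\<^sub>R axis l 1)" by (simp add: sum_3 vec_eq_iff forall_3 axis_def)
  then have "L v = L (\<Sum>l\<in>UNIV. v $ l *\<^sub>R axis l 1)" by simp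
  then show ?thesis by (simp add: linear_sum[OF assms] linear_cmul[OF assms])
qed

lemma C1_along_continuous_apply:
  assumes "C1_along S f f'" "continuous_on S X"
  shows "continuous_on S (\<lambda>y. f' y (X y :: real^3))"
proof -
  have "continuous_on S (\<lambda>y. \<Sum>l\<in>UNIV. X y $ l *\<^sub>R f' y (axis l 1))"
    by (intro continuous_intros assms C1_alongD(2)[OF assms(1)])
  then show ?thesis
    by (rule continuous_on_eq) (metis linear_sum_axis C1_alongD(4)[OF assms(1)])
qed

section \<open>Integrals of partial derivatives\<close>

text \<open>
  The integral of a difference quotient of a compactly supported function vanishes, since
  Lebesgue measure is translation invariant.  The difference quotients converge to the directional
  derivative and are bounded by its maximum on a common ball.
\<close>

lemma integral_directional_derivative_zero:
  fixes G :: "'a::euclidean_space \<Rightarrow> 'b::euclidean_space"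
  assumes W: "open W" and G: "\<And>u. u \<in> W \<Longrightarrow> (G has_derivative G' u) (at u)"
    and c: "continuous_on W (\<lambda>u. G' u v)" and K: "compact K" "K \<subseteq> W" "\<And>u. u \<in> W - K \<Longrightarrow> G u = 0"
  shows "integrable lborel (\<lambda>u. indicator W u *\<^sub>R G' u v)" "(LINT u|lborel. indicator W u *\<^sub>R G' u v) = 0"
proof -
  define H where "H = (\<lambda>u. if u \<in> W then G u else 0)"
  define H' where "H' = (\<lambda>u. if u \<in> K then G' u else (\<lambda>_. 0))"
  have H0: "H u = 0" if "u \<notin> K" for u using K that by (auto simp: H_def)
  have op: "open (- K)" using K(1) compact_imp_closed by blast
  have dH0: "(H has_derivative (\<lambda>_. 0)) (at u)" if "u \<notin> K" for u
    by (rule has_derivative_transform_within_open[OF has_derivative_const[of 0] op]) (use that H0 in auto)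
  have dHW: "(H has_derivative G' u) (at u)" if "u \<in> W" for u
    by (rule has_derivative_transform_within_open[OF G W]) (use that in \<open>auto simp: H_def\<close>)
  have dH: "(H has_derivative H' u) (at u)" for u
    using dH0 dHW K(2) by (auto simp: H'_def)
  have eqW: "indicator W u *\<^sub>R G' u v = H' u v" for u
  proof (cases "u \<in> W \<and> u \<notin> K")
    case True
    then have "G' u = (\<lambda>_. 0)" using has_derivative_unique dHW dH0 by blast
    then show ?thesis using True by (simp add: H'_def)
  qed (use K in \<open>auto simp: H'_def\<close>)
  have contK: "continuous_on K (\<lambda>u. G' u v)" using c K(2) continuous_on_subset by blast
  have "bounded ((\<lambda>u. G' u v) ` K)" using K(1) contK by (intro compact_imp_bounded compact_continuous_image)
  then obtain B where B: "B > 0" "\<And>x. x \<in> (\<lambda>u. G' u v) ` K \<Longrightarrow> norm x \<le> B" unfolding bounded_pos by blast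
  have H'B: "norm (H' u v) \<le> B" for u using B by (auto simp: H'_def)
  obtain R where R: "\<And>x. x \<in> K \<Longrightarrow> norm x \<le> R" using compact_imp_bounded[OF K(1)] unfolding bounded_iff by blast
  \<comment> \<open>Contains the support of \<open>H\<close> and all its translates by \<open>- t *\<^sub>R v\<close> with \<open>0 \<le> t \<le> 1\<close>.\<close>
  define K' where "K' = cball (0::'a) (R + norm v)"
  have H'K: "H' u v = indicator K u *\<^sub>R G' u v" for u by (simp add: H'_def)
  have iH': "integrable lborel (\<lambda>u. H' u v)"
    unfolding H'K by (rule borel_integrable_compact[OF K(1) contK])
  have contH: "continuous_on UNIV H"
    using dH has_derivative_continuous by (simp add: continuous_on_eq_continuous_at) blast
  have Hi: "H = (\<lambda>u. indicator K u *\<^sub>R H u)" using H0 by (auto simp: indicator_def)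
  have iH: "integrable lborel H"
    by (subst Hi, rule borel_integrable_compact[OF K(1)]) (rule continuous_on_subset[OF contH], simp)
  define h where "h = (\<lambda>n. 1 / real (Suc n))"
  have h: "h n > 0" "h n \<le> 1" for n by (auto simp: h_def)
  have h0: "h \<longlonglongrightarrow> 0" unfolding h_def by (rule LIMSEQ_Suc[OF lim_1_over_n])
  define D where "D = (\<lambda>n u. (1 / h n) *\<^sub>R (H (u + h n *\<^sub>R v) - H u))"
  have mH: "H \<in> borel_measurable borel" using contH by (rule borel_measurable_continuous_onI)
  have shift: "integrable lborel (\<lambda>u. H (u + a)) \<and> (LINT u|lborel. H (u + a)) = (LINT u|lborel. H u)" for a
  proof -
    have d: "distr lborel borel ((+) a) = (lborel :: 'a measure)" by (rule lborel_distr_plus)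
    have "integrable (distr lborel borel ((+) a)) H" unfolding d using iH .
    then have "integrable lborel (\<lambda>u. H (a + u))" using mH by (subst (asm) integrable_distr_eq) auto
    moreover have "(LINT u|distr lborel borel ((+) a). H u) = (LINT u|lborel. H (a + u))"
      using mH by (subst integral_distr) auto
    ultimately show ?thesis using d by (simp add: add.commute)
  qed
  have D0: "(LINT u|lborel. D n u) = 0" for n
    unfolding D_def using shift[of "h n *\<^sub>R v"] iH by simp
  have Dlim: "(\<lambda>n. D n u) \<longlonglongrightarrow> H' u v" for u
  proof -
    have "((\<lambda>t. u + t *\<^sub>R v) has_derivative (\<lambda>t. t *\<^sub>R v)) (at (0::real))"
      by (auto intro!: derivative_eq_intros)
    from has_derivative_compose[OF this, of H "H' u"] dH[of u]
    have "((\<lambda>t. H (u + t *\<^sub>R v)) has_derivative (\<lambda>t. H' u (t *\<^sub>R v))) (at 0)" by simp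
    then have lim: "((\<lambda>t. norm (H (u + t *\<^sub>R v) - H u - t *\<^sub>R H' u v) / norm t) \<longlongrightarrow> 0) (at 0)"
      using linear_cmul[OF has_derivative_linear[OF dH[of u]]] by (simp add: has_derivative_at)
    have "filterlim h (at 0) sequentially"
      using h0 h(1) by (intro filterlim_atI) (auto simp: less_imp_neq[symmetric] intro!: always_eventually)
    from filterlim_compose[OF lim this]
    have "(\<lambda>n. norm (H (u + h n *\<^sub>R v) - H u - h n *\<^sub>R H' u v) / norm (h n)) \<longlonglongrightarrow> 0" .
    moreover have "norm (H (u + h n *\<^sub>R v) - H u - h n *\<^sub>R H' u v) / norm (h n) = norm (D n u - H' u v)" for n
    proof -
      have "D n u - H' u v = (1 / h n) *\<^sub>R (H (u + h n *\<^sub>R v) - H u - h n *\<^sub>R H' u v)"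
        using h(1)[of n] by (simp add: D_def scaleR_right_diff_distrib)
      then show ?thesis using h(1)[of n] by simp
    qed
    ultimately have "(\<lambda>n. norm (D n u - H' u v)) \<longlonglongrightarrow> 0" by simp
    then show ?thesis by (simp add: tendsto_norm_zero_iff LIM_zero_cancel)
  qed
  have DB: "norm (D n u) \<le> indicator K' u *\<^sub>R B" for n u
  proof (cases "u \<in> K'")
    case True
    have "norm (H (u + h n *\<^sub>R v) - H (u + 0 *\<^sub>R v)) \<le> B * norm (h n - 0)"
    proof (rule differentiable_bound[of "{0..h n}" "\<lambda>t. H (u + t *\<^sub>R v)" "\<lambda>t s. H' (u + t *\<^sub>R v) (s *\<^sub>R v)"])
      fix t :: real assume "t \<in> {0..h n}"
      show "((\<lambda>t. H (u + t *\<^sub>R v)) has_derivative (\<lambda>s. H' (u + t *\<^sub>R v) (s *\<^sub>R v))) (at t within {0..h n})"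
        by (rule has_derivative_at_withinI, rule has_derivative_compose[OF _ dH]) (auto intro!: derivative_eq_intros)
      show "onorm (\<lambda>s. H' (u + t *\<^sub>R v) (s *\<^sub>R v)) \<le> B"
      proof (rule onorm_le)
        fix s :: real
        show "norm (H' (u + t *\<^sub>R v) (s *\<^sub>R v)) \<le> B * norm s"
          using H'B[of "u + t *\<^sub>R v"] linear_cmul[OF has_derivative_linear[OF dH[of "u + t *\<^sub>R v"]], of s v]
          by (simp add: mult.commute[of B] mult_left_mono)
      qed
    qed (use h[of n] in auto)
    then have "norm (D n u) \<le> (1 / h n) * (B * h n)" unfolding D_def using h[of n] 
      by (simp add: divide_simps)
    then show ?thesis using True h[of n] by simp
  next
    case False
    then have n1: "norm u > R + norm v" by (simp add: K'_def)
    then have u: "u \<notin> K" using R[of u] norm_ge_zero[of v] by linarith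
    have "norm (h n *\<^sub>R v) \<le> norm v" using h[of n] by (simp add: mult_left_le_one_le)
    then have "norm (u + h n *\<^sub>R v) > R" using n1 norm_diff_ineq[of u "h n *\<^sub>R v"] by linarith
    then have "u + h n *\<^sub>R v \<notin> K" using R[of "u + h n *\<^sub>R v"] by linarith
    then show ?thesis using u H0 False by (simp add: D_def)
  qed
  have "(\<lambda>n. LINT u|lborel. D n u) \<longlonglongrightarrow> (LINT u|lborel. H' u v)"
  proof (rule integral_dominated_convergence[where w="\<lambda>u. indicator K' u *\<^sub>R B"])
    show "integrable lborel (\<lambda>u. indicator K' u *\<^sub>R B)"
      unfolding K'_def by (rule borel_integrable_compact) auto
    show "D n \<in> borel_measurable lborel" for n unfolding D_def using mH by simp
    show "(\<lambda>u. H' u v) \<in> borel_measurable lborel" using iH' by auto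
  qed (use Dlim DB in auto)
  then have "(LINT u|lborel. H' u v) = 0" unfolding D0 by (simp add: LIMSEQ_const_iff)
  then show "integrable lborel (\<lambda>u. indicator W u *\<^sub>R G' u v)" "(LINT u|lborel. indicator W u *\<^sub>R G' u v) = 0"
    unfolding eqW using iH' by auto
qed

section \<open>Vector algebra\<close>

text \<open>
  Three vectors orthogonal to a common unit vector are linearly dependent.
\<close>

lemma inner_cross_parallel:
  fixes n a b m :: "real^3"
  assumes "n \<bullet> n = 1" "a \<bullet> n = 0" "b \<bullet> n = 0" "m \<bullet> n = 0"
  shows "m \<bullet> cross3 a b = 0"
proof -
  have "(m \<bullet> cross3 a b) * (n \<bullet> n) - (m \<bullet> n) * (n \<bullet> cross3 a b) = cross3 m n \<bullet> ((a \<bullet> n) *\<^sub>R b - (b \<bullet> n) *\<^sub>R a)"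
    by (simp add: cross3_simps)
  then show ?thesis using assms by simp
qed

text \<open>
  With \<open>n\<close> normal to \<open>a\<close> and \<open>b\<close> this expands a tangent vector \<open>x\<close> in the frame \<open>a\<close>, \<open>b\<close>: the third term
  vanishes, and Cramer's rule with denominators cleared is left.
\<close>

lemma cramer_cross:
  fixes n a b x :: "real^3"
  shows "(n \<bullet> cross3 x b) *\<^sub>R a + (n \<bullet> cross3 a x) *\<^sub>R b + (cross3 a b \<bullet> x) *\<^sub>R n = (n \<bullet> cross3 a b) *\<^sub>R x"
  by (simp add: vec_eq_iff forall_3 cross3_simps)

text \<open>
  The derivative of the determinant of a frame moved by \<open>L\<close> is the trace of \<open>L\<close> times the
  determinant.
\<close>

lemma trace_cross:
  fixes L :: "real^3 \<Rightarrow> real^3" and n a b :: "real^3"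
  assumes "linear L"
  shows "n \<bullet> cross3 (L a) b + n \<bullet> cross3 a (L b) + cross3 a b \<bullet> L n = (\<Sum>l\<in>UNIV. L (axis l 1) $ l) * (n \<bullet> cross3 a b)"
  unfolding linear_sum_axis[OF assms, of a] linear_sum_axis[OF assms, of b] linear_sum_axis[OF assms, of n]
  by (simp add: cross3_simps)

lemma normal_of_tangents:
  fixes a b \<nu> :: "real^3"
  assumes "cross3 a b \<noteq> 0" "norm \<nu> = 1" "\<nu> \<bullet> a = 0" "\<nu> \<bullet> b = 0"
  obtains s where "s = 1 \<or> s = -1" "\<nu> = s *\<^sub>R (cross3 a b /\<^sub>R norm (cross3 a b))"
proof -
  define N where "N = cross3 a b"
  have N: "norm N > 0" using assms(1) by (simp add: N_def)
  have "cross3 \<nu> N = 0"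
    unfolding N_def Lagrange using assms by simp
  moreover have "(N \<bullet> N) *\<^sub>R \<nu> - (N \<bullet> \<nu>) *\<^sub>R N = cross3 N (cross3 \<nu> N)"
    by (simp add: vec_eq_iff forall_3 cross3_simps)
  ultimately have "(N \<bullet> N) *\<^sub>R \<nu> = (N \<bullet> \<nu>) *\<^sub>R N" by simp
  then have "(1 / (norm N)\<^sup>2) *\<^sub>R ((norm N)\<^sup>2 *\<^sub>R \<nu>) = (1 / (norm N)\<^sup>2) *\<^sub>R ((N \<bullet> \<nu>) *\<^sub>R N)"
    by (simp add: dot_square_norm)
  then have eq: "\<nu> = ((N \<bullet> \<nu>) / norm N) *\<^sub>R (N /\<^sub>R norm N)"
    using N by (simp add: power2_eq_square divide_simps)
  then have "norm \<nu> = \<bar>(N \<bullet> \<nu>) / norm N\<bar>"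
    using N by (metis norm_scaleR norm_sgn sgn_div_norm mult.right_neutral norm_zero less_irrefl)
  then have "(N \<bullet> \<nu>) / norm N = 1 \<or> (N \<bullet> \<nu>) / norm N = -1" using assms(2) by linarith
  then show ?thesis using that eq unfolding N_def by blast
qed

section \<open>The divergence theorem on a surface\<close>

text \<open>
  The surface divergence of a real field with derivative \<open>X'\<close>: the trace of \<open>X'\<close> over the
  tangent plane.
\<close>

definition tdiv :: "(real^3 \<Rightarrow> real^3) \<Rightarrow> (real^3 \<Rightarrow> real^3 \<Rightarrow> real^3) \<Rightarrow> real^3 \<Rightarrow> real" where
  "tdiv \<nu> X' y = (\<Sum>l\<in>UNIV. X' y (axis l 1) $ l) - \<nu> y \<bullet> X' y (\<nu> y)"

definition chart_normal :: "(real^2 \<Rightarrow> real^3) \<Rightarrow> real^2 \<Rightarrow> real^3" where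
  "chart_normal r u = cross3 (param_pd 1 r u) (param_pd 2 r u) /\<^sub>R area_elt r u"

lemma chart_normal:
  assumes "local_param S W r" "u \<in> W"
  shows "chart_normal r u \<bullet> chart_normal r u = 1"
    "param_pd 1 r u \<bullet> chart_normal r u = 0" "param_pd 2 r u \<bullet> chart_normal r u = 0"
    "cross3 (param_pd 1 r u) (param_pd 2 r u) = area_elt r u *\<^sub>R chart_normal r u"
    "chart_normal r u \<bullet> cross3 (param_pd 1 r u) (param_pd 2 r u) = area_elt r u"
proof -
  have J: "area_elt r u > 0" using local_paramD(8)[OF assms] .
  show 1: "chart_normal r u \<bullet> chart_normal r u = 1"
    using J by (simp add: chart_normal_def dot_square_norm area_elt_def power2_eq_square field_simps)
  show "param_pd 1 r u \<bullet> chart_normal r u = 0" "param_pd 2 r u \<bullet> chart_normal r u = 0"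
    by (simp_all add: chart_normal_def dot_cross_self)
  show 2: "cross3 (param_pd 1 r u) (param_pd 2 r u) = area_elt r u *\<^sub>R chart_normal r u"
    using J by (simp add: chart_normal_def)
  show "chart_normal r u \<bullet> cross3 (param_pd 1 r u) (param_pd 2 r u) = area_elt r u"
    unfolding 2 by (simp add: 1)
qed

lemma unit_normal_chart:
  assumes "unit_normal S \<nu>" "local_param S W r" "u \<in> W"
  obtains s where "s = 1 \<or> s = -1" "\<nu> (r u) = s *\<^sub>R chart_normal r u"
proof -
  have "r u \<in> S" using local_paramD(6)[OF assms(2)] assms(3) by blast
  then have n: "norm (\<nu> (r u)) = 1" "\<nu> (r u) \<bullet> param_pd 1 r u = 0" "\<nu> (r u) \<bullet> param_pd 2 r u = 0"
    using assms by (auto simp: unit_normal_def)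
  from normal_of_tangents[OF local_paramD(7)[OF assms(2,3)] n] that
  show ?thesis unfolding chart_normal_def area_elt_def by blast
qed

text \<open>
  The product on the left depends on \<open>X'\<close> only through its values on the two tangent vectors.
  Hence surface divergences do not depend on how a field is extended off the surface.
\<close>

lemma tdiv_chart:
  assumes "unit_normal S \<nu>" "local_param S W r" "u \<in> W" and L: "linear (X' (r u))"
  shows "area_elt r u * tdiv \<nu> X' (r u) =
    chart_normal r u \<bullet> cross3 (X' (r u) (param_pd 1 r u)) (param_pd 2 r u) +
    chart_normal r u \<bullet> cross3 (param_pd 1 r u) (X' (r u) (param_pd 2 r u))"
proof -
  obtain s where s: "s = 1 \<or> s = -1" "\<nu> (r u) = s *\<^sub>R chart_normal r u"
    using unit_normal_chart[OF assms(1-3)] .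
  then have "\<nu> (r u) \<bullet> X' (r u) (\<nu> (r u)) = chart_normal r u \<bullet> X' (r u) (chart_normal r u)"
    by (auto simp: linear_neg[OF L])
  then show ?thesis
    using trace_cross[OF L, of "chart_normal r u" "param_pd 1 r u" "param_pd 2 r u"] chart_normal[OF assms(2,3)]
    by (simp add: tdiv_def algebra_simps)
qed

lemma continuous_chart_normal:
  assumes "local_param S W r"
  shows "continuous_on W (chart_normal r)"
  unfolding chart_normal_def[abs_def]
  by (intro continuous_intros continuous_on_cross local_paramD(10,11)[OF assms])
    (use local_paramD(8)[OF assms] in force)

text \<open>
  The derivative of a unit vector field is orthogonal to the field; this makes the derivatives
  of the normal drop out of the divergence below.
\<close>

lemma chart_normal_derivative:
  assumes p: "local_param S W r"
  obtains n' where "\<And>u. u \<in> W \<Longrightarrow> (chart_normal r has_derivative n' u) (at u)"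
    "\<And>v. continuous_on W (\<lambda>u. n' u v)" "\<And>u v. u \<in> W \<Longrightarrow> n' u v \<bullet> chart_normal r u = 0"
proof -
  have sm: "smooth_on W (param_pd i r)" for i using smooth_on_pd[OF local_paramD(2)[OF p]] .
  have cD: "continuous_on W (\<lambda>u. chart_D (param_pd i r) u v)" for i v
    unfolding chart_D_def by (intro continuous_intros smooth_on_continuous[OF smooth_on_pd[OF sm]])
  have dD: "(param_pd i r has_derivative chart_D (param_pd i r) u) (at u)" if "u \<in> W" for i u
    using smooth_on_has_derivative[OF sm that] unfolding chart_D_def[abs_def] .
  define N where "N = (\<lambda>u. cross3 (param_pd 1 r u) (param_pd 2 r u))"
  define N' where "N' = (\<lambda>u v. cross3 (param_pd 1 r u) (chart_D (param_pd 2 r) u v) + cross3 (chart_D (param_pd 1 r) u v) (param_pd 2 r u))"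
  have dN: "(N has_derivative N' u) (at u)" if "u \<in> W" for u
    unfolding N_def N'_def by (rule has_derivative_cross3[OF dD dD]) (use that in auto)
  have N0: "N u \<noteq> 0" if "u \<in> W" for u using local_paramD(7)[OF p that] by (simp add: N_def)
  define n' where "n' = (\<lambda>u v. inverse (norm (N u)) *\<^sub>R N' u v +
     (- (inverse (norm (N u)) * (N' u v \<bullet> sgn (N u)) * inverse (norm (N u)))) *\<^sub>R N u)"
  have cn: "chart_normal r = (\<lambda>u. inverse (norm (N u)) *\<^sub>R N u)"
    by (simp add: fun_eq_iff chart_normal_def N_def area_elt_def)
  have dn: "(chart_normal r has_derivative n' u) (at u)" if "u \<in> W" for u
  proof -
    have d0: "((\<lambda>u. norm (N u)) has_derivative (\<lambda>v. N' u v \<bullet> sgn (N u))) (at u)"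
      by (rule has_derivative_compose[OF dN[OF that] has_derivative_norm[OF N0[OF that]]])
    have "((\<lambda>u. inverse (norm (N u))) has_derivative (\<lambda>v. - (inverse (norm (N u)) * (N' u v \<bullet> sgn (N u)) * inverse (norm (N u))))) (at u)"
      using N0[OF that] by (intro Deriv.has_derivative_inverse d0) simp
    from has_derivative_scaleR[OF this dN[OF that]] show ?thesis unfolding cn n'_def .
  qed
  show ?thesis
  proof (rule that[OF dn])
    show "continuous_on W (\<lambda>u. n' u v)" for v
    proof -
      have cN: "continuous_on W N" unfolding N_def
        by (intro continuous_on_cross local_paramD(10)[OF p])
      have cN': "continuous_on W (\<lambda>u. N' u v)" unfolding N'_def
        by (intro continuous_intros continuous_on_cross local_paramD(10)[OF p] cD)
      show ?thesis unfolding n'_def sgn_div_norm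
        by (intro continuous_intros cN cN') (use N0 in auto)
    qed
    show "n' u v \<bullet> chart_normal r u = 0" if u: "u \<in> W" for u v
    proof -
      have "norm (N u) > 0" using N0[OF u] by simp
      then show ?thesis unfolding n'_def cn sgn_div_norm
        by (simp add: inner_left_distrib inner_diff_left dot_square_norm power2_eq_square field_simps)
    qed
  qed
qed

text \<open>
  The surface divergence of the field \<open>\<psi> X\<close>, for \<open>X\<close> tangential.
\<close>

definition div_integrand where
  "div_integrand \<nu> X X' \<psi> \<psi>' y = tdiv \<nu> X' y *\<^sub>R \<psi> y + \<psi>' y (X y)"

text \<open>
  Let \<open>t1\<close>, \<open>t2\<close> be the coordinate tangents, \<open>J\<close> the area element and \<open>n\<close> the normal.  By
  \<open>cramer_cross\<close>, \<open>J X\<close> has the coordinates \<open>n \<bullet> (X \<times> t2)\<close> and \<open>n \<bullet> (t1 \<times> X)\<close>.  Differentiating these,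
  times \<open>\<psi>\<close>, in the first and second variable and adding yields \<open>J\<close> times the surface divergence of
  \<open>\<psi> X\<close>: derivatives of \<open>n\<close> contribute nothing, because they, \<open>X\<close> and the tangents are all
  tangential, and the second derivatives of \<open>r\<close> cancel by symmetry.  Both summands are partial
  derivatives of compactly supported functions, whose integrals vanish.
\<close>

lemma chart_divergence:
  fixes \<psi> :: "real^3 \<Rightarrow> 'b::euclidean_space"
  assumes p: "local_param S W r" and nu: "unit_normal S \<nu>"
    and X: "C1_along S X X'" and tan: "\<And>y. y \<in> S \<Longrightarrow> X y \<bullet> \<nu> y = 0"
    and psi: "C1_along S \<psi> \<psi>'"
    and K: "compact K" "K \<subseteq> W" "\<And>u. u \<in> W - K \<Longrightarrow> \<psi> (r u) = 0"
  shows "integrable lborel (\<lambda>u. indicator W u *\<^sub>R area_elt r u *\<^sub>R div_integrand \<nu> X X' \<psi> \<psi>' (r u))"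
    "(LINT u|lborel. indicator W u *\<^sub>R area_elt r u *\<^sub>R div_integrand \<nu> X X' \<psi> \<psi>' (r u)) = 0"
proof -
  obtain n' where n': "\<And>u. u \<in> W \<Longrightarrow> (chart_normal r has_derivative n' u) (at u)"
    "\<And>v. continuous_on W (\<lambda>u. n' u v)" "\<And>u v. u \<in> W \<Longrightarrow> n' u v \<bullet> chart_normal r u = 0"
    using chart_normal_derivative[OF p] by blast
  define n where "n = chart_normal r"
  define t1 where "t1 = param_pd 1 r"
  define t2 where "t2 = param_pd 2 r"
  have sm: "smooth_on W (param_pd i r)" for i using smooth_on_pd[OF local_paramD(2)[OF p]] .
  have cD: "continuous_on W (\<lambda>u. chart_D (param_pd i r) u v)" for i v
    unfolding chart_D_def by (intro continuous_intros smooth_on_continuous[OF smooth_on_pd[OF sm]])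
  have dD: "(param_pd i r has_derivative chart_D (param_pd i r) u) (at u)" if "u \<in> W" for i u
    using smooth_on_has_derivative[OF sm that] unfolding chart_D_def[abs_def] .
  have rS: "r u \<in> S" if "u \<in> W" for u using local_paramD(6)[OF p] that by blast
  have dr: "(r has_derivative chart_D r u) (at u)" if "u \<in> W" for u using local_paramD(9)[OF p that] .
  have dX: "((\<lambda>u. X (r u)) has_derivative (\<lambda>v. X' (r u) (chart_D r u v))) (at u)" if "u \<in> W" for u
    by (rule has_derivative_compose[OF dr[OF that] C1_alongD(1)[OF X rS[OF that]]])
  have dpsi: "((\<lambda>u. \<psi> (r u)) has_derivative (\<lambda>v. \<psi>' (r u) (chart_D r u v))) (at u)" if "u \<in> W" for u
    by (rule has_derivative_compose[OF dr[OF that] C1_alongD(1)[OF psi rS[OF that]]])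
  have comp: "continuous_on W (\<lambda>u. f (r u))" if "continuous_on S f" for f :: "real^3 \<Rightarrow> 'c::topological_space"
    using continuous_on_compose2[OF that local_paramD(5)[OF p] local_paramD(6)[OF p]] by simp
  have cr: "continuous_on W (\<lambda>u. f' (r u) (chart_D r u v))" if "C1_along S f f'" for f and f' :: "real^3 \<Rightarrow> real^3 \<Rightarrow> 'c::real_normed_vector" and v
  proof -
    have "continuous_on W (\<lambda>u. \<Sum>l\<in>UNIV. chart_D r u v $ l *\<^sub>R f' (r u) (axis l 1))"
      unfolding chart_D_def
      by (intro continuous_intros local_paramD(10)[OF p] comp C1_alongD(2)[OF that])
    then show ?thesis
      by (rule continuous_on_eq) (metis linear_sum_axis C1_alongD(4)[OF that] rS)
  qed
  define G1 where "G1 = (\<lambda>u. (n u \<bullet> cross3 (X (r u)) (t2 u)) *\<^sub>R \<psi> (r u))"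
  define G2 where "G2 = (\<lambda>u. (n u \<bullet> cross3 (t1 u) (X (r u))) *\<^sub>R \<psi> (r u))"
  define G1' where "G1' = (\<lambda>u v. (n u \<bullet> cross3 (X (r u)) (t2 u)) *\<^sub>R \<psi>' (r u) (chart_D r u v) +
    (n u \<bullet> (cross3 (X (r u)) (chart_D t2 u v) + cross3 (X' (r u) (chart_D r u v)) (t2 u)) + n' u v \<bullet> cross3 (X (r u)) (t2 u)) *\<^sub>R \<psi> (r u))"
  define G2' where "G2' = (\<lambda>u v. (n u \<bullet> cross3 (t1 u) (X (r u))) *\<^sub>R \<psi>' (r u) (chart_D r u v) +
    (n u \<bullet> (cross3 (t1 u) (X' (r u) (chart_D r u v)) + cross3 (chart_D t1 u v) (X (r u))) + n' u v \<bullet> cross3 (t1 u) (X (r u))) *\<^sub>R \<psi> (r u))"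
  have dG1: "(G1 has_derivative G1' u) (at u)" if "u \<in> W" for u
    unfolding G1_def G1'_def n_def t1_def t2_def
    by (intro has_derivative_scaleR has_derivative_inner has_derivative_cross3 n' dX dpsi dD that)
  have dG2: "(G2 has_derivative G2' u) (at u)" if "u \<in> W" for u
    unfolding G2_def G2'_def n_def t1_def t2_def
    by (intro has_derivative_scaleR has_derivative_inner has_derivative_cross3 n' dX dpsi dD that)
  note cont = continuous_chart_normal[OF p] n'(2) comp[OF C1_alongD(3)[OF X]] comp[OF C1_alongD(3)[OF psi]]
    cr[OF X] cr[OF psi] cD local_paramD(10)[OF p]
  have cG1: "continuous_on W (\<lambda>u. G1' u v)" for v
    unfolding G1'_def n_def t1_def t2_def by (intro continuous_intros continuous_on_cross cont)
  have cG2: "continuous_on W (\<lambda>u. G2' u v)" for v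
    unfolding G2'_def n_def t1_def t2_def by (intro continuous_intros continuous_on_cross cont)
  have z: "G1 u = 0" "G2 u = 0" if "u \<in> W - K" for u using K(3)[OF that] by (simp_all add: G1_def G2_def)
  have I1: "integrable lborel (\<lambda>u. indicator W u *\<^sub>R G1' u (axis 1 1))" "(LINT u|lborel. indicator W u *\<^sub>R G1' u (axis 1 1)) = 0"
    by (rule integral_directional_derivative_zero[OF local_paramD(1)[OF p] dG1 cG1 K(1,2) z(1)]; assumption)+
  have I2: "integrable lborel (\<lambda>u. indicator W u *\<^sub>R G2' u (axis 2 1))" "(LINT u|lborel. indicator W u *\<^sub>R G2' u (axis 2 1)) = 0"
    by (rule integral_directional_derivative_zero[OF local_paramD(1)[OF p] dG2 cG2 K(1,2) z(2)]; assumption)+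
  have key: "G1' u (axis 1 1) + G2' u (axis 2 1) = area_elt r u *\<^sub>R div_integrand \<nu> X X' \<psi> \<psi>' (r u)" if u: "u \<in> W" for u
  proof -
    note cn = chart_normal[OF p u, folded n_def t1_def t2_def]
    have LX: "linear (X' (r u))" and Lp: "linear (\<psi>' (r u))"
      using C1_alongD(4)[OF X rS[OF u]] C1_alongD(4)[OF psi rS[OF u]] .
    obtain s where s: "s = 1 \<or> s = -1" "\<nu> (r u) = s *\<^sub>R n u"
      using unit_normal_chart[OF nu p u] unfolding n_def .
    then have Xn: "X (r u) \<bullet> n u = 0" using tan[OF rS[OF u]] by auto
    have b: "n' u v \<bullet> cross3 (X (r u)) (t2 u) = 0" "n' u v \<bullet> cross3 (t1 u) (X (r u)) = 0" for v
      using inner_cross_parallel[OF cn(1) Xn cn(3)] inner_cross_parallel[OF cn(1) cn(2) Xn] n'(3)[OF u]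
      unfolding n_def by simp_all
    have ax: "chart_D q u (axis 1 1) = param_pd 1 q u" "chart_D q u (axis 2 1) = param_pd 2 q u" for q
      by (simp_all add: chart_D_def axis_def)
    have sym: "chart_D t2 u (axis 1 1) = chart_D t1 u (axis 2 1)"
      unfolding ax t1_def t2_def by (rule param_pd_commute[OF local_paramD(1,2)[OF p] u])
    have sk: "n u \<bullet> cross3 (X (r u)) q + n u \<bullet> cross3 q (X (r u)) = 0" for q
      by (subst (2) cross_skew) simp
    have "cross3 (t1 u) (t2 u) \<bullet> X (r u) = 0" unfolding cn(4) using Xn by (simp add: inner_commute)
    then have Xdec: "(n u \<bullet> cross3 (X (r u)) (t2 u)) *\<^sub>R t1 u + (n u \<bullet> cross3 (t1 u) (X (r u))) *\<^sub>R t2 u = area_elt r u *\<^sub>R X (r u)"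
      using cramer_cross[of "n u" "X (r u)" "t2 u" "t1 u"] cn(5) by simp
    have "(n u \<bullet> cross3 (X (r u)) (t2 u)) *\<^sub>R \<psi>' (r u) (t1 u) + (n u \<bullet> cross3 (t1 u) (X (r u))) *\<^sub>R \<psi>' (r u) (t2 u)
       = \<psi>' (r u) (area_elt r u *\<^sub>R X (r u))"
      unfolding Xdec[symmetric] by (simp add: linear_add[OF Lp] linear_cmul[OF Lp])
    also have "\<dots> = area_elt r u *\<^sub>R \<psi>' (r u) (X (r u))" by (rule linear_cmul[OF Lp])
    finally have e1: "(n u \<bullet> cross3 (X (r u)) (t2 u)) *\<^sub>R \<psi>' (r u) (t1 u) + (n u \<bullet> cross3 (t1 u) (X (r u))) *\<^sub>R \<psi>' (r u) (t2 u)
       = area_elt r u *\<^sub>R \<psi>' (r u) (X (r u))" .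
    have e2: "area_elt r u * tdiv \<nu> X' (r u) = n u \<bullet> cross3 (X' (r u) (t1 u)) (t2 u) + n u \<bullet> cross3 (t1 u) (X' (r u) (t2 u))"
      using tdiv_chart[where X'=X', OF nu p u LX] unfolding n_def t1_def t2_def .
    have r1: "chart_D r u (axis 1 1) = t1 u" "chart_D r u (axis 2 1) = t2 u" by (simp_all add: ax t1_def t2_def)
    define q where "q = chart_D t1 u (axis 2 1)"
    have "G1' u (axis 1 1) + G2' u (axis 2 1) =
      ((n u \<bullet> cross3 (X (r u)) (t2 u)) *\<^sub>R \<psi>' (r u) (t1 u) + (n u \<bullet> cross3 (t1 u) (X (r u))) *\<^sub>R \<psi>' (r u) (t2 u)) +
      ((n u \<bullet> cross3 (X (r u)) q + n u \<bullet> cross3 q (X (r u))) +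
        (n u \<bullet> cross3 (X' (r u) (t1 u)) (t2 u) + n u \<bullet> cross3 (t1 u) (X' (r u) (t2 u)))) *\<^sub>R \<psi> (r u)"
      unfolding G1'_def G2'_def b r1 sym q_def[symmetric] by (simp add: inner_right_distrib algebra_simps)
    also have "\<dots> = area_elt r u *\<^sub>R \<psi>' (r u) (X (r u)) + (area_elt r u * tdiv \<nu> X' (r u)) *\<^sub>R \<psi> (r u)"
      unfolding e1 sk e2 by simp
    finally show ?thesis by (simp add: div_integrand_def algebra_simps)
  qed
  have eq: "indicator W u *\<^sub>R area_elt r u *\<^sub>R div_integrand \<nu> X X' \<psi> \<psi>' (r u) =
      indicator W u *\<^sub>R G1' u (axis 1 1) + indicator W u *\<^sub>R G2' u (axis 2 1)" for u
    using key[of u] by (simp add: indicator_def)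
  show "integrable lborel (\<lambda>u. indicator W u *\<^sub>R area_elt r u *\<^sub>R div_integrand \<nu> X X' \<psi> \<psi>' (r u))"
    unfolding eq using I1(1) I2(1) by (rule Bochner_Integration.integrable_add)
  show "(LINT u|lborel. indicator W u *\<^sub>R area_elt r u *\<^sub>R div_integrand \<nu> X X' \<psi> \<psi>' (r u)) = 0"
    unfolding eq Bochner_Integration.integral_add[OF I1(1) I2(1)] I1(2) I2(2) by simp
qed

lemma continuous_on_via_charts:
  assumes S: "smooth_surface S" and f: "\<And>W r. local_param S W r \<Longrightarrow> continuous_on W (\<lambda>u. f (r u))"
  shows "continuous_on S f"
proof -
  have "\<exists>T. open T \<and> y \<in> T \<and> continuous_on (S \<inter> T) f" if yS: "y \<in> S" for y
  proof -
    obtain W r u where p: "local_param S W r" "u \<in> W" "y = r u" using smooth_surfaceE[OF S yS] .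
    obtain g where g: "homeomorphism W (r ` W) r g" using local_param_inv[OF p(1)] .
    obtain T where T: "open T" "r ` W = S \<inter> T" using local_paramD(3)[OF p(1)] by (auto simp: openin_open)
    have "continuous_on (r ` W) (\<lambda>y. f (r (g y)))"
      using continuous_on_compose2[OF f[OF p(1)], of "r ` W" g] g by (simp add: homeomorphism_def)
    then have "continuous_on (r ` W) f"
      by (rule continuous_on_eq) (use g in \<open>auto simp: homeomorphism_def\<close>)
    moreover have "y \<in> r ` W" using p by simp
    ultimately show ?thesis using T by (intro exI[of _ T]) auto
  qed
  then show ?thesis
    unfolding continuous_on_eq_continuous_within
  proof (intro ballI)
    fix y assume y: "y \<in> S"
    then obtain T where T: "open T" "y \<in> T" "continuous_on (S \<inter> T) f"
      using \<open>\<And>y. y \<in> S \<Longrightarrow> \<exists>T. open T \<and> y \<in> T \<and> continuous_on (S \<inter> T) f\<close> by blast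
    then have "continuous (at y within S \<inter> T) f" using y by (simp add: continuous_on_eq_continuous_within)
    moreover have "at y within S \<inter> T = at y within S" by (rule at_within_nhd[OF T(2,1)]) auto
    ultimately show "continuous (at y within S) f" by simp
  qed
qed

lemma continuous_tdiv:
  assumes S: "smooth_surface S" and nu: "unit_normal S \<nu>" and X: "C1_along S X X'"
  shows "continuous_on S (tdiv \<nu> X')"
proof (rule continuous_on_via_charts[OF S])
  fix W r assume p: "local_param S W r"
  have "continuous_on W (\<lambda>u. (\<Sum>l\<in>UNIV. X' (r u) (axis l 1) $ l)
      - chart_normal r u \<bullet> (\<Sum>l\<in>UNIV. chart_normal r u $ l *\<^sub>R X' (r u) (axis l 1)))"
    by (intro continuous_intros continuous_chart_normal[OF p]
         continuous_on_compose2[OF C1_alongD(2)[OF X] local_paramD(5)[OF p] local_paramD(6)[OF p]])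
  then show "continuous_on W (\<lambda>u. tdiv \<nu> X' (r u))"
  proof (rule continuous_on_eq)
    fix u assume u: "u \<in> W"
    have "r u \<in> S" using local_paramD(6)[OF p] u by blast
    then have L: "linear (X' (r u))" using C1_alongD(4)[OF X] by blast
    obtain s where "s = 1 \<or> s = -1" "\<nu> (r u) = s *\<^sub>R chart_normal r u" using unit_normal_chart[OF nu p u] .
    then show "(\<Sum>l\<in>UNIV. X' (r u) (axis l 1) $ l)
      - chart_normal r u \<bullet> (\<Sum>l\<in>UNIV. chart_normal r u $ l *\<^sub>R X' (r u) (axis l 1)) = tdiv \<nu> X' (r u)"
      unfolding linear_sum_axis[OF L, symmetric] tdiv_def by (auto simp: linear_neg[OF L])
  qed
qed

text \<open>
  The squared positive part is continuously differentiable, and two copies of it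
  compose to \<open>sstep\<close>, a step of class C^1 that equals 0 up to 0 and 1 from 1 on.
\<close>

definition sqp :: "real \<Rightarrow> real" where "sqp t = (max 0 t)\<^sup>2"

lemma sqp_deriv: "(sqp has_real_derivative 2 * max 0 t) (at t)"
proof -
  consider "t > 0" | "t < 0" | "t = 0" by linarith
  then show ?thesis
  proof cases
    case 1
    have "((\<lambda>t. t\<^sup>2) has_real_derivative 2 * t) (at t)" by (auto intro!: derivative_eq_intros)
    then show ?thesis
      by (rule DERIV_cong[OF has_field_derivative_transform_within_open[of _ _ _ "{0<..}"]]) (use 1 in \<open>auto simp: sqp_def\<close>)
  next
    case 2
    have "((\<lambda>t. 0) has_real_derivative 0) (at t)" by (rule DERIV_const)
    then show ?thesis
      by (rule DERIV_cong[OF has_field_derivative_transform_within_open[of _ _ _ "{..<0}"]]) (use 2 in \<open>auto simp: sqp_def\<close>)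
  next
    case 3
    have "((\<lambda>h. sqp h / h) \<longlongrightarrow> 0) (at 0)"
    proof (rule tendsto_rabs_zero_cancel, rule tendsto_0_le[where K=1])
      show "((\<lambda>h::real. h) \<longlongrightarrow> 0) (at 0)" by (rule tendsto_ident_at)
      show "\<forall>\<^sub>F h in at 0. norm \<bar>sqp h / h\<bar> \<le> norm h * 1"
        by (rule always_eventually) (auto simp: sqp_def max_def power2_eq_square)
    qed
    then show ?thesis unfolding 3 by (simp add: has_field_derivative_iff sqp_def)
  qed
qed

definition sstep :: "real \<Rightarrow> real" where "sstep t = sqp (1 - sqp (1 - t))"
definition sstep' :: "real \<Rightarrow> real" where "sstep' t = 4 * max 0 (1 - sqp (1 - t)) * max 0 (1 - t)"

lemma sstep_deriv: "(sstep has_real_derivative sstep' t) (at t)"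
proof -
  have "((\<lambda>t. 1 - sqp (1 - t)) has_real_derivative 2 * max 0 (1 - t)) (at t)"
    by (auto intro!: derivative_eq_intros DERIV_chain2[OF sqp_deriv])
  from DERIV_chain2[OF sqp_deriv this] show ?thesis
    unfolding sstep_def[abs_def] sstep'_def by (rule DERIV_cong) simp
qed

lemma sstep_0: "t \<le> 0 \<Longrightarrow> sstep t = 0"
proof -
  assume t: "t \<le> 0"
  have "1 \<le> (1 - t)\<^sup>2" using t power_mono[of 1 "1 - t" 2] by simp
  then show ?thesis using t by (simp add: sstep_def sqp_def)
qed

lemma sstep_1: "t \<ge> 1 \<Longrightarrow> sstep t = 1" by (simp add: sstep_def sqp_def)

lemma sstep_range: "0 \<le> sstep t" "sstep t \<le> 1"
proof -
  show "0 \<le> sstep t" by (simp add: sstep_def sqp_def)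
  have "max 0 (1 - sqp (1 - t)) \<le> 1" by (simp add: sqp_def)
  then show "sstep t \<le> 1" unfolding sstep_def sqp_def[of "1 - sqp (1 - t)"] by (simp add: power_le_one)
qed

lemma sstep'_0: "t \<le> 0 \<or> t \<ge> 1 \<Longrightarrow> sstep' t = 0"
proof -
  assume t: "t \<le> 0 \<or> t \<ge> 1"
  have "1 \<le> (1 - t)\<^sup>2" if "t \<le> 0" using that power_mono[of 1 "1 - t" 2] by simp
  then show ?thesis using t by (auto simp: sstep'_def sqp_def)
qed

lemma sstep'_bound: "\<bar>sstep' t\<bar> \<le> 4"
proof (cases "t \<le> 0")
  case False
  have "max 0 (1 - sqp (1 - t)) * max 0 (1 - t) \<le> 1 * 1"
    using False by (intro mult_mono) (auto simp: sqp_def)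
  then show ?thesis by (simp add: sstep'_def abs_mult)
qed (simp add: sstep'_0)

lemma continuous_sstep': "continuous_on A sstep'"
  unfolding sstep'_def[abs_def] sqp_def by (intro continuous_intros)

lemma continuous_sstep: "continuous_on A sstep"
  unfolding sstep_def[abs_def] sqp_def by (intro continuous_intros)

lemma C1_along_sstep:
  assumes "C1_along S q q'"
  shows "C1_along S (\<lambda>y. sstep (q y)) (\<lambda>y v. sstep' (q y) * q' y v)"
  unfolding C1_along_def
proof (intro conjI ballI allI)
  fix y assume "y \<in> S"
  from has_derivative_compose[OF C1_alongD(1)[OF assms this], of sstep "\<lambda>h. sstep' (q y) * h"]
  show "((\<lambda>y. sstep (q y)) has_derivative (\<lambda>v. sstep' (q y) * q' y v)) (at y)"
    using sstep_deriv[of "q y"] by (simp add: has_field_derivative_def)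
next
  show "continuous_on S (\<lambda>y. sstep' (q y) * q' y v)" for v
    by (intro continuous_intros C1_alongD(2)[OF assms] continuous_on_compose2[OF continuous_sstep' C1_alongD(3)[OF assms]]) auto
qed

definition bump :: "real^3 \<Rightarrow> real \<Rightarrow> real^3 \<Rightarrow> real" where
  "bump p \<rho> y = sstep (2 - ((y - p) \<bullet> (y - p)) / \<rho>\<^sup>2)"

lemma C1_along_bump: "\<exists>b'. C1_along S (bump p \<rho>) b'"
proof -
  have "C1_along S (\<lambda>y. 2 - ((y - p) \<bullet> (y - p)) / \<rho>\<^sup>2) (\<lambda>y v. - (2 * ((y - p) \<bullet> v)) / \<rho>\<^sup>2)"
    unfolding C1_along_def
  proof (intro conjI ballI allI)
    fix y :: "real^3"
    show "((\<lambda>y. 2 - ((y - p) \<bullet> (y - p)) / \<rho>\<^sup>2) has_derivative (\<lambda>v. - (2 * ((y - p) \<bullet> v)) / \<rho>\<^sup>2)) (at y)"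
      by (auto intro!: derivative_eq_intros simp: inner_commute divide_inverse algebra_simps)
  qed (unfold divide_inverse, intro continuous_intros)
  from C1_along_sstep[OF this] show ?thesis unfolding bump_def[abs_def] by blast
qed

lemma bump_1: "\<rho> > 0 \<Longrightarrow> y \<in> ball p \<rho> \<Longrightarrow> bump p \<rho> y = 1"
proof -
  assume r: "\<rho> > 0" "y \<in> ball p \<rho>"
  have "norm (y - p) < \<rho>" using r by (simp add: dist_norm norm_minus_commute)
  then have "(norm (y - p))\<^sup>2 \<le> \<rho>\<^sup>2" by (intro power_mono) auto
  then have "((y - p) \<bullet> (y - p)) / \<rho>\<^sup>2 \<le> 1" using r by (simp add: dot_square_norm divide_le_eq)
  then show ?thesis by (simp add: bump_def sstep_1)
qed

lemma bump_0: "\<rho> > 0 \<Longrightarrow> y \<notin> cball p (2 * \<rho>) \<Longrightarrow> bump p \<rho> y = 0"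
proof -
  assume r: "\<rho> > 0" "y \<notin> cball p (2 * \<rho>)"
  have "2 * \<rho> \<le> norm (y - p)" using r by (simp add: dist_norm norm_minus_commute)
  then have "(2 * \<rho>)\<^sup>2 \<le> (norm (y - p))\<^sup>2" using r by (intro power_mono) auto
  moreover have "2 * \<rho>\<^sup>2 \<le> (2 * \<rho>)\<^sup>2" by (simp add: power2_eq_square)
  ultimately have "2 * \<rho>\<^sup>2 \<le> (y - p) \<bullet> (y - p)" by (simp only: dot_square_norm)
  then have "((y - p) \<bullet> (y - p)) / \<rho>\<^sup>2 \<ge> 2" using r by (simp add: le_divide_eq)
  then show ?thesis by (simp add: bump_def sstep_0)
qed

locale surface_field =
  fixes S :: "(real^3) set" and \<nu> :: "real^3 \<Rightarrow> real^3" and X :: "real^3 \<Rightarrow> real^3" and X'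
  assumes S: "S \<in> sets borel" "smooth_surface S" and nu: "unit_normal S \<nu>"
    and X: "C1_along S X X'" and tan: "\<And>y. y \<in> S \<Longrightarrow> X y \<bullet> \<nu> y = 0"
begin

lemma continuous_div_integrand:
  assumes "C1_along S \<psi> \<psi>'"
  shows "continuous_on S (div_integrand \<nu> X X' \<psi> \<psi>')"
  unfolding div_integrand_def[abs_def]
  by (intro continuous_intros continuous_tdiv[OF S(2) nu X] C1_alongD(3)[OF assms]
     C1_along_continuous_apply[OF assms] C1_alongD(3)[OF X])

text \<open>
  Off the closed set \<open>C\<close> the function \<open>\<psi>\<close> vanishes in a whole neighbourhood, hence so does its
  derivative.
\<close>

lemma div_integrand_vanishes:
  assumes psi: "C1_along S \<psi> \<psi>'" and C: "closed C" "\<And>y. y \<notin> C \<Longrightarrow> \<psi> y = 0" and y: "y \<in> S" "y \<notin> C"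
  shows "div_integrand \<nu> X X' \<psi> \<psi>' y = 0"
proof -
  have "(\<psi> has_derivative (\<lambda>_. 0)) (at y)"
    by (rule has_derivative_transform_within_open[OF has_derivative_const[of 0] open_Compl[OF C(1)]]) (use C y in auto)
  then have "\<psi>' y = (\<lambda>_. 0)" using C1_alongD(1)[OF psi y(1)] has_derivative_unique by blast
  then show ?thesis using C(2)[OF y(2)] by (simp add: div_integrand_def)
qed

abbreviation "div_zero \<psi> \<psi>' \<equiv> set_integrable (surface_measure S) S (div_integrand \<nu> X X' \<psi> \<psi>') \<and>
  (LINT y:S|surface_measure S. div_integrand \<nu> X X' \<psi> \<psi>' y) = 0"

lemma divergence_in_chart:
  fixes \<psi> :: "real^3 \<Rightarrow> 'b::euclidean_space"
  assumes psi: "C1_along S \<psi> \<psi>'" and C: "closed C" "\<And>y. y \<notin> C \<Longrightarrow> \<psi> y = 0"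
    and p: "local_param S W r" and CS: "compact (S \<inter> C)" "S \<inter> C \<subseteq> r ` W"
  shows "div_zero \<psi> \<psi>'"
proof -
  let ?f = "div_integrand \<nu> X X' \<psi> \<psi>'"
  define f where "f = (\<lambda>y. indicator S y *\<^sub>R ?f y)"
  have fm: "f \<in> borel_measurable borel" unfolding f_def
    by (rule borel_measurable_continuous_on_indicator[OF S(1) continuous_div_integrand[OF psi]])
  obtain g where g: "homeomorphism W (r ` W) r g" using local_param_inv[OF p] .
  define K where "K = g ` (S \<inter> C)"
  have "continuous_on (r ` W) g" using g by (simp add: homeomorphism_def)
  then have K: "compact K" unfolding K_def by (rule compact_continuous_image[OF continuous_on_subset[OF _ CS(2)] CS(1)])
  have gr: "g ` r ` W = W" "\<And>u. u \<in> W \<Longrightarrow> g (r u) = u" using g by (auto simp: homeomorphism_def)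
  have KW: "K \<subseteq> W" unfolding K_def using image_mono[OF CS(2), of g] gr(1) by simp
  have rS: "r u \<in> S" if "u \<in> W" for u using local_paramD(6)[OF p] that by blast
  have Kz: "\<psi> (r u) = 0" if u: "u \<in> W - K" for u
  proof (rule C(2), rule notI)
    assume "r u \<in> C"
    then have "g (r u) \<in> K" using rS u by (auto simp: K_def)
    then show False using u gr(2)[of u] by simp
  qed
  note cd = chart_divergence[OF p nu X tan psi K KW Kz]
  have eq: "chart_dens W r u *\<^sub>R f (chart_ext W r u) = indicator W u *\<^sub>R area_elt r u *\<^sub>R ?f (r u)" for u
    using rS[of u] by (simp add: chart_dens_def chart_ext_def f_def indicator_def)
  note ic = integral_chart[OF S p fm, unfolded eq]
  have ind: "indicator (r ` W) y *\<^sub>R f y = indicator S y *\<^sub>R ?f y" for y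
  proof (cases "y \<in> S \<and> y \<notin> r ` W")
    case True
    then have "?f y = 0" using div_integrand_vanishes[OF psi C] CS(2) by blast
    then show ?thesis by (simp add: f_def)
  next
    case False
    then show ?thesis using local_paramD(6)[OF p] by (auto simp: f_def indicator_def)
  qed
  show ?thesis
    using ic cd unfolding set_integrable_def set_lebesgue_integral_def ind by simp
qed

text \<open>
  Each point of the surface is the centre of a ball whose double lies in a chart.  Finitely many
  of the balls cover the support of \<open>\<psi>\<close>, and induction on their number takes the place of a
  partition of unity: a bump at one centre splits \<open>\<psi>\<close> into a part inside the chart and a part that vanishes
  on that ball, so that its support is covered by the remaining balls.
\<close>

theorem divergence_theorem:
  fixes \<psi> :: "real^3 \<Rightarrow> 'b::euclidean_space"
  assumes psi: "C1_along S \<psi> \<psi>'" and C: "closed C" "\<And>y. y \<notin> C \<Longrightarrow> \<psi> y = 0" and CS: "compact (S \<inter> C)"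
  shows "div_zero \<psi> \<psi>'"
proof -
  have "\<exists>\<rho>>0. \<exists>W r. local_param S W r \<and> compact (S \<inter> cball p (2 * \<rho>)) \<and> S \<inter> cball p (2 * \<rho>) \<subseteq> r ` W" if pS: "p \<in> S" for p
  proof -
    obtain W r u where W: "local_param S W r" "u \<in> W" "p = r u" using smooth_surfaceE[OF S(2) pS] .
    obtain d where d: "d > 0" "cball u d \<subseteq> W" using local_paramD(1)[OF W(1)] W(2) open_contains_cball by blast
    obtain T where T: "open T" "r ` ball u d = S \<inter> T" and pT: "p \<in> T"
      using chart_ball_open[OF W(1,2) d] W(3) by metis
    from pT obtain e where e: "e > 0" "cball p e \<subseteq> T" using T(1) open_contains_cball by blast
    have eq: "S \<inter> cball p e = r ` cball u d \<inter> cball p e"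
    proof (intro equalityI subsetI)
      fix y assume y: "y \<in> S \<inter> cball p e"
      then have "y \<in> r ` ball u d" unfolding T(2) using e(2) by auto
      then show "y \<in> r ` cball u d \<inter> cball p e" using y ball_subset_cball[of u d] by auto
    next
      fix y assume "y \<in> r ` cball u d \<inter> cball p e"
      then show "y \<in> S \<inter> cball p e" using d(2) local_paramD(6)[OF W(1)] by auto
    qed
    have "compact (r ` cball u d)"
      by (intro compact_continuous_image continuous_on_subset[OF local_paramD(5)[OF W(1)] d(2)] compact_cball)
    then have "compact (S \<inter> cball p e)" unfolding eq by (intro compact_Int_closed) auto
    moreover have "S \<inter> cball p e \<subseteq> r ` W" unfolding eq using d(2) by auto
    ultimately show ?thesis using e(1) W(1) by (intro exI[of _ "e/2"]) auto
  qed
  then obtain \<rho> where \<rho>: "\<And>p. p \<in> S \<Longrightarrow> \<rho> p > 0 \<and> (\<exists>W r. local_param S W r \<and> compact (S \<inter> cball p (2 * \<rho> p)) \<and> S \<inter> cball p (2 * \<rho> p) \<subseteq> r ` W)"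
    by metis
  have ind: "div_zero \<psi> \<psi>'"
    if "finite A" "A \<subseteq> S" "C1_along S \<psi> \<psi>'" "closed C" "\<And>y. y \<notin> C \<Longrightarrow> \<psi> y = 0" "compact (S \<inter> C)" "S \<inter> C \<subseteq> (\<Union>p\<in>A. ball p (\<rho> p))"
    for A and \<psi> :: "real^3 \<Rightarrow> 'b" and \<psi>' C
    using that
  proof (induction A arbitrary: \<psi> \<psi>' C rule: finite_induct)
    case empty
    have e: "indicator S y *\<^sub>R div_integrand \<nu> X X' \<psi> \<psi>' y = 0" for y
      using div_integrand_vanishes[OF empty(2,3,4), of y] empty(6) by (auto simp: indicator_def)
    show ?case unfolding set_integrable_def set_lebesgue_integral_def e by simp
  next
    case (insert p A)
    have pS: "p \<in> S" using insert by simp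
    note r = \<rho>[OF pS]
    obtain b' where b': "C1_along S (bump p (\<rho> p)) b'" using C1_along_bump by blast
    define c where "c = (\<lambda>y. 1 - bump p (\<rho> p) y)"
    have c': "C1_along S c (\<lambda>y v. - b' y v)"
      using b' unfolding C1_along_def c_def by (auto intro!: derivative_eq_intros continuous_intros)
    define \<psi>1' where "\<psi>1' = (\<lambda>y v. bump p (\<rho> p) y *\<^sub>R \<psi>' y v + b' y v *\<^sub>R \<psi> y)"
    define \<psi>2' where "\<psi>2' = (\<lambda>y v. c y *\<^sub>R \<psi>' y v + - b' y v *\<^sub>R \<psi> y)"
    have 1: "C1_along S (\<lambda>y. bump p (\<rho> p) y *\<^sub>R \<psi> y) \<psi>1'" unfolding \<psi>1'_def
      by (rule C1_along_scaleR[OF b' insert(5)])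
    have 2: "C1_along S (\<lambda>y. c y *\<^sub>R \<psi> y) \<psi>2'" unfolding \<psi>2'_def
      by (rule C1_along_scaleR[OF c' insert(5)])
    obtain W r where W: "local_param S W r" "compact (S \<inter> cball p (2 * \<rho> p))" "S \<inter> cball p (2 * \<rho> p) \<subseteq> r ` W"
      using r by blast
    have z1: "div_zero (\<lambda>y. bump p (\<rho> p) y *\<^sub>R \<psi> y) \<psi>1'"
      by (rule divergence_in_chart[OF 1 _ _ W(1,2,3)]) (use r bump_0 in auto)
    have z2: "div_zero (\<lambda>y. c y *\<^sub>R \<psi> y) \<psi>2'"
    proof (rule insert.IH[OF _ 2])
      show "closed (C - ball p (\<rho> p))" using insert(6) by (intro closed_Diff) auto
      show "c y *\<^sub>R \<psi> y = 0" if "y \<notin> C - ball p (\<rho> p)" for y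
        using that insert(7)[of y] bump_1[of "\<rho> p" y p] r by (auto simp: c_def)
      have "S \<inter> (C - ball p (\<rho> p)) = (S \<inter> C) \<inter> - ball p (\<rho> p)" by blast
      then show "compact (S \<inter> (C - ball p (\<rho> p)))" using insert(8) by (simp add: compact_Int_closed closed_Compl)
      show "S \<inter> (C - ball p (\<rho> p)) \<subseteq> (\<Union>p\<in>A. ball p (\<rho> p))" using insert(9) by auto
      show "A \<subseteq> S" using insert by simp
    qed
    have eq: "div_integrand \<nu> X X' \<psi> \<psi>' = (\<lambda>y. div_integrand \<nu> X X' (\<lambda>y. bump p (\<rho> p) y *\<^sub>R \<psi> y) \<psi>1' y + div_integrand \<nu> X X' (\<lambda>y. c y *\<^sub>R \<psi> y) \<psi>2' y)"
      by (auto simp: div_integrand_def \<psi>1'_def \<psi>2'_def c_def algebra_simps)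
    show ?case unfolding eq using z1 z2 by (auto simp: set_integral_add)
  qed
  obtain A where A: "A \<subseteq> S \<inter> C" "finite A" "S \<inter> C \<subseteq> (\<Union>p\<in>A. ball p (\<rho> p))"
  proof (rule compactE_image[OF CS, of "S \<inter> C" "\<lambda>p. ball p (\<rho> p)"])
    show "S \<inter> C \<subseteq> (\<Union>p\<in>S \<inter> C. ball p (\<rho> p))" using \<rho> by force
  qed auto
  have "A \<subseteq> S" using A(1) by blast
  show ?thesis by (rule ind[OF A(2) \<open>A \<subseteq> S\<close> psi C CS A(3)])
qed

end

section \<open>Complex fields\<close>

definition Rev :: "complex^3 \<Rightarrow> real^3" where "Rev v = (\<chi> l. Re (v $ l))"
definition Imv :: "complex^3 \<Rightarrow> real^3" where "Imv v = (\<chi> l. Im (v $ l))"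

lemma bounded_linear_Rev: "bounded_linear Rev" and bounded_linear_Imv: "bounded_linear Imv"
  by (auto intro!: linear_conv_bounded_linear[THEN iffD1] simp: linear_iff Rev_def Imv_def vec_eq_iff)

lemma Rev_Imv_nth [simp]: "Rev v $ l = Re (v $ l)" "Imv v $ l = Im (v $ l)" by (simp_all add: Rev_def Imv_def)

text \<open>
  \<open>surf_div\<close> uses a derivative within the surface selected by choice, about which only the values on tangent
  vectors are known; by \<open>tdiv_chart\<close> these values determine the surface divergence, which can
  thus be computed from any extension \<open>F\<close>.
\<close>

lemma surf_div_eq:
  assumes S: "smooth_surface S" and nu: "unit_normal S \<nu>" and F: "C1_along S F F'"
    and eq: "\<And>y. y \<in> S \<Longrightarrow> \<phi> y = F y" and y: "y \<in> S"
  shows "surf_div S \<nu> \<phi> y = Complex (tdiv \<nu> (\<lambda>y v. Rev (F' y v)) y) (tdiv \<nu> (\<lambda>y v. Imv (F' y v)) y)"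
proof -
  obtain W r u where p: "local_param S W r" "u \<in> W" "y = r u" using smooth_surfaceE[OF S y] .
  have "(F has_derivative F' y) (at y within S)" by (rule has_derivative_at_withinI[OF C1_alongD(1)[OF F y]])
  then have d1: "(\<phi> has_derivative F' y) (at y within S)"
    by (rule has_derivative_transform[OF y eq, rotated])
  define D where "D = frechet_derivative \<phi> (at y within S)"
  have d2: "(\<phi> has_derivative D) (at y within S)"
    unfolding D_def using d1 frechet_derivative_works differentiable_def by blast
  have sub: "r ` W \<subseteq> S" using local_paramD(6)[OF p(1)] .
  have comp: "((\<lambda>w. \<phi> (r w)) has_derivative (\<lambda>h. A (chart_D r u h))) (at u)" if "(\<phi> has_derivative A) (at y within S)" for A
  proof -
    have "((\<lambda>w. \<phi> (r w)) has_derivative (\<lambda>h. A (chart_D r u h))) (at u within W)"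
      by (rule has_derivative_in_compose[OF has_derivative_at_withinI[OF local_paramD(9)[OF p(1,2)]]
            has_derivative_subset[OF that[unfolded p(3)] sub]])
    then show ?thesis using at_within_open[OF p(2) local_paramD(1)[OF p(1)]] by simp
  qed
  have "(\<lambda>h. D (chart_D r u h)) = (\<lambda>h. F' y (chart_D r u h))"
    using comp[OF d1] comp[OF d2] has_derivative_unique by blast
  then have Dt: "D (param_pd 1 r u) = F' y (param_pd 1 r u)" "D (param_pd 2 r u) = F' y (param_pd 2 r u)"
    by (auto simp: fun_eq_iff chart_D_def axis_def dest: spec[of _ "axis 1 1"] spec[of _ "axis 2 1"])
  have lin: "linear D" "linear (F' y)" using d1 d2 has_derivative_linear by blast+
  have lc: "linear (\<lambda>v. h (A v))" if "bounded_linear h" "linear A" for h :: "complex^3 \<Rightarrow> real^3" and A :: "real^3 \<Rightarrow> complex^3"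
    using linear_compose[OF that(2) bounded_linear.linear[OF that(1)]] by (simp add: o_def)
  have J: "area_elt r u > 0" using local_paramD(8)[OF p(1,2)] .
  have tt: "tdiv \<nu> (\<lambda>y v. h (D v)) y = tdiv \<nu> (\<lambda>y v. h (F' y v)) y" if h: "bounded_linear h" for h :: "complex^3 \<Rightarrow> real^3"
  proof -
    have "area_elt r u * tdiv \<nu> (\<lambda>y v. h (D v)) y = area_elt r u * tdiv \<nu> (\<lambda>y v. h (F' y v)) y"
      using tdiv_chart[where X'="\<lambda>y v. h (D v)", OF nu p(1,2) lc[OF h lin(1)]]
        tdiv_chart[where X'="\<lambda>y v. h (F' y v)", OF nu p(1,2)] lc[OF h lin(2)]
      unfolding p(3)[symmetric] Dt by simp
    then show ?thesis using J by simp
  qed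
  have "surf_div S \<nu> \<phi> y = Complex (tdiv \<nu> (\<lambda>y v. Rev (D v)) y) (tdiv \<nu> (\<lambda>y v. Imv (D v)) y)"
    unfolding surf_div_def D_def[symmetric] tdiv_def
    by (simp add: complex_eq_iff sum_3 cdot_def cvec_def inner_vec_def)
  then show ?thesis using tt[OF bounded_linear_Rev] tt[OF bounded_linear_Imv] by simp
qed

text \<open>
  The divergence theorem for the real and the imaginary part of the field.
\<close>

lemma complex_divergence:
  fixes \<psi> :: "real^3 \<Rightarrow> complex"
  assumes S: "S \<in> sets borel" "smooth_surface S" and nu: "unit_normal S \<nu>" and F: "C1_along S F F'"
    and eq: "\<And>y. y \<in> S \<Longrightarrow> \<phi> y = F y" and tan: "tangential S \<nu> \<phi>"
    and psi: "C1_along S \<psi> \<psi>'" and C: "closed C" "\<And>y. y \<notin> C \<Longrightarrow> \<psi> y = 0" "compact (S \<inter> C)"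
  shows "set_integrable (surface_measure S) S (\<lambda>y. surf_div S \<nu> \<phi> y * \<psi> y + (\<Sum>l\<in>UNIV. \<psi>' y (axis l 1) * \<phi> y $ l))"
    "(LINT y:S|surface_measure S. surf_div S \<nu> \<phi> y * \<psi> y + (\<Sum>l\<in>UNIV. \<psi>' y (axis l 1) * \<phi> y $ l)) = 0"
proof -
  have t: "Rev (F y) \<bullet> \<nu> y = 0 \<and> Imv (F y) \<bullet> \<nu> y = 0" if "y \<in> S" for y
    using tan eq[OF that] that by (auto simp: tangential_def cdot_def cvec_def inner_vec_def sum_3 complex_eq_iff mult.commute)
  interpret R: surface_field S \<nu> "\<lambda>y. Rev (F y)" "\<lambda>y v. Rev (F' y v)"
    by (rule surface_field.intro[OF S nu C1_along_linear[OF bounded_linear_Rev F] conjunct1[OF t]])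
  interpret I: surface_field S \<nu> "\<lambda>y. Imv (F y)" "\<lambda>y v. Imv (F' y v)"
    by (rule surface_field.intro[OF S nu C1_along_linear[OF bounded_linear_Imv F] conjunct2[OF t]])
  note dR = R.divergence_theorem[OF psi C] and dI = I.divergence_theorem[OF psi C]
  let ?R = "div_integrand \<nu> (\<lambda>y. Rev (F y)) (\<lambda>y v. Rev (F' y v)) \<psi> \<psi>'"
  let ?I = "div_integrand \<nu> (\<lambda>y. Imv (F y)) (\<lambda>y v. Imv (F' y v)) \<psi> \<psi>'"
  have e: "indicator S y *\<^sub>R (surf_div S \<nu> \<phi> y * \<psi> y + (\<Sum>l\<in>UNIV. \<psi>' y (axis l 1) * \<phi> y $ l)) = indicator S y *\<^sub>R (?R y + \<i> * ?I y)" for y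
  proof (cases "y \<in> S")
    case True
    have L: "linear (\<psi>' y)" using C1_alongD(4)[OF psi True] .
    have c: "\<phi> y $ l = of_real (Re (F y $ l)) + \<i> * of_real (Im (F y $ l))" for l
      using complex_eq[of "F y $ l"] eq[OF True] by simp
    have 1: "\<psi>' y (Rev (F y)) + \<i> * \<psi>' y (Imv (F y)) = (\<Sum>l\<in>UNIV. \<psi>' y (axis l 1) * \<phi> y $ l)"
      unfolding linear_sum_axis[OF L, of "Rev (F y)"] linear_sum_axis[OF L, of "Imv (F y)"] c
      by (simp add: sum_3 scaleR_conv_of_real algebra_simps)
    have 2: "surf_div S \<nu> \<phi> y = of_real (tdiv \<nu> (\<lambda>y v. Rev (F' y v)) y) + \<i> * of_real (tdiv \<nu> (\<lambda>y v. Imv (F' y v)) y)"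
      using surf_div_eq[where \<phi>=\<phi>, OF S(2) nu F eq True] unfolding Complex_eq by simp
    show ?thesis unfolding 1[symmetric] 2 div_integrand_def by (simp add: scaleR_conv_of_real algebra_simps)
  qed simp
  have "set_integrable (surface_measure S) S (\<lambda>y. ?R y + \<i> * ?I y)"
    using dR dI by (auto intro!: set_integral_add set_integrable_mult_right)
  moreover have "(LINT y:S|surface_measure S. ?R y + \<i> * ?I y) = 0"
    using dR dI by (subst set_integral_add) (auto intro!: set_integrable_mult_right)
  ultimately show "set_integrable (surface_measure S) S (\<lambda>y. surf_div S \<nu> \<phi> y * \<psi> y + (\<Sum>l\<in>UNIV. \<psi>' y (axis l 1) * \<phi> y $ l))"
    "(LINT y:S|surface_measure S. surf_div S \<nu> \<phi> y * \<psi> y + (\<Sum>l\<in>UNIV. \<psi>' y (axis l 1) * \<phi> y $ l)) = 0"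
    unfolding set_integrable_def set_lebesgue_integral_def e by auto
qed

lemma continuous_surf_div:
  assumes S: "smooth_surface S" and nu: "unit_normal S \<nu>" and F: "C1_along S F F'"
    and eq: "\<And>y. y \<in> S \<Longrightarrow> \<phi> y = F y"
  shows "continuous_on S (surf_div S \<nu> \<phi>)"
proof -
  have "continuous_on S (\<lambda>y. Complex (tdiv \<nu> (\<lambda>y v. Rev (F' y v)) y) (tdiv \<nu> (\<lambda>y v. Imv (F' y v)) y))"
    unfolding Complex_eq
    by (intro continuous_intros continuous_tdiv[OF S nu C1_along_linear[OF bounded_linear_Rev F]]
        continuous_tdiv[OF S nu C1_along_linear[OF bounded_linear_Imv F]])
  then show ?thesis by (rule continuous_on_eq) (simp add: surf_div_eq[OF S nu F eq])
qed

section \<open>The stretched kernel\<close>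

lemma matrix_inv_diag:
  fixes d :: "3 \<Rightarrow> complex"
  assumes "\<And>i. d i \<noteq> 0"
  shows "matrix_inv (\<chi> i j. if i = j then d i else 0) = (\<chi> i j. if i = j then inverse (d i) else 0)"
    (is "matrix_inv ?A = ?B")
proof -
  have AB: "?A ** ?B = mat 1" "?B ** ?A = mat 1"
    using assms by (auto simp: matrix_matrix_mult_def mat_def vec_eq_iff sum_3 forall_3)
  have inv: "?A ** matrix_inv ?A = mat 1 \<and> matrix_inv ?A ** ?A = mat 1"
    unfolding matrix_inv_def by (rule someI[of _ ?B]) (use AB in simp)
  have "matrix_inv ?A = matrix_inv ?A ** (?A ** ?B)" unfolding AB by (rule matrix_mul_rid[symmetric])
  also have "\<dots> = (matrix_inv ?A ** ?A) ** ?B" by (rule matrix_mul_assoc)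
  also have "\<dots> = ?B" unfolding conjunct2[OF inv] by (rule matrix_mul_lid)
  finally show ?thesis .
qed

lemma diag_vec_mult: "((\<chi> i j. if i = j then d i else 0) *v u) = (\<chi> i. d i * u $ i)" for d :: "3 \<Rightarrow> complex"
  by (auto simp: matrix_vector_mult_def vec_eq_iff forall_3 sum_3)

lemma power5: "(s::complex) ^ 5 = s * s * s * s * s"
  by (simp add: eval_nat_numeral)

text \<open>
  The fundamental solution as a function of the squared distance \<open>q\<close>, and its first two
  derivatives.
\<close>

definition Hk :: "real \<Rightarrow> complex \<Rightarrow> complex" where
  "Hk k q = exp (\<i> * of_real k * csqrt q) / (4 * of_real pi * csqrt q)"
definition Hk' :: "real \<Rightarrow> complex \<Rightarrow> complex" where
  "Hk' k q = exp (\<i> * of_real k * csqrt q) * (\<i> * of_real k * csqrt q - 1) / (8 * of_real pi * csqrt q ^ 3)"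
definition Hk'' :: "real \<Rightarrow> complex \<Rightarrow> complex" where
  "Hk'' k q = exp (\<i> * of_real k * csqrt q) * (3 - 3 * \<i> * of_real k * csqrt q - (of_real k)\<^sup>2 * (csqrt q)\<^sup>2) / (16 * of_real pi * csqrt q ^ 5)"

lemma Hk_deriv:
  assumes q: "q \<notin> \<real>\<^sub>\<le>\<^sub>0"
  shows "(Hk k has_field_derivative Hk' k q) (at q)" "(Hk' k has_field_derivative Hk'' k q) (at q)"
proof -
  define s where "s = csqrt q"
  have s: "s \<noteq> 0" using q by (auto simp: s_def)
  define c where "c = \<i> * complex_of_real k"
  define E where "E = exp (c * s)"
  have c2: "c * c = - (of_real k)\<^sup>2" by (simp add: c_def power2_eq_square algebra_simps)
  have dE: "((\<lambda>s. exp (c * s)) has_field_derivative E * c) (at s)"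
    unfolding E_def by (auto intro!: derivative_eq_intros)
  have dc: "(csqrt has_field_derivative inverse (2 * s)) (at q)" unfolding s_def by (rule has_field_derivative_csqrt[OF q])
  have p: "of_real pi \<noteq> (0::complex)" by simp
  have "((\<lambda>s. exp (c * s) / (4 * of_real pi * s)) has_field_derivative
      ((E * c) * (4 * of_real pi * s) - E * (4 * of_real pi)) / ((4 * of_real pi * s) * (4 * of_real pi * s))) (at s)"
    unfolding E_def[symmetric] using s by (intro DERIV_divide[THEN DERIV_cong] dE) (auto intro!: derivative_eq_intros simp: E_def)
  from DERIV_chain2[OF this[unfolded s_def] dc]
  have "(Hk k has_field_derivative ((E * c) * (4 * of_real pi * s) - E * (4 * of_real pi)) / ((4 * of_real pi * s) * (4 * of_real pi * s)) * inverse (2 * s)) (at q)"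
    unfolding Hk_def[abs_def] c_def s_def .
  moreover have "((E * c) * (4 * of_real pi * s) - E * (4 * of_real pi)) / ((4 * of_real pi * s) * (4 * of_real pi * s)) * inverse (2 * s)
     = E * (c * s - 1) / (8 * of_real pi * s ^ 3)"
    using s by (simp add: field_simps power3_eq_cube)
  ultimately show "(Hk k has_field_derivative Hk' k q) (at q)"
    unfolding Hk'_def E_def c_def s_def by simp
  have "((\<lambda>s. exp (c * s) * (c * s - 1) / (8 * of_real pi * s ^ 3)) has_field_derivative
      ((E * c * (c * s - 1) + E * c) * (8 * of_real pi * s ^ 3) - E * (c * s - 1) * (24 * of_real pi * s\<^sup>2)) / ((8 * of_real pi * s ^ 3) * (8 * of_real pi * s ^ 3))) (at s)"
  proof -
    have n: "((\<lambda>s. exp (c * s) * (c * s - 1)) has_field_derivative (E * c * (c * s - 1) + E * c)) (at s)"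
      by (rule DERIV_cong[OF DERIV_mult[OF dE]]) (auto intro!: derivative_eq_intros simp: E_def algebra_simps)
    have d: "((\<lambda>s. 8 * of_real pi * s ^ 3) has_field_derivative (24 * of_real pi * s\<^sup>2)) (at s)"
      by (auto intro!: derivative_eq_intros)
    show ?thesis using DERIV_divide[OF n d] s by (simp add: E_def)
  qed
  from DERIV_chain2[OF this[unfolded s_def] dc]
  have "(Hk' k has_field_derivative ((E * c * (c * s - 1) + E * c) * (8 * of_real pi * s ^ 3) - E * (c * s - 1) * (24 * of_real pi * s\<^sup>2)) / ((8 * of_real pi * s ^ 3) * (8 * of_real pi * s ^ 3)) * inverse (2 * s)) (at q)"
    unfolding Hk'_def[abs_def] c_def s_def .
  moreover have "((E * c * (c * s - 1) + E * c) * (8 * of_real pi * s ^ 3) - E * (c * s - 1) * (24 * of_real pi * s\<^sup>2)) / ((8 * of_real pi * s ^ 3) * (8 * of_real pi * s ^ 3)) * inverse (2 * s)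
     = E * (3 - 3 * (c * s) + (c * c) * s\<^sup>2) / (16 * of_real pi * s ^ 5)"
  proof -
    have 1: "(E * c * (c * s - 1) + E * c) * (8 * of_real pi * s ^ 3) - E * (c * s - 1) * (24 * of_real pi * s\<^sup>2)
       = 8 * of_real pi * s\<^sup>2 * (E * (3 - 3 * (c * s) + (c * c) * s\<^sup>2))"
      by (simp add: algebra_simps power2_eq_square power3_eq_cube)
    have 2: "((8 * of_real pi * s ^ 3) * (8 * of_real pi * s ^ 3)) * (2 * s) = 8 * of_real pi * s\<^sup>2 * (16 * of_real pi * s ^ 5)"
      by (simp add: power2_eq_square power3_eq_cube power5)
    have 3: "8 * of_real pi * s\<^sup>2 \<noteq> 0" using s p by simp
    have "((E * c * (c * s - 1) + E * c) * (8 * of_real pi * s ^ 3) - E * (c * s - 1) * (24 * of_real pi * s\<^sup>2)) / ((8 * of_real pi * s ^ 3) * (8 * of_real pi * s ^ 3)) * inverse (2 * s)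
      = ((E * c * (c * s - 1) + E * c) * (8 * of_real pi * s ^ 3) - E * (c * s - 1) * (24 * of_real pi * s\<^sup>2)) / (((8 * of_real pi * s ^ 3) * (8 * of_real pi * s ^ 3)) * (2 * s))"
      by (simp only: divide_inverse inverse_mult_distrib mult.assoc)
    then show ?thesis unfolding 1 2 nonzero_mult_divide_mult_cancel_left[OF 3] .
  qed
  ultimately show "(Hk' k has_field_derivative Hk'' k q) (at q)"
    unfolding Hk''_def E_def c2 unfolding c_def s_def by (simp add: algebra_simps)
qed

text \<open>
  For a function \<open>H\<close> of \<open>q = |z|\<^sup>2\<close> in three dimensions, \<open>\<Delta> H = 6 H' + 4 q H''\<close>; this is the Helmholtz equation
  for radial functions.
\<close>

lemma Hk_ode:
  assumes "q \<noteq> 0"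
  shows "6 * Hk' k q + 4 * q * Hk'' k q = - (of_real k)\<^sup>2 * Hk k q"
proof -
  define s where "s = csqrt q"
  have s: "s \<noteq> 0" "q = s\<^sup>2" using assms by (auto simp: s_def)
  define E where "E = exp (\<i> * of_real k * s)"
  have "6 * (E * (\<i> * of_real k * s - 1) / (8 * of_real pi * s ^ 3)) +
     4 * s\<^sup>2 * (E * (3 - 3 * \<i> * of_real k * s - (of_real k)\<^sup>2 * s\<^sup>2) / (16 * of_real pi * s ^ 5))
     = - (of_real k)\<^sup>2 * (E / (4 * of_real pi * s))"
  proof -
    define d where "d = of_real pi * s ^ 3"
    have d: "d \<noteq> 0" using s(1) by (simp add: d_def)
    have s2: "s\<^sup>2 \<noteq> 0" using s(1) by simp
    have e: "8 * of_real pi * s ^ 3 = 8 * d" "16 * of_real pi * s ^ 5 = (16 * d) * s\<^sup>2" "4 * d = (4 * of_real pi * s) * s\<^sup>2"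
      by (simp_all add: d_def power2_eq_square power3_eq_cube power5)
    define X where "X = E * (\<i> * of_real k * s - 1)"
    define Y where "Y = E * (3 - 3 * \<i> * of_real k * s - (of_real k)\<^sup>2 * s\<^sup>2)"
    have XY: "3 * X + Y = (- (of_real k)\<^sup>2 * E) * s\<^sup>2" by (simp add: X_def Y_def algebra_simps)
    have 1: "6 * (X / (8 * d)) = 3 * X / (4 * d)" using d by (simp add: field_simps)
    have 2: "4 * s\<^sup>2 * (Y / (16 * d * s\<^sup>2)) = Y / (4 * d)" using d s(1) by (simp add: field_simps)
    have "3 * X / (4 * d) + Y / (4 * d) = ((- (of_real k)\<^sup>2 * E) * s\<^sup>2) / ((4 * of_real pi * s) * s\<^sup>2)"
      unfolding add_divide_distrib[symmetric] XY e(3) ..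
    also have "\<dots> = (- (of_real k)\<^sup>2 * E) / (4 * of_real pi * s)"
      by (rule nonzero_mult_divide_mult_cancel_right[OF s2])
    finally show ?thesis unfolding e X_def[symmetric] Y_def[symmetric] 1 2 by simp
  qed
  then show ?thesis unfolding Hk_def Hk'_def Hk''_def s_def[symmetric] E_def[symmetric] unfolding s(2) .
qed

text \<open>
  A complex displacement with components \<open>t l * (1 + \<i> * s l)\<close> can have a square with negative real
  part.  Multiplication by \<open>1 - \<i> * M\<close> moves all these squares into the right half-plane, since
  \<open>Re ((1 - \<i> * M) * (1 + \<i> * s)\<^sup>2) = 1 + s * (2 * M - s)\<close>.  This keeps them off the branch cut and bounds
  them below by the real distance.
\<close>

lemma stretched_square_bound:
  fixes s t :: "3 \<Rightarrow> real"
  assumes "\<And>l. 0 \<le> s l" "\<And>l. s l \<le> M"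
  shows "Re ((1 - \<i> * of_real M) * (\<Sum>l\<in>UNIV. (of_real (t l) * (1 + \<i> * of_real (s l)))\<^sup>2)) \<ge> (\<Sum>l\<in>UNIV. (t l)\<^sup>2)"
proof -
  have "Re ((1 - \<i> * of_real M) * (of_real (t l) * (1 + \<i> * of_real (s l)))\<^sup>2) = (t l)\<^sup>2 * (1 + s l * (2 * M - s l))" for l
    by (simp add: power2_eq_square algebra_simps)
  moreover have "(t l)\<^sup>2 * (1 + s l * (2 * M - s l)) \<ge> (t l)\<^sup>2" for l
  proof -
    have "0 \<le> s l * (2 * M - s l)" using assms[of l] by (intro mult_nonneg_nonneg) auto
    then show ?thesis using mult_left_mono[of 1 "1 + s l * (2 * M - s l)" "(t l)\<^sup>2"] by simp
  qed
  ultimately show ?thesis unfolding sum_distrib_left Re_sum by (intro sum_mono) simp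
qed

lemma sector_bound:
  assumes "Re ((1 - \<i> * of_real M) * q) \<ge> a" "a > 0"
  shows "q \<notin> \<real>\<^sub>\<le>\<^sub>0" "norm q \<ge> a / norm (1 - \<i> * of_real M)"
proof -
  show "q \<notin> \<real>\<^sub>\<le>\<^sub>0"
  proof
    assume "q \<in> \<real>\<^sub>\<le>\<^sub>0"
    then have "Re q \<le> 0" "Im q = 0" by (auto simp: complex_nonpos_Reals_iff)
    then show False using assms by simp
  qed
  have "a \<le> norm ((1 - \<i> * of_real M) * q)" using assms(1) complex_Re_le_cmod order_trans by blast
  then have "a \<le> norm (1 - \<i> * of_real M) * norm q" by (simp add: norm_mult)
  moreover have "norm (1 - \<i> * of_real M) > 0" by (auto simp: complex_eq_iff)
  ultimately show "norm q \<ge> a / norm (1 - \<i> * of_real M)" by (simp add: divide_le_eq mult.commute)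
qed

lemma vector_derivative_quotient_at_right:
  fixes f :: "real \<Rightarrow> 'b::real_normed_vector"
  assumes "(f has_vector_derivative d) (at 0)"
  shows "((\<lambda>e. (f e - f 0) /\<^sub>R e) \<longlongrightarrow> d) (at_right 0)"
proof -
  have "(f has_derivative (\<lambda>h. h *\<^sub>R d)) (at 0)" using assms by (simp add: has_vector_derivative_def)
  then have lim: "((\<lambda>e. norm (f e - f 0 - e *\<^sub>R d) / norm e) \<longlongrightarrow> 0) (at 0)"
    by (simp add: has_derivative_at)
  then have lim: "((\<lambda>e. norm (f e - f 0 - e *\<^sub>R d) / norm e) \<longlongrightarrow> 0) (at_right 0)"
    by (rule filterlim_mono[OF _ order_refl at_le]) simp
  have "((\<lambda>e. norm ((f e - f 0) /\<^sub>R e - d)) \<longlongrightarrow> 0) (at_right 0)"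
  proof (rule Lim_transform_eventually[OF lim])
    show "\<forall>\<^sub>F e in at_right 0. norm (f e - f 0 - e *\<^sub>R d) / norm e = norm ((f e - f 0) /\<^sub>R e - d)"
      unfolding eventually_at_right_field
    proof (intro exI[of _ 1] conjI allI impI)
      fix e :: real assume e: "0 < e"
      have "(f e - f 0) /\<^sub>R e - d = (f e - f 0 - e *\<^sub>R d) /\<^sub>R e"
        using e by (simp add: scaleR_right_diff_distrib)
      then show "norm (f e - f 0 - e *\<^sub>R d) / norm e = norm ((f e - f 0) /\<^sub>R e - d)"
        using e by (simp add: divide_inverse mult.commute)
    qed simp
  qed
  then show ?thesis by (simp add: tendsto_norm_zero_iff LIM_zero_cancel)
qed

lemma csqrt_scale: "e > 0 \<Longrightarrow> csqrt ((of_real e)\<^sup>2 * w) = of_real e * csqrt w"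
proof (rule csqrt_unique)
  assume e: "e > 0"
  show "(of_real e * csqrt w)\<^sup>2 = (of_real e)\<^sup>2 * w" by (simp add: power_mult_distrib)
  show "0 < Re (of_real e * csqrt w) \<or> Re (of_real e * csqrt w) = 0 \<and> 0 \<le> Im (of_real e * csqrt w)"
    using csqrt_principal[of w] e by auto
qed

lemma norm_sq3: "(norm v)\<^sup>2 = (\<Sum>l\<in>UNIV. (v $ l)\<^sup>2)" for v :: "real^3"
  unfolding power2_norm_eq_inner inner_vec_def by (simp add: power2_eq_square)

locale stretching =
  fixes \<sigma> :: "3 \<Rightarrow> real \<Rightarrow> real" and M :: real
  assumes cont: "\<And>l. continuous_on UNIV (\<sigma> l)" and nonneg: "\<And>l t. 0 \<le> \<sigma> l t" and le_M: "\<And>l t. \<sigma> l t \<le> M"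
begin

lemma M_nonneg: "0 \<le> M" using nonneg[of 1 0] le_M[of 1 0] by simp

text \<open>
  The imaginary part of a stretched coordinate, as a function of the real coordinate.
\<close>

definition prim :: "3 \<Rightarrow> real \<Rightarrow> real" where
  "prim l t = interval_lebesgue_integral lborel 0 (ereal t) (\<sigma> l)"

lemma prim_deriv: "(prim l has_real_derivative \<sigma> l t) (at t)"
proof -
  have "((\<lambda>u. LBINT y=ereal 0..ereal u. \<sigma> l y) has_vector_derivative \<sigma> l t) (at t within {-(\<bar>t\<bar>+1)..\<bar>t\<bar>+1})"
    by (rule interval_integral_FTC2) (auto intro: continuous_on_subset[OF cont])
  moreover have "at t within {-(\<bar>t\<bar>+1)..\<bar>t\<bar>+1} = at t"
    by (rule at_within_interior) auto
  ultimately show ?thesis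
    unfolding prim_def[abs_def] zero_ereal_def by (simp add: has_real_derivative_iff_has_vector_derivative)
qed

lemma stretch_nth: "stretch \<sigma> x $ l = of_real (x $ l) + \<i> * of_real (prim l (x $ l))"
  by (simp add: stretch_def prim_def)

text \<open>
  By the mean value theorem a difference of stretched coordinates is the real difference times
  \<open>1 + \<i> * s\<close> with \<open>s\<close> in the range of \<open>\<sigma>\<close>, so \<open>stretched_square_bound\<close> applies.
\<close>

lemma stretch_diff: "\<exists>s. 0 \<le> s \<and> s \<le> M \<and> stretch \<sigma> x $ l - stretch \<sigma> y $ l = of_real (x $ l - y $ l) * (1 + \<i> * of_real s)"
proof -
  have "\<exists>s. 0 \<le> s \<and> s \<le> M \<and> prim l b - prim l a = (b - a) * s" if ab: "a < b" for a b
  proof -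
    obtain z where "prim l b - prim l a = (b - a) * \<sigma> l z" using MVT2[OF ab prim_deriv] by blast
    then show ?thesis using nonneg le_M by (intro exI[of _ "\<sigma> l z"]) auto
  qed
  then have "\<exists>s. 0 \<le> s \<and> s \<le> M \<and> prim l (x $ l) - prim l (y $ l) = (x $ l - y $ l) * s"
    using M_nonneg by (cases "x $ l" "y $ l" rule: linorder_cases) (force simp: algebra_simps)+
  then obtain s where s: "0 \<le> s" "s \<le> M" "prim l (x $ l) - prim l (y $ l) = (x $ l - y $ l) * s" by blast
  have "stretch \<sigma> x $ l - stretch \<sigma> y $ l = of_real (x $ l - y $ l) + \<i> * of_real (prim l (x $ l) - prim l (y $ l))"
    by (simp add: stretch_nth algebra_simps)
  then show ?thesis using s by (intro exI[of _ s]) (simp add: algebra_simps)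
qed

text \<open>
  The square of the stretched distance.
\<close>

definition Q :: "real^3 \<Rightarrow> real^3 \<Rightarrow> complex" where
  "Q x y = (\<Sum>l\<in>UNIV. (stretch \<sigma> x $ l - stretch \<sigma> y $ l)\<^sup>2)"

lemma Phi_Hk: "Phi \<sigma> k x y = Hk k (Q x y)"
  by (simp add: Phi_def Hk_def rho_def Q_def)

definition cM :: real where "cM = norm (1 - \<i> * of_real M)"

lemma cM_pos: "cM > 0" by (auto simp: cM_def complex_eq_iff)

lemma Q_sector: "Re ((1 - \<i> * of_real M) * Q x y) \<ge> (norm (x - y))\<^sup>2"
proof -
  have "\<forall>l. \<exists>s. 0 \<le> s \<and> s \<le> M \<and> stretch \<sigma> x $ l - stretch \<sigma> y $ l = of_real (x $ l - y $ l) * (1 + \<i> * of_real s)"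
    using stretch_diff by blast
  then obtain s where s: "\<And>l. 0 \<le> s l \<and> s l \<le> M \<and> stretch \<sigma> x $ l - stretch \<sigma> y $ l = of_real (x $ l - y $ l) * (1 + \<i> * of_real (s l))"
    by metis
  have "Q x y = (\<Sum>l\<in>UNIV. (of_real ((x - y) $ l) * (1 + \<i> * of_real (s l)))\<^sup>2)"
    using s by (simp add: Q_def)
  then show ?thesis using stretched_square_bound[of s M "\<lambda>l. (x - y) $ l"] s by (simp only: norm_sq3)
qed

lemma Q_bounds:
  assumes "x \<noteq> y"
  shows "Q x y \<notin> \<real>\<^sub>\<le>\<^sub>0" "norm (Q x y) \<ge> (norm (x - y))\<^sup>2 / cM" "Q x y \<noteq> 0"
proof -
  have "0 < (norm (x - y))\<^sup>2" using assms by simp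
  note sb = sector_bound[OF Q_sector this]
  show "Q x y \<notin> \<real>\<^sub>\<le>\<^sub>0" "norm (Q x y) \<ge> (norm (x - y))\<^sup>2 / cM" using sb by (simp_all add: cM_def)
  then show "Q x y \<noteq> 0" by auto
qed

lemma stretch_diff_bound: "norm (stretch \<sigma> x $ l - stretch \<sigma> y $ l) \<le> (1 + M) * \<bar>x $ l - y $ l\<bar>"
proof -
  obtain s where s: "0 \<le> s" "s \<le> M" "stretch \<sigma> x $ l - stretch \<sigma> y $ l = of_real (x $ l - y $ l) * (1 + \<i> * of_real s)"
    using stretch_diff by blast
  have "norm (1 + \<i> * of_real s) \<le> 1 + M"
    using norm_triangle_ineq[of 1 "\<i> * of_real s"] s by (simp add: norm_mult)
  then show ?thesis unfolding s(3) norm_mult norm_of_real by (subst mult.commute) (rule mult_right_mono, auto)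
qed

lemma alpha_bound: "norm (alpha \<sigma> l x) \<le> 1 + M" "alpha \<sigma> l x \<noteq> 0"
proof -
  show "norm (alpha \<sigma> l x) \<le> 1 + M"
    using norm_triangle_ineq[of 1 "\<i> * of_real (\<sigma> l (x $ l))"] nonneg le_M by (simp add: norm_mult alpha_def) (metis order_trans add_left_mono)
  show "alpha \<sigma> l x \<noteq> 0" by (auto simp: alpha_def complex_eq_iff)
qed

lemma Q_upper: "norm (Q x y) \<le> ((1 + M) * norm (x - y))\<^sup>2"
proof -
  have "norm (Q x y) \<le> (\<Sum>l\<in>UNIV. norm ((stretch \<sigma> x $ l - stretch \<sigma> y $ l)\<^sup>2))"
    unfolding Q_def by (rule norm_sum)
  also have "\<dots> \<le> (\<Sum>l\<in>UNIV. (1 + M)\<^sup>2 * ((x - y) $ l)\<^sup>2)"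
  proof (rule sum_mono)
    fix l :: 3
    have "norm (stretch \<sigma> x $ l - stretch \<sigma> y $ l) ^ 2 \<le> ((1 + M) * \<bar>x $ l - y $ l\<bar>) ^ 2"
      by (intro power_mono stretch_diff_bound) simp
    then show "norm ((stretch \<sigma> x $ l - stretch \<sigma> y $ l)\<^sup>2) \<le> (1 + M)\<^sup>2 * ((x - y) $ l)\<^sup>2"
      by (simp add: norm_power power_mult_distrib)
  qed
  also have "\<dots> = ((1 + M) * norm (x - y))\<^sup>2" by (simp add: power_mult_distrib norm_sq3 sum_distrib_left)
  finally show ?thesis .
qed

lemma stretch_deriv: "((\<lambda>y. stretch \<sigma> y $ l) has_derivative (\<lambda>v. alpha \<sigma> l y * of_real (v $ l))) (at y)"
proof -
  have "((\<lambda>y :: real^3. prim l (y $ l)) has_derivative (\<lambda>v. \<sigma> l (y $ l) * v $ l)) (at y)"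
  proof -
    have "((\<lambda>y :: real^3. y $ l) has_derivative (\<lambda>v. v $ l)) (at y)"
      by (rule bounded_linear_imp_has_derivative[OF bounded_linear_vec_nth])
    from has_derivative_compose[OF this prim_deriv[unfolded has_field_derivative_def]] show ?thesis .
  qed
  then have 1: "((\<lambda>y :: real^3. of_real (prim l (y $ l)) :: complex) has_derivative (\<lambda>v. of_real (\<sigma> l (y $ l) * v $ l))) (at y)"
    by (rule has_derivative_of_real)
  have 2: "((\<lambda>y :: real^3. of_real (y $ l) :: complex) has_derivative (\<lambda>v. of_real (v $ l))) (at y)"
    by (rule has_derivative_of_real[OF bounded_linear_imp_has_derivative[OF bounded_linear_vec_nth]])
  have "(\<lambda>v :: real^3. of_real (v $ l) + \<i> * of_real (\<sigma> l (y $ l) * v $ l)) = (\<lambda>v. alpha \<sigma> l y * of_real (v $ l))"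
    by (simp add: alpha_def algebra_simps)
  then show ?thesis unfolding stretch_nth
    using has_derivative_add[OF 2 has_derivative_mult_right[OF 1, of "\<i>"]] by simp
qed

lemma continuous_stretch: "continuous_on A (\<lambda>y. stretch \<sigma> y $ l)"
  by (rule has_derivative_continuous_on[OF has_derivative_at_withinI[OF stretch_deriv]])

lemma continuous_alpha: "continuous_on A (\<lambda>y. alpha \<sigma> l y)"
  unfolding alpha_def by (intro continuous_intros continuous_on_compose2[OF cont]) auto

text \<open>
  By the chain rule this is the derivative of \<open>Phi \<sigma> k x\<close> at \<open>y\<close> in the direction \<open>v\<close>.
\<close>

definition Phi_y :: "real \<Rightarrow> real^3 \<Rightarrow> real^3 \<Rightarrow> real^3 \<Rightarrow> complex" where
  "Phi_y k x y v = - (Hk' k (Q x y) * (\<Sum>l\<in>UNIV. 2 * (stretch \<sigma> x $ l - stretch \<sigma> y $ l) * alpha \<sigma> l y * of_real (v $ l)))"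

lemma continuous_Q: "continuous_on A (\<lambda>y. Q x y)"
  unfolding Q_def by (intro continuous_intros continuous_stretch)

lemma Q_deriv: "(Q x has_derivative (\<lambda>v. - (\<Sum>l\<in>UNIV. 2 * (stretch \<sigma> x $ l - stretch \<sigma> y $ l) * alpha \<sigma> l y * of_real (v $ l)))) (at y)"
proof -
  let ?w = "\<lambda>l y. stretch \<sigma> x $ l - stretch \<sigma> y $ l"
  have w: "((\<lambda>y. ?w l y) has_derivative (\<lambda>v. 0 - alpha \<sigma> l y * of_real (v $ l))) (at y)" for l
    by (rule has_derivative_diff[OF has_derivative_const stretch_deriv])
  have "((\<lambda>y. \<Sum>l\<in>UNIV. ?w l y * ?w l y) has_derivative
    (\<lambda>v. \<Sum>l\<in>UNIV. ?w l y * (0 - alpha \<sigma> l y * of_real (v $ l)) + (0 - alpha \<sigma> l y * of_real (v $ l)) * ?w l y)) (at y)"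
    by (rule has_derivative_sum, rule has_derivative_mult[OF w w])
  moreover have "(\<lambda>v. \<Sum>l\<in>UNIV. ?w l y * (0 - alpha \<sigma> l y * of_real (v $ l)) + (0 - alpha \<sigma> l y * of_real (v $ l)) * ?w l y)
    = (\<lambda>v :: real^3. - (\<Sum>l\<in>UNIV. 2 * ?w l y * alpha \<sigma> l y * of_real (v $ l)))"
    unfolding sum_negf[symmetric] by (intro ext sum.cong refl) (simp add: algebra_simps)
  ultimately show ?thesis unfolding Q_def[abs_def] power2_eq_square by simp
qed

lemma Q_commute: "Q x y = Q y x"
  unfolding Q_def by (rule sum.cong) (auto simp: power2_commute)

lemma Phi_C1: "C1_along (- {x}) (Phi \<sigma> k x) (Phi_y k x)"
  unfolding C1_along_def
proof (intro conjI ballI allI)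
  fix y assume y: "y \<in> - {x}"
  have "x \<noteq> y" using y by simp
  note d = Hk_deriv(1)[OF Q_bounds(1)[OF this], of k, unfolded has_field_derivative_def]
  show "(Phi \<sigma> k x has_derivative Phi_y k x y) (at y)"
    using has_derivative_compose[OF Q_deriv d] unfolding Phi_Hk[abs_def] Phi_y_def[abs_def] by simp
next
  fix v
  have c1: "continuous_on (- {x}) (\<lambda>y. csqrt (Q x y))"
    by (rule continuous_on_compose2[OF continuous_on_csqrt continuous_Q]) (use Q_bounds(1) in auto)
  have nz: "csqrt (Q x y) \<noteq> 0" if "y \<in> - {x}" for y using Q_bounds(3)[of x y] that by auto
  have cH: "continuous_on (- {x}) (\<lambda>y. Hk' k (Q x y))"
    unfolding Hk'_def
    by (intro continuous_on_divide continuous_on_mult continuous_on_exp continuous_on_diff continuous_on_power continuous_on_const c1)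
      (use nz in simp)
  show "continuous_on (- {x}) (\<lambda>y. Phi_y k x y v)"
    unfolding Phi_y_def
    by (intro continuous_on_minus continuous_on_mult[OF cH] continuous_on_sum)
      (intro continuous_on_mult continuous_on_diff continuous_on_const continuous_alpha continuous_stretch)
qed

lemma Q_line: "((\<lambda>t. Q (x + t *\<^sub>R axis l 1) y) has_vector_derivative (2 * (stretch \<sigma> (x + t *\<^sub>R axis l 1) $ l - stretch \<sigma> y $ l) * alpha \<sigma> l (x + t *\<^sub>R axis l 1))) (at t)"
  and stretch_line: "((\<lambda>t. stretch \<sigma> (x + t *\<^sub>R axis l 1) $ m) has_vector_derivative (if m = l then alpha \<sigma> l (x + t *\<^sub>R axis l 1) else 0)) (at t)"
proof -
  have d: "((\<lambda>t. x + t *\<^sub>R axis l 1) has_derivative (\<lambda>t. t *\<^sub>R axis l (1::real))) (at t)"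
    using has_derivative_add[OF has_derivative_const[of x] has_derivative_scaleR_left[OF has_derivative_ident, of "axis l (1::real)"]]
    by simp
  have ax: "(h *\<^sub>R axis l (1::real)) $ m = (if m = l then h else 0)" for h and m :: 3
    by (simp add: axis_def)
  have Qc: "(\<lambda>z. Q z y) = Q y" by (rule ext) (rule Q_commute)
  show "((\<lambda>t. stretch \<sigma> (x + t *\<^sub>R axis l 1) $ m) has_vector_derivative (if m = l then alpha \<sigma> l (x + t *\<^sub>R axis l 1) else 0)) (at t)"
  proof -
    have "(\<lambda>h. alpha \<sigma> m (x + t *\<^sub>R axis l 1) * of_real ((h *\<^sub>R axis l (1::real)) $ m)) = (\<lambda>h. h *\<^sub>R (if m = l then alpha \<sigma> l (x + t *\<^sub>R axis l 1) else 0))"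
      unfolding ax by (auto simp: scaleR_conv_of_real mult.commute)
    then show ?thesis
      using has_derivative_compose[OF d stretch_deriv[of m]] unfolding has_vector_derivative_def by simp
  qed
  have "((\<lambda>z. Q z y) has_derivative (\<lambda>v. - (\<Sum>m\<in>UNIV. 2 * (stretch \<sigma> y $ m - stretch \<sigma> (x + t *\<^sub>R axis l 1) $ m) * alpha \<sigma> m (x + t *\<^sub>R axis l 1) * of_real (v $ m)))) (at (x + t *\<^sub>R axis l 1))"
    unfolding Qc by (rule Q_deriv)
  from has_derivative_compose[OF d this]
  have "((\<lambda>t. Q (x + t *\<^sub>R axis l 1) y) has_derivative (\<lambda>h. - (\<Sum>m\<in>UNIV. 2 * (stretch \<sigma> y $ m - stretch \<sigma> (x + t *\<^sub>R axis l 1) $ m) * alpha \<sigma> m (x + t *\<^sub>R axis l 1) * of_real ((h *\<^sub>R axis l 1) $ m)))) (at t)" .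
  moreover have "- (\<Sum>m\<in>UNIV. 2 * (stretch \<sigma> y $ m - stretch \<sigma> (x + t *\<^sub>R axis l 1) $ m) * alpha \<sigma> m (x + t *\<^sub>R axis l 1) * of_real ((h *\<^sub>R axis l 1) $ m))
    = h *\<^sub>R (2 * (stretch \<sigma> (x + t *\<^sub>R axis l 1) $ l - stretch \<sigma> y $ l) * alpha \<sigma> l (x + t *\<^sub>R axis l 1))" for h
  proof -
    have "(\<Sum>m\<in>UNIV. f m * of_real ((h *\<^sub>R axis l (1::real)) $ m)) = f l * of_real h" for f :: "3 \<Rightarrow> complex"
    proof -
      have "(\<Sum>m\<in>UNIV. f m * of_real ((h *\<^sub>R axis l (1::real)) $ m)) = (\<Sum>m\<in>UNIV. if m = l then f l * of_real h else 0)"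
        unfolding ax by (rule sum.cong) auto
      then show ?thesis by simp
    qed
    then show ?thesis unfolding scaleR_conv_of_real[where 'a=complex] by (simp only:) (simp add: algebra_simps)
  qed
  ultimately show "((\<lambda>t. Q (x + t *\<^sub>R axis l 1) y) has_vector_derivative (2 * (stretch \<sigma> (x + t *\<^sub>R axis l 1) $ l - stretch \<sigma> y $ l) * alpha \<sigma> l (x + t *\<^sub>R axis l 1))) (at t)"
    unfolding has_vector_derivative_def by simp
qed

lemma alpha_line: "m \<noteq> l \<Longrightarrow> alpha \<sigma> m (x + t *\<^sub>R axis l 1) = alpha \<sigma> m x"
  by (simp add: alpha_def axis_def)

text \<open>
  The coefficient \<open>J/\<alpha>\<^sub>l\<close> in the stretched divergence is constant along the \<open>l\<close>-th axis.  So no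
  derivative of the profile, which is merely continuous, appears in the divergence.
\<close>

lemma Jac_line: "Jac \<sigma> (x + t *\<^sub>R axis l 1) * inverse (alpha \<sigma> l (x + t *\<^sub>R axis l 1)) = Jac \<sigma> x * inverse (alpha \<sigma> l x)"
proof -
  have "l = 1 \<or> l = 2 \<or> l = 3" by (rule exhaust_3)
  then show ?thesis
    using alpha_bound(2)
    by (elim disjE) (simp_all add: Jac_def alpha_line[of 1 2] alpha_line[of 1 3] alpha_line[of 2 1] alpha_line[of 2 3] alpha_line[of 3 1] alpha_line[of 3 2])
qed

lemma Jac_nonzero: "Jac \<sigma> x \<noteq> 0" using alpha_bound(2) by (simp add: Jac_def)

lemma Hk_line:
  assumes "x + t *\<^sub>R axis l 1 \<noteq> y"
  shows "((\<lambda>t. Hk k (Q (x + t *\<^sub>R axis l 1) y)) has_vector_derivative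
      (2 * (stretch \<sigma> (x + t *\<^sub>R axis l 1) $ l - stretch \<sigma> y $ l) * alpha \<sigma> l (x + t *\<^sub>R axis l 1)) * Hk' k (Q (x + t *\<^sub>R axis l 1) y)) (at t)"
    "((\<lambda>t. Hk' k (Q (x + t *\<^sub>R axis l 1) y)) has_vector_derivative
      (2 * (stretch \<sigma> (x + t *\<^sub>R axis l 1) $ l - stretch \<sigma> y $ l) * alpha \<sigma> l (x + t *\<^sub>R axis l 1)) * Hk'' k (Q (x + t *\<^sub>R axis l 1) y)) (at t)"
  using field_vector_diff_chain_at[OF Q_line Hk_deriv(1)[OF Q_bounds(1)[OF assms]]]
    field_vector_diff_chain_at[OF Q_line Hk_deriv(2)[OF Q_bounds(1)[OF assms]]]
  by (simp_all add: o_def)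

lemma pd_Phi:
  assumes "x \<noteq> y"
  shows "pd l (\<lambda>z. Phi \<sigma> k z y) x = (2 * (stretch \<sigma> x $ l - stretch \<sigma> y $ l) * alpha \<sigma> l x) * Hk' k (Q x y)"
proof -
  have "x + 0 *\<^sub>R axis l 1 \<noteq> y" using assms by simp
  from vector_derivative_at[OF Hk_line(1)[OF this]] show ?thesis
    by (simp add: pd_def Phi_Hk)
qed

text \<open>
  The antisymmetry of the derivatives of \<open>\<Phi>\<close> in \<open>x\<close> and \<open>y\<close>: the stretched derivative in \<open>x\<close> carries no factor \<open>\<alpha>\<^sub>l(x)\<close>,
  and the factor \<open>\<alpha>\<^sub>l(y)\<close> supplied by \<open>B(y)\<close> is the one that belongs to the derivative in \<open>y\<close>.
\<close>

lemma div_kernel_eq: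
  assumes "x \<noteq> y"
  shows "div_kernel \<sigma> k \<phi> x y = - (\<Sum>l\<in>UNIV. Phi_y k x y (axis l 1) * \<phi> y $ l)"
proof -
  define c where "c = (\<chi> i. alpha \<sigma> i y * \<phi> y $ i)"
  have By: "Bmat \<sigma> y *v \<phi> y = c" unfolding Bmat_def diag_vec_mult c_def ..
  have comp: "(Jac \<sigma> z *s (matrix_inv (Bmat \<sigma> z) *v (Phi \<sigma> k z y *s c))) $ l = (Jac \<sigma> z * inverse (alpha \<sigma> l z)) * c $ l * Hk k (Q z y)" for z l
    unfolding Bmat_def matrix_inv_diag[of "\<lambda>i. alpha \<sigma> i z", OF alpha_bound(2)] diag_vec_mult
    by (simp add: Phi_Hk)
  have pdl: "pd l (\<lambda>z. (Jac \<sigma> z *s (matrix_inv (Bmat \<sigma> z) *v (Phi \<sigma> k z y *s c))) $ l) x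
     = Jac \<sigma> x * (2 * (stretch \<sigma> x $ l - stretch \<sigma> y $ l) * c $ l * Hk' k (Q x y))" for l
  proof -
    have "x + 0 *\<^sub>R axis l 1 \<noteq> y" using assms by simp
    from vector_derivative_at[OF has_vector_derivative_mult_right[OF Hk_line(1)[OF this, of k], of "(Jac \<sigma> x * inverse (alpha \<sigma> l x)) * c $ l"]]
    have "pd l (\<lambda>z. (Jac \<sigma> z *s (matrix_inv (Bmat \<sigma> z) *v (Phi \<sigma> k z y *s c))) $ l) x
       = (Jac \<sigma> x * inverse (alpha \<sigma> l x)) * c $ l * ((2 * (stretch \<sigma> x $ l - stretch \<sigma> y $ l) * alpha \<sigma> l x) * Hk' k (Q x y))"
      unfolding pd_def comp Jac_line by simp
    then show ?thesis using alpha_bound(2)[of l x] by simp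
  qed
  have "div_kernel \<sigma> k \<phi> x y = (\<Sum>l\<in>UNIV. 2 * (stretch \<sigma> x $ l - stretch \<sigma> y $ l) * c $ l * Hk' k (Q x y))"
    unfolding div_kernel_def sdiv_def div3_def By pdl sum_distrib_left[symmetric] using Jac_nonzero[of x] by simp
  also have "\<dots> = - (\<Sum>l\<in>UNIV. Phi_y k x y (axis l 1) * \<phi> y $ l)"
  proof -
    have e: "Phi_y k x y (axis l 1) = - (Hk' k (Q x y) * (2 * (stretch \<sigma> x $ l - stretch \<sigma> y $ l) * alpha \<sigma> l y))" for l
    proof -
      have "(\<Sum>m\<in>UNIV. 2 * (stretch \<sigma> x $ m - stretch \<sigma> y $ m) * alpha \<sigma> m y * of_real (axis l (1::real) $ m))
        = (\<Sum>m\<in>UNIV. if m = l then 2 * (stretch \<sigma> x $ l - stretch \<sigma> y $ l) * alpha \<sigma> l y else 0)"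
        by (rule sum.cong) (auto simp: axis_def)
      then show ?thesis unfolding Phi_y_def by simp
    qed
    show ?thesis unfolding sum_negf[symmetric] e by (intro sum.cong refl) (simp add: c_def)
  qed
  finally show ?thesis .
qed

text \<open>
  In stretched coordinates the operator is the Laplacian and the kernel is \<open>Hk\<close> of the sum of the squares, so
  \<open>Hk_ode\<close> applies.
\<close>

lemma slap_Phi:
  assumes "x \<noteq> y"
  shows "slap \<sigma> (\<lambda>z. Phi \<sigma> k z y) x = - (of_real k)\<^sup>2 * Phi \<sigma> k x y"
proof -
  have "Amat \<sigma> z = (\<chi> i j. if i = j then inverse (Jac \<sigma> z) * (alpha \<sigma> i z)\<^sup>2 else 0)" for z
    by (auto simp: Amat_def Bmat_def mat_def matrix_matrix_mult_def vec_eq_iff forall_3 sum_3 power2_eq_square)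
  then have comp: "(matrix_inv (Amat \<sigma> z) *v grad v z) $ l = inverse (inverse (Jac \<sigma> z) * (alpha \<sigma> l z)\<^sup>2) * pd l v z" for z l v
    using matrix_inv_diag[of "\<lambda>i. inverse (Jac \<sigma> z) * (alpha \<sigma> i z)\<^sup>2"] alpha_bound(2) Jac_nonzero
    by (simp add: diag_vec_mult grad_def)
  have comp2: "(matrix_inv (Amat \<sigma> z) *v grad (\<lambda>z. Phi \<sigma> k z y) z) $ l
     = (Jac \<sigma> z * inverse (alpha \<sigma> l z)) * (2 * (stretch \<sigma> z $ l - stretch \<sigma> y $ l) * Hk' k (Q z y))" if "z \<noteq> y" for z l
    unfolding comp pd_Phi[OF that] using alpha_bound(2)[of l z] Jac_nonzero[of z]
    by (simp add: power2_eq_square field_simps)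
  let ?w = "\<lambda>l. stretch \<sigma> x $ l - stretch \<sigma> y $ l"
  have pdl: "pd l (\<lambda>z. (matrix_inv (Amat \<sigma> z) *v grad (\<lambda>z. Phi \<sigma> k z y) z) $ l) x
     = Jac \<sigma> x * (4 * (?w l)\<^sup>2 * Hk'' k (Q x y) + 2 * Hk' k (Q x y))" for l
  proof -
    have n0: "x + 0 *\<^sub>R axis l 1 \<noteq> y" using assms by simp
    define c where "c = Jac \<sigma> x * inverse (alpha \<sigma> l x)"
    have d1: "((\<lambda>t. 2 * (stretch \<sigma> (x + t *\<^sub>R axis l 1) $ l - stretch \<sigma> y $ l)) has_vector_derivative (2 * alpha \<sigma> l x)) (at 0)"
      using has_vector_derivative_mult_right[OF has_vector_derivative_diff[OF stretch_line[of x l l 0] has_vector_derivative_const[of "stretch \<sigma> y $ l"]], of 2]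
      by simp
    have d2: "((\<lambda>t. c * (2 * (stretch \<sigma> (x + t *\<^sub>R axis l 1) $ l - stretch \<sigma> y $ l) * Hk' k (Q (x + t *\<^sub>R axis l 1) y))) has_vector_derivative
       c * (2 * ?w l * (2 * ?w l * alpha \<sigma> l x * Hk'' k (Q x y)) + 2 * alpha \<sigma> l x * Hk' k (Q x y))) (at 0)"
      using has_vector_derivative_mult_right[OF has_vector_derivative_mult[OF d1 Hk_line(2)[OF n0, of k]], of c] by simp
    have op: "open {t. x + t *\<^sub>R axis l (1::real) \<noteq> y}"
      by (intro open_Collect_neq continuous_intros)
    have "((\<lambda>t. (matrix_inv (Amat \<sigma> (x + t *\<^sub>R axis l 1)) *v grad (\<lambda>z. Phi \<sigma> k z y) (x + t *\<^sub>R axis l 1)) $ l) has_vector_derivative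
       c * (2 * ?w l * (2 * ?w l * alpha \<sigma> l x * Hk'' k (Q x y)) + 2 * alpha \<sigma> l x * Hk' k (Q x y))) (at 0)"
      by (rule has_vector_derivative_transform_within_open[OF d2 op]) (use assms in \<open>auto simp: comp2 Jac_line c_def\<close>)
    note vd = vector_derivative_at[OF this]
    have "c * (2 * ?w l * (2 * ?w l * alpha \<sigma> l x * Hk'' k (Q x y)) + 2 * alpha \<sigma> l x * Hk' k (Q x y))
      = (c * alpha \<sigma> l x) * (4 * (?w l)\<^sup>2 * Hk'' k (Q x y) + 2 * Hk' k (Q x y))"
      by (simp add: algebra_simps power2_eq_square)
    moreover have "c * alpha \<sigma> l x = Jac \<sigma> x" using alpha_bound(2)[of l x] by (simp add: c_def)
    ultimately show ?thesis unfolding pd_def vd by simp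
  qed
  have "slap \<sigma> (\<lambda>z. Phi \<sigma> k z y) x = (\<Sum>l\<in>UNIV. 4 * (?w l)\<^sup>2 * Hk'' k (Q x y) + 2 * Hk' k (Q x y))"
    unfolding slap_def div3_def pdl sum_distrib_left[symmetric] using Jac_nonzero[of x] by simp
  also have "\<dots> = 6 * Hk' k (Q x y) + 4 * Q x y * Hk'' k (Q x y)"
    by (simp add: Q_def sum_3 algebra_simps)
  also have "\<dots> = - (of_real k)\<^sup>2 * Phi \<sigma> k x y"
    unfolding Hk_ode[OF Q_bounds(3)[OF assms]] Phi_Hk ..
  finally show ?thesis .
qed

lemma csqrt_Q_lower:
  assumes "x \<noteq> y"
  shows "norm (csqrt (Q x y)) \<ge> norm (x - y) / sqrt cM"
proof -
  have "sqrt ((norm (x - y))\<^sup>2 / cM) \<le> sqrt (norm (Q x y))"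
    using Q_bounds(2)[OF assms] by (rule real_sqrt_le_mono)
  then show ?thesis by (simp add: real_sqrt_divide)
qed

lemma csqrt_Q_upper: "norm (csqrt (Q x y)) \<le> (1 + M) * norm (x - y)"
proof -
  have "sqrt (norm (Q x y)) \<le> sqrt (((1 + M) * norm (x - y))\<^sup>2)"
    using Q_upper by (rule real_sqrt_le_mono)
  then show ?thesis using M_nonneg by simp
qed

text \<open>
  The square root of \<open>Q\<close> is bounded above and below by multiples of \<open>norm (x - y)\<close>, and the exponential is
  bounded on bounded sets; the derivative gains one more inverse power of the distance.
\<close>

lemma Phi_bounds:
  assumes "R > 0"
  obtains C where "C > 0" "\<And>x y. x \<noteq> y \<Longrightarrow> norm (x - y) \<le> R \<Longrightarrow> norm (Phi \<sigma> k x y) \<le> C / norm (x - y)"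
    "\<And>x y v. x \<noteq> y \<Longrightarrow> norm (x - y) \<le> R \<Longrightarrow> norm (Phi_y k x y v) \<le> C * norm v / (norm (x - y))\<^sup>2"
proof -
  define E where "E = exp (\<bar>k\<bar> * ((1 + M) * R))"
  define c where "c = sqrt cM"
  have c: "c > 0" using cM_pos by (simp add: c_def)
  have E: "E > 0" by (simp add: E_def)
  have Ex: "norm (exp (\<i> * of_real k * csqrt (Q x y))) \<le> E" if "norm (x - y) \<le> R" for x y
  proof -
    have "norm (exp (\<i> * of_real k * csqrt (Q x y))) \<le> exp (norm (\<i> * of_real k * csqrt (Q x y)))" by (rule norm_exp)
    also have "norm (\<i> * of_real k * csqrt (Q x y)) \<le> \<bar>k\<bar> * ((1 + M) * R)"
    proof -
      have "norm (csqrt (Q x y)) \<le> (1 + M) * R"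
        using csqrt_Q_upper[of x y] mult_left_mono[OF that, of "1 + M"] M_nonneg by linarith
      then show ?thesis by (simp only: norm_mult norm_ii norm_of_real) (simp add: mult_left_mono)
    qed
    finally show ?thesis by (simp add: E_def)
  qed
  define C1 where "C1 = E * c"
  define C2 where "C2 = E * (\<bar>k\<bar> * ((1 + M) * R) + 1) * c ^ 3 * (6 * (1 + M)\<^sup>2)"
  have C: "C1 > 0" "C2 \<ge> 0" using E c M_nonneg assms by (simp_all add: C1_def C2_def)
  show ?thesis
  proof (rule that[of "C1 + C2"])
    show "C1 + C2 > 0" using C by simp
    show "norm (Phi \<sigma> k x y) \<le> (C1 + C2) / norm (x - y)" if xy: "x \<noteq> y" "norm (x - y) \<le> R" for x y
    proof -
      have n: "norm (x - y) > 0" using xy by simp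
      have s: "norm (csqrt (Q x y)) \<ge> norm (x - y) / c" using csqrt_Q_lower[OF xy(1)] by (simp add: c_def)
      have s': "0 < norm (x - y) / c" using n c by simp
      have pi1: "1 \<le> 4 * pi" using pi_gt3 by linarith
      have den: "norm (x - y) / c \<le> 4 * pi * norm (csqrt (Q x y))"
        using mult_mono[OF pi1 s] s' by simp
      have "norm (Phi \<sigma> k x y) = norm (exp (\<i> * of_real k * csqrt (Q x y))) / (4 * pi * norm (csqrt (Q x y)))"
        unfolding Phi_Hk Hk_def norm_divide norm_mult[of "4 * _"] norm_mult[of 4] norm_of_real by simp
      also have "\<dots> \<le> E / (norm (x - y) / c)"
        using Ex[OF xy(2)] E den s' by (intro frac_le) auto
      also have "\<dots> = C1 / norm (x - y)" by (simp add: C1_def)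
      also have "\<dots> \<le> (C1 + C2) / norm (x - y)" using C n by (intro divide_right_mono) auto
      finally show ?thesis .
    qed
    show "norm (Phi_y k x y v) \<le> (C1 + C2) * norm v / (norm (x - y))\<^sup>2" if xy: "x \<noteq> y" "norm (x - y) \<le> R" for x y v
    proof -
      let ?n = "norm (x - y)"
      have n: "?n > 0" using xy by simp
      have s: "norm (csqrt (Q x y)) \<ge> ?n / c" using csqrt_Q_lower[OF xy(1)] by (simp add: c_def)
      have s': "0 < ?n / c" using n c by simp
      have pi1: "1 \<le> 8 * pi" using pi_gt3 by linarith
      have s3: "(?n / c) ^ 3 \<le> norm (csqrt (Q x y)) ^ 3" using s s' by (intro power_mono) auto
      have den: "(?n / c) ^ 3 \<le> 8 * pi * norm (csqrt (Q x y)) ^ 3"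
        using mult_mono[OF pi1 s3] s' by simp
      have num: "norm (\<i> * of_real k * csqrt (Q x y) - 1) \<le> \<bar>k\<bar> * ((1 + M) * R) + 1"
      proof -
        have "norm (csqrt (Q x y)) \<le> (1 + M) * R"
          using csqrt_Q_upper[of x y] mult_left_mono[OF xy(2), of "1 + M"] M_nonneg by linarith
        then have "\<bar>k\<bar> * norm (csqrt (Q x y)) \<le> \<bar>k\<bar> * ((1 + M) * R)" by (rule mult_left_mono) simp
        then have "norm (\<i> * of_real k * csqrt (Q x y)) \<le> \<bar>k\<bar> * ((1 + M) * R)" by (simp add: norm_mult)
        then show ?thesis using norm_triangle_ineq4[of "\<i> * of_real k * csqrt (Q x y)" 1] by simp
      qed
      have "norm (Hk' k (Q x y)) = norm (exp (\<i> * of_real k * csqrt (Q x y))) * norm (\<i> * of_real k * csqrt (Q x y) - 1) / (8 * pi * norm (csqrt (Q x y)) ^ 3)"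
        unfolding Hk'_def norm_divide norm_mult[of "8 * _"] norm_mult[of 8] norm_mult[of "exp _"] norm_of_real norm_power by simp
      also have "\<dots> \<le> (E * (\<bar>k\<bar> * ((1 + M) * R) + 1)) / (?n / c) ^ 3"
        using s' E by (intro frac_le den mult_mono Ex[OF xy(2)] num) (auto intro!: mult_nonneg_nonneg add_nonneg_nonneg M_nonneg less_imp_le[OF assms])
      finally have H: "norm (Hk' k (Q x y)) \<le> (E * (\<bar>k\<bar> * ((1 + M) * R) + 1)) / (?n / c) ^ 3" .
      have "norm (\<Sum>l\<in>UNIV. 2 * (stretch \<sigma> x $ l - stretch \<sigma> y $ l) * alpha \<sigma> l y * of_real (v $ l)) \<le> (\<Sum>l\<in>(UNIV::3 set). 2 * ((1 + M) * ?n) * (1 + M) * norm v)"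
      proof (rule sum_norm_le)
        fix l :: 3
        have a: "norm (stretch \<sigma> x $ l - stretch \<sigma> y $ l) \<le> (1 + M) * ?n"
          using stretch_diff_bound[of x l y] component_le_norm_cart[of "x - y" l] M_nonneg
          by (intro order_trans[OF stretch_diff_bound mult_left_mono]) auto
        have b: "norm (of_real (v $ l) :: complex) \<le> norm v" using component_le_norm_cart[of v l] by simp
        show "norm (2 * (stretch \<sigma> x $ l - stretch \<sigma> y $ l) * alpha \<sigma> l y * of_real (v $ l)) \<le> 2 * ((1 + M) * ?n) * (1 + M) * norm v"
          unfolding norm_mult norm_numeral
          using M_nonneg by (intro mult_mono[OF mult_mono[OF mult_left_mono[OF a] alpha_bound(1)] b]) auto
      qed
      also have "\<dots> = 6 * (1 + M)\<^sup>2 * ?n * norm v" by (simp add: power2_eq_square)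
      finally have W: "norm (\<Sum>l\<in>UNIV. 2 * (stretch \<sigma> x $ l - stretch \<sigma> y $ l) * alpha \<sigma> l y * of_real (v $ l)) \<le> 6 * (1 + M)\<^sup>2 * ?n * norm v" .
      have "norm (Phi_y k x y v) \<le> (E * (\<bar>k\<bar> * ((1 + M) * R) + 1)) / (?n / c) ^ 3 * (6 * (1 + M)\<^sup>2 * ?n * norm v)"
        unfolding Phi_y_def norm_minus_cancel norm_mult[of "Hk' _ _"]
        using E s' M_nonneg assms by (intro mult_mono[OF H W]) (auto intro!: divide_nonneg_nonneg mult_nonneg_nonneg add_nonneg_nonneg)
      also have "\<dots> = C2 * norm v / ?n\<^sup>2"
        using n c by (simp add: C2_def power_divide power2_eq_square power3_eq_cube)
      also have "\<dots> \<le> (C1 + C2) * norm v / ?n\<^sup>2"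
        using C by (intro divide_right_mono mult_right_mono) auto
      finally show ?thesis .
    qed
  qed
qed

lemma lap_kernel_eq:
  assumes "x \<noteq> y"
  shows "lap_kernel \<sigma> k \<phi> x y = - ((of_real k)\<^sup>2 *s (Phi \<sigma> k x y *s (Bmat \<sigma> y *v \<phi> y)))"
  unfolding lap_kernel_def slap_Phi[OF assms] by (simp add: vec_eq_iff)

text \<open>
  Freezing \<open>\<alpha>\<close> at \<open>x\<close> and \<open>k\<close> at 0 gives the leading parts of the kernel and its derivative at the diagonal,
  as functions of the tangential direction \<open>t\<close>: homogeneous of degree -1 and even, respectively
  of degree -2 and odd.
\<close>

definition q0 :: "real^3 \<Rightarrow> real^3 \<Rightarrow> complex" where
  "q0 x t = (\<Sum>l\<in>UNIV. (alpha \<sigma> l x * of_real (t $ l))\<^sup>2)"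

definition Phi0 :: "real^3 \<Rightarrow> real^3 \<Rightarrow> complex" where
  "Phi0 x t = 1 / (4 * of_real pi * csqrt (q0 x t))"

definition Phi_y0 :: "real^3 \<Rightarrow> real^3 \<Rightarrow> real^3 \<Rightarrow> complex" where
  "Phi_y0 x t v = - (1 / (8 * of_real pi * csqrt (q0 x t) ^ 3)) * (\<Sum>l\<in>UNIV. 2 * (alpha \<sigma> l x * of_real (t $ l)) * alpha \<sigma> l x * of_real (v $ l))"

lemma Phi0_even: "Phi0 x (- t) = Phi0 x t" and Phi_y0_odd: "Phi_y0 x (- t) v = - Phi_y0 x t v"
proof -
  have q: "q0 x (- t) = q0 x t" by (simp add: q0_def)
  show "Phi0 x (- t) = Phi0 x t" by (simp add: Phi0_def q)
  show "Phi_y0 x (- t) v = - Phi_y0 x t v" by (simp add: Phi_y0_def q sum_negf)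
qed

lemma q0_sector:
  assumes "t \<noteq> 0"
  shows "q0 x t \<notin> \<real>\<^sub>\<le>\<^sub>0"
proof -
  have e: "q0 x t = (\<Sum>l\<in>UNIV. (of_real (t $ l) * (1 + \<i> * of_real (\<sigma> l (x $ l))))\<^sup>2)"
    by (simp add: q0_def alpha_def mult.commute)
  have "Re ((1 - \<i> * of_real M) * q0 x t) \<ge> (\<Sum>l\<in>UNIV. (t $ l)\<^sup>2)"
    unfolding e by (rule stretched_square_bound[OF nonneg le_M])
  then have "Re ((1 - \<i> * of_real M) * q0 x t) \<ge> (norm t)\<^sup>2" unfolding norm_sq3 .
  then show ?thesis by (rule sector_bound) (use assms in simp)
qed

text \<open>
  Only limits along curves through \<open>x\<close> are stated: pointwise convergence after rescaling is what
  dominated convergence needs in \<open>annulus_integral_vanishes\<close>.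
\<close>

lemma kernel_asymptotics:
  fixes y :: "real \<Rightarrow> real^3"
  assumes y0: "y 0 = x" and dy: "(y has_vector_derivative t) (at 0)" and t: "t \<noteq> 0"
  shows "((\<lambda>e. of_real e * Phi \<sigma> k x (y e)) \<longlongrightarrow> Phi0 x t) (at_right 0)"
    "((\<lambda>e. (of_real e)\<^sup>2 * Phi_y k x (y e) v) \<longlongrightarrow> Phi_y0 x t v) (at_right 0)"
proof -
  let ?w = "\<lambda>l e. stretch \<sigma> x $ l - stretch \<sigma> (y e) $ l"
  have w: "((\<lambda>e. ?w l e / of_real e) \<longlongrightarrow> - (alpha \<sigma> l x * of_real (t $ l))) (at_right 0)" for l
  proof -
    have "((\<lambda>e. stretch \<sigma> (y e) $ l) has_vector_derivative (alpha \<sigma> l x * of_real (t $ l))) (at 0)"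
    proof -
      have "((\<lambda>e. stretch \<sigma> (y e) $ l) has_derivative (\<lambda>h. alpha \<sigma> l (y 0) * of_real ((h *\<^sub>R t) $ l))) (at 0)"
        by (rule has_derivative_compose[OF dy[unfolded has_vector_derivative_def] stretch_deriv])
      then show ?thesis unfolding has_vector_derivative_def y0 scaleR_conv_of_real[where 'a=complex] by (simp add: mult_ac)
    qed
    from tendsto_minus[OF vector_derivative_quotient_at_right[OF this]]
    show ?thesis unfolding y0 by (simp add: scaleR_conv_of_real divide_inverse mult.commute algebra_simps)
  qed
  have q: "((\<lambda>e. Q x (y e) / (of_real e)\<^sup>2) \<longlongrightarrow> q0 x t) (at_right 0)"
  proof -
    have "((\<lambda>e. \<Sum>l\<in>UNIV. (?w l e / of_real e)\<^sup>2) \<longlongrightarrow> (\<Sum>l\<in>UNIV. (- (alpha \<sigma> l x * of_real (t $ l)))\<^sup>2)) (at_right 0)"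
      by (intro tendsto_sum tendsto_power w)
    then show ?thesis unfolding Q_def q0_def by (simp add: power_divide sum_divide_distrib)
  qed
  have z0: "csqrt (q0 x t) \<noteq> 0" using q0_sector[OF t, of x] by auto
  have z: "((\<lambda>e. csqrt (Q x (y e) / (of_real e)\<^sup>2)) \<longlongrightarrow> csqrt (q0 x t)) (at_right 0)"
    by (rule isCont_tendsto_compose[OF _ q]) (rule continuous_at_csqrt[OF q0_sector[OF t]])
  have e0: "((\<lambda>e. of_real e :: complex) \<longlongrightarrow> 0) (at_right 0)"
    using tendsto_of_real[OF tendsto_ident_at[of 0 "{0<..}"]] by simp
  have s: "\<forall>\<^sub>F e in at_right 0. csqrt (Q x (y e)) = of_real e * csqrt (Q x (y e) / (of_real e)\<^sup>2)"
    unfolding eventually_at_right_field by (rule exI[of _ 1]) (auto simp: csqrt_scale[symmetric])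
  have s0: "((\<lambda>e. csqrt (Q x (y e))) \<longlongrightarrow> 0) (at_right 0)"
    using tendsto_mult[OF e0 z] s by (simp add: tendsto_cong)
  have E: "((\<lambda>e. exp (\<i> * of_real k * csqrt (Q x (y e)))) \<longlongrightarrow> 1) (at_right 0)"
    using tendsto_exp[OF tendsto_mult_left[OF s0, of "\<i> * of_real k"]] by simp
  have p: "\<forall>\<^sub>F e in at_right 0. (e::real) > 0" by (simp add: eventually_at_right_less)
  show "((\<lambda>e. of_real e * Phi \<sigma> k x (y e)) \<longlongrightarrow> Phi0 x t) (at_right 0)"
  proof (rule Lim_transform_eventually)
    show "((\<lambda>e. exp (\<i> * of_real k * csqrt (Q x (y e))) / (4 * of_real pi * csqrt (Q x (y e) / (of_real e)\<^sup>2))) \<longlongrightarrow> Phi0 x t) (at_right 0)"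
      unfolding Phi0_def using z0 by (intro tendsto_divide tendsto_mult E z tendsto_const) auto
    show "\<forall>\<^sub>F e in at_right 0. exp (\<i> * of_real k * csqrt (Q x (y e))) / (4 * of_real pi * csqrt (Q x (y e) / (of_real e)\<^sup>2)) = of_real e * Phi \<sigma> k x (y e)"
      using s p
    proof eventually_elim
      case (elim e)
      define Z where "Z = csqrt (Q x (y e) / (of_real e)\<^sup>2)"
      have Z: "csqrt (Q x (y e)) = of_real e * Z" using elim(1) by (simp add: Z_def)
      define N where "N = exp (\<i> * of_real k * csqrt (Q x (y e)))"
      show ?case unfolding Phi_Hk Hk_def N_def[symmetric] Z_def[symmetric] unfolding Z
        using elim(2) by simp
    qed
  qed
  have al: "((\<lambda>e. alpha \<sigma> l (y e)) \<longlongrightarrow> alpha \<sigma> l x) (at_right 0)" for l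
  proof -
    have "isCont y 0" using dy by (rule has_vector_derivative_continuous)
    then have "(y \<longlongrightarrow> x) (at 0)" using y0 by (simp add: isCont_def)
    then have yl: "(y \<longlongrightarrow> x) (at_right 0)" by (rule filterlim_mono[OF _ order_refl at_le]) simp
    have "isCont (\<lambda>y. alpha \<sigma> l y) x" using continuous_alpha[of UNIV l] by (simp add: continuous_on_eq_continuous_at)
    then show ?thesis by (rule isCont_tendsto_compose[OF _ yl])
  qed
  have H: "((\<lambda>e. exp (\<i> * of_real k * csqrt (Q x (y e))) * (\<i> * of_real k * csqrt (Q x (y e)) - 1) / (8 * of_real pi * csqrt (Q x (y e) / (of_real e)\<^sup>2) ^ 3))
      \<longlongrightarrow> 1 * (\<i> * of_real k * 0 - 1) / (8 * of_real pi * csqrt (q0 x t) ^ 3)) (at_right 0)"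
    using z0 by (intro tendsto_divide tendsto_mult tendsto_diff tendsto_power E z s0 tendsto_const) auto
  have W: "((\<lambda>e. \<Sum>l\<in>UNIV. 2 * (?w l e / of_real e) * alpha \<sigma> l (y e) * of_real (v $ l)) \<longlongrightarrow>
     (\<Sum>l\<in>UNIV. 2 * (- (alpha \<sigma> l x * of_real (t $ l))) * alpha \<sigma> l x * of_real (v $ l))) (at_right 0)"
    by (intro tendsto_sum tendsto_mult tendsto_const w al)
  show "((\<lambda>e. (of_real e)\<^sup>2 * Phi_y k x (y e) v) \<longlongrightarrow> Phi_y0 x t v) (at_right 0)"
  proof (rule Lim_transform_eventually)
    have "- ((1 * (\<i> * of_real k * 0 - 1) / (8 * of_real pi * csqrt (q0 x t) ^ 3)) * (\<Sum>l\<in>UNIV. 2 * (- (alpha \<sigma> l x * of_real (t $ l))) * alpha \<sigma> l x * of_real (v $ l))) = Phi_y0 x t v"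
      unfolding Phi_y0_def by (simp add: sum_negf)
    with tendsto_minus[OF tendsto_mult[OF H W]]
    show "((\<lambda>e. - (exp (\<i> * of_real k * csqrt (Q x (y e))) * (\<i> * of_real k * csqrt (Q x (y e)) - 1) / (8 * of_real pi * csqrt (Q x (y e) / (of_real e)\<^sup>2) ^ 3)
       * (\<Sum>l\<in>UNIV. 2 * (?w l e / of_real e) * alpha \<sigma> l (y e) * of_real (v $ l)))) \<longlongrightarrow> Phi_y0 x t v) (at_right 0)"
      by simp
    show "\<forall>\<^sub>F e in at_right 0. - (exp (\<i> * of_real k * csqrt (Q x (y e))) * (\<i> * of_real k * csqrt (Q x (y e)) - 1) / (8 * of_real pi * csqrt (Q x (y e) / (of_real e)\<^sup>2) ^ 3)
       * (\<Sum>l\<in>UNIV. 2 * (?w l e / of_real e) * alpha \<sigma> l (y e) * of_real (v $ l))) = (of_real e)\<^sup>2 * Phi_y k x (y e) v"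
      using s p
    proof eventually_elim
      case (elim e)
      define Z where "Z = csqrt (Q x (y e) / (of_real e)\<^sup>2)"
      have Z: "csqrt (Q x (y e)) = of_real e * Z" using elim(1) by (simp add: Z_def)
      define N where "N = exp (\<i> * of_real k * csqrt (Q x (y e))) * (\<i> * of_real k * csqrt (Q x (y e)) - 1)"
      have H': "Hk' k (Q x (y e)) = N / (8 * of_real pi * (of_real e * Z) ^ 3)"
        unfolding Hk'_def N_def Z[symmetric] ..
      have e: "of_real e \<noteq> (0::complex)" using elim(2) by simp
      have "(\<Sum>l\<in>UNIV. 2 * ?w l e * alpha \<sigma> l (y e) * of_real (v $ l)) = of_real e * (\<Sum>l\<in>UNIV. 2 * (?w l e / of_real e) * alpha \<sigma> l (y e) * of_real (v $ l))"
        unfolding sum_distrib_left using e by (intro sum.cong refl) simp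
      then have "(of_real e)\<^sup>2 * Phi_y k x (y e) v = - ((of_real e)\<^sup>2 * (N / (8 * of_real pi * (of_real e * Z) ^ 3)) * (of_real e * (\<Sum>l\<in>UNIV. 2 * (?w l e / of_real e) * alpha \<sigma> l (y e) * of_real (v $ l))))"
        unfolding Phi_y_def H' by simp
      moreover have "(of_real e)\<^sup>2 * (N / (8 * of_real pi * (of_real e * Z) ^ 3)) * (of_real e * w) = N / (8 * of_real pi * Z ^ 3) * w" for w
        using e by (simp add: power_mult_distrib power2_eq_square power3_eq_cube)
      ultimately show ?case unfolding N_def[symmetric] Z_def[symmetric] by simp
    qed
  qed
qed

end

section \<open>Singular integrals\<close>

text \<open>
  Dyadic decomposition: on the shell where \<open>norm v\<close> is about \<open>d / 2 ^ n\<close> the integrand is about \<open>2 ^ n / d\<close> and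
  the area is about \<open>d\<^sup>2 / 4 ^ n\<close>, which leaves a geometric series.
\<close>

lemma nn_integral_inverse_norm_finite:
  assumes d: "d > 0"
  shows "(\<integral>\<^sup>+v. ennreal (1 / norm v) * indicator (cball 0 d) v \<partial>(lborel :: (real^2) measure)) < \<infinity>"
proof -
  have le: "ennreal (1 / norm v) * indicator (cball 0 d) v \<le> (\<Sum>n. ennreal (2 ^ Suc n / d) * indicator (cball 0 (d / 2 ^ n)) v)" for v :: "real^2"
  proof (cases "v = 0 \<or> v \<notin> cball 0 d")
    case True
    then show ?thesis by auto
  next
    case False
    then have v: "v \<noteq> 0" "norm v \<le> d" "norm v > 0" by auto
    obtain N where N: "d / norm v < 2 ^ N" using real_arch_pow[of 2 "d / norm v"] by auto
    \<comment> \<open>The predecessor of this index is the shell that contains \<open>v\<close>.\<close>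
    define n where "n = (LEAST n. d / norm v < 2 ^ n)"
    have n: "d / norm v < 2 ^ n" unfolding n_def using N by (rule LeastI)
    have "n \<noteq> 0"
    proof
      assume "n = 0"
      then have "d / norm v < 1" using n by simp
      then show False using v by (simp add: divide_simps)
    qed
    then obtain m where m: "n = Suc m" using not0_implies_Suc by blast
    have "\<not> d / norm v < 2 ^ m" using not_less_Least[of m "\<lambda>n. d / norm v < 2 ^ n"] m unfolding n_def by simp
    then have vm: "norm v \<le> d / 2 ^ m" using v by (simp add: field_simps)
    have "1 / norm v \<le> 2 ^ Suc m / d" using n v d unfolding m by (simp add: field_simps)
    then have "ennreal (1 / norm v) * indicator (cball 0 d) v \<le> ennreal (2 ^ Suc m / d) * indicator (cball 0 (d / 2 ^ m)) v"
      using v vm by (simp add: ennreal_leI)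
    also have "\<dots> \<le> (\<Sum>n. ennreal (2 ^ Suc n / d) * indicator (cball 0 (d / 2 ^ n)) v)"
    proof -
      define g where "g = (\<lambda>n. ennreal (2 ^ Suc n / d) * indicator (cball 0 (d / 2 ^ n)) v)"
      have "g m \<le> suminf g" using sum_le_suminf[OF summableI, of "{m}" g] by simp
      then show ?thesis unfolding g_def .
    qed
    finally show ?thesis .
  qed
  have "(\<integral>\<^sup>+v. ennreal (1 / norm v) * indicator (cball 0 d) v \<partial>(lborel :: (real^2) measure))
     \<le> (\<integral>\<^sup>+v. (\<Sum>n. ennreal (2 ^ Suc n / d) * indicator (cball 0 (d / 2 ^ n)) v) \<partial>(lborel :: (real^2) measure))"
    by (rule nn_integral_mono) (rule le)
  also have "\<dots> = (\<Sum>n. \<integral>\<^sup>+v. ennreal (2 ^ Suc n / d) * indicator (cball 0 (d / 2 ^ n)) v \<partial>(lborel :: (real^2) measure))"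
    by (rule nn_integral_suminf) (intro borel_measurable_times_ennreal borel_measurable_const borel_measurable_indicator; simp)
  also have "\<dots> = (\<Sum>n. ennreal (2 * unit_ball_vol 2 * d * (1/2) ^ n))"
  proof (rule suminf_cong)
    fix n
    have "(\<integral>\<^sup>+v. ennreal (2 ^ Suc n / d) * indicator (cball 0 (d / 2 ^ n)) v \<partial>(lborel :: (real^2) measure))
       = ennreal (2 ^ Suc n / d) * emeasure lborel (cball (0 :: real^2) (d / 2 ^ n))"
      by (subst nn_integral_cmult_indicator) auto
    also have "\<dots> = ennreal (2 ^ Suc n / d) * ennreal (unit_ball_vol 2 * (d / 2 ^ n)\<^sup>2)"
      using d by (subst emeasure_cball) auto
    also have "\<dots> = ennreal (2 ^ Suc n / d * (unit_ball_vol 2 * (d / 2 ^ n)\<^sup>2))"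
      using d by (intro ennreal_mult[symmetric]) auto
    also have "2 ^ Suc n / d * (unit_ball_vol 2 * (d / 2 ^ n)\<^sup>2) = 2 * unit_ball_vol 2 * d * (1/2) ^ n"
      using d by (simp add: power_divide power2_eq_square field_simps)
    finally show "(\<integral>\<^sup>+v. ennreal (2 ^ Suc n / d) * indicator (cball 0 (d / 2 ^ n)) v \<partial>(lborel :: (real^2) measure)) = ennreal (2 * unit_ball_vol 2 * d * (1/2) ^ n)" .
  qed
  also have "\<dots> < \<infinity>"
  proof -
    have "summable (\<lambda>n. 2 * unit_ball_vol 2 * d * (1/2) ^ n)" by (intro summable_mult summable_geometric) simp
    then have "(\<Sum>n. ennreal (2 * unit_ball_vol 2 * d * (1/2) ^ n)) = ennreal (\<Sum>n. 2 * unit_ball_vol 2 * d * (1/2) ^ n)"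
      using d by (intro suminf_ennreal2) (auto intro!: mult_nonneg_nonneg)
    then show ?thesis by simp
  qed
  finally show ?thesis .
qed

text \<open>
  The quantitative form of a chart at \<open>x\<close> used for singular integrals: expansion by at least \<open>c\<close>, area
  element at most \<open>B\<close>, and the image of a small disc contains all of the surface within \<open>\<rho>\<close> of \<open>x\<close>.
\<close>

lemma chart_at:
  assumes S: "smooth_surface S" and x: "x \<in> S"
  obtains W r u c B d \<rho> where "local_param S W r" "u \<in> W" "x = r u" "c > 0" "B > 0" "d > 0" "cball u d \<subseteq> W"
    "\<And>w. w \<in> ball u d \<Longrightarrow> c * norm (w - u) \<le> norm (r w - x)" "\<And>w. w \<in> cball u d \<Longrightarrow> area_elt r w \<le> B"
    "\<rho> > 0" "S \<inter> ball x \<rho> \<subseteq> r ` ball u d"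
proof -
  obtain W r u where p: "local_param S W r" "u \<in> W" "x = r u" using smooth_surfaceE[OF S x] .
  obtain c d1 where c: "c > 0" "d1 > 0" "ball u d1 \<subseteq> W" "\<And>w. w \<in> ball u d1 \<Longrightarrow> c * norm (w - u) \<le> norm (r w - r u)"
    using chart_expands[OF p(1,2)] by blast
  obtain d2 where d2: "d2 > 0" "cball u d2 \<subseteq> W" using local_paramD(1)[OF p(1)] p(2) open_contains_cball by blast
  define d where "d = min d1 d2"
  have d: "d > 0" "cball u d \<subseteq> W" "ball u d \<subseteq> ball u d1" using c d2 by (auto simp: d_def)
  obtain B where B: "B > 0" "\<And>w. w \<in> cball u d \<Longrightarrow> area_elt r w \<le> B"
    using area_elt_bounded[OF p(1) d(2)] by blast
  obtain T where T: "open T" "r ` ball u d = S \<inter> T" and xT: "x \<in> T"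
    using chart_ball_open[OF p(1,2) d(1,2)] p(3) by metis
  from xT obtain \<rho> where \<rho>: "\<rho> > 0" "ball x \<rho> \<subseteq> T" using T(1) open_contains_ball by blast
  show ?thesis
  proof (rule that[OF p c(1) B(1) d(1,2) _ _ \<rho>(1)])
    show "c * norm (w - u) \<le> norm (r w - x)" if "w \<in> ball u d" for w using c(4)[of w] that d(3) p(3) by auto
    show "area_elt r w \<le> B" if "w \<in> cball u d" for w using B(2)[OF that] .
    show "S \<inter> ball x \<rho> \<subseteq> r ` ball u d" unfolding T(2) using \<rho>(2) by blast
  qed
qed

locale finite_surface =
  fixes S :: "(real^3) set"
  assumes S: "S \<in> sets borel" "smooth_surface S" and fin: "emeasure (surface_measure S) S < \<infinity>"
begin

abbreviation "\<mu> \<equiv> surface_measure S"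

lemma measurable_\<mu>: "measurable \<mu> N = measurable borel N"
  by (rule measurable_surface_measure[OF S])

lemma sets_\<mu>: "sets \<mu> = sets borel" by (rule sets_surface_measure[OF S])

text \<open>
  Functions matter on \<open>S\<close> only, and the kernels have no reasonable value at \<open>x\<close>.
\<close>

definition meas :: "(real^3 \<Rightarrow> 'b::euclidean_space) \<Rightarrow> bool" where
  "meas f \<longleftrightarrow> (\<lambda>y. indicator S y *\<^sub>R f y) \<in> borel_measurable borel"

text \<open>
  A singularity at one point does not affect measurability, whatever value is assigned there.
\<close>

lemma meas_continuous:
  assumes "continuous_on (S - {x}) f"
  shows "meas f"
proof -
  have "(\<lambda>y. indicator (S - {x}) y *\<^sub>R f y) \<in> borel_measurable borel"
    using S(1) assms by (intro borel_measurable_continuous_on_indicator) auto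
  moreover have "(\<lambda>y. indicator (S \<inter> {x}) y *\<^sub>R f x) \<in> borel_measurable borel"
    using S(1) by (intro borel_measurable_scaleR borel_measurable_indicator) auto
  moreover have "(\<lambda>y. indicator S y *\<^sub>R f y) = (\<lambda>y. indicator (S - {x}) y *\<^sub>R f y + indicator (S \<inter> {x}) y *\<^sub>R f x)"
    by (auto simp: indicator_def)
  ultimately show ?thesis unfolding meas_def by simp
qed

lemma meas_scale:
  assumes "meas f" "\<beta> \<in> borel_measurable borel"
  shows "meas (\<lambda>y. \<beta> y *\<^sub>R f y)"
proof -
  have "(\<lambda>y. \<beta> y *\<^sub>R (indicator S y *\<^sub>R f y)) \<in> borel_measurable borel"
    by (rule borel_measurable_scaleR[OF assms(2) assms(1)[unfolded meas_def]])
  then show ?thesis unfolding meas_def by (simp add: mult.commute)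
qed

lemma integrable_dominated:
  assumes f: "meas f" and g: "set_integrable \<mu> S g" and le: "\<And>y. y \<in> S \<Longrightarrow> norm (f y) \<le> g y"
  shows "set_integrable \<mu> S f"
  unfolding set_integrable_def
proof (rule Bochner_Integration.integrable_bound)
  show "integrable \<mu> (\<lambda>y. indicator S y *\<^sub>R g y)" using g by (simp add: set_integrable_def)
  show "(\<lambda>y. indicator S y *\<^sub>R f y) \<in> borel_measurable \<mu>" using f by (simp add: meas_def measurable_\<mu>)
  show "AE y in \<mu>. norm (indicator S y *\<^sub>R f y) \<le> norm (indicator S y *\<^sub>R g y)"
    using order_trans[OF le abs_ge_self] by (intro always_eventually) (auto simp: indicator_def)
qed

lemma integrable_const: "set_integrable \<mu> S (\<lambda>_. c :: real)"
proof -
  have "integrable \<mu> (indicator S :: _ \<Rightarrow> real)"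
    using S(1) fin by (intro integrable_real_indicator) (auto simp: sets_\<mu>)
  then show ?thesis unfolding set_integrable_def by simp
qed

lemma integrable_bounded:
  assumes "meas f" "\<And>y. y \<in> S \<Longrightarrow> norm (f y) \<le> C"
  shows "set_integrable \<mu> S f"
  by (rule integrable_dominated[OF assms(1) integrable_const assms(2)])

text \<open>
  In a chart at \<open>x\<close> the integrand is at most a multiple of the inverse distance in the plane;
  away from \<open>x\<close> it is bounded and the surface has finite measure.
\<close>

lemma integrable_inverse_dist:
  assumes x: "x \<in> S"
  shows "set_integrable \<mu> S (\<lambda>y. C / norm (x - y))"
proof -
  obtain W r u c B d \<rho> where p: "local_param S W r" "u \<in> W" "x = r u" and c: "c > 0" "B > 0" "d > 0" "cball u d \<subseteq> W"
    and lo: "\<And>w. w \<in> ball u d \<Longrightarrow> c * norm (w - u) \<le> norm (r w - x)" and up: "\<And>w. w \<in> cball u d \<Longrightarrow> area_elt r w \<le> B"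
    and rho: "\<rho> > 0" "S \<inter> ball x \<rho> \<subseteq> r ` ball u d"
    using chart_at[OF S(2) x] by blast
  define f where "f = (\<lambda>y. ennreal (1 / norm (x - y)) * indicator (S \<inter> ball x \<rho>) y)"
  have [measurable]: "S \<inter> ball x \<rho> \<in> sets borel" using S(1) by simp
  have [measurable]: "cball (0 :: real^2) d \<in> sets borel" by simp
  have fm: "f \<in> borel_measurable borel" unfolding f_def by measurable
  have mm: "(\<lambda>y. indicator S y *\<^sub>R (1 / norm (x - y))) \<in> borel_measurable \<mu>"
    unfolding measurable_\<mu> using S(1) by measurable
  have rW: "r ` ball u d \<subseteq> r ` W" using c(4) ball_subset_cball[of u d] by (intro image_mono) (rule order_trans)
  have "(\<integral>\<^sup>+y. f y \<partial>\<mu>) = (\<integral>\<^sup>+y. indicator (r ` W) y * f y \<partial>\<mu>)"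
  proof (rule nn_integral_cong)
    fix y
    have "y \<in> S \<inter> ball x \<rho> \<Longrightarrow> y \<in> r ` W" using subsetD[OF order_trans[OF rho(2) rW]] .
    then show "f y = indicator (r ` W) y * f y" by (cases "y \<in> S \<inter> ball x \<rho>") (simp_all add: f_def)
  qed
  also have "\<dots> = (\<integral>\<^sup>+w. ennreal (chart_dens W r w) * f (chart_ext W r w) \<partial>lborel)"
    by (rule nn_integral_chart[OF S p(1) fm])
  also have "\<dots> \<le> (\<integral>\<^sup>+w. ennreal (B / c) * (ennreal (1 / norm (w - u)) * indicator (cball 0 d) (w - u)) \<partial>lborel)"
  proof (rule nn_integral_mono)
    fix w
    show "ennreal (chart_dens W r w) * f (chart_ext W r w) \<le> ennreal (B / c) * (ennreal (1 / norm (w - u)) * indicator (cball 0 d) (w - u))"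
    proof (cases "w \<in> W \<and> r w \<in> S \<inter> ball x \<rho>")
      case True
      have bW: "ball u d \<subseteq> W" using c(4) ball_subset_cball[of u d] by (rule order_trans[rotated])
      have "r w \<in> r ` ball u d" using True rho(2) by blast
      then have w: "w \<in> ball u d" using inj_on_image_mem_iff[OF local_paramD(4)[OF p(1)] _ bW] True by simp
      show ?thesis
      proof (cases "w = u")
        case False
        have "1 / norm (x - r w) \<le> 1 / (c * norm (w - u))"
          using lo[OF w] False c(1) by (intro frac_le) (auto simp: norm_minus_commute)
        then have "area_elt r w * (1 / norm (x - r w)) \<le> B * (1 / (c * norm (w - u)))"
          using up[of w] w c by (intro mult_mono) (auto intro: less_imp_le)
        then have "ennreal (area_elt r w * (1 / norm (x - r w))) \<le> ennreal ((B / c) * (1 / norm (w - u)))"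
          by (intro ennreal_leI) simp
        moreover have "area_elt r w \<ge> 0" by (simp add: area_elt_def)
        ultimately show ?thesis using True w c
          by (simp add: chart_dens_def chart_ext_def f_def ennreal_mult[symmetric] dist_norm norm_minus_commute)
      qed (use True p in \<open>simp add: chart_dens_def chart_ext_def f_def\<close>)
    qed (cases "w \<in> W"; auto simp: chart_dens_def f_def chart_ext_def)
  qed
  also have "\<dots> = ennreal (B / c) * (\<integral>\<^sup>+w. ennreal (1 / norm (w - u)) * indicator (cball 0 d) (w - u) \<partial>lborel)"
    by (rule nn_integral_cmult) measurable
  also have "(\<integral>\<^sup>+w. ennreal (1 / norm (w - u)) * indicator (cball 0 d) (w - u) \<partial>lborel) = (\<integral>\<^sup>+v. ennreal (1 / norm v) * indicator (cball 0 d) v \<partial>(lborel :: (real^2) measure))"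
  proof -
    have "(\<integral>\<^sup>+v. ennreal (1 / norm v) * indicator (cball 0 d) v \<partial>distr lborel borel ((+) (- u))) = (\<integral>\<^sup>+w. ennreal (1 / norm (- u + w)) * indicator (cball 0 d) (- u + w) \<partial>lborel)"
      by (rule nn_integral_distr) measurable
    then show ?thesis unfolding lborel_distr_plus uminus_add_conv_diff by (rule sym)
  qed
  also have "ennreal (B / c) * \<dots> < \<infinity>"
    using nn_integral_inverse_norm_finite[OF c(3)] by (simp add: ennreal_mult_less_top)
  finally have finf: "(\<integral>\<^sup>+y. f y \<partial>\<mu>) < \<infinity>" .
  have "(\<integral>\<^sup>+y. ennreal (norm (indicator S y *\<^sub>R (1 / norm (x - y)))) \<partial>\<mu>) \<le> (\<integral>\<^sup>+y. f y + ennreal (1 / \<rho>) * indicator S y \<partial>\<mu>)"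
  proof (rule nn_integral_mono)
    fix y
    show "ennreal (norm (indicator S y *\<^sub>R (1 / norm (x - y)))) \<le> f y + ennreal (1 / \<rho>) * indicator S y"
    proof (cases "y \<in> S \<and> y \<notin> ball x \<rho>")
      case True
      then have "\<rho> \<le> norm (x - y)" by (simp add: dist_norm)
      then have "1 / norm (x - y) \<le> 1 / \<rho>" using rho(1) by (intro frac_le) auto
      then show ?thesis using True by (simp add: f_def ennreal_leI)
    next
      case False
      then show ?thesis by (cases "y \<in> S") (auto simp: f_def)
    qed
  qed
  also have "\<dots> = (\<integral>\<^sup>+y. f y \<partial>\<mu>) + ennreal (1 / \<rho>) * emeasure \<mu> S"
    using S(1) fm by (subst nn_integral_add) (auto simp: measurable_\<mu> sets_\<mu> nn_integral_cmult_indicator)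
  also have "\<dots> < \<infinity>" using finf fin by (simp add: ennreal_mult_less_top)
  finally have "set_integrable \<mu> S (\<lambda>y. 1 / norm (x - y))"
    unfolding set_integrable_def integrable_iff_bounded using mm by simp
  from set_integrable_mult_right[OF this, of C] show ?thesis by simp
qed

lemma AE_neq: "AE y in \<mu>. y \<noteq> x"
  using emeasure_surface_singleton[OF S, of x] by (intro AE_I[of _ _ "{x}"]) (auto simp: sets_\<mu>)

end

lemma integral_affine:
  fixes h :: "'a::euclidean_space \<Rightarrow> 'b::euclidean_space"
  assumes c: "c \<noteq> 0" and h: "h \<in> borel_measurable borel"
  shows "(LINT x|lborel. h x) = (LINT x|lborel. \<bar>c\<bar> ^ DIM('a) *\<^sub>R h (t + c *\<^sub>R x))"
proof -
  have m: "(\<lambda>x. t + c *\<^sub>R x) \<in> measurable lborel (borel :: 'a measure)" by simp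
  have l: "(lborel :: 'a measure) = density (distr lborel borel (\<lambda>x. t + c *\<^sub>R x)) (\<lambda>_. ennreal (\<bar>c\<bar> ^ DIM('a)))"
    using lborel_affine[OF c, of t] by (simp add: ennreal_power)
  have "(LINT x|lborel. h x) = (LINT x|density (distr lborel borel (\<lambda>x. t + c *\<^sub>R x)) (\<lambda>_. ennreal (\<bar>c\<bar> ^ DIM('a))). h x)"
    using l by simp
  also have "\<dots> = (LINT x|distr lborel borel (\<lambda>x. t + c *\<^sub>R x). \<bar>c\<bar> ^ DIM('a) *\<^sub>R h x)"
    using h by (intro integral_density) auto
  also have "\<dots> = (LINT x|lborel. \<bar>c\<bar> ^ DIM('a) *\<^sub>R h (t + c *\<^sub>R x))"
    using h by (intro integral_distr m) auto
  finally show ?thesis .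
qed

text \<open>
  The \<open>v\<close> with \<open>norm (D v) = 1\<close> form the boundary of a convex set.
\<close>

lemma AE_linear_norm_neq_1:
  fixes D :: "real^2 \<Rightarrow> real^3"
  assumes "linear D"
  shows "AE v in lborel. norm (D v) \<noteq> 1"
proof -
  define K where "K = {v. norm (D v) \<le> 1}"
  have cD: "continuous_on UNIV D" using assms by (simp add: linear_continuous_on linear_conv_bounded_linear)
  have "convex K"
    unfolding K_def convex_def
  proof (intro allI ballI impI)
    fix x y and a b :: real assume h: "x \<in> {v. norm (D v) \<le> 1}" "y \<in> {v. norm (D v) \<le> 1}" "0 \<le> a" "0 \<le> b" "a + b = 1"
    have "norm (D (a *\<^sub>R x + b *\<^sub>R y)) \<le> a * norm (D x) + b * norm (D y)"
      using norm_triangle_ineq[of "a *\<^sub>R D x" "b *\<^sub>R D y"] h by (simp add: linear_add[OF assms] linear_cmul[OF assms])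
    also have "\<dots> \<le> a * 1 + b * 1" using h by (intro add_mono mult_left_mono) auto
    finally show "a *\<^sub>R x + b *\<^sub>R y \<in> {v. norm (D v) \<le> 1}" using h by simp
  qed
  then have "negligible (frontier K)" by (rule negligible_convex_frontier)
  then have "frontier K \<in> null_sets lborel"
    by (simp add: negligible_iff_null_sets null_sets_completion_iff)
  moreover have "v \<in> frontier K" if "norm (D v) = 1" for v
  proof -
    have "v \<notin> interior K"
    proof
      assume "v \<in> interior K"
      then obtain e where e: "e > 0" "ball v e \<subseteq> K" using mem_interior by blast
      have v0: "v \<noteq> 0" using that linear_0[OF assms] by auto
      define s where "s = e / (2 * norm v)"
      have s: "s > 0" using e v0 by (simp add: s_def)
      have "dist v ((1 + s) *\<^sub>R v) = e / 2" using v0 e by (simp add: dist_norm algebra_simps s_def)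
      then have "(1 + s) *\<^sub>R v \<in> K" using e by (intro subsetD[OF e(2)]) simp
      then have "(1 + s) * norm (D v) \<le> 1" using s by (simp add: K_def linear_cmul[OF assms])
      then show False using that s by simp
    qed
    moreover have "v \<in> K" using that by (simp add: K_def)
    ultimately show ?thesis using closure_subset by (auto simp: frontier_def)
  qed
  ultimately show ?thesis by (intro AE_I'[of "frontier K"]) auto
qed

context finite_surface begin

text \<open>
  In a chart at \<open>x\<close>, substitute \<open>u + e v\<close>.  The factor \<open>e\<^sup>2\<close> from the area balances the growth of \<open>f\<close>, so the
  rescaled integrands stay bounded on a fixed disc and converge pointwise to a function that \<open>flim\<close> makes odd
  in \<open>v\<close>.  Averaging the integrand over \<open>v\<close> and \<open>- v\<close> before passing to the limit gives 0 by dominated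
  convergence, which uses only the pointwise limits.  The weight may jump at 1, since
  \<open>AE_linear_norm_neq_1\<close> makes that circle negligible.
\<close>

lemma annulus_integral_vanishes:
  fixes f :: "real^3 \<Rightarrow> complex"
  assumes x: "x \<in> S" and f: "meas f" and bd: "\<And>y. y \<in> S \<Longrightarrow> y \<noteq> x \<Longrightarrow> norm (f y) \<le> C / (norm (y - x))\<^sup>2"
    and asym: "\<And>y t. y 0 = x \<Longrightarrow> (y has_vector_derivative t) (at 0) \<Longrightarrow> t \<noteq> 0 \<Longrightarrow>
      ((\<lambda>e. e\<^sup>2 *\<^sub>R f (y e)) \<longlongrightarrow> flim t) (at_right 0)"
    and odd: "\<And>t. flim (- t) = - flim t"
    and w: "w \<in> borel_measurable borel" "\<And>s. \<bar>w s\<bar> \<le> Bw" "\<And>s. s < 1 \<or> s > 2 \<Longrightarrow> w s = 0" "\<And>s. s \<noteq> 1 \<Longrightarrow> isCont w s"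
  shows "((\<lambda>e. LINT y:S|\<mu>. w ((norm (y - x))\<^sup>2 / e\<^sup>2) *\<^sub>R f y) \<longlongrightarrow> 0) (at_right 0)"
proof -
  obtain W r u c B d \<rho> where p: "local_param S W r" "u \<in> W" "x = r u" and c: "c > 0" "B > 0" "d > 0" "cball u d \<subseteq> W"
    and lo: "\<And>w. w \<in> ball u d \<Longrightarrow> c * norm (w - u) \<le> norm (r w - x)" and up: "\<And>w. w \<in> cball u d \<Longrightarrow> area_elt r w \<le> B"
    and rho: "\<rho> > 0" "S \<inter> ball x \<rho> \<subseteq> r ` ball u d"
    using chart_at[OF S(2) x] by blast
  define C' where "C' = max C 0"
  have bd': "norm (f y) \<le> C' / (norm (y - x))\<^sup>2" if "y \<in> S" "y \<noteq> x" for y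
    using bd[OF that] divide_right_mono[of C C' "(norm (y - x))\<^sup>2"] by (simp add: C'_def)
  have C': "C' \<ge> 0" by (simp add: C'_def)
  have Bw: "Bw \<ge> 0" using w(2)[of 0] by linarith
  have bW: "ball u d \<subseteq> W" using c(4) ball_subset_cball[of u d] by (rule order_trans[rotated])
  \<comment> \<open>The integrand in the chart, with the area element.\<close>
  define G where "G = (\<lambda>e v. indicator W v *\<^sub>R area_elt r v *\<^sub>R w ((norm (r v - x))\<^sup>2 / e\<^sup>2) *\<^sub>R f (r v))"
  have fS: "(\<lambda>y. indicator S y *\<^sub>R f y) \<in> borel_measurable borel" using f by (simp add: meas_def)
  define h where "h = (\<lambda>e y. w ((norm (y - x))\<^sup>2 / e\<^sup>2) *\<^sub>R (indicator S y *\<^sub>R f y))"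
  have hm: "h e \<in> borel_measurable borel" for e
    unfolding h_def by (intro borel_measurable_scaleR fS measurable_compose[OF _ w(1)]) measurable
  have Gh: "chart_dens W r v *\<^sub>R h e (chart_ext W r v) = G e v" for e v
    using local_paramD(6)[OF p(1)] by (auto simp: G_def h_def chart_dens_def chart_ext_def indicator_def)
  have Gm: "G e \<in> borel_measurable borel" for e
    unfolding Gh[symmetric] using chart_measurable[OF p(1)]
    by (intro borel_measurable_scaleR measurable_compose[OF _ hm]) auto
  have Gball: "v \<in> ball u d \<and> c * norm (v - u) \<le> 2 * e \<and> norm (r v - x) \<ge> e"
    if "G e v \<noteq> 0" "e > 0" "2 * e < \<rho>" for e v
  proof -
    have vW: "v \<in> W" and wn: "w ((norm (r v - x))\<^sup>2 / e\<^sup>2) \<noteq> 0" using that(1) by (auto simp: G_def indicator_def split: if_splits)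
    have s: "1 \<le> (norm (r v - x))\<^sup>2 / e\<^sup>2" "(norm (r v - x))\<^sup>2 / e\<^sup>2 \<le> 2" using w(3) wn by force+
    have "e\<^sup>2 \<le> (norm (r v - x))\<^sup>2" using s(1) that(2) by (simp add: le_divide_eq)
    then have lo': "e \<le> norm (r v - x)" by (rule power2_le_imp_le[OF _ norm_ge_zero])
    have "(norm (r v - x))\<^sup>2 \<le> 2 * e\<^sup>2" using s(2) that(2) by (simp add: divide_le_eq)
    also have "\<dots> \<le> (2 * e)\<^sup>2" by (simp add: power2_eq_square)
    finally have "(norm (r v - x))\<^sup>2 \<le> (2 * e)\<^sup>2" .
    then have hi: "norm (r v - x) \<le> 2 * e" by (rule power2_le_imp_le) (use that(2) in simp)
    have "r v \<in> S" using vW local_paramD(6)[OF p(1)] by (intro subsetD[of "r ` W" S]) auto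
    moreover have "r v \<in> ball x \<rho>" using hi that(3) by (simp add: dist_norm norm_minus_commute)
    ultimately have "r v \<in> r ` ball u d" by (intro subsetD[OF rho(2)] IntI)
    then have vb: "v \<in> ball u d" using inj_on_image_mem_iff[OF local_paramD(4)[OF p(1)] vW bW] by simp
    then show ?thesis using lo[OF vb] lo' hi by linarith
  qed
  have int_eq: "(LINT y:S|\<mu>. w ((norm (y - x))\<^sup>2 / e\<^sup>2) *\<^sub>R f y) = (LINT v|lborel. G e v)" if e: "e > 0" "2 * e < \<rho>" for e
  proof -
    have "indicator S y *\<^sub>R (w ((norm (y - x))\<^sup>2 / e\<^sup>2) *\<^sub>R f y) = indicator (r ` W) y *\<^sub>R h e y" for y
    proof (cases "y \<in> S \<and> y \<notin> r ` W")
      case True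
      then have "y \<notin> ball x \<rho>" using rho(2) bW by blast
      then have "2 * e < norm (y - x)" using e by (simp add: dist_norm norm_minus_commute)
      then have "(2 * e)\<^sup>2 < (norm (y - x))\<^sup>2" using e by (intro power_strict_mono) auto
      moreover have "2 * e\<^sup>2 \<le> (2 * e)\<^sup>2" by (simp add: power2_eq_square)
      ultimately have "2 * e\<^sup>2 < (norm (y - x))\<^sup>2" by (rule order_le_less_trans[rotated])
      then have "(norm (y - x))\<^sup>2 / e\<^sup>2 > 2" using e by (simp add: less_divide_eq)
      then show ?thesis using w(3) True by simp
    next
      case False
      then show ?thesis using local_paramD(6)[OF p(1)] by (auto simp: h_def indicator_def)
    qed
    then have "(LINT y:S|\<mu>. w ((norm (y - x))\<^sup>2 / e\<^sup>2) *\<^sub>R f y) = (LINT y:r ` W|\<mu>. h e y)"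
      unfolding set_lebesgue_integral_def by simp
    also have "\<dots> = (LINT v|lborel. G e v)" unfolding integral_chart(2)[OF S p(1) hm] Gh ..
    finally show ?thesis .
  qed
  define H where "H = (\<lambda>e v. e\<^sup>2 *\<^sub>R G e (u + e *\<^sub>R v))"
  have Hm: "H e \<in> borel_measurable borel" for e
    unfolding H_def by (intro borel_measurable_scaleR measurable_compose[OF _ Gm]) measurable
  have int_H: "(LINT v|lborel. G e v) = (LINT v|lborel. H e v)" if "e > 0" for e
    unfolding H_def by (subst integral_affine[where c=e and t=u]) (use that Gm in auto)
  define R where "R = 2 / c"
  have Hbd: "norm (H e v) \<le> indicator (cball 0 R) v *\<^sub>R (B * Bw * C')" if e: "e > 0" "2 * e < \<rho>" for e v
  proof (cases "G e (u + e *\<^sub>R v) = 0")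
    case True
    then show ?thesis using c Bw C' by (simp add: H_def)
  next
    case False
    define z where "z = u + e *\<^sub>R v"
    note gb = Gball[OF False e, folded z_def]
    have "c * (e * norm v) \<le> 2 * e" using gb e by (simp add: z_def)
    then have "norm v \<le> R" using e c by (simp add: R_def field_simps)
    then have vR: "v \<in> cball 0 R" by simp
    have zW: "z \<in> W" using gb bW by blast
    have "r z \<in> S" using zW local_paramD(6)[OF p(1)] by blast
    moreover have "r z \<noteq> x" using gb e by auto
    ultimately have "norm (f (r z)) \<le> C' / (norm (r z - x))\<^sup>2" by (rule bd')
    also have "\<dots> \<le> C' / e\<^sup>2"
      using gb e C' by (intro frac_le power_mono) auto
    finally have fb: "norm (f (r z)) \<le> C' / e\<^sup>2" .
    have "norm (H e v) = e\<^sup>2 * (\<bar>area_elt r z\<bar> * (\<bar>w ((norm (r z - x))\<^sup>2 / e\<^sup>2)\<bar> * norm (f (r z))))"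
      using zW by (simp add: H_def G_def z_def abs_mult)
    also have "\<dots> \<le> e\<^sup>2 * (B * (Bw * (C' / e\<^sup>2)))"
      using up[of z] gb c Bw by (intro mult_left_mono mult_mono w(2) fb) (auto simp: area_elt_def)
    also have "\<dots> = B * Bw * C'" using e by simp
    finally show ?thesis using vR by simp
  qed
  define D where "D = chart_D r u"
  have D: "linear D" "\<And>v. D v = 0 \<Longrightarrow> v = 0"
    using chart_D_linear chart_D_inj[OF p(1,2)] linear_injective_0[OF chart_D_linear] unfolding D_def by blast+
  have Hlim: "((\<lambda>e. H e v) \<longlongrightarrow> area_elt r u *\<^sub>R w ((norm (D v))\<^sup>2) *\<^sub>R flim (D v)) (at_right 0)"
    if v: "v \<noteq> 0" "norm (D v) \<noteq> 1" for v
  proof -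
    define y where "y = (\<lambda>e. r (u + e *\<^sub>R v))"
    have y0: "y 0 = x" by (simp add: y_def p(3))
    have dl: "((\<lambda>e. u + e *\<^sub>R v) has_derivative (\<lambda>h. h *\<^sub>R v)) (at (0::real))"
      using has_derivative_add[OF has_derivative_const[of u] has_derivative_scaleR_left[OF has_derivative_ident, of v]] by simp
    have "(y has_derivative (\<lambda>h. D (h *\<^sub>R v))) (at 0)"
      unfolding y_def D_def by (rule has_derivative_compose[OF dl]) (use local_paramD(9)[OF p(1,2)] in simp)
    then have dy: "(y has_vector_derivative D v) (at 0)"
      unfolding has_vector_derivative_def by (simp add: linear_cmul[OF D(1)])
    have t0: "D v \<noteq> 0" using D(2) v by blast
    have l1: "((\<lambda>e. e\<^sup>2 *\<^sub>R f (y e)) \<longlongrightarrow> flim (D v)) (at_right 0)" by (rule asym[OF y0 dy t0])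
    have uc: "((\<lambda>e. u + e *\<^sub>R v) \<longlongrightarrow> u) (at_right 0)"
      using tendsto_add[OF tendsto_const[of u] tendsto_scaleR[OF tendsto_ident_at[of 0 "{0<..}"] tendsto_const[of v]]] by simp
    have ca: "isCont (area_elt r) u"
      using local_paramD(1,11)[OF p(1)] p(2) by (simp add: continuous_on_eq_continuous_at)
    have l2: "((\<lambda>e. area_elt r (u + e *\<^sub>R v)) \<longlongrightarrow> area_elt r u) (at_right 0)"
      by (rule isCont_tendsto_compose[OF ca uc])
    have "((\<lambda>e. (norm ((y e - y 0) /\<^sub>R e))\<^sup>2) \<longlongrightarrow> (norm (D v))\<^sup>2) (at_right 0)"
      by (intro tendsto_power tendsto_norm vector_derivative_quotient_at_right dy)
    then have l3: "((\<lambda>e. (norm (y e - x))\<^sup>2 / e\<^sup>2) \<longlongrightarrow> (norm (D v))\<^sup>2) (at_right 0)"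
      by (simp add: y0 power_mult_distrib power_divide divide_inverse power_inverse mult.commute)
    have "(norm (D v))\<^sup>2 \<noteq> 1"
    proof
      assume "(norm (D v))\<^sup>2 = 1"
      then have "norm (D v) = 1 \<or> norm (D v) = - 1" by (simp add: power2_eq_1_iff)
      then show False using v(2) norm_ge_zero[of "D v"] by linarith
    qed
    then have l4: "((\<lambda>e. w ((norm (y e - x))\<^sup>2 / e\<^sup>2)) \<longlongrightarrow> w ((norm (D v))\<^sup>2)) (at_right 0)"
      by (rule isCont_tendsto_compose[OF w(4) l3])
    have "((\<lambda>e. area_elt r (u + e *\<^sub>R v) *\<^sub>R w ((norm (y e - x))\<^sup>2 / e\<^sup>2) *\<^sub>R (e\<^sup>2 *\<^sub>R f (y e))) \<longlongrightarrow> area_elt r u *\<^sub>R w ((norm (D v))\<^sup>2) *\<^sub>R flim (D v)) (at_right 0)"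
      by (intro tendsto_scaleR l1 l2 l4)
    moreover have "\<forall>\<^sub>F e in at_right 0. area_elt r (u + e *\<^sub>R v) *\<^sub>R w ((norm (y e - x))\<^sup>2 / e\<^sup>2) *\<^sub>R (e\<^sup>2 *\<^sub>R f (y e)) = H e v"
    proof -
      have "\<forall>\<^sub>F e in at_right 0. u + e *\<^sub>R v \<in> W"
        using topological_tendstoD[OF uc local_paramD(1)[OF p(1)] p(2)] .
      then show ?thesis by eventually_elim (simp add: H_def G_def y_def mult_ac)
    qed
    ultimately show ?thesis by (rule Lim_transform_eventually)
  qed
  have sym: "(LINT v|lborel. H e v) = (LINT v|lborel. (1/2) *\<^sub>R (H e v + H e (- v)))" if e: "e > 0" "2 * e < \<rho>" for e
  proof -
    have iK: "integrable lborel (\<lambda>v::real^2. indicator (cball 0 R) v *\<^sub>R (B * Bw * C'))"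
      by (rule borel_integrable_compact) auto
    have i1: "integrable lborel (H e)"
      by (rule Bochner_Integration.integrable_bound[OF iK]) (use Hm Hbd[OF e] c Bw C' in \<open>auto simp: abs_mult\<close>)
    have i2: "integrable lborel (\<lambda>v. H e (- v))"
      by (rule Bochner_Integration.integrable_bound[OF iK])
        (use Hm Hbd[OF e, of "- _"] c Bw C' in \<open>auto simp: abs_mult indicator_def split: if_splits\<close>)
    have "(LINT v|lborel. H e v) = (LINT v|lborel. H e (- v))"
      using integral_affine[of "-1" "H e" 0] Hm by simp
    then show ?thesis using i1 i2 by (simp add: scaleR_2[symmetric])
  qed
  show ?thesis
  proof (rule tendsto_at_right_sequentially[where b="\<rho> / 2"])
    show "0 < \<rho> / 2" using rho by simp
    fix E :: "nat \<Rightarrow> real" assume E: "\<And>n. 0 < E n" "\<And>n. E n < \<rho> / 2" "E \<longlonglongrightarrow> 0"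
    have E2: "2 * E n < \<rho>" for n using E(2)[of n] by simp
    have ER: "filterlim E (at_right 0) sequentially"
      using E(1,3) by (intro tendsto_imp_filterlim_at_right) (auto intro: always_eventually)
    have "(\<lambda>n. LINT v|lborel. (1/2) *\<^sub>R (H (E n) v + H (E n) (- v))) \<longlonglongrightarrow> (LINT v|(lborel :: (real^2) measure). 0 :: complex)"
    proof (rule integral_dominated_convergence[where w="\<lambda>v. indicator (cball 0 R) v *\<^sub>R (B * Bw * C')"])
      show "integrable lborel (\<lambda>v::real^2. indicator (cball 0 R) v *\<^sub>R (B * Bw * C'))"
        by (rule borel_integrable_compact) auto
      show "(\<lambda>v. (1/2) *\<^sub>R (H (E n) v + H (E n) (- v))) \<in> borel_measurable lborel" for n
        using Hm by measurable
      have "norm ((1/2) *\<^sub>R (H (E n) v + H (E n) (- v))) \<le> indicator (cball 0 R) v *\<^sub>R (B * Bw * C')" for n v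
      proof -
        have "norm (H (E n) v + H (E n) (- v)) \<le> 2 * (indicator (cball 0 R) v *\<^sub>R (B * Bw * C'))"
          using norm_triangle_ineq[of "H (E n) v" "H (E n) (- v)"] Hbd[OF E(1) E2, of n v] Hbd[OF E(1) E2, of n "- v"]
          by (simp add: indicator_def)
        then show ?thesis by simp
      qed
      then show "AE v in lborel. norm ((1/2) *\<^sub>R (H (E n) v + H (E n) (- v))) \<le> indicator (cball 0 R) v *\<^sub>R (B * Bw * C')" for n
        by simp
      have "AE v in lborel. v \<noteq> 0" by (rule AE_lborel_singleton)
      then show "AE v in lborel. (\<lambda>n. (1/2) *\<^sub>R (H (E n) v + H (E n) (- v))) \<longlonglongrightarrow> 0"
        using AE_linear_norm_neq_1[OF D(1)]
      proof eventually_elim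
        case (elim v)
        have n: "norm (D (- v)) = norm (D v)" by (simp add: linear_neg[OF D(1)])
        have "((\<lambda>e. (1/2) *\<^sub>R (H e v + H e (- v))) \<longlongrightarrow> (1/2) *\<^sub>R (area_elt r u *\<^sub>R w ((norm (D v))\<^sup>2) *\<^sub>R flim (D v) + area_elt r u *\<^sub>R w ((norm (D (- v)))\<^sup>2) *\<^sub>R flim (D (- v)))) (at_right 0)"
          using elim n by (intro tendsto_scaleR tendsto_const tendsto_add Hlim) auto
        then have "((\<lambda>e. (1/2) *\<^sub>R (H e v + H e (- v))) \<longlongrightarrow> 0) (at_right 0)"
          unfolding n by (simp add: linear_neg[OF D(1)] odd)
        then show ?case using filterlim_compose ER by blast
      qed
    qed simp
    then show "(\<lambda>n. LINT y:S|\<mu>. w ((norm (y - x))\<^sup>2 / (E n)\<^sup>2) *\<^sub>R f y) \<longlonglongrightarrow> 0"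
      unfolding int_eq[OF E(1) E2] int_H[OF E(1)] sym[OF E(1) E2] by simp
  qed
qed

text \<open>
  Inside the ball of radius \<open>e\<close> the weight vanishes, and outside it the singular bound on \<open>f\<close> is a constant.
\<close>

lemma cutoff_integrable:
  fixes f :: "real^3 \<Rightarrow> 'b::euclidean_space"
  assumes f: "meas f" and bd: "\<And>y. y \<in> S \<Longrightarrow> y \<noteq> x \<Longrightarrow> norm (f y) \<le> C / (norm (y - x))\<^sup>2"
    and b: "\<beta> \<in> borel_measurable borel" "\<And>s. \<bar>\<beta> s\<bar> \<le> B" "\<And>s. s < 1 \<Longrightarrow> \<beta> s = 0" and e: "e > 0"
  shows "set_integrable \<mu> S (\<lambda>y. \<beta> ((norm (y - x))\<^sup>2 / e\<^sup>2) *\<^sub>R f y)"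
proof (rule integrable_bounded)
  have "(\<lambda>y. \<beta> ((norm (y - x))\<^sup>2 / e\<^sup>2)) \<in> borel_measurable borel"
    by (rule measurable_compose[OF _ b(1)]) measurable
  then show "meas (\<lambda>y. \<beta> ((norm (y - x))\<^sup>2 / e\<^sup>2) *\<^sub>R f y)" by (rule meas_scale[OF f])
  have B: "B \<ge> 0" using b(2)[of 0] by linarith
  show "norm (\<beta> ((norm (y - x))\<^sup>2 / e\<^sup>2) *\<^sub>R f y) \<le> B * (\<bar>C\<bar> / e\<^sup>2)" if y: "y \<in> S" for y
  proof (cases "(norm (y - x))\<^sup>2 / e\<^sup>2 < 1")
    case True
    then show ?thesis using b(3) B by simp
  next
    case False
    have p: "0 < e\<^sup>2" using e by simp
    have le: "e\<^sup>2 \<le> (norm (y - x))\<^sup>2" using False unfolding not_less le_divide_eq_1_pos[OF p] .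
    then have "y \<noteq> x" using e by auto
    have "norm (f y) \<le> \<bar>C\<bar> / e\<^sup>2"
      using bd[OF y \<open>y \<noteq> x\<close>] frac_le[of "\<bar>C\<bar>" C "e\<^sup>2" "(norm (y - x))\<^sup>2"] frac_le[of "\<bar>C\<bar>" "\<bar>C\<bar>" "e\<^sup>2" "(norm (y - x))\<^sup>2"] le e
        divide_right_mono[of C "\<bar>C\<bar>" "(norm (y - x))\<^sup>2"]
      by (meson abs_ge_self abs_ge_zero order_refl order_trans zero_le_power2 zero_less_power)
    then show ?thesis unfolding norm_scaleR using b(2) B by (intro mult_mono) auto
  qed
qed

end

section \<open>The principal value of the divergence\<close>

text \<open>
  A point \<open>x\<close> on a bounded surface of finite measure, a field \<open>\<phi>\<close> with extension \<open>F\<close>, and as the only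
  information about the boundary the weak form of the divergence theorem for \<open>\<phi>\<close>.
\<close>

locale layer = stretching \<sigma> M + finite_surface S for \<sigma> M S +
  fixes \<nu> :: "real^3 \<Rightarrow> real^3" and \<phi> F :: "real^3 \<Rightarrow> complex^3" and F' and D B\<phi> Bd k :: real and x :: "real^3"
  assumes nu: "unit_normal S \<nu>" and F: "C1_along S F F'" and eq: "\<And>y. y \<in> S \<Longrightarrow> \<phi> y = F y"
    and diam: "D > 0" "\<And>y. y \<in> S \<Longrightarrow> norm (x - y) \<le> D"
    and b\<phi>: "\<And>y. y \<in> S \<Longrightarrow> norm (\<phi> y) \<le> B\<phi>" and bd: "\<And>y. y \<in> S \<Longrightarrow> norm (surf_div S \<nu> \<phi> y) \<le> Bd"
    and weak: "\<And>\<psi> \<psi>'. C1_along UNIV \<psi> \<psi>' \<Longrightarrow>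
      set_integrable (surface_measure S) S (\<lambda>y. surf_div S \<nu> \<phi> y * \<psi> y + (\<Sum>l\<in>UNIV. \<psi>' y (axis l 1) * \<phi> y $ l)) \<and>
      (LINT y:S|surface_measure S. surf_div S \<nu> \<phi> y * \<psi> y + (\<Sum>l\<in>UNIV. \<psi>' y (axis l 1) * \<phi> y $ l)) = 0"
    and x: "x \<in> S"
begin

abbreviation "sd \<equiv> surf_div S \<nu> \<phi>"

text \<open>
  \<open>K\<close> is the kernel of the principal value and \<open>eta e\<close> the smooth cutoff, which rises from 0 to 1 as \<open>sq e y\<close> rises from
  1 to 2.  The gradient of the cutoff produces \<open>w1 (sq e y) *\<^sub>R f2 y\<close>, where \<open>f2\<close> has been normalized to
  degree -2, and \<open>w2\<close> is the difference between the sharp and the smooth cutoff.  Both weights vanish outside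
  the interval from 1 to 2.
\<close>

definition K where "K y = - (\<Sum>l\<in>UNIV. Phi_y k x y (axis l 1) * F y $ l)"

definition f2 where "f2 y = Phi \<sigma> k x y * (\<Sum>l\<in>UNIV. of_real ((y - x) $ l) * F y $ l) / (of_real (norm (y - x)))\<^sup>2"

definition sq where "sq e y = (norm (y - x))\<^sup>2 / e\<^sup>2" for e :: real

definition eta where "eta e y = sstep (sq e y - 1)" for e :: real

definition w1 :: "real \<Rightarrow> real" where "w1 s = 2 * s * sstep' (s - 1)"
definition w2 :: "real \<Rightarrow> real" where "w2 s = (if s \<ge> 1 then 1 else 0) - sstep (s - 1)"

lemma K_div_kernel: "y \<in> S \<Longrightarrow> y \<noteq> x \<Longrightarrow> div_kernel \<sigma> k \<phi> x y = K y"
  unfolding K_def by (subst div_kernel_eq) (auto simp: eq)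

lemma bounds: obtains C where "C > 0"
    "\<And>y. y \<in> S \<Longrightarrow> y \<noteq> x \<Longrightarrow> norm (Phi \<sigma> k x y) \<le> C / norm (x - y)"
    "\<And>y. y \<in> S \<Longrightarrow> y \<noteq> x \<Longrightarrow> norm (K y) \<le> C / (norm (y - x))\<^sup>2"
    "\<And>y. y \<in> S \<Longrightarrow> y \<noteq> x \<Longrightarrow> norm (f2 y) \<le> C / (norm (y - x))\<^sup>2"
proof -
  obtain C where C: "C > 0" "\<And>x y. x \<noteq> y \<Longrightarrow> norm (x - y) \<le> D \<Longrightarrow> norm (Phi \<sigma> k x y) \<le> C / norm (x - y)"
    "\<And>x y v. x \<noteq> y \<Longrightarrow> norm (x - y) \<le> D \<Longrightarrow> norm (Phi_y k x y v) \<le> C * norm v / (norm (x - y))\<^sup>2"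
    using Phi_bounds[OF diam(1)] by blast
  have B0: "B\<phi> \<ge> 0" using b\<phi>[OF x] norm_ge_zero[of "\<phi> x"] by linarith
  have nF: "norm (F y $ l) \<le> B\<phi>" if "y \<in> S" for y l
    using b\<phi>[OF that] Finite_Cartesian_Product.norm_nth_le[of "F y" l] eq[OF that] by simp
  show ?thesis
  proof (rule that[of "C + 3 * C * B\<phi>"])
    show "C + 3 * C * B\<phi> > 0" using C(1) B0 by (simp add: add_pos_nonneg)
    have CC: "C \<le> C + 3 * C * B\<phi>" "3 * C * B\<phi> \<le> C + 3 * C * B\<phi>" using C(1) B0 by auto
    show "norm (Phi \<sigma> k x y) \<le> (C + 3 * C * B\<phi>) / norm (x - y)" if "y \<in> S" "y \<noteq> x" for y
      using C(2)[OF _ diam(2)[OF that(1)]] that divide_right_mono[OF CC(1), of "norm (x - y)"] by force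
    show "norm (K y) \<le> (C + 3 * C * B\<phi>) / (norm (y - x))\<^sup>2" if y: "y \<in> S" "y \<noteq> x" for y
    proof -
      have "norm (K y) \<le> (\<Sum>l\<in>(UNIV::3 set). C / (norm (y - x))\<^sup>2 * B\<phi>)"
        unfolding K_def norm_minus_cancel
      proof (rule sum_norm_le)
        fix l :: 3
        have "norm (Phi_y k x y (axis l 1)) \<le> C / (norm (y - x))\<^sup>2"
          using C(3)[of x y "axis l 1"] y diam(2)[OF y(1)] by (simp add: norm_minus_commute)
        then show "norm (Phi_y k x y (axis l 1) * F y $ l) \<le> C / (norm (y - x))\<^sup>2 * B\<phi>"
          unfolding norm_mult using nF[OF y(1)] C(1) by (intro mult_mono) auto
      qed
      also have "\<dots> = (3 * C * B\<phi>) / (norm (y - x))\<^sup>2" by simp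
      also have "\<dots> \<le> (C + 3 * C * B\<phi>) / (norm (y - x))\<^sup>2" using CC(2) by (rule divide_right_mono) simp
      finally show ?thesis .
    qed
    show "norm (f2 y) \<le> (C + 3 * C * B\<phi>) / (norm (y - x))\<^sup>2" if y: "y \<in> S" "y \<noteq> x" for y
    proof -
      have n: "norm (y - x) > 0" using y by simp
      have P: "norm (Phi \<sigma> k x y) \<le> C / norm (y - x)"
        using C(2)[of x y] y diam(2)[OF y(1)] by (simp add: norm_minus_commute)
      have "norm (\<Sum>l\<in>UNIV. of_real ((y - x) $ l) * F y $ l) \<le> (\<Sum>l\<in>(UNIV::3 set). norm (y - x) * B\<phi>)"
      proof (rule sum_norm_le)
        fix l :: 3
        show "norm (of_real ((y - x) $ l) * F y $ l) \<le> norm (y - x) * B\<phi>"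
          unfolding norm_mult norm_of_real using nF[OF y(1)] component_le_norm_cart[of "y - x" l]
          by (intro mult_mono) auto
      qed
      then have s: "norm (\<Sum>l\<in>UNIV. of_real ((y - x) $ l) * F y $ l) \<le> 3 * norm (y - x) * B\<phi>" by simp
      have "norm (f2 y) = norm (Phi \<sigma> k x y) * norm (\<Sum>l\<in>UNIV. of_real ((y - x) $ l) * F y $ l) / (norm (y - x))\<^sup>2"
        unfolding f2_def norm_divide norm_mult norm_power by simp
      also have "\<dots> \<le> (C / norm (y - x)) * (3 * norm (y - x) * B\<phi>) / (norm (y - x))\<^sup>2"
        using C(1) n by (intro divide_right_mono mult_mono P s) auto
      also have "\<dots> = (3 * C * B\<phi>) / (norm (y - x))\<^sup>2" using n by simp
      also have "\<dots> \<le> (C + 3 * C * B\<phi>) / (norm (y - x))\<^sup>2" using CC(2) by (rule divide_right_mono) simp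
      finally show ?thesis .
    qed
  qed
qed

lemma continuous_Phi: "continuous_on (S - {x}) (Phi \<sigma> k x)"
  by (rule continuous_on_subset[OF C1_alongD(3)[OF Phi_C1[of x k]]]) auto

lemma continuous_F: "continuous_on (S - {x}) F"
  by (rule continuous_on_subset[OF C1_alongD(3)[OF F]]) auto

lemma continuous_sd: "continuous_on S sd"
  by (rule continuous_surf_div[OF S(2) nu F eq])

lemma continuous_K: "continuous_on (S - {x}) K"
  unfolding K_def[abs_def]
  by (intro continuous_on_minus continuous_on_sum continuous_on_mult continuous_on_subset[OF C1_alongD(2)[OF Phi_C1[of x k]]]
     continuous_on_component continuous_F) auto

lemma continuous_f2: "continuous_on (S - {x}) f2"
  unfolding f2_def[abs_def]
  by (intro continuous_on_divide continuous_on_mult continuous_on_sum continuous_Phi continuous_on_of_real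
     continuous_on_component continuous_F continuous_on_diff continuous_on_id continuous_on_const continuous_on_power continuous_on_norm) auto

lemma meas_K: "meas K" by (rule meas_continuous[OF continuous_K])
lemma meas_f2: "meas f2" by (rule meas_continuous[OF continuous_f2])

lemma meas_sdPhi: "meas (\<lambda>y. Phi \<sigma> k x y * sd y)"
  by (rule meas_continuous[of x]) (intro continuous_on_mult continuous_Phi continuous_on_subset[OF continuous_sd], auto)

lemma integrable_singular:
  fixes f :: "real^3 \<Rightarrow> 'b::euclidean_space"
  assumes f: "meas f" and le: "\<And>y. y \<in> S \<Longrightarrow> y \<noteq> x \<Longrightarrow> norm (f y) \<le> C / norm (x - y)"
  shows "set_integrable \<mu> S f"
proof -
  have g: "set_integrable \<mu> S (\<lambda>y. C / norm (x - y) + norm (f x))"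
    using set_integral_add(1)[OF integrable_inverse_dist[OF x, of C] integrable_const[of "norm (f x)"]] .
  show ?thesis
  proof (rule integrable_dominated[OF f g])
    show "norm (f y) \<le> C / norm (x - y) + norm (f x)" if "y \<in> S" for y
      using le[OF that] by (cases "y = x") (auto intro: add_increasing2)
  qed
qed

lemma integrable_sdPhi: "set_integrable \<mu> S (\<lambda>y. Phi \<sigma> k x y * sd y)"
proof -
  obtain C where C: "C > 0" "\<And>y. y \<in> S \<Longrightarrow> y \<noteq> x \<Longrightarrow> norm (Phi \<sigma> k x y) \<le> C / norm (x - y)" by (rule bounds) (rule that; blast)
  have "norm (Phi \<sigma> k x y * sd y) \<le> (C * Bd) / norm (x - y)" if y: "y \<in> S" "y \<noteq> x" for y
  proof -
    have "norm (Phi \<sigma> k x y * sd y) \<le> C / norm (x - y) * Bd"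
      unfolding norm_mult using C(1) by (intro mult_mono C(2)[OF y] bd[OF y(1)]) auto
    then show ?thesis by simp
  qed
  then show ?thesis by (rule integrable_singular[OF meas_sdPhi])
qed

lemma Bmat_apply: "Bmat \<sigma> y *v v = (\<chi> i. alpha \<sigma> i y * v $ i)"
  unfolding Bmat_def diag_vec_mult ..

lemma norm_Bmat: "norm (Bmat \<sigma> y *v v) \<le> (1 + M) * norm v"
proof -
  have "(norm (Bmat \<sigma> y *v v))\<^sup>2 = (\<Sum>l\<in>UNIV. (norm (alpha \<sigma> l y * v $ l))\<^sup>2)"
    unfolding Bmat_apply by (simp add: norm_vec_def L2_set_def sum_nonneg)
  also have "\<dots> \<le> (\<Sum>l\<in>UNIV. ((1 + M) * norm (v $ l))\<^sup>2)"
    by (intro sum_mono power_mono) (auto simp: norm_mult intro!: mult_right_mono alpha_bound(1))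
  also have "\<dots> = ((1 + M) * norm v)\<^sup>2"
    by (simp add: norm_vec_def L2_set_def sum_nonneg power_mult_distrib sum_distrib_left)
  finally show ?thesis by (rule power2_le_imp_le) (simp add: M_nonneg)
qed

lemma integrable_vec: "set_integrable \<mu> S (\<lambda>y. Phi \<sigma> k x y *s (Bmat \<sigma> y *v \<phi> y))"
proof -
  obtain C where C: "C > 0" "\<And>y. y \<in> S \<Longrightarrow> y \<noteq> x \<Longrightarrow> norm (Phi \<sigma> k x y) \<le> C / norm (x - y)" by (rule bounds) (rule that; blast)
  have ns: "norm (a *s v) = norm a * norm v" for a :: complex and v :: "complex^3"
    by (simp add: norm_vec_def norm_mult L2_set_left_distrib[symmetric] L2_set_right_distrib)
  have m: "meas (\<lambda>y. Phi \<sigma> k x y *s (Bmat \<sigma> y *v \<phi> y))"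
  proof (rule meas_continuous)
    have "continuous_on (S - {x}) (\<lambda>y. \<chi> i. Phi \<sigma> k x y * (alpha \<sigma> i y * F y $ i))"
      by (intro continuous_on_vec_lambda continuous_on_mult continuous_Phi continuous_alpha continuous_on_component continuous_F)
    then show "continuous_on (S - {x}) (\<lambda>y. Phi \<sigma> k x y *s (Bmat \<sigma> y *v \<phi> y))"
      by (rule continuous_on_eq) (auto simp: Bmat_apply vec_eq_iff eq)
  qed
  have "norm (Phi \<sigma> k x y *s (Bmat \<sigma> y *v \<phi> y)) \<le> (C * ((1 + M) * B\<phi>)) / norm (x - y)" if y: "y \<in> S" "y \<noteq> x" for y
  proof -
    have "norm (Bmat \<sigma> y *v \<phi> y) \<le> (1 + M) * B\<phi>"
      using norm_Bmat[of y "\<phi> y"] mult_left_mono[OF b\<phi>[OF y(1)], of "1 + M"] M_nonneg by linarith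
    then have "norm (Phi \<sigma> k x y) * norm (Bmat \<sigma> y *v \<phi> y) \<le> C / norm (x - y) * ((1 + M) * B\<phi>)"
      using C(1) by (intro mult_mono C(2)[OF y]) auto
    then show ?thesis unfolding ns by simp
  qed
  then show ?thesis by (rule integrable_singular[OF m])
qed

text \<open>
  The formula for the kernel holds for \<open>y \<noteq> x\<close>; the point \<open>x\<close> itself has measure zero.
\<close>

lemma lap_kernel_integral:
  "set_integrable \<mu> S (lap_kernel \<sigma> k \<phi> x)"
  "(LINT y:S|\<mu>. lap_kernel \<sigma> k \<phi> x y) = - ((of_real k)\<^sup>2 *s vec_layer \<sigma> k S \<phi> x)"
proof -
  let ?V = "\<lambda>y. Phi \<sigma> k x y *s (Bmat \<sigma> y *v \<phi> y)"
  let ?c = "- complex_of_real (k\<^sup>2)"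
  have sc: "?c *s v = (- (k\<^sup>2)) *\<^sub>R v" for v :: "complex^3"
    by (simp add: vec_eq_iff scaleR_conv_of_real[where 'a=complex])
  have e: "lap_kernel \<sigma> k \<phi> x y = (- (k\<^sup>2)) *\<^sub>R ?V y" if "y \<noteq> x" for y
    unfolding sc[symmetric] lap_kernel_eq[OF that[symmetric]] by (simp add: vec_eq_iff)
  have iV: "set_integrable \<mu> S (\<lambda>y. (- (k\<^sup>2)) *\<^sub>R ?V y)"
    using integrable_vec by (intro set_integrable_scaleR_right) auto
  have cont: "meas (lap_kernel \<sigma> k \<phi> x)"
  proof (rule meas_continuous)
    have "continuous_on (S - {x}) (\<lambda>y. \<chi> i. - of_real (k\<^sup>2) * (Phi \<sigma> k x y * (alpha \<sigma> i y * F y $ i)))"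
      by (intro continuous_on_vec_lambda continuous_on_mult continuous_on_const continuous_Phi continuous_alpha continuous_on_component continuous_F)
    then show "continuous_on (S - {x}) (lap_kernel \<sigma> k \<phi> x)"
    proof (rule continuous_on_eq)
      fix y assume "y \<in> S - {x}"
      then have "y \<in> S" "x \<noteq> y" by auto
      then show "(\<chi> i. - of_real (k\<^sup>2) * (Phi \<sigma> k x y * (alpha \<sigma> i y * F y $ i))) = lap_kernel \<sigma> k \<phi> x y"
        unfolding lap_kernel_eq[OF \<open>x \<noteq> y\<close>] Bmat_apply by (simp add: vec_eq_iff eq)
    qed
  qed
  have ae: "AE y in \<mu>. indicator S y *\<^sub>R ((- (k\<^sup>2)) *\<^sub>R ?V y) = indicator S y *\<^sub>R lap_kernel \<sigma> k \<phi> x y"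
    using AE_neq[of x] by eventually_elim (simp add: e)
  have m1: "(\<lambda>y. indicator S y *\<^sub>R lap_kernel \<sigma> k \<phi> x y) \<in> borel_measurable \<mu>"
    using cont by (simp add: meas_def measurable_\<mu>)
  have m2: "(\<lambda>y. indicator S y *\<^sub>R ((- (k\<^sup>2)) *\<^sub>R ?V y)) \<in> borel_measurable \<mu>"
    using iV unfolding set_integrable_def by (rule borel_measurable_integrable)
  show "set_integrable \<mu> S (lap_kernel \<sigma> k \<phi> x)"
    using iV integrable_cong_AE[OF m2 m1 ae] unfolding set_integrable_def by simp
  have "(LINT y:S|\<mu>. lap_kernel \<sigma> k \<phi> x y) = (LINT y:S|\<mu>. (- (k\<^sup>2)) *\<^sub>R ?V y)"
    unfolding set_lebesgue_integral_def using integral_cong_AE[OF m2 m1 ae] by simp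
  also have "\<dots> = (- (k\<^sup>2)) *\<^sub>R vec_layer \<sigma> k S \<phi> x"
    unfolding vec_layer_def by (rule set_integral_scaleR_right)
  also have "\<dots> = - ((of_real k)\<^sup>2 *s vec_layer \<sigma> k S \<phi> x)" unfolding sc[symmetric] by (simp add: vec_eq_iff)
  finally show "(LINT y:S|\<mu>. lap_kernel \<sigma> k \<phi> x y) = - ((of_real k)\<^sup>2 *s vec_layer \<sigma> k S \<phi> x)" .
qed

text \<open>
  The derivative of the smoothly truncated kernel.  The clause at \<open>x\<close> records that the truncated kernel vanishes near \<open>x\<close>,
  while \<open>Phi \<sigma> k x\<close> has no derivative there.
\<close>

definition psi' where
  "psi' e y v = (if y = x then 0 else eta e y *\<^sub>R Phi_y k x y v + (sstep' (sq e y - 1) * (2 * ((y - x) \<bullet> v) / e\<^sup>2)) *\<^sub>R Phi \<sigma> k x y)"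

lemma C1_eta: "C1_along T (eta e) (\<lambda>y v. sstep' (sq e y - 1) * (2 * ((y - x) \<bullet> v) / e\<^sup>2))"
proof -
  have "C1_along T (\<lambda>y. sq e y - 1) (\<lambda>y v. 2 * ((y - x) \<bullet> v) / e\<^sup>2)"
    unfolding C1_along_def
  proof (intro conjI ballI allI)
    fix y :: "real^3"
    have d: "((\<lambda>y. y - x) has_derivative (\<lambda>v. v)) (at y)"
      using has_derivative_diff[OF has_derivative_ident has_derivative_const[of x]] by simp
    have "((\<lambda>y. (y - x) \<bullet> (y - x) * (1 / e\<^sup>2) - 1) has_derivative (\<lambda>v. ((y - x) \<bullet> v + v \<bullet> (y - x)) * (1 / e\<^sup>2) - 0)) (at y)"
      by (intro has_derivative_diff has_derivative_const has_derivative_mult_left has_derivative_inner d)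
    then show "((\<lambda>y. sq e y - 1) has_derivative (\<lambda>v. 2 * ((y - x) \<bullet> v) / e\<^sup>2)) (at y)"
      by (simp add: sq_def dot_square_norm inner_commute)
  next
    show "continuous_on T (\<lambda>y. 2 * ((y - x) \<bullet> v) / e\<^sup>2)" for v
      unfolding divide_inverse by (intro continuous_intros)
  qed
  from C1_along_sstep[OF this] show ?thesis unfolding eta_def[abs_def] .
qed

lemma eta_ball:
  assumes e: "e > 0" and y: "y \<in> ball x e"
  shows "eta e y = 0" "sstep' (sq e y - 1) = 0"
proof -
  have "norm (y - x) \<le> e" using y by (simp add: dist_norm norm_minus_commute)
  then have "(norm (y - x))\<^sup>2 \<le> e\<^sup>2" by (intro power_mono) auto
  then have "sq e y - 1 \<le> 0" using e by (simp add: sq_def divide_le_eq)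
  then show "eta e y = 0" "sstep' (sq e y - 1) = 0" by (simp_all add: eta_def sstep_0 sstep'_0)
qed

lemma C1_psi:
  assumes e: "e > 0"
  shows "C1_along UNIV (\<lambda>y. eta e y *\<^sub>R Phi \<sigma> k x y) (psi' e)"
proof -
  have c: "C1_along (- {x}) (\<lambda>y. eta e y *\<^sub>R Phi \<sigma> k x y) (psi' e)"
  proof -
    note c0 = C1_along_scaleR[OF C1_eta[of "- {x}" e] Phi_C1[of x k]]
    show ?thesis unfolding C1_along_def
    proof (intro conjI ballI allI)
      show "((\<lambda>y. eta e y *\<^sub>R Phi \<sigma> k x y) has_derivative psi' e y) (at y)" if "y \<in> - {x}" for y
        using C1_alongD(1)[OF c0 that] that unfolding psi'_def[abs_def] by simp
      show "continuous_on (- {x}) (\<lambda>y. psi' e y v)" for v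
        by (rule continuous_on_eq[OF C1_alongD(2)[OF c0, of v]]) (simp add: psi'_def)
    qed
  qed
  have z: "psi' e y v = 0" if "y \<in> ball x e" for y v
    using eta_ball[OF e that] by (simp add: psi'_def)
  have U: "UNIV = - {x} \<union> ball x e" using e by auto
  show ?thesis unfolding C1_along_def
  proof (intro conjI ballI allI)
    fix y
    show "((\<lambda>y. eta e y *\<^sub>R Phi \<sigma> k x y) has_derivative psi' e y) (at y)"
    proof (cases "y = x")
      case True
      have "((\<lambda>y. eta e y *\<^sub>R Phi \<sigma> k x y) has_derivative (\<lambda>_. 0)) (at x)"
        by (rule has_derivative_transform_within_open[OF has_derivative_const[of 0] open_ball[of x e]])
          (use e eta_ball[OF e] in auto)
      then show ?thesis using True by (simp add: psi'_def[abs_def])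
    next
      case False
      then show ?thesis using C1_alongD(1)[OF c] by simp
    qed
  next
    fix v
    have "continuous_on (ball x e) (\<lambda>y. psi' e y v)"
      by (rule continuous_on_eq[OF continuous_on_const[of _ 0]]) (simp add: z)
    then show "continuous_on UNIV (\<lambda>y. psi' e y v)"
      unfolding U by (intro continuous_on_open_Un C1_alongD(2)[OF c]) auto
  qed
qed

lemma borel_w: "w1 \<in> borel_measurable borel" "w2 \<in> borel_measurable borel" "(\<lambda>s. sstep (s - 1)) \<in> borel_measurable borel"
  "(\<lambda>s::real. if s \<ge> 1 then 1 else 0 :: real) \<in> borel_measurable borel"
proof -
  have c: "continuous_on UNIV (\<lambda>s. sstep (s - 1))" "continuous_on UNIV (\<lambda>s. sstep' (s - 1))"
    by (intro continuous_on_compose2[OF continuous_sstep[of UNIV]] continuous_on_compose2[OF continuous_sstep'[of UNIV]] continuous_intros; simp)+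
  show s: "(\<lambda>s. sstep (s - 1)) \<in> borel_measurable borel" by (rule borel_measurable_continuous_onI[OF c(1)])
  show i: "(\<lambda>s::real. if s \<ge> 1 then 1 else 0 :: real) \<in> borel_measurable borel" by measurable
  show "w1 \<in> borel_measurable borel" unfolding w1_def[abs_def]
    by (rule borel_measurable_continuous_onI) (intro continuous_on_mult continuous_on_const continuous_on_id c)
  show "w2 \<in> borel_measurable borel" unfolding w2_def[abs_def] by (intro borel_measurable_diff i s)
qed

lemma w1_props: "\<bar>w1 s\<bar> \<le> 16" "s < 1 \<or> s > 2 \<Longrightarrow> w1 s = 0" "isCont w1 s"
proof -
  show z: "w1 s = 0" if "s < 1 \<or> s > 2" using that by (auto simp: w1_def sstep'_0)
  show "\<bar>w1 s\<bar> \<le> 16"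
  proof (cases "s < 1 \<or> s > 2")
    case False
    then have "\<bar>2 * s\<bar> * \<bar>sstep' (s - 1)\<bar> \<le> 4 * 4" by (intro mult_mono sstep'_bound) auto
    then show ?thesis by (simp add: w1_def abs_mult)
  qed (simp add: z)
  have "continuous_on UNIV w1" unfolding w1_def[abs_def]
    by (intro continuous_on_mult continuous_on_const continuous_on_id continuous_on_compose2[OF continuous_sstep'[of UNIV]] continuous_intros) auto
  then show "isCont w1 s" by (simp add: continuous_on_eq_continuous_at)
qed

lemma w2_props: "\<bar>w2 s\<bar> \<le> 1" "s < 1 \<or> s > 2 \<Longrightarrow> w2 s = 0" "s \<noteq> 1 \<Longrightarrow> isCont w2 s"
proof -
  show "\<bar>w2 s\<bar> \<le> 1" using sstep_range[of "s - 1"] sstep_0[of "s - 1"] by (auto simp: w2_def)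
  show "w2 s = 0" if "s < 1 \<or> s > 2" using that by (auto simp: w2_def sstep_0 sstep_1)
  show "isCont w2 s" if "s \<noteq> 1"
  proof -
    have c: "isCont (\<lambda>s. sstep (s - 1)) s"
      using continuous_on_compose2[OF continuous_sstep[of UNIV], of UNIV "\<lambda>s. s - 1"] by (simp add: continuous_on_eq_continuous_at continuous_intros)
    have "isCont (\<lambda>s::real. if s \<ge> 1 then 1 else 0 :: real) s"
    proof (cases "s > 1")
      case True
      have "\<forall>\<^sub>F s in nhds s. (if s \<ge> 1 then 1 else 0 :: real) = 1"
        using eventually_nhds_in_open[of "{1<..}" s] True by (auto elim!: eventually_mono)
      then show ?thesis using isCont_cong[of "\<lambda>s. if s \<ge> 1 then 1 else 0 :: real" "\<lambda>_. 1" s] by simp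
    next
      case False
      then have "\<forall>\<^sub>F s in nhds s. (if s \<ge> 1 then 1 else 0 :: real) = 0"
        using eventually_nhds_in_open[of "{..<1}" s] that by (auto elim!: eventually_mono)
      then show ?thesis using isCont_cong[of "\<lambda>s. if s \<ge> 1 then 1 else 0 :: real" "\<lambda>_. 0" s] by simp
    qed
    then show ?thesis unfolding w2_def[abs_def] using c by (intro continuous_diff)
  qed
qed

lemma F_tendsto:
  assumes "y 0 = x" "(y has_vector_derivative t) (at 0)"
  shows "((\<lambda>e. F (y e) $ l) \<longlongrightarrow> F x $ l) (at_right 0)"
proof -
  have "isCont y 0" using assms(2) by (rule has_vector_derivative_continuous)
  then have "(y \<longlongrightarrow> x) (at 0)" using assms(1) by (simp add: isCont_def)
  then have y: "(y \<longlongrightarrow> x) (at_right 0)" by (rule filterlim_mono[OF _ order_refl at_le]) simp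
  have "isCont F x" by (rule has_derivative_continuous[OF C1_alongD(1)[OF F x]])
  from isCont_tendsto_compose[OF this y] show ?thesis by (rule tendsto_vec_nth)
qed

text \<open>
  \<open>K\<close> is odd at leading order like the derivative of the kernel; \<open>f2\<close> is odd as the product of the
  even kernel with the odd factor \<open>y - x\<close>.
\<close>

lemma K_annulus: 
  assumes w: "w \<in> borel_measurable borel" "\<And>s. \<bar>w s\<bar> \<le> Bw" "\<And>s. s < 1 \<or> s > 2 \<Longrightarrow> w s = 0" "\<And>s. s \<noteq> 1 \<Longrightarrow> isCont w s"
  shows "((\<lambda>e. LINT y:S|\<mu>. w (sq e y) *\<^sub>R K y) \<longlongrightarrow> 0) (at_right 0)"
    "((\<lambda>e. LINT y:S|\<mu>. w (sq e y) *\<^sub>R f2 y) \<longlongrightarrow> 0) (at_right 0)"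
proof -
  obtain C where C: "\<And>y. y \<in> S \<Longrightarrow> y \<noteq> x \<Longrightarrow> norm (K y) \<le> C / (norm (y - x))\<^sup>2"
    "\<And>y. y \<in> S \<Longrightarrow> y \<noteq> x \<Longrightarrow> norm (f2 y) \<le> C / (norm (y - x))\<^sup>2" by (rule bounds) (rule that; blast)
  show "((\<lambda>e. LINT y:S|\<mu>. w (sq e y) *\<^sub>R K y) \<longlongrightarrow> 0) (at_right 0)" unfolding sq_def
  proof (rule annulus_integral_vanishes[OF x meas_K C(1) _ _ w, where flim="\<lambda>t. - (\<Sum>l\<in>UNIV. Phi_y0 x t (axis l 1) * F x $ l)"])
    fix y :: "real \<Rightarrow> real^3" and t assume y: "y 0 = x" "(y has_vector_derivative t) (at 0)" "t \<noteq> 0"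
    have "((\<lambda>e. - (\<Sum>l\<in>UNIV. ((of_real e)\<^sup>2 * Phi_y k x (y e) (axis l 1)) * F (y e) $ l)) \<longlongrightarrow> - (\<Sum>l\<in>UNIV. Phi_y0 x t (axis l 1) * F x $ l)) (at_right 0)"
      by (intro tendsto_minus tendsto_sum tendsto_mult kernel_asymptotics(2)[OF y] F_tendsto[OF y(1,2)])
    then show "((\<lambda>e. e\<^sup>2 *\<^sub>R K (y e)) \<longlongrightarrow> - (\<Sum>l\<in>UNIV. Phi_y0 x t (axis l 1) * F x $ l)) (at_right 0)"
      unfolding K_def by (simp add: scaleR_conv_of_real sum_distrib_left mult.assoc)
  qed (simp_all add: Phi_y0_odd sum_negf)
  show "((\<lambda>e. LINT y:S|\<mu>. w (sq e y) *\<^sub>R f2 y) \<longlongrightarrow> 0) (at_right 0)" unfolding sq_def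
  proof (rule annulus_integral_vanishes[OF x meas_f2 C(2) _ _ w, where flim="\<lambda>t. Phi0 x t * (\<Sum>l\<in>UNIV. of_real (t $ l) * F x $ l) / (of_real (norm t))\<^sup>2"])
    fix y :: "real \<Rightarrow> real^3" and t assume y: "y 0 = x" "(y has_vector_derivative t) (at 0)" "t \<noteq> 0"
    note q = vector_derivative_quotient_at_right[OF y(2), unfolded y(1)]
    have "((\<lambda>e. (of_real e * Phi \<sigma> k x (y e)) * (\<Sum>l\<in>UNIV. of_real (((y e - x) /\<^sub>R e) $ l) * F (y e) $ l) / (of_real (norm ((y e - x) /\<^sub>R e)))\<^sup>2)
       \<longlongrightarrow> Phi0 x t * (\<Sum>l\<in>UNIV. of_real (t $ l) * F x $ l) / (of_real (norm t))\<^sup>2) (at_right 0)"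
      using y(3) by (intro tendsto_divide tendsto_mult tendsto_sum kernel_asymptotics(1)[OF y] F_tendsto[OF y(1,2)] tendsto_of_real
         tendsto_vec_nth q tendsto_power tendsto_norm) auto
    moreover have "\<forall>\<^sub>F e in at_right 0. (of_real e * Phi \<sigma> k x (y e)) * (\<Sum>l\<in>UNIV. of_real (((y e - x) /\<^sub>R e) $ l) * F (y e) $ l) / (of_real (norm ((y e - x) /\<^sub>R e)))\<^sup>2
        = e\<^sup>2 *\<^sub>R f2 (y e)"
      unfolding eventually_at_right_field
    proof (intro exI[of _ 1] conjI allI impI)
      fix e :: real assume e: "0 < e"
      have s: "(\<Sum>l\<in>UNIV. of_real (((y e - x) /\<^sub>R e) $ l) * F (y e) $ l) = (\<Sum>l\<in>UNIV. of_real ((y e - x) $ l) * F (y e) $ l) / of_real e"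
        unfolding sum_divide_distrib by (rule sum.cong) (simp_all add: divide_inverse mult_ac)
      have n: "(of_real (norm ((y e - x) /\<^sub>R e)) :: complex) = of_real (norm (y e - x)) / of_real e"
        using e by (simp add: divide_inverse mult.commute)
      show "(of_real e * Phi \<sigma> k x (y e)) * (\<Sum>l\<in>UNIV. of_real (((y e - x) /\<^sub>R e) $ l) * F (y e) $ l) / (of_real (norm ((y e - x) /\<^sub>R e)))\<^sup>2
        = e\<^sup>2 *\<^sub>R f2 (y e)"
        unfolding s n f2_def scaleR_conv_of_real[where 'a=complex] using e by (simp add: power_divide)
    qed simp
    ultimately show "((\<lambda>e. e\<^sup>2 *\<^sub>R f2 (y e)) \<longlongrightarrow> Phi0 x t * (\<Sum>l\<in>UNIV. of_real (t $ l) * F x $ l) / (of_real (norm t))\<^sup>2) (at_right 0)"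
      by (rule Lim_transform_eventually)
  qed (simp_all add: Phi0_even sum_negf)
qed

lemma eta_limit: "((\<lambda>e. LINT y:S|\<mu>. eta e y *\<^sub>R (Phi \<sigma> k x y * sd y)) \<longlongrightarrow> scal_layer \<sigma> k S sd x) (at_right 0)"
proof (rule tendsto_at_right_sequentially[where b=1])
  fix E :: "nat \<Rightarrow> real" assume E: "\<And>n. 0 < E n" "E \<longlonglongrightarrow> 0"
  show "(\<lambda>n. LINT y:S|\<mu>. eta (E n) y *\<^sub>R (Phi \<sigma> k x y * sd y)) \<longlonglongrightarrow> scal_layer \<sigma> k S sd x"
    unfolding scal_layer_def set_lebesgue_integral_def
  proof (rule integral_dominated_convergence[where w="\<lambda>y. norm (indicator S y *\<^sub>R (Phi \<sigma> k x y * sd y))"])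
    show "(\<lambda>y. indicator S y *\<^sub>R (Phi \<sigma> k x y * sd y)) \<in> borel_measurable \<mu>"
      using meas_sdPhi by (simp add: meas_def measurable_\<mu>)
    show "integrable \<mu> (\<lambda>y. norm (indicator S y *\<^sub>R (Phi \<sigma> k x y * sd y)))"
      using integrable_sdPhi unfolding set_integrable_def by (rule integrable_norm)
    have "eta (E n) \<in> borel_measurable borel" for n
      by (rule borel_measurable_continuous_onI[OF C1_alongD(3)[OF C1_eta]])
    from meas_scale[OF meas_sdPhi this]
    show "(\<lambda>y. indicator S y *\<^sub>R (eta (E n) y *\<^sub>R (Phi \<sigma> k x y * sd y))) \<in> borel_measurable \<mu>" for n
      by (simp add: meas_def measurable_\<mu>)
    have "norm (eta (E n) y *\<^sub>R z) \<le> norm z" for n y and z :: complex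
      using mult_left_le_one_le[of "norm z" "\<bar>eta (E n) y\<bar>"] sstep_range[of "sq (E n) y - 1"] by (simp add: eta_def)
    then show "AE y in \<mu>. norm (indicator S y *\<^sub>R (eta (E n) y *\<^sub>R (Phi \<sigma> k x y * sd y))) \<le> norm (indicator S y *\<^sub>R (Phi \<sigma> k x y * sd y))" for n
      by (intro always_eventually allI) (auto simp: indicator_def)
    show "AE y in \<mu>. (\<lambda>n. indicator S y *\<^sub>R (eta (E n) y *\<^sub>R (Phi \<sigma> k x y * sd y))) \<longlonglongrightarrow> indicator S y *\<^sub>R (Phi \<sigma> k x y * sd y)"
      using AE_neq[of x]
    proof eventually_elim
      case (elim y)
      have n: "norm (y - x) / 2 > 0" using elim by simp
      have "\<forall>\<^sub>F n in sequentially. E n < norm (y - x) / 2" by (rule order_tendstoD(2)[OF E(2) n])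
      then have "\<forall>\<^sub>F n in sequentially. indicator S y *\<^sub>R (eta (E n) y *\<^sub>R (Phi \<sigma> k x y * sd y)) = indicator S y *\<^sub>R (Phi \<sigma> k x y * sd y)"
      proof eventually_elim
        case (elim n)
        then have "2 * E n \<le> norm (y - x)" by simp
        then have "(2 * E n)\<^sup>2 \<le> (norm (y - x))\<^sup>2" using E(1)[of n] by (intro power_mono) auto
        moreover have "2 * (E n)\<^sup>2 \<le> (2 * E n)\<^sup>2" by (simp add: power2_eq_square)
        ultimately have "2 * (E n)\<^sup>2 \<le> (norm (y - x))\<^sup>2" by (rule order_trans[rotated])
        then have "sq (E n) y - 1 \<ge> 1" using E(1)[of n] by (simp add: sq_def le_divide_eq)
        then show ?case by (simp add: eta_def sstep_1)
      qed
      then show ?case by (rule tendsto_eventually)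
    qed
  qed
qed simp

text \<open>
  The weak divergence theorem with the test function \<open>eta e y *\<^sub>R Phi \<sigma> k x y\<close> moves the derivative from the
  truncated kernel to the field.  The identity is exact for every \<open>e\<close>; only its last two terms are errors.
\<close>

lemma pv_identity:
  assumes e: "e > 0"
  shows "set_integrable \<mu> (S - ball x e) (div_kernel \<sigma> k \<phi> x)"
    "(LINT y:(S - ball x e)|\<mu>. div_kernel \<sigma> k \<phi> x y) =
      (LINT y:S|\<mu>. eta e y *\<^sub>R (Phi \<sigma> k x y * sd y)) + (LINT y:S|\<mu>. w1 (sq e y) *\<^sub>R f2 y) + (LINT y:S|\<mu>. w2 (sq e y) *\<^sub>R K y)"
proof -
  obtain C where C: "\<And>y. y \<in> S \<Longrightarrow> y \<noteq> x \<Longrightarrow> norm (K y) \<le> C / (norm (y - x))\<^sup>2"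
    "\<And>y. y \<in> S \<Longrightarrow> y \<noteq> x \<Longrightarrow> norm (f2 y) \<le> C / (norm (y - x))\<^sup>2" by (rule bounds) (rule that; blast)
  define ch where "ch = (\<lambda>s::real. if s \<ge> 1 then 1 else 0 :: real)"
  have ie: "set_integrable \<mu> S (\<lambda>y. eta e y *\<^sub>R K y)" unfolding eta_def sq_def
    by (rule cutoff_integrable[OF meas_K C(1) borel_w(3) _ _ e, of 1]) (use sstep_range in \<open>auto simp: sstep_0\<close>)
  have i2: "set_integrable \<mu> S (\<lambda>y. w2 (sq e y) *\<^sub>R K y)" unfolding sq_def
    by (rule cutoff_integrable[OF meas_K C(1) borel_w(2) _ _ e, of 1]) (use w2_props in auto)
  have i1: "set_integrable \<mu> S (\<lambda>y. w1 (sq e y) *\<^sub>R f2 y)" unfolding sq_def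
    by (rule cutoff_integrable[OF meas_f2 C(2) borel_w(1) _ _ e, of 16]) (use w1_props in auto)
  have ic: "set_integrable \<mu> S (\<lambda>y. ch (sq e y) *\<^sub>R K y)" unfolding sq_def
    by (rule cutoff_integrable[OF meas_K C(1) borel_w(4)[folded ch_def] _ _ e, of 1]) (auto simp: ch_def)
  have isd: "set_integrable \<mu> S (\<lambda>y. eta e y *\<^sub>R (Phi \<sigma> k x y * sd y))"
  proof (rule integrable_dominated[where g="\<lambda>y. norm (Phi \<sigma> k x y * sd y)"])
    have "eta e \<in> borel_measurable borel"
      by (rule borel_measurable_continuous_onI[OF C1_alongD(3)[OF C1_eta]])
    then show "meas (\<lambda>y. eta e y *\<^sub>R (Phi \<sigma> k x y * sd y))" by (rule meas_scale[OF meas_sdPhi])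
    show "set_integrable \<mu> S (\<lambda>y. norm (Phi \<sigma> k x y * sd y))" using integrable_sdPhi by (rule set_integrable_norm)
    show "norm (eta e y *\<^sub>R (Phi \<sigma> k x y * sd y)) \<le> norm (Phi \<sigma> k x y * sd y)" for y
      using mult_left_le_one_le[of "norm (Phi \<sigma> k x y * sd y)" "\<bar>eta e y\<bar>"] sstep_range[of "sq e y - 1"] by (simp add: eta_def)
  qed
  have ind: "indicator (S - ball x e) y *\<^sub>R div_kernel \<sigma> k \<phi> x y = indicator S y *\<^sub>R (ch (sq e y) *\<^sub>R K y)" for y
  proof (cases "y \<in> S")
    case True
    have "y \<notin> ball x e \<longleftrightarrow> e \<le> norm (y - x)" by (simp add: dist_norm norm_minus_commute not_less)
    also have "\<dots> \<longleftrightarrow> e\<^sup>2 \<le> (norm (y - x))\<^sup>2" using e by (simp add: power_mono_iff)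
    also have "\<dots> \<longleftrightarrow> sq e y \<ge> 1" using e by (simp add: sq_def le_divide_eq)
    finally have i: "y \<notin> ball x e \<longleftrightarrow> sq e y \<ge> 1" .
    show ?thesis
    proof (cases "y \<in> ball x e")
      case False
      then have "y \<noteq> x" using e by auto
      then show ?thesis using True False i K_div_kernel[OF True] by (simp add: ch_def)
    qed (use i in \<open>simp add: ch_def\<close>)
  qed simp
  show "set_integrable \<mu> (S - ball x e) (div_kernel \<sigma> k \<phi> x)"
    using ic unfolding set_integrable_def ind .
  have PV: "(LINT y:(S - ball x e)|\<mu>. div_kernel \<sigma> k \<phi> x y) = (LINT y:S|\<mu>. eta e y *\<^sub>R K y) + (LINT y:S|\<mu>. w2 (sq e y) *\<^sub>R K y)"
  proof -
    have "(LINT y:(S - ball x e)|\<mu>. div_kernel \<sigma> k \<phi> x y) = (LINT y:S|\<mu>. ch (sq e y) *\<^sub>R K y)"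
      unfolding set_lebesgue_integral_def ind ..
    also have "(\<lambda>y. ch (sq e y) *\<^sub>R K y) = (\<lambda>y. eta e y *\<^sub>R K y + w2 (sq e y) *\<^sub>R K y)"
      by (simp add: fun_eq_iff eta_def w2_def ch_def algebra_simps)
    also have "(LINT y:S|\<mu>. eta e y *\<^sub>R K y + w2 (sq e y) *\<^sub>R K y) = (LINT y:S|\<mu>. eta e y *\<^sub>R K y) + (LINT y:S|\<mu>. w2 (sq e y) *\<^sub>R K y)"
      by (rule set_integral_add(2)[OF ie i2])
    finally show ?thesis .
  qed
  have pt: "sd y * (eta e y *\<^sub>R Phi \<sigma> k x y) + (\<Sum>l\<in>UNIV. psi' e y (axis l 1) * \<phi> y $ l)
     = eta e y *\<^sub>R (Phi \<sigma> k x y * sd y) + w1 (sq e y) *\<^sub>R f2 y - eta e y *\<^sub>R K y" if y: "y \<in> S" "y \<noteq> x" for y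
  proof -
    have n: "norm (y - x) \<noteq> 0" using y by simp
    have in': "(y - x) \<bullet> axis l 1 = (y - x) $ l" for l by (simp add: inner_axis)
    define P where "P = Phi \<sigma> k x y"
    define c where "c = sstep' (sq e y - 1) * 2 / e\<^sup>2"
    have "(\<Sum>l\<in>UNIV. psi' e y (axis l 1) * \<phi> y $ l) = (\<Sum>l\<in>UNIV. eta e y *\<^sub>R (Phi_y k x y (axis l 1) * F y $ l) + c *\<^sub>R (P * (of_real ((y - x) $ l) * F y $ l)))"
    proof (rule sum.cong)
      fix l :: 3
      have alg: "(h *\<^sub>R A + (s * (2 * a / q)) *\<^sub>R P) * f = h *\<^sub>R (A * f) + (s * 2 / q) *\<^sub>R (P * (of_real a * f))" for h s a q :: real and A f :: complex
        by (simp add: scaleR_conv_of_real algebra_simps)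
      have p: "psi' e y (axis l 1) = eta e y *\<^sub>R Phi_y k x y (axis l 1) + (sstep' (sq e y - 1) * (2 * ((y - x) $ l) / e\<^sup>2)) *\<^sub>R P"
        using y(2) unfolding psi'_def in' P_def by simp
      show "psi' e y (axis l 1) * \<phi> y $ l = eta e y *\<^sub>R (Phi_y k x y (axis l 1) * F y $ l) + c *\<^sub>R (P * (of_real ((y - x) $ l) * F y $ l))"
        unfolding p c_def eq[OF y(1)] by (rule alg)
    qed simp
    also have "\<dots> = eta e y *\<^sub>R (\<Sum>l\<in>UNIV. Phi_y k x y (axis l 1) * F y $ l) + c *\<^sub>R (P * (\<Sum>l\<in>UNIV. of_real ((y - x) $ l) * F y $ l))"
      by (simp add: sum.distrib scaleR_sum_right sum_distrib_left)
    also have "c *\<^sub>R (P * (\<Sum>l\<in>UNIV. of_real ((y - x) $ l) * F y $ l)) = w1 (sq e y) *\<^sub>R f2 y"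
    proof -
      have "w1 (sq e y) = c * (norm (y - x))\<^sup>2" by (simp add: w1_def c_def sq_def)
      then show ?thesis using n unfolding f2_def P_def by (simp add: scaleR_conv_of_real)
    qed
    also have "eta e y *\<^sub>R (\<Sum>l\<in>UNIV. Phi_y k x y (axis l 1) * F y $ l) = - (eta e y *\<^sub>R K y)"
      by (simp add: K_def)
    finally show ?thesis by (simp add: mult.commute)
  qed
  note wk = weak[OF C1_psi[OF e]]
  have "(LINT y:S|\<mu>. eta e y *\<^sub>R (Phi \<sigma> k x y * sd y) + w1 (sq e y) *\<^sub>R f2 y - eta e y *\<^sub>R K y)
     = (LINT y:S|\<mu>. sd y * (eta e y *\<^sub>R Phi \<sigma> k x y) + (\<Sum>l\<in>UNIV. psi' e y (axis l 1) * \<phi> y $ l))"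
    unfolding set_lebesgue_integral_def
  proof (rule integral_cong_AE)
    show "AE y in \<mu>. indicator S y *\<^sub>R (eta e y *\<^sub>R (Phi \<sigma> k x y * sd y) + w1 (sq e y) *\<^sub>R f2 y - eta e y *\<^sub>R K y)
       = indicator S y *\<^sub>R (sd y * (eta e y *\<^sub>R Phi \<sigma> k x y) + (\<Sum>l\<in>UNIV. psi' e y (axis l 1) * \<phi> y $ l))"
      using AE_neq[of x]
    proof eventually_elim
      case (elim y)
      then show ?case using pt[of y] by (cases "y \<in> S") auto
    qed
    show "(\<lambda>y. indicator S y *\<^sub>R (sd y * (eta e y *\<^sub>R Phi \<sigma> k x y) + (\<Sum>l\<in>UNIV. psi' e y (axis l 1) * \<phi> y $ l))) \<in> borel_measurable \<mu>"
      using conjunct1[OF wk] unfolding set_integrable_def by (rule borel_measurable_integrable)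
    show "(\<lambda>y. indicator S y *\<^sub>R (eta e y *\<^sub>R (Phi \<sigma> k x y * sd y) + w1 (sq e y) *\<^sub>R f2 y - eta e y *\<^sub>R K y)) \<in> borel_measurable \<mu>"
      using set_integral_diff(1)[OF set_integral_add(1)[OF isd i1] ie] unfolding set_integrable_def by (rule borel_measurable_integrable)
  qed
  then have "(LINT y:S|\<mu>. eta e y *\<^sub>R (Phi \<sigma> k x y * sd y) + w1 (sq e y) *\<^sub>R f2 y - eta e y *\<^sub>R K y) = 0"
    using wk by simp
  then have "(LINT y:S|\<mu>. eta e y *\<^sub>R (Phi \<sigma> k x y * sd y)) + (LINT y:S|\<mu>. w1 (sq e y) *\<^sub>R f2 y) - (LINT y:S|\<mu>. eta e y *\<^sub>R K y) = 0"
    unfolding set_integral_diff(2)[OF set_integral_add(1)[OF isd i1] ie] set_integral_add(2)[OF isd i1] .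
  then show "(LINT y:(S - ball x e)|\<mu>. div_kernel \<sigma> k \<phi> x y) =
      (LINT y:S|\<mu>. eta e y *\<^sub>R (Phi \<sigma> k x y * sd y)) + (LINT y:S|\<mu>. w1 (sq e y) *\<^sub>R f2 y) + (LINT y:S|\<mu>. w2 (sq e y) *\<^sub>R K y)"
    unfolding PV by simp
qed

theorem pv_eq_scal_layer:
  "has_pv_integral S (div_kernel \<sigma> k \<phi> x) x (scal_layer \<sigma> k S sd x)"
  "pv_div \<sigma> k S \<phi> x = scal_layer \<sigma> k S sd x"
proof -
  have "((\<lambda>e. (LINT y:S|\<mu>. eta e y *\<^sub>R (Phi \<sigma> k x y * sd y)) + (LINT y:S|\<mu>. w1 (sq e y) *\<^sub>R f2 y) + (LINT y:S|\<mu>. w2 (sq e y) *\<^sub>R K y))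
    \<longlongrightarrow> scal_layer \<sigma> k S sd x + 0 + 0) (at_right 0)"
    by (intro tendsto_add eta_limit K_annulus(2)[OF borel_w(1) w1_props] K_annulus(1)[OF borel_w(2) w2_props])
  moreover have "\<forall>\<^sub>F e in at_right 0. (LINT y:S|\<mu>. eta e y *\<^sub>R (Phi \<sigma> k x y * sd y)) + (LINT y:S|\<mu>. w1 (sq e y) *\<^sub>R f2 y) + (LINT y:S|\<mu>. w2 (sq e y) *\<^sub>R K y)
      = (LINT y:(S - ball x e)|\<mu>. div_kernel \<sigma> k \<phi> x y)"
    unfolding eventually_at_right_field by (rule exI[of _ 1]) (auto simp: pv_identity(2))
  ultimately have "((\<lambda>e. LINT y:(S - ball x e)|\<mu>. div_kernel \<sigma> k \<phi> x y) \<longlongrightarrow> scal_layer \<sigma> k S sd x + 0 + 0) (at_right 0)"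
    by (rule Lim_transform_eventually)
  then show pv: "has_pv_integral S (div_kernel \<sigma> k \<phi> x) x (scal_layer \<sigma> k S sd x)"
    unfolding has_pv_integral_def using pv_identity(1) by simp
  show "pv_div \<sigma> k S \<phi> x = scal_layer \<sigma> k S sd x"
    unfolding pv_div_def pv_integral_def
  proof (rule the_equality[where P="has_pv_integral S (div_kernel \<sigma> k \<phi> x) x", OF pv])
    fix L assume "has_pv_integral S (div_kernel \<sigma> k \<phi> x) x L"
    then show "L = scal_layer \<sigma> k S sd x"
      using pv unfolding has_pv_integral_def by (auto intro: tendsto_unique[OF trivial_limit_at_right_real])
  qed
qed

end

section \<open>From the principal value to the operator\<close>

lemma has_derivative_cong_on:
  assumes "\<And>y. y \<in> S \<Longrightarrow> f y = g y" "x \<in> S"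
  shows "(f has_derivative D) (at x within S) \<longleftrightarrow> (g has_derivative D) (at x within S)"
  using has_derivative_transform[OF assms(2), of f g D] has_derivative_transform[OF assms(2), of g f D] assms(1) by metis

lemma frechet_derivative_cong_on:
  assumes "\<And>y. y \<in> S \<Longrightarrow> f y = g y" "x \<in> S"
  shows "frechet_derivative f (at x within S) = frechet_derivative g (at x within S)"
    "f differentiable (at x within S) \<longleftrightarrow> g differentiable (at x within S)"
  unfolding frechet_derivative_def differentiable_def using has_derivative_cong_on[OF assms] by auto

lemma ccross_simps:
  "ccross v (a + b) = ccross v a + ccross v b" "ccross v (c *s a) = c *s ccross v a"
  "ccross v (a - c *s v) = ccross v a"
  by (simp_all add: ccross_def vec_eq_iff forall_3 vector_def algebra_simps)

text \<open>
  The divergence theorem for \<open>\<psi> \<phi>\<close> without boundary term, against all test functions.  In this form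
  the boundary condition at the edge passes to unions of disjoint pieces.
\<close>

definition weak_div :: "(real^3) set \<Rightarrow> (real^3 \<Rightarrow> real^3) \<Rightarrow> (real^3 \<Rightarrow> complex^3) \<Rightarrow> bool" where
  "weak_div S \<nu> \<phi> \<longleftrightarrow> (\<forall>\<psi> \<psi>'. C1_along UNIV \<psi> \<psi>' \<longrightarrow>
      set_integrable (surface_measure S) S (\<lambda>y. surf_div S \<nu> \<phi> y * \<psi> y + (\<Sum>l\<in>UNIV. \<psi>' y (axis l 1) * \<phi> y $ l)) \<and>
      (LINT y:S|surface_measure S. surf_div S \<nu> \<phi> y * \<psi> y + (\<Sum>l\<in>UNIV. \<psi>' y (axis l 1) * \<phi> y $ l)) = 0)"

text \<open>
  Three bounded diagonal entries, and three bounded terms in the derivative along the normal.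
\<close>

lemma tdiv_bound:
  assumes "norm (\<nu> y) = 1" "linear (X' y)" "\<And>l. norm (X' y (axis l 1)) \<le> L"
  shows "\<bar>tdiv \<nu> X' y\<bar> \<le> 6 * L"
proof -
  have L0: "L \<ge> 0" using assms(3)[of 1] norm_ge_zero[of "X' y (axis 1 1)"] by linarith
  have "\<bar>\<Sum>l\<in>UNIV. X' y (axis l 1) $ l\<bar> \<le> (\<Sum>l\<in>(UNIV::3 set). L)"
    by (rule order_trans[OF sum_abs]) (intro sum_mono order_trans[OF component_le_norm_cart] assms(3))
  then have 1: "\<bar>\<Sum>l\<in>UNIV. X' y (axis l 1) $ l\<bar> \<le> 3 * L" by simp
  have "norm (X' y (\<nu> y)) \<le> (\<Sum>l\<in>(UNIV::3 set). L)"
    unfolding linear_sum_axis[OF assms(2), of "\<nu> y"]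
  proof (rule sum_norm_le)
    fix l :: 3
    have "\<bar>\<nu> y $ l\<bar> \<le> 1" using component_le_norm_cart[of "\<nu> y" l] assms(1) by simp
    then show "norm (\<nu> y $ l *\<^sub>R X' y (axis l 1)) \<le> L"
      using mult_mono[OF _ assms(3)[of l], of "\<bar>\<nu> y $ l\<bar>" 1] L0 by simp
  qed
  then have "norm (X' y (\<nu> y)) \<le> 3 * L" by simp
  then have "\<bar>\<nu> y \<bullet> X' y (\<nu> y)\<bar> \<le> 3 * L"
    using Cauchy_Schwarz_ineq2[of "\<nu> y" "X' y (\<nu> y)"] assms(1) by simp
  then show ?thesis using 1 unfolding tdiv_def by linarith
qed

lemma norm_Rev_Imv: "norm (Rev v) \<le> norm v" "norm (Imv v) \<le> norm v"
  unfolding norm_vec_def by (auto intro!: L2_set_mono simp: abs_Re_le_cmod abs_Im_le_cmod)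

lemma surf_div_bound:
  assumes S: "smooth_surface S" and nu: "unit_normal S \<nu>" and F: "C1_along S F F'"
    and eq: "\<And>y. y \<in> S \<Longrightarrow> \<phi> y = F y" and L: "\<And>y l. y \<in> S \<Longrightarrow> norm (F' y (axis l 1)) \<le> L" and y: "y \<in> S"
  shows "norm (surf_div S \<nu> \<phi> y) \<le> 12 * L"
proof -
  have n: "norm (\<nu> y) = 1" using nu y by (simp add: unit_normal_def)
  have l: "linear (\<lambda>v. Rev (F' y v))" "linear (\<lambda>v. Imv (F' y v))"
    using C1_alongD(4)[OF C1_along_linear[OF bounded_linear_Rev F] y] C1_alongD(4)[OF C1_along_linear[OF bounded_linear_Imv F] y] by auto
  have "\<bar>tdiv \<nu> (\<lambda>y v. Rev (F' y v)) y\<bar> \<le> 6 * L"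
    by (rule tdiv_bound[where X'="\<lambda>y v. Rev (F' y v)" and y=y and \<nu>=\<nu>, OF n l(1)]) (rule order_trans[OF norm_Rev_Imv(1) L[OF y]])
  moreover have "\<bar>tdiv \<nu> (\<lambda>y v. Imv (F' y v)) y\<bar> \<le> 6 * L"
    by (rule tdiv_bound[where X'="\<lambda>y v. Imv (F' y v)" and y=y and \<nu>=\<nu>, OF n l(2)]) (rule order_trans[OF norm_Rev_Imv(2) L[OF y]])
  moreover have "surf_div S \<nu> \<phi> y = Complex (tdiv \<nu> (\<lambda>y v. Rev (F' y v)) y) (tdiv \<nu> (\<lambda>y v. Imv (F' y v)) y)"
    by (rule surf_div_eq[OF S nu F _ y]) (rule eq)
  ultimately show ?thesis
    using cmod_le[of "Complex (tdiv \<nu> (\<lambda>y v. Rev (F' y v)) y) (tdiv \<nu> (\<lambda>y v. Imv (F' y v)) y)"] by simp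
qed

text \<open>
  The closure of a bounded surface is compact, so the extension and its derivative are bounded there;
  a single constant serves for both.
\<close>

lemma C1_up_to_edge_extension:
  assumes "C1_up_to_edge S \<phi>" "bounded S"
  obtains F F' L where "C1_along (closure S) F F'" "\<And>y. y \<in> closure S \<Longrightarrow> \<phi> y = F y" "L \<ge> 0"
    "\<And>y l. y \<in> closure S \<Longrightarrow> norm (F' y (axis l 1)) \<le> L" "\<And>y. y \<in> closure S \<Longrightarrow> norm (\<phi> y) \<le> L"
proof -
  obtain U F where U: "open U" "closure S \<subseteq> U" "Ck_on 1 U F" "\<forall>x\<in>closure S. F x = \<phi> x"
    using assms(1) unfolding C1_up_to_edge_def by blast
  define F' where "F' = (\<lambda>y. frechet_derivative F (at y))"
  have d: "(F has_derivative F' y) (at y)" if "y \<in> U" for y unfolding F'_def using Ck_on_1D(1)[OF U(3) that] .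
  have c: "continuous_on U (\<lambda>y. F' y (axis l 1))" for l
    unfolding F'_def by (rule Ck_on_1D(2)[OF U(3)]) (simp add: axis_in_Basis_iff)
  have "C1_along U F F'"
    unfolding C1_along_def
  proof (intro conjI ballI allI d)
    fix v
    have "continuous_on U (\<lambda>y. \<Sum>l\<in>UNIV. v $ l *\<^sub>R F' y (axis l 1))"
      by (intro continuous_on_sum continuous_on_scaleR continuous_on_const c)
    then show "continuous_on U (\<lambda>y. F' y v)"
      by (rule continuous_on_eq) (rule linear_sum_axis[OF has_derivative_linear[OF d], symmetric])
  qed
  then have C1: "C1_along (closure S) F F'" using U(2) by (rule C1_along_subset)
  have cpt: "compact (closure S)" using assms(2) by (simp add: compact_closure)
  have bd: "\<exists>B. \<forall>y\<in>closure S. norm (h y) \<le> B" if "continuous_on (closure S) h" for h :: "real^3 \<Rightarrow> complex^3"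
    using compact_imp_bounded[OF compact_continuous_image[OF that cpt]] unfolding bounded_iff by auto
  have "\<forall>l. \<exists>B. \<forall>y\<in>closure S. norm (F' y (axis l 1)) \<le> B" using bd[OF C1_alongD(2)[OF C1]] by blast
  then obtain B where B: "\<And>l y. y \<in> closure S \<Longrightarrow> norm (F' y (axis l 1)) \<le> B l" by metis
  obtain B0 where B0: "\<And>y. y \<in> closure S \<Longrightarrow> norm (F y) \<le> B0" using bd[OF C1_alongD(3)[OF C1]] by blast
  define L where "L = \<bar>B0\<bar> + (\<Sum>l\<in>UNIV. \<bar>B l\<bar>)"
  have LB: "B l \<le> L" for l
  proof -
    have "\<bar>B l\<bar> \<le> (\<Sum>l\<in>UNIV. \<bar>B l\<bar>)" by (rule member_le_sum) auto
    then show ?thesis unfolding L_def by linarith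
  qed
  show ?thesis
  proof (rule that[OF C1])
    show "\<phi> y = F y" if "y \<in> closure S" for y using U(4) that by simp
    show "0 \<le> L" by (simp add: L_def sum_nonneg)
    show "norm (F' y (axis l 1)) \<le> L" if "y \<in> closure S" for y l using B[OF that, of l] LB[of l] by linarith
    show "norm (\<phi> y) \<le> L" if "y \<in> closure S" for y
    proof -
      have "0 \<le> (\<Sum>l\<in>UNIV. \<bar>B l\<bar>)" by (rule sum_nonneg) simp
      moreover have "norm (\<phi> y) \<le> B0" using B0[OF that] U(4) that by simp
      ultimately show ?thesis unfolding L_def by linarith
    qed
  qed
qed

text \<open>
  The principal value and the scalar layer agree at every point of the surface, hence as functions there, and
  derivatives within the surface depend on nothing else.  This gives the equality of the outer derivatives without deciding
  whether they exist.
\<close>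

lemma (in stretching) hypersingular_identity:
  assumes S: "S \<in> sets borel" "smooth_surface S" "emeasure (surface_measure S) S < \<infinity>" "bounded S"
    and nu: "unit_normal S \<nu>" and phi: "C1_up_to_edge S \<phi>" and weak: "weak_div S \<nu> \<phi>" and x: "x \<in> S"
  shows "hypersing_converges \<sigma> k S \<phi> x \<and> layers_converge \<sigma> k S \<nu> \<phi> x \<and>
          (pv_div \<sigma> k S \<phi> differentiable (at x within S) \<longleftrightarrow>
           scal_layer \<sigma> k S (surf_div S \<nu> \<phi>) differentiable (at x within S)) \<and>
          hypersing \<sigma> k S \<nu> \<phi> x =
            complex_of_real (k\<^sup>2) *s
              ccross (cvec (\<nu> x)) (Bmat \<sigma> x *v vec_layer \<sigma> k S \<phi> x)
            + surf_curl S \<nu> (scal_layer \<sigma> k S (surf_div S \<nu> \<phi>)) x"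
proof -
  obtain F F' L where F: "C1_along (closure S) F F'" "\<And>y. y \<in> closure S \<Longrightarrow> \<phi> y = F y" "L \<ge> 0"
    "\<And>y l. y \<in> closure S \<Longrightarrow> norm (F' y (axis l 1)) \<le> L" "\<And>y. y \<in> closure S \<Longrightarrow> norm (\<phi> y) \<le> L"
  proof (rule C1_up_to_edge_extension[OF phi S(4)])
    fix F F' L assume "C1_along (closure S) F F'" "\<And>y. y \<in> closure S \<Longrightarrow> \<phi> y = F y" "(L::real) \<ge> 0"
      "\<And>y l. y \<in> closure S \<Longrightarrow> norm (F' y (axis l 1)) \<le> L" "\<And>y. y \<in> closure S \<Longrightarrow> norm (\<phi> y) \<le> L"
    then show thesis by (rule that)
  qed
  note cS = subsetD[OF closure_subset[of S]]
  note FS = C1_along_subset[OF F(1) closure_subset]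
  obtain R where R: "R > 0" "\<And>y. y \<in> S \<Longrightarrow> norm y \<le> R" using S(4) unfolding bounded_pos by blast
  \<comment> \<open>The bound \<open>12 * L\<close> is that of \<open>surf_div_bound\<close>: \<open>6 * L\<close> for the real and for the imaginary part.\<close>
  have layer: "layer \<sigma> M S \<nu> \<phi> F F' (2 * R) L (12 * L) x'" if x': "x' \<in> S" for x'
  proof (intro layer.intro layer_axioms.intro)
    show "stretching \<sigma> M" by (rule stretching_axioms)
    show "finite_surface S" using S by unfold_locales auto
    show "norm (x' - y) \<le> 2 * R" if "y \<in> S" for y
      using norm_triangle_ineq4[of x' y] R(2)[OF x'] R(2)[OF that] by linarith
    show "norm (surf_div S \<nu> \<phi> y) \<le> 12 * L" if "y \<in> S" for y
      by (rule surf_div_bound[OF S(2) nu FS _ _ that]) (use F cS in auto)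
  qed (use nu FS F cS R weak x' in \<open>auto simp: weak_div_def\<close>)
  have pv: "pv_div \<sigma> k S \<phi> y = scal_layer \<sigma> k S (surf_div S \<nu> \<phi>) y" if "y \<in> S" for y
    by (rule layer.pv_eq_scal_layer(2)[OF layer[OF that]])
  have fd: "frechet_derivative (pv_div \<sigma> k S \<phi>) (at x within S) = frechet_derivative (scal_layer \<sigma> k S (surf_div S \<nu> \<phi>)) (at x within S)"
    "pv_div \<sigma> k S \<phi> differentiable (at x within S) \<longleftrightarrow> scal_layer \<sigma> k S (surf_div S \<nu> \<phi>) differentiable (at x within S)"
    by (rule frechet_derivative_cong_on[OF pv x]; assumption)+
  interpret layer \<sigma> M S \<nu> \<phi> F F' "2 * R" L "12 * L" k x by (rule layer[OF x])
  have hc: "hypersing_converges \<sigma> k S \<phi> x"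
    unfolding hypersing_converges_def using lap_kernel_integral(1) pv_eq_scal_layer(1) by blast
  have lc: "layers_converge \<sigma> k S \<nu> \<phi> x"
    unfolding layers_converge_def using integrable_vec integrable_sdPhi by blast
  have Binv: "Bmat \<sigma> x *v (matrix_inv (Bmat \<sigma> x) *v g) = g" for g
    unfolding Bmat_def matrix_inv_diag[of "\<lambda>i. alpha \<sigma> i x", OF alpha_bound(2)] diag_vec_mult
    using alpha_bound(2) by (simp add: vec_eq_iff)
  have Blin: "Bmat \<sigma> x *v (a + b) = Bmat \<sigma> x *v a + Bmat \<sigma> x *v b" "Bmat \<sigma> x *v (c *s a) = c *s (Bmat \<sigma> x *v a)" for a b c
    unfolding Bmat_def diag_vec_mult by (simp_all add: vec_eq_iff algebra_simps)
  have gr: "grad_on S (pv_div \<sigma> k S \<phi>) x = grad_on S (scal_layer \<sigma> k S (surf_div S \<nu> \<phi>)) x"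
    unfolding grad_on_def fd(1) ..
  have "hypersing \<sigma> k S \<nu> \<phi> x = complex_of_real (k\<^sup>2) *s
              ccross (cvec (\<nu> x)) (Bmat \<sigma> x *v vec_layer \<sigma> k S \<phi> x)
            + surf_curl S \<nu> (scal_layer \<sigma> k S (surf_div S \<nu> \<phi>)) x"
    unfolding hypersing_def lap_kernel_integral(2) minus_minus sgrad_on_def Blin Binv ccross_simps(1,2) gr
      surf_curl_def surf_grad_def ccross_simps(3) by simp
  then show ?thesis using hc lc fd(2) by blast
qed

section \<open>Relatively open pieces\<close>

lemma set_integral_openin:
  fixes f :: "real^3 \<Rightarrow> 'b::{banach, second_countable_topology}"
  assumes S: "S \<in> sets borel" "smooth_surface S" and S': "S' \<in> sets borel" and o: "openin (top_of_set S) S'"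
    and f: "set_integrable (surface_measure S') S' f"
  shows "set_integrable (surface_measure S) S' f" "(LINT y:S'|surface_measure S. f y) = (LINT y:S'|surface_measure S'. f y)"
proof -
  note sm = smooth_surface_openin[OF S(2) o]
  have m: "(\<lambda>y. indicator S' y *\<^sub>R f y) \<in> borel_measurable borel"
    using borel_measurable_integrable[OF f[unfolded set_integrable_def]] unfolding measurable_surface_measure[OF S' sm] .
  have d: "surface_measure S' = density (surface_measure S) (\<lambda>y. ennreal (indicator S' y))"
    using surface_measure_openin[OF S S' sm o] by (simp add: ennreal_indicator)
  have i: "(\<lambda>y. indicator S' y :: real) \<in> borel_measurable (surface_measure S)"
    unfolding measurable_surface_measure[OF S] using S' by simp
  have m': "(\<lambda>y. indicator S' y *\<^sub>R f y) \<in> borel_measurable (surface_measure S)"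
    unfolding measurable_surface_measure[OF S] by (rule m)
  have e: "indicator S' y *\<^sub>R (indicator S' y *\<^sub>R f y) = indicator S' y *\<^sub>R f y" for y
    by (simp add: indicator_def)
  have nn: "AE y in surface_measure S. 0 \<le> (indicator S' y :: real)" by simp
  have "integrable (density (surface_measure S) (\<lambda>y. ennreal (indicator S' y))) (\<lambda>y. indicator S' y *\<^sub>R f y)"
    using f unfolding set_integrable_def d .
  then show "set_integrable (surface_measure S) S' f"
    unfolding set_integrable_def integrable_density[OF m' i nn] e .
  show "(LINT y:S'|surface_measure S. f y) = (LINT y:S'|surface_measure S'. f y)"
    unfolding set_lebesgue_integral_def d integral_density[OF m' i nn] e ..
qed

lemma emeasure_openin:
  assumes S: "S \<in> sets borel" "smooth_surface S" and S': "S' \<in> sets borel" and o: "openin (top_of_set S) S'"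
  shows "emeasure (surface_measure S') S' = emeasure (surface_measure S) S'"
proof -
  have i: "(indicator S' :: _ \<Rightarrow> ennreal) \<in> borel_measurable (surface_measure S)"
    unfolding measurable_surface_measure[OF S] using S' by simp
  have "emeasure (surface_measure S') S' = (\<integral>\<^sup>+y. indicator S' y * indicator S' y \<partial>surface_measure S)"
    unfolding surface_measure_openin[OF S S' smooth_surface_openin[OF S(2) o] o]
    using S' by (subst emeasure_density[OF i]) (auto simp: sets_surface_measure[OF S])
  also have "\<dots> = (\<integral>\<^sup>+y. indicator S' y \<partial>surface_measure S)"
    by (rule nn_integral_cong) (simp add: indicator_def)
  also have "\<dots> = emeasure (surface_measure S) S'" using S' by (simp add: sets_surface_measure[OF S])
  finally show ?thesis .
qed

lemma at_within_openin:
  assumes "openin (top_of_set S) S'" "x \<in> S'"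
  shows "at x within S' = at x within S"
proof -
  obtain T where T: "open T" "S' = S \<inter> T" using assms(1) by (auto simp: openin_open)
  then show ?thesis using assms(2) by (intro at_within_nhd[of x T]) auto
qed

lemma surf_div_openin:
  assumes "openin (top_of_set S) S'" "x \<in> S'"
  shows "surf_div S' \<nu> \<phi> x = surf_div S \<nu> \<phi> x"
  unfolding surf_div_def at_within_openin[OF assms] ..

lemma unit_normal_openin:
  assumes "openin (top_of_set S) S'" "unit_normal S \<nu>"
  shows "unit_normal S' \<nu>"
  using assms(2) local_param_openin[OF assms(1)] openin_imp_subset[OF assms(1)] unfolding unit_normal_def by blast

lemma union_pieces:
  assumes "openin (top_of_set (A \<union> B)) A" "openin (top_of_set (A \<union> B)) B"
  shows "smooth_surface A \<Longrightarrow> smooth_surface B \<Longrightarrow> smooth_surface (A \<union> B)"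
    "unit_normal A \<nu> \<Longrightarrow> unit_normal B \<nu> \<Longrightarrow> unit_normal (A \<union> B) \<nu>"
proof -
  assume s: "smooth_surface A" "smooth_surface B"
  show "smooth_surface (A \<union> B)"
    unfolding smooth_surface_def
  proof
    fix x assume "x \<in> A \<union> B"
    then have "(\<exists>W r. local_param A W r \<and> x \<in> r ` W) \<or> (\<exists>W r. local_param B W r \<and> x \<in> r ` W)"
      using s unfolding smooth_surface_def by (elim UnE) simp_all
    then show "\<exists>W r. local_param (A \<union> B) W r \<and> x \<in> r ` W"
      using local_param_openin[OF assms(1)] local_param_openin[OF assms(2)] by (elim disjE exE conjE) (intro exI conjI; assumption?; simp)+
  qed
next
  assume n: "unit_normal A \<nu>" "unit_normal B \<nu>"
  show "unit_normal (A \<union> B) \<nu>"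
    unfolding unit_normal_def
  proof (intro conjI ballI allI impI)
    show "norm (\<nu> x) = 1" if "x \<in> A \<union> B" for x using n that by (auto simp: unit_normal_def)
    fix W r u i assume p: "local_param (A \<union> B) W r" and u: "u \<in> W"
    have "r u \<in> A \<union> B" by (rule subsetD[OF local_paramD(6)[OF p] imageI[OF u]])
    then show "\<nu> (r u) \<bullet> param_pd i r u = 0"
    proof
      assume "r u \<in> A"
      then show ?thesis using n(1) local_param_restrict[OF p assms(1)] u by (simp add: unit_normal_def)
    next
      assume "r u \<in> B"
      then show ?thesis using n(2) local_param_restrict[OF p assms(2)] u by (simp add: unit_normal_def)
    qed
  qed
qed

text \<open>
  Derivatives within a relatively open piece are those within the union, so the statements for the
  two pieces add up.
\<close>

lemma weak_div_union:
  assumes o: "openin (top_of_set (A \<union> B)) A" "openin (top_of_set (A \<union> B)) B" and dis: "A \<inter> B = {}"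
    and b: "A \<in> sets borel" "B \<in> sets borel" and s: "smooth_surface (A \<union> B)"
    and w: "weak_div A \<nu> \<phi>" "weak_div B \<nu> \<phi>"
  shows "weak_div (A \<union> B) \<nu> \<phi>"
  unfolding weak_div_def
proof (intro allI impI)
  fix \<psi> :: "real^3 \<Rightarrow> complex" and \<psi>' assume psi: "C1_along UNIV \<psi> \<psi>'"
  let ?h = "\<lambda>S y. surf_div S \<nu> \<phi> y * \<psi> y + (\<Sum>l\<in>UNIV. \<psi>' y (axis l 1) * \<phi> y $ l)"
  let ?S = "A \<union> B"
  have bS: "?S \<in> sets borel" using b by simp
  have piece: "set_integrable (surface_measure ?S) P (?h ?S) \<and> (LINT y:P|surface_measure ?S. ?h ?S y) = 0"
    if P: "openin (top_of_set ?S) P" "P \<in> sets borel" "weak_div P \<nu> \<phi>" for P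
  proof -
    have hp: "set_integrable (surface_measure P) P (?h P)" "(LINT y:P|surface_measure P. ?h P y) = 0"
      using P(3) psi unfolding weak_div_def by blast+
    note so = set_integral_openin[OF bS s P(2,1) hp(1)]
    have e: "indicator P y *\<^sub>R ?h P y = indicator P y *\<^sub>R ?h ?S y" for y
      using surf_div_openin[OF P(1), of y \<nu> \<phi>] by (cases "y \<in> P") auto
    show ?thesis using so hp(2) unfolding set_integrable_def set_lebesgue_integral_def e by simp
  qed
  note pA = piece[OF o(1) b(1) w(1)] and pB = piece[OF o(2) b(2) w(2)]
  show "set_integrable (surface_measure ?S) ?S (?h ?S) \<and> (LINT y:?S|surface_measure ?S. ?h ?S y) = 0"
    using pA pB b set_integral_Un[OF dis, of "surface_measure ?S" "?h ?S"]
      set_integrable_Un[of "surface_measure ?S" A "?h ?S" B] by (simp add: sets_surface_measure[OF bS s])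
qed

text \<open>
  On a compact surface every test function has compact support.
\<close>

lemma weak_div_compact:
  assumes S: "smooth_surface S" "compact S" and nu: "unit_normal S \<nu>"
    and F: "C1_along S F F'" "\<And>y. y \<in> S \<Longrightarrow> \<phi> y = F y" and tan: "tangential S \<nu> \<phi>"
  shows "weak_div S \<nu> \<phi>"
  unfolding weak_div_def
proof (intro allI impI)
  fix \<psi> :: "real^3 \<Rightarrow> complex" and \<psi>' assume psi: "C1_along UNIV \<psi> \<psi>'"
  have b: "S \<in> sets borel" using S(2) by (intro borel_closed compact_imp_closed)
  show "set_integrable (surface_measure S) S (\<lambda>y. surf_div S \<nu> \<phi> y * \<psi> y + (\<Sum>l\<in>UNIV. \<psi>' y (axis l 1) * \<phi> y $ l)) \<and>
      (LINT y:S|surface_measure S. surf_div S \<nu> \<phi> y * \<psi> y + (\<Sum>l\<in>UNIV. \<psi>' y (axis l 1) * \<phi> y $ l)) = 0"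
    using complex_divergence[where \<phi>=\<phi> and \<psi>=\<psi> and \<psi>'=\<psi>' and C=UNIV, OF b S(1) nu F tan C1_along_subset[OF psi subset_UNIV] closed_UNIV] S(2)
    by simp
qed

section \<open>The stretching profile\<close>

lemma pml_f1_range:
  assumes P: "P \<ge> 2" and s: "-1 \<le> s" "s \<le> 0"
  shows "0 \<le> pml_f1 P s" "pml_f1 P s \<le> 1/2"
proof -
  have c: "1/2 - 1 / real P \<ge> 0" using P by (simp add: field_simps)
  have "(- s) ^ 3 \<le> 1" using s by (intro power_le_one) auto
  then have s3: "-1 \<le> s ^ 3" by simp
  have s0: "s ^ 3 \<le> 0" using s by (simp add: power3_eq_cube mult_nonneg_nonpos2 mult_nonpos_nonpos mult_nonneg_nonpos)
  have "(1/2 - 1 / real P) * (-1) \<le> (1/2 - 1 / real P) * s ^ 3" by (rule mult_left_mono[OF s3 c])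
  moreover have "-1 / real P \<le> s / real P" using s by (intro divide_right_mono) auto
  ultimately show "0 \<le> pml_f1 P s" unfolding pml_f1_def by simp
  have "(1/2 - 1 / real P) * s ^ 3 \<le> 0" using c s0 by (rule mult_nonneg_nonpos)
  moreover have "s / real P \<le> 0" using s by (simp add: divide_nonpos_nonneg)
  ultimately show "pml_f1 P s \<le> 1/2" unfolding pml_f1_def by linarith
qed

text \<open>
  Clamping the scaled variable to the interval from -1 to 0 turns the three cases of the profile into a single
  formula: \<open>pml_f1\<close> is 0 at -1, where the profile is 0, and 1/2 at 0, where it is \<open>S\<close>.  This makes continuity evident.
  The bound \<open>2 * S\<close> is immediate from the formula.
\<close>

lemma stretching_pml:
  fixes a T :: "real^3"
  assumes a: "\<forall>l. a $ l > 0" and T: "\<forall>l. T $ l > 0" and S: "S > 0" and P: "P \<ge> 2"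
  shows "stretching (\<lambda>l. pml_sigma (a $ l) (T $ l) S P) (2 * S)"
proof
  fix l :: 3
  define s where "s = (\<lambda>t. max (-1) (min 0 ((\<bar>t\<bar> - (a $ l + T $ l)) / T $ l)))"
  define g where "g = (\<lambda>t. 2 * S * pml_f1 P (s t) ^ P / (pml_f1 P (s t) ^ P + (1 - pml_f1 P (s t)) ^ P))"
  have Tl: "T $ l > 0" and al: "a $ l > 0" using a T by auto
  have sr: "-1 \<le> s t" "s t \<le> 0" for t by (auto simp: s_def)
  note fr = pml_f1_range[OF P sr]
  have den: "pml_f1 P (s t) ^ P + (1 - pml_f1 P (s t)) ^ P > 0" for t
    using fr[of t] by (intro add_nonneg_pos zero_le_power zero_less_power) auto
  have eq: "pml_sigma (a $ l) (T $ l) S P = g"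
  proof
    fix t
    consider "\<bar>t\<bar> < a $ l" | "a $ l \<le> \<bar>t\<bar>" "\<bar>t\<bar> \<le> a $ l + T $ l" | "\<bar>t\<bar> > a $ l + T $ l" by linarith
    then show "pml_sigma (a $ l) (T $ l) S P t = g t"
    proof cases
      case 1
      have "(\<bar>t\<bar> - (a $ l + T $ l)) / T $ l \<le> -1" using 1 Tl by (simp add: divide_le_eq)
      then have "s t = -1" by (simp add: s_def)
      then have "pml_f1 P (s t) = 0" by (simp add: pml_f1_def)
      then show ?thesis using 1 P by (simp add: pml_sigma_def g_def)
    next
      case 2
      have "(\<bar>t\<bar> - (a $ l + T $ l)) / T $ l \<ge> -1" "(\<bar>t\<bar> - (a $ l + T $ l)) / T $ l \<le> 0"
        using 2 Tl by (simp_all add: le_divide_eq divide_le_eq)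
      then have "s t = (\<bar>t\<bar> - (a $ l + T $ l)) / T $ l" by (simp add: s_def)
      then show ?thesis using 2 by (simp add: pml_sigma_def g_def Let_def)
    next
      case 3
      have "(\<bar>t\<bar> - (a $ l + T $ l)) / T $ l \<ge> 0" using 3 Tl by simp
      then have "s t = 0" by (simp add: s_def)
      then have f: "pml_f1 P (s t) = 1/2" by (simp add: pml_f1_def)
      define q :: real where "q = (1/2) ^ P"
      have "q > 0" by (simp add: q_def)
      have "g t = 2 * S * q / (q + q)" unfolding g_def f q_def by simp
      also have "\<dots> = S" using \<open>q > 0\<close> by simp
      finally have "g t = S" .
      moreover have "\<not> \<bar>t\<bar> < a $ l" using 3 Tl by linarith
      ultimately show ?thesis using 3 by (simp add: pml_sigma_def)
    qed
  qed
  have cs: "continuous_on UNIV s" unfolding s_def using Tl by (intro continuous_intros) auto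
  have cf: "continuous_on UNIV (\<lambda>t. pml_f1 P (s t))" unfolding pml_f1_def using P by (intro continuous_intros cs) auto
  show "continuous_on UNIV (pml_sigma (a $ l) (T $ l) S P)"
    unfolding eq g_def using den by (intro continuous_intros cf) (auto simp: less_imp_neq[symmetric])
  fix t
  show "0 \<le> pml_sigma (a $ l) (T $ l) S P t"
    unfolding eq g_def using den[of t] fr[of t] S by (intro divide_nonneg_pos mult_nonneg_nonneg zero_le_power) auto
  have "pml_f1 P (s t) ^ P \<le> pml_f1 P (s t) ^ P + (1 - pml_f1 P (s t)) ^ P"
    using fr[of t] by simp
  then have "2 * S * pml_f1 P (s t) ^ P \<le> 2 * S * (pml_f1 P (s t) ^ P + (1 - pml_f1 P (s t)) ^ P)"
    using S by (intro mult_left_mono) auto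
  then show "pml_sigma (a $ l) (T $ l) S P t \<le> 2 * S"
    unfolding eq g_def using den[of t] by (simp add: divide_le_eq)
qed

section \<open>The truncated interface\<close>

lemma mem_centered_box: "x \<in> box (- b) b \<longleftrightarrow> (\<forall>l. \<bar>x $ l\<bar> < b $ l)" for x b :: "real^3"
  by (auto simp: mem_box_cart abs_less_iff) (smt (verit))+

locale truncated_interface =
  fixes \<Gamma> :: "(real^3) set" and a b :: "real^3" and h :: real and \<nu> :: "real^3 \<Rightarrow> real^3"
    and \<phi> F :: "real^3 \<Rightarrow> complex^3" and F' and L :: real and \<Gamma>b
  assumes ab: "\<And>l. 0 < a $ l" "\<And>l. a $ l < b $ l"
    and closed: "closed \<Gamma>" and smooth: "smooth_surface \<Gamma>"
    and plane: "\<Gamma> - box (- a) a = plane h - box (- a) a"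
    and \<Gamma>b: "\<Gamma>b = \<Gamma> \<inter> box (- b) b" and height: "\<And>y. y \<in> \<Gamma>b \<Longrightarrow> \<bar>y $ 3\<bar> < a $ 3"
    and nu: "unit_normal \<Gamma>b \<nu>" and tan: "tangential \<Gamma>b \<nu> \<phi>"
    and F: "C1_along (closure \<Gamma>b) F F'" and eq: "\<And>y. y \<in> closure \<Gamma>b \<Longrightarrow> \<phi> y = F y" and L0: "L \<ge> 0"
    and L: "\<And>y l. y \<in> closure \<Gamma>b \<Longrightarrow> norm (F' y (axis l 1)) \<le> L" "\<And>y. y \<in> closure \<Gamma>b \<Longrightarrow> norm (\<phi> y) \<le> L"
    and edge: "\<And>y. y \<in> edge \<Gamma>b \<Longrightarrow> \<phi> y = 0"
begin

lemma openin_\<Gamma>b: "openin (top_of_set \<Gamma>) \<Gamma>b" unfolding \<Gamma>b by (rule openin_open_Int[OF open_box])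
lemma borel_\<Gamma>b: "\<Gamma>b \<in> sets borel" unfolding \<Gamma>b using closed by (intro sets.Int borel_closed borel_open open_box) auto
lemma smooth_\<Gamma>b: "smooth_surface \<Gamma>b" by (rule smooth_surface_openin[OF smooth openin_\<Gamma>b])
lemma bounded_\<Gamma>b: "bounded \<Gamma>b" unfolding \<Gamma>b by (rule bounded_subset[OF bounded_box]) auto
lemma compact_closure_\<Gamma>b: "compact (closure \<Gamma>b)" using bounded_\<Gamma>b by (simp add: compact_closure)

lemma finite_\<Gamma>b: "emeasure (surface_measure \<Gamma>b) \<Gamma>b < \<infinity>"
proof -
  have b: "\<Gamma> \<in> sets borel" using closed by simp
  have c: "closure \<Gamma>b \<subseteq> \<Gamma>" using closed by (intro closure_minimal) (auto simp: \<Gamma>b)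
  have "emeasure (surface_measure \<Gamma>b) \<Gamma>b = emeasure (surface_measure \<Gamma>) \<Gamma>b"
    by (rule emeasure_openin[OF b smooth borel_\<Gamma>b openin_\<Gamma>b])
  also have "\<dots> \<le> emeasure (surface_measure \<Gamma>) (closure \<Gamma>b)"
    by (rule emeasure_mono[OF closure_subset]) (simp add: sets_surface_measure[OF b smooth])
  also have "\<dots> < \<infinity>" by (rule emeasure_compact_finite[OF b smooth compact_closure_\<Gamma>b c])
  finally show ?thesis .
qed

text \<open>
  Where \<open>\<bar>y $ l\<bar>\<close> exceeds \<open>a $ l\<close> the surface is the horizontal plane, so the straight segment from \<open>y\<close> in the direction of the
  \<open>l\<close>-axis stays on it until it meets the edge.  There \<open>\<phi>\<close> vanishes, and the derivative is bounded by \<open>L\<close>.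
\<close>

lemma decay_at_edge:
  assumes y: "y \<in> \<Gamma>b" and l: "l \<noteq> 3" "\<bar>y $ l\<bar> > a $ l"
  shows "norm (\<phi> y) \<le> L * (b $ l - \<bar>y $ l\<bar>)"
proof -
  define s where "s = (if y $ l \<ge> 0 then 1 else - 1 :: real)"
  define p where "p = (\<lambda>t. y + (t * s) *\<^sub>R axis l 1)"
  define \<tau> where "\<tau> = b $ l - \<bar>y $ l\<bar>"
  have yb: "\<bar>y $ m\<bar> < b $ m" for m using y by (simp add: \<Gamma>b mem_centered_box)
  have \<tau>: "\<tau> > 0" using yb[of l] by (simp add: \<tau>_def)
  have pl: "\<bar>p t $ l\<bar> = \<bar>y $ l\<bar> + t" if "t \<ge> 0" for t
    using that by (auto simp: p_def s_def)
  have pm: "p t $ m = y $ m" if "m \<noteq> l" for t m using that by (simp add: p_def axis_def)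
  have "y \<notin> box (- a) a" using l(2) by (auto simp: mem_centered_box not_less intro!: exI[of _ l])
  then have "y \<in> plane h" using y plane by (auto simp: \<Gamma>b)
  then have ph: "p t \<in> plane h" for t using pm[of 3] l(1) by (simp add: plane_def)
  have inb: "p t \<in> \<Gamma>b" if t: "0 \<le> t" "t < \<tau>" for t
  proof -
    have "p t \<notin> box (- a) a" using pl[OF t(1)] l(2) t(1) by (auto simp: mem_centered_box not_less intro!: exI[of _ l])
    then have "p t \<in> \<Gamma> - box (- a) a" unfolding plane using ph by simp
    moreover have "\<bar>p t $ m\<bar> < b $ m" for m
      using pl[OF t(1)] pm[of m t] yb[of m] t(2) by (cases "m = l") (simp_all add: \<tau>_def)
    ultimately show ?thesis by (simp add: \<Gamma>b mem_centered_box)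
  qed
  have dp: "(p has_derivative (\<lambda>t. (t * s) *\<^sub>R axis l 1)) (at t)" for t
    using has_derivative_add[OF has_derivative_const[of y] has_derivative_scaleR_left[OF has_derivative_mult_left[OF has_derivative_ident, of s], of "axis l (1::real)"]]
    unfolding p_def by simp
  have "p ` closure {0..<\<tau>} \<subseteq> closure \<Gamma>b"
  proof (rule image_closure_subset)
    show "continuous_on (closure {0..<\<tau>}) p"
      by (rule has_derivative_continuous_on[OF has_derivative_at_withinI[OF dp]])
    show "p ` {0..<\<tau>} \<subseteq> closure \<Gamma>b"
    proof (rule image_subsetI)
      show "p t \<in> closure \<Gamma>b" if "t \<in> {0..<\<tau>}" for t
        using inb[of t] that closure_subset[of \<Gamma>b] by (intro subsetD[OF closure_subset]) auto
    qed
  qed simp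
  then have cl: "p t \<in> closure \<Gamma>b" if "t \<in> {0..\<tau>}" for t using that \<tau> by auto
  have "p \<tau> \<notin> \<Gamma>b"
  proof
    assume "p \<tau> \<in> \<Gamma>b"
    then have "\<bar>p \<tau> $ l\<bar> < b $ l" by (simp add: \<Gamma>b mem_centered_box)
    then show False using pl[of \<tau>] \<tau> by (simp add: \<tau>_def)
  qed
  then have "p \<tau> \<in> edge \<Gamma>b" using cl[of \<tau>] \<tau> by (simp add: edge_def)
  then have F0: "F (p \<tau>) = 0" using edge[of "p \<tau>"] eq[of "p \<tau>"] cl[of \<tau>] \<tau> by simp
  have "norm (F (p 0) - F (p \<tau>)) \<le> L * norm (0 - \<tau>)"
  proof (rule differentiable_bound[of "{0..\<tau>}" "\<lambda>t. F (p t)" "\<lambda>t u. F' (p t) ((u * s) *\<^sub>R axis l 1)"])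
    fix t assume t: "t \<in> {0..\<tau>}"
    show "((\<lambda>t. F (p t)) has_derivative (\<lambda>u. F' (p t) ((u * s) *\<^sub>R axis l 1))) (at t within {0..\<tau>})"
      by (rule has_derivative_at_withinI, rule has_derivative_compose[OF dp C1_alongD(1)[OF F cl[OF t]]])
    show "onorm (\<lambda>u. F' (p t) ((u * s) *\<^sub>R axis l 1)) \<le> L"
    proof (rule onorm_le)
      fix u :: real
      have "norm (F' (p t) ((u * s) *\<^sub>R axis l 1)) = \<bar>u * s\<bar> * norm (F' (p t) (axis l 1))"
        unfolding linear_cmul[OF C1_alongD(4)[OF F cl[OF t]]] by simp
      also have "\<dots> = \<bar>u\<bar> * norm (F' (p t) (axis l 1))" by (simp add: s_def abs_mult)
      also have "\<dots> \<le> \<bar>u\<bar> * L" by (rule mult_left_mono[OF L(1)[OF cl[OF t]]]) simp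
      finally show "norm (F' (p t) ((u * s) *\<^sub>R axis l 1)) \<le> L * norm u" by (simp add: mult.commute)
    qed
  qed (use \<tau> in auto)
  moreover have "p 0 = y" by (simp add: p_def)
  moreover have "\<phi> y = F y" using eq y closure_subset[of \<Gamma>b] by (intro eq subsetD[OF closure_subset])
  ultimately show ?thesis using F0 \<tau> by (simp add: \<tau>_def)
qed

text \<open>
  \<open>s \<delta> l\<close> is a cutoff in the \<open>l\<close>-th coordinate: it vanishes for \<open>(y $ l)\<^sup>2 \<ge> (b $ l)\<^sup>2 - \<delta>\<close> and equals 1 for
  \<open>(y $ l)\<^sup>2 \<le> (b $ l)\<^sup>2 - 2 * \<delta>\<close>; squares keep it differentiable at 0.  \<open>c \<delta> l\<close> is its partial derivative in that
  coordinate.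
\<close>

definition q :: "real \<Rightarrow> 3 \<Rightarrow> real^3 \<Rightarrow> real" where "q \<delta> l y = ((b $ l)\<^sup>2 - (y $ l)\<^sup>2) / \<delta> - 1"
definition s where "s \<delta> l y = sstep (q \<delta> l y)"
definition c where "c \<delta> l y = sstep' (q \<delta> l y) * (- (2 * y $ l) / \<delta>)"

lemma C1_s: "C1_along T (s \<delta> l) (\<lambda>y v. c \<delta> l y * v $ l)"
proof -
  have "C1_along T (q \<delta> l) (\<lambda>y v. - (2 * y $ l) / \<delta> * v $ l)"
    unfolding C1_along_def
  proof (intro conjI ballI allI)
    fix y :: "real^3"
    have d: "((\<lambda>y :: real^3. y $ l) has_derivative (\<lambda>v. v $ l)) (at y)"
      by (rule bounded_linear_imp_has_derivative[OF bounded_linear_vec_nth])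
    have "((\<lambda>y. ((b $ l)\<^sup>2 - y $ l * y $ l) * (1 / \<delta>) - 1) has_derivative (\<lambda>v. (0 - (y $ l * v $ l + v $ l * y $ l)) * (1 / \<delta>) - 0)) (at y)"
      by (intro has_derivative_diff has_derivative_const has_derivative_mult_left has_derivative_mult d)
    moreover have "(\<lambda>v. (0 - (y $ l * v $ l + v $ l * y $ l)) * (1 / \<delta>) - 0) = (\<lambda>v. - (2 * y $ l) / \<delta> * v $ l)"
      by (simp add: fun_eq_iff algebra_simps)
    ultimately show "(q \<delta> l has_derivative (\<lambda>v. - (2 * y $ l) / \<delta> * v $ l)) (at y)"
      unfolding q_def[abs_def] by (simp add: power2_eq_square)
  next
    show "continuous_on T (\<lambda>y. - (2 * y $ l) / \<delta> * v $ l)" for v :: "real^3"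
      unfolding divide_inverse by (intro continuous_intros)
  qed
  from C1_along_sstep[OF this] show ?thesis unfolding s_def[abs_def] c_def by (simp add: mult.assoc)
qed

lemma s_range: "0 \<le> s \<delta> l y" "s \<delta> l y \<le> 1" using sstep_range by (simp_all add: s_def)

lemma cutoff_trivial:
  assumes "\<delta> > 0" "2 * \<delta> \<le> (b $ l)\<^sup>2 - (y $ l)\<^sup>2"
  shows "s \<delta> l y = 1" "c \<delta> l y = 0"
proof -
  have "q \<delta> l y \<ge> 1" using assms by (simp add: q_def le_divide_eq)
  then show "s \<delta> l y = 1" "c \<delta> l y = 0" by (simp_all add: s_def c_def sstep_1 sstep'_0)
qed

text \<open>
  The gradient of the cutoff is of order \<open>1/\<delta>\<close>, but it lives in a strip of width of order \<open>\<delta>\<close> along the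
  edge, where \<open>\<phi>\<close> is of order \<open>\<delta>\<close>.  The strips at the top and at the bottom
  of the box do not meet the surface.
\<close>

lemma cutoff_gradient_bound:
  assumes d: "\<delta> > 0" "\<And>l. 2 * \<delta> \<le> (b $ l)\<^sup>2 - (a $ l)\<^sup>2" and y: "y \<in> \<Gamma>b"
  shows "\<bar>c \<delta> l y\<bar> * norm (\<phi> y) \<le> 16 * L"
proof (cases "c \<delta> l y = 0")
  case True
  then show ?thesis using L0 by simp
next
  case False
  have yb: "\<bar>y $ l\<bar> < b $ l" using y by (simp add: \<Gamma>b mem_centered_box)
  have b0: "b $ l > 0" using ab[of l] by simp
  have lt: "(b $ l)\<^sup>2 - (y $ l)\<^sup>2 < 2 * \<delta>" using cutoff_trivial(2)[OF d(1), of l y] False by linarith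
  then have "(a $ l)\<^sup>2 < (y $ l)\<^sup>2" using d(2)[of l] by linarith
  then have "(a $ l)\<^sup>2 < \<bar>y $ l\<bar>\<^sup>2" by simp
  then have ay: "a $ l < \<bar>y $ l\<bar>" by (rule power2_less_imp_less) simp
  have l3: "l \<noteq> 3" using ay height[OF y] by auto
  have prod: "(b $ l - \<bar>y $ l\<bar>) * b $ l \<le> 2 * \<delta>"
  proof -
    have "(b $ l - \<bar>y $ l\<bar>) * b $ l \<le> (b $ l - \<bar>y $ l\<bar>) * (b $ l + \<bar>y $ l\<bar>)"
      using yb by (intro mult_left_mono) auto
    also have "\<dots> = (b $ l)\<^sup>2 - (y $ l)\<^sup>2" by (simp add: power2_eq_square algebra_simps)
    finally show ?thesis using lt by linarith
  qed
  have "\<bar>c \<delta> l y\<bar> = \<bar>sstep' (q \<delta> l y)\<bar> * (2 * \<bar>y $ l\<bar> / \<delta>)" using d(1) by (simp add: c_def abs_mult)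
  also have "\<dots> \<le> 4 * (2 * b $ l / \<delta>)"
    using yb d(1) by (intro mult_mono sstep'_bound divide_right_mono) auto
  finally have cb: "\<bar>c \<delta> l y\<bar> \<le> 8 * b $ l / \<delta>" by simp
  have "\<bar>c \<delta> l y\<bar> * norm (\<phi> y) \<le> (8 * b $ l / \<delta>) * (L * (b $ l - \<bar>y $ l\<bar>))"
    using b0 d(1) by (intro mult_mono cb decay_at_edge[OF y l3 ay]) auto
  also have "\<dots> = 8 * L / \<delta> * ((b $ l - \<bar>y $ l\<bar>) * b $ l)" by simp
  also have "\<dots> \<le> 8 * L / \<delta> * (2 * \<delta>)" using L0 d(1) by (intro mult_left_mono[OF prod]) auto
  also have "\<dots> = 16 * L" using d(1) by simp
  finally show ?thesis .
qed

text \<open>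
  The divergence theorem for a test function cut off near all faces of the box; the support meets the interface in a
  compact set.
\<close>

lemma cutoff_weak:
  fixes \<psi> :: "real^3 \<Rightarrow> complex"
  assumes psi: "C1_along UNIV \<psi> \<psi>'" and d: "\<delta> > 0"
  defines "H \<equiv> \<lambda>y. (s \<delta> 1 y * s \<delta> 2 y * s \<delta> 3 y) *\<^sub>R (surf_div \<Gamma>b \<nu> \<phi> y * \<psi> y + (\<Sum>l\<in>UNIV. \<psi>' y (axis l 1) * \<phi> y $ l))
     + ((s \<delta> 2 y * s \<delta> 3 y * c \<delta> 1 y) *\<^sub>R \<phi> y $ 1 + (s \<delta> 1 y * s \<delta> 3 y * c \<delta> 2 y) *\<^sub>R \<phi> y $ 2 + (s \<delta> 1 y * s \<delta> 2 y * c \<delta> 3 y) *\<^sub>R \<phi> y $ 3) * \<psi> y"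
  shows "set_integrable (surface_measure \<Gamma>b) \<Gamma>b H" "(LINT y:\<Gamma>b|surface_measure \<Gamma>b. H y) = 0"
proof -
  define C where "C = {y. \<forall>l. (y $ l)\<^sup>2 \<le> (b $ l)\<^sup>2 - \<delta>}"
  have C_eq: "C = (\<Inter>l. {y. (y $ l)\<^sup>2 \<le> (b $ l)\<^sup>2 - \<delta>})" by (auto simp: C_def)
  have "closed C" unfolding C_eq by (intro closed_INT ballI closed_Collect_le continuous_intros)
  have "C \<subseteq> box (- b) b"
  proof
    fix y assume y: "y \<in> C"
    have "\<bar>y $ l\<bar> < b $ l" for l
    proof (rule power2_less_imp_less)
      have "(y $ l)\<^sup>2 \<le> (b $ l)\<^sup>2 - \<delta>" using y by (simp add: C_def)
      then show "\<bar>y $ l\<bar>\<^sup>2 < (b $ l)\<^sup>2" using d unfolding power2_abs by linarith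
      show "0 \<le> b $ l" using ab[of l] by simp
    qed
    then show "y \<in> box (- b) b" by (simp add: mem_centered_box)
  qed
  then have GC: "\<Gamma>b \<inter> C = \<Gamma> \<inter> C" "bounded C" using bounded_subset[OF bounded_box] by (auto simp: \<Gamma>b)
  have "compact (\<Gamma>b \<inter> C)" unfolding GC(1) compact_eq_bounded_closed
    using GC(2) closed \<open>closed C\<close> by (auto intro: bounded_subset)
  have z: "s \<delta> 1 y *\<^sub>R s \<delta> 2 y *\<^sub>R s \<delta> 3 y *\<^sub>R \<psi> y = 0" if "y \<notin> C" for y
  proof -
    obtain l where "(y $ l)\<^sup>2 > (b $ l)\<^sup>2 - \<delta>" using \<open>y \<notin> C\<close> by (auto simp: C_def not_le)
    then have "q \<delta> l y \<le> 0" using d by (simp add: q_def divide_le_eq)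
    then have "s \<delta> l y = 0" by (simp add: s_def sstep_0)
    moreover have "l = 1 \<or> l = 2 \<or> l = 3" by (rule exhaust_3)
    ultimately show ?thesis by auto
  qed
  note C1 = C1_along_scaleR[OF C1_s[of \<Gamma>b \<delta> 1] C1_along_scaleR[OF C1_s[of \<Gamma>b \<delta> 2] C1_along_scaleR[OF C1_s[of \<Gamma>b \<delta> 3] C1_along_subset[OF psi subset_UNIV]]]]
  have FS: "C1_along \<Gamma>b F F'" by (rule C1_along_subset[OF F closure_subset])
  have eqS: "\<phi> y = F y" if "y \<in> \<Gamma>b" for y by (rule eq[OF subsetD[OF closure_subset that]])
  let ?\<psi> = "\<lambda>y. s \<delta> 1 y *\<^sub>R s \<delta> 2 y *\<^sub>R s \<delta> 3 y *\<^sub>R \<psi> y"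
  let ?\<psi>' = "\<lambda>y v. s \<delta> 1 y *\<^sub>R (s \<delta> 2 y *\<^sub>R (s \<delta> 3 y *\<^sub>R \<psi>' y v + (c \<delta> 3 y * v $ 3) *\<^sub>R \<psi> y) + (c \<delta> 2 y * v $ 2) *\<^sub>R s \<delta> 3 y *\<^sub>R \<psi> y) + (c \<delta> 1 y * v $ 1) *\<^sub>R s \<delta> 2 y *\<^sub>R s \<delta> 3 y *\<^sub>R \<psi> y"
  have He: "surf_div \<Gamma>b \<nu> \<phi> y * ?\<psi> y + (\<Sum>l\<in>UNIV. ?\<psi>' y (axis l 1) * \<phi> y $ l) = H y" for y
    unfolding H_def by (simp add: sum_3 axis_def scaleR_conv_of_real algebra_simps)
  have "set_integrable (surface_measure \<Gamma>b) \<Gamma>b (\<lambda>y. surf_div \<Gamma>b \<nu> \<phi> y * ?\<psi> y + (\<Sum>l\<in>UNIV. ?\<psi>' y (axis l 1) * \<phi> y $ l))"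
    "(LINT y:\<Gamma>b|surface_measure \<Gamma>b. surf_div \<Gamma>b \<nu> \<phi> y * ?\<psi> y + (\<Sum>l\<in>UNIV. ?\<psi>' y (axis l 1) * \<phi> y $ l)) = 0"
    by (rule complex_divergence[OF borel_\<Gamma>b smooth_\<Gamma>b nu FS eqS tan C1 \<open>closed C\<close> z \<open>compact (\<Gamma>b \<inter> C)\<close>]; assumption)+
  then show "set_integrable (surface_measure \<Gamma>b) \<Gamma>b H" "(LINT y:\<Gamma>b|surface_measure \<Gamma>b. H y) = 0"
    unfolding He by simp_all
qed

text \<open>
  Let the cutoffs approach 1.  At each fixed point they are eventually trivial, and \<open>cutoff_gradient_bound\<close>
  provides a constant that dominates the terms with their gradients.
\<close>

lemma weak_div_\<Gamma>b: "weak_div \<Gamma>b \<nu> \<phi>"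
  unfolding weak_div_def
proof (intro allI impI)
  fix \<psi> :: "real^3 \<Rightarrow> complex" and \<psi>' assume psi: "C1_along UNIV \<psi> \<psi>'"
  interpret finite_surface \<Gamma>b by unfold_locales (rule borel_\<Gamma>b smooth_\<Gamma>b finite_\<Gamma>b)+
  let ?g = "\<lambda>y. surf_div \<Gamma>b \<nu> \<phi> y * \<psi> y + (\<Sum>l\<in>UNIV. \<psi>' y (axis l 1) * \<phi> y $ l)"
  have cS: "y \<in> closure \<Gamma>b" if "y \<in> \<Gamma>b" for y by (rule subsetD[OF closure_subset that])
  have FS: "C1_along \<Gamma>b F F'" by (rule C1_along_subset[OF F closure_subset])
  have eqS: "\<phi> y = F y" if "y \<in> \<Gamma>b" for y by (rule eq[OF cS[OF that]])
  have sd: "norm (surf_div \<Gamma>b \<nu> \<phi> y) \<le> 12 * L" if "y \<in> \<Gamma>b" for y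
    by (rule surf_div_bound[OF smooth_\<Gamma>b nu FS eqS L(1)[OF cS] that])
  have csd: "continuous_on \<Gamma>b (surf_div \<Gamma>b \<nu> \<phi>)" by (rule continuous_surf_div[OF smooth_\<Gamma>b nu FS eqS])
  have bd: "\<exists>B. \<forall>y\<in>closure \<Gamma>b. norm (f y) \<le> B" if "continuous_on UNIV f" for f :: "real^3 \<Rightarrow> complex"
    using compact_imp_bounded[OF compact_continuous_image[OF continuous_on_subset[OF that subset_UNIV] compact_closure_\<Gamma>b]]
    unfolding bounded_iff by auto
  obtain B where B: "\<And>y. y \<in> closure \<Gamma>b \<Longrightarrow> norm (\<psi> y) \<le> B" using bd[OF C1_alongD(3)[OF psi]] by blast
  have "\<forall>l. \<exists>B. \<forall>y\<in>closure \<Gamma>b. norm (\<psi>' y (axis l 1)) \<le> B" using bd[OF C1_alongD(2)[OF psi]] by blast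
  then obtain B' where B': "\<And>l y. y \<in> closure \<Gamma>b \<Longrightarrow> norm (\<psi>' y (axis l 1)) \<le> B' l" by metis
  define G where "G = 12 * L * \<bar>B\<bar> + (\<Sum>l\<in>UNIV. \<bar>B' l\<bar> * L)"
  have Bn: "norm (\<psi> y) \<le> \<bar>B\<bar>" if "y \<in> \<Gamma>b" for y using B[OF cS[OF that]] by linarith
  have gG: "norm (?g y) \<le> G" if y: "y \<in> \<Gamma>b" for y
  proof -
    have 1: "norm (surf_div \<Gamma>b \<nu> \<phi> y * \<psi> y) \<le> 12 * L * \<bar>B\<bar>"
      unfolding norm_mult using L0 by (intro mult_mono sd[OF y] Bn[OF y]) auto
    have 2: "norm (\<Sum>l\<in>UNIV. \<psi>' y (axis l 1) * \<phi> y $ l) \<le> (\<Sum>l\<in>UNIV. \<bar>B' l\<bar> * L)"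
    proof (rule sum_norm_le)
      fix l :: 3
      have "norm (\<phi> y $ l) \<le> L" using L(2)[OF cS[OF y]] Finite_Cartesian_Product.norm_nth_le[of "\<phi> y" l] by linarith
      moreover have "norm (\<psi>' y (axis l 1)) \<le> \<bar>B' l\<bar>" using B'[OF cS[OF y], of l] by linarith
      ultimately show "norm (\<psi>' y (axis l 1) * \<phi> y $ l) \<le> \<bar>B' l\<bar> * L" unfolding norm_mult by (intro mult_mono) auto
    qed
    show ?thesis unfolding G_def by (rule order_trans[OF norm_triangle_ineq add_mono[OF 1 2]])
  qed
  have mg: "meas ?g"
  \<comment> \<open>The function is continuous everywhere on the surface, so the excepted point is arbitrary.\<close>
  proof (rule meas_continuous[of undefined], rule continuous_on_subset[of \<Gamma>b])
    have "continuous_on \<Gamma>b (\<lambda>y. surf_div \<Gamma>b \<nu> \<phi> y * \<psi> y + (\<Sum>l\<in>UNIV. \<psi>' y (axis l 1) * F y $ l))"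
      by (intro continuous_on_add continuous_on_mult continuous_on_sum csd continuous_on_component C1_alongD(3)[OF FS]
        continuous_on_subset[OF C1_alongD(3)[OF psi] subset_UNIV] continuous_on_subset[OF C1_alongD(2)[OF psi] subset_UNIV])
    then show "continuous_on \<Gamma>b ?g" by (rule continuous_on_eq) (simp add: eqS)
  qed auto
  have ig: "set_integrable \<mu> \<Gamma>b ?g" by (rule integrable_bounded[OF mg gG])
  \<comment> \<open>If \<open>2 * \<delta> \<le> m\<close>, the strips in which the cutoffs vary lie where the interface is flat.\<close>
  define m where "m = Min (range (\<lambda>l. (b $ l)\<^sup>2 - (a $ l)\<^sup>2))"
  have m0: "m > 0" unfolding m_def using ab by (simp add: Min_gr_iff power_strict_mono less_imp_le)
  have ml: "m \<le> (b $ l)\<^sup>2 - (a $ l)\<^sup>2" for l unfolding m_def by (intro Min_le) auto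
  define \<delta> where "\<delta> = (\<lambda>n. (m / 2) * (1 / real (Suc n)))"
  have \<delta>: "\<delta> n > 0" "2 * \<delta> n \<le> m" for n using m0 by (auto simp: \<delta>_def divide_le_eq)
  have \<delta>0: "\<delta> \<longlonglongrightarrow> 0" unfolding \<delta>_def
    using tendsto_mult[OF tendsto_const[of "m / 2"] LIMSEQ_Suc[OF lim_1_over_n]] by simp
  have d2: "2 * \<delta> n \<le> (b $ l)\<^sup>2 - (a $ l)\<^sup>2" for n l using \<delta>(2)[of n] ml[of l] by linarith
  define R where "R = (\<lambda>n y. (s (\<delta> n) 2 y * s (\<delta> n) 3 y * c (\<delta> n) 1 y) *\<^sub>R \<phi> y $ 1 + (s (\<delta> n) 1 y * s (\<delta> n) 3 y * c (\<delta> n) 2 y) *\<^sub>R \<phi> y $ 2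
      + (s (\<delta> n) 1 y * s (\<delta> n) 2 y * c (\<delta> n) 3 y) *\<^sub>R \<phi> y $ 3)"
  define H where "H = (\<lambda>n y. (s (\<delta> n) 1 y * s (\<delta> n) 2 y * s (\<delta> n) 3 y) *\<^sub>R ?g y + R n y * \<psi> y)"
  have H: "set_integrable \<mu> \<Gamma>b (H n)" "(LINT y:\<Gamma>b|\<mu>. H n y) = 0" for n
    using cutoff_weak[OF psi \<delta>(1)[of n]] unfolding H_def R_def by auto
  have Rb: "norm (R n y) \<le> 48 * L" if y: "y \<in> \<Gamma>b" for n y
  proof -
    have one: "norm ((s (\<delta> n) i y * s (\<delta> n) j y * c (\<delta> n) l y) *\<^sub>R \<phi> y $ l) \<le> 16 * L" for i j l
    proof -
      have "\<bar>s (\<delta> n) i y * s (\<delta> n) j y\<bar> \<le> 1"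
        using s_range[of "\<delta> n" i y] s_range[of "\<delta> n" j y] by (simp add: mult_le_one)
      then have "norm ((s (\<delta> n) i y * s (\<delta> n) j y * c (\<delta> n) l y) *\<^sub>R \<phi> y $ l) \<le> 1 * (\<bar>c (\<delta> n) l y\<bar> * norm (\<phi> y))"
        unfolding norm_scaleR abs_mult[of "_ * _"] mult.assoc[of _ "\<bar>c _ _ _\<bar>"]
        by (intro mult_mono mult_left_mono Finite_Cartesian_Product.norm_nth_le) auto
      also have "\<dots> \<le> 16 * L" using cutoff_gradient_bound[OF \<delta>(1) d2 y] by simp
      finally show ?thesis .
    qed
    show ?thesis unfolding R_def using one[of 2 3 1] one[of 1 3 2] one[of 1 2 3]
      by (intro order_trans[OF norm_triangle_ineq] order_trans[OF add_mono[OF norm_triangle_ineq order_refl]]) linarith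
  qed
  have Hb: "norm (H n y) \<le> G + 48 * L * \<bar>B\<bar>" if y: "y \<in> \<Gamma>b" for n y
  proof -
    have "\<bar>s (\<delta> n) 1 y * s (\<delta> n) 2 y * s (\<delta> n) 3 y\<bar> \<le> 1"
      using s_range[of "\<delta> n" 1 y] s_range[of "\<delta> n" 2 y] s_range[of "\<delta> n" 3 y] by (simp add: mult_le_one)
    then have "norm ((s (\<delta> n) 1 y * s (\<delta> n) 2 y * s (\<delta> n) 3 y) *\<^sub>R ?g y) \<le> 1 * G"
      unfolding norm_scaleR by (intro mult_mono gG[OF y]) auto
    moreover have "norm (R n y * \<psi> y) \<le> 48 * L * \<bar>B\<bar>"
      unfolding norm_mult using L0 by (intro mult_mono Rb[OF y] Bn[OF y]) auto
    ultimately show ?thesis unfolding H_def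
      using norm_triangle_ineq[of "(s (\<delta> n) 1 y * s (\<delta> n) 2 y * s (\<delta> n) 3 y) *\<^sub>R ?g y" "R n y * \<psi> y"] by linarith
  qed
  have Hlim: "(\<lambda>n. H n y) \<longlonglongrightarrow> ?g y" if y: "y \<in> \<Gamma>b" for y
  proof -
    have ev: "\<forall>\<^sub>F n in sequentially. 2 * \<delta> n \<le> (b $ l)\<^sup>2 - (y $ l)\<^sup>2" for l
    proof -
      have "\<bar>y $ l\<bar> < b $ l" using y by (simp add: \<Gamma>b mem_centered_box)
      then have "\<bar>y $ l\<bar>\<^sup>2 < (b $ l)\<^sup>2" by (rule power_strict_mono) auto
      then have "0 < ((b $ l)\<^sup>2 - (y $ l)\<^sup>2) / 2" by simp
      from order_tendstoD(2)[OF \<delta>0 this] show ?thesis by eventually_elim simp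
    qed
    have "\<forall>\<^sub>F n in sequentially. H n y = ?g y"
      using ev[of 1] ev[of 2] ev[of 3]
    proof eventually_elim
      case (elim n)
      show ?case unfolding H_def R_def using cutoff_trivial[OF \<delta>(1) elim(1)] cutoff_trivial[OF \<delta>(1) elim(2)] cutoff_trivial[OF \<delta>(1) elim(3)]
        by simp
    qed
    then show ?thesis by (rule tendsto_eventually)
  qed
  have "(\<lambda>n. LINT y:\<Gamma>b|\<mu>. H n y) \<longlonglongrightarrow> (LINT y:\<Gamma>b|\<mu>. ?g y)"
    unfolding set_lebesgue_integral_def
  proof (rule integral_dominated_convergence[where w="\<lambda>y. indicator \<Gamma>b y *\<^sub>R (G + 48 * L * \<bar>B\<bar>)"])
    show "(\<lambda>y. indicator \<Gamma>b y *\<^sub>R ?g y) \<in> borel_measurable \<mu>" using mg by (simp add: meas_def measurable_\<mu>)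
    show "(\<lambda>y. indicator \<Gamma>b y *\<^sub>R H n y) \<in> borel_measurable \<mu>" for n
      using H(1)[of n] unfolding set_integrable_def by (rule borel_measurable_integrable)
    show "integrable \<mu> (\<lambda>y. indicator \<Gamma>b y *\<^sub>R (G + 48 * L * \<bar>B\<bar>))"
      using integrable_const[of "G + 48 * L * \<bar>B\<bar>"] by (simp add: set_integrable_def)
    show "AE y in \<mu>. (\<lambda>n. indicator \<Gamma>b y *\<^sub>R H n y) \<longlonglongrightarrow> indicator \<Gamma>b y *\<^sub>R ?g y"
    proof (intro always_eventually allI)
      fix y show "(\<lambda>n. indicator \<Gamma>b y *\<^sub>R H n y) \<longlonglongrightarrow> indicator \<Gamma>b y *\<^sub>R ?g y"
        using Hlim[of y] by (cases "y \<in> \<Gamma>b") simp_all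
    qed
    show "AE y in \<mu>. norm (indicator \<Gamma>b y *\<^sub>R H n y) \<le> indicator \<Gamma>b y *\<^sub>R (G + 48 * L * \<bar>B\<bar>)" for n
      using Hb by (intro always_eventually) (auto simp: indicator_def)
  qed
  then have "(LINT y:\<Gamma>b|\<mu>. ?g y) = 0" unfolding H(2) by (simp add: LIMSEQ_const_iff)
  then show "set_integrable \<mu> \<Gamma>b ?g \<and> (LINT y:\<Gamma>b|\<mu>. ?g y) = 0" using ig by blast
qed

end

section \<open>The hyper-singular operators\<close>

text \<open>
  The boundary of the obstacle and \<open>\<Gamma>\<close> are disjoint closed sets, so the two parts of \<open>\<Gamma>sb\<close> are
  relatively open in it, and the weak divergence theorem holds on the union because it holds on each.
\<close>

theorem theorem3p8:
  fixes a T :: "real^3" and S h c1 c2 \<omega> :: real and P :: nat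
    and \<mu> \<epsilon> k :: "nat \<Rightarrow> real"
    and \<Gamma> \<Gamma>b \<Omega>1 \<Omega>2 U0 \<Gamma>sb :: "(real^3) set"
    and \<nu> :: "real^3 \<Rightarrow> real^3"
    and \<sigma> :: "3 \<Rightarrow> real \<Rightarrow> real"
  assumes a_pos: "\<forall>l. a $ l > 0" and T_pos: "\<forall>l. T $ l > 0"
    and S_pos: "S > 0" and P_ge: "P \<ge> 2"
    and sigma: "\<sigma> = (\<lambda>l. pml_sigma (a $ l) (T $ l) S P)"
    and wavenumbers: "\<forall>j\<in>{1,2}. k j = \<omega> * sqrt (\<mu> j * \<epsilon> j) \<and> k j > 0"
    and layers: "layered a h \<Gamma> \<Omega>1 \<Omega>2"
    and normal: "unit_normal \<Gamma> \<nu>" "points_into \<Gamma> \<Omega>1 \<Omega>2 \<nu>"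
    and truncated: "\<Gamma>b = \<Gamma> \<inter> box (- (a + T)) (a + T)"
    and c: "0 < c1" "c1 < a $ 1" "0 < c2" "c2 < a $ 2"
    and flat: "\<forall>x\<in>\<Gamma>b. \<bar>x $ 1\<bar> > c1 \<or> \<bar>x $ 2\<bar> > c2 \<longrightarrow> \<nu> x = vector [0, 0, - 1]"
    and height: "\<forall>x\<in>\<Gamma>b. \<bar>x $ 3\<bar> < a $ 3"
    and obstacle: "open U0" "bounded U0" "smooth_surface (frontier U0)" "closure U0 \<inter> \<Gamma> = {}"
      "unit_normal (frontier U0) \<nu>"
    and Gamma_star: "\<Gamma>sb = frontier U0 \<union> \<Gamma>b"
  shows
    "(\<forall>\<phi>. C1_up_to_edge \<Gamma>b \<phi> \<and> tangential \<Gamma>b \<nu> \<phi> \<and> (\<forall>x\<in>edge \<Gamma>b. \<phi> x = 0) \<longrightarrow>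
       (\<forall>j\<in>{1,2}. \<forall>x\<in>\<Gamma>b.
          hypersing_converges \<sigma> (k j) \<Gamma>b \<phi> x \<and> layers_converge \<sigma> (k j) \<Gamma>b \<nu> \<phi> x \<and>
          (pv_div \<sigma> (k j) \<Gamma>b \<phi> differentiable (at x within \<Gamma>b) \<longleftrightarrow>
           scal_layer \<sigma> (k j) \<Gamma>b (surf_div \<Gamma>b \<nu> \<phi>) differentiable (at x within \<Gamma>b)) \<and>
          hypersing \<sigma> (k j) \<Gamma>b \<nu> \<phi> x =
            complex_of_real ((k j)\<^sup>2) *s
              ccross (cvec (\<nu> x)) (Bmat \<sigma> x *v vec_layer \<sigma> (k j) \<Gamma>b \<phi> x)
            + surf_curl \<Gamma>b \<nu> (scal_layer \<sigma> (k j) \<Gamma>b (surf_div \<Gamma>b \<nu> \<phi>)) x))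
     \<and>
     (\<forall>\<phi>. C1_up_to_edge \<Gamma>sb \<phi> \<and> tangential \<Gamma>sb \<nu> \<phi> \<and> (\<forall>x\<in>edge \<Gamma>b. \<phi> x = 0) \<longrightarrow>
       (\<forall>x\<in>\<Gamma>sb.
          hypersing_converges \<sigma> (k 1) \<Gamma>sb \<phi> x \<and> layers_converge \<sigma> (k 1) \<Gamma>sb \<nu> \<phi> x \<and>
          (pv_div \<sigma> (k 1) \<Gamma>sb \<phi> differentiable (at x within \<Gamma>sb) \<longleftrightarrow>
           scal_layer \<sigma> (k 1) \<Gamma>sb (surf_div \<Gamma>sb \<nu> \<phi>) differentiable (at x within \<Gamma>sb)) \<and>
          hypersing \<sigma> (k 1) \<Gamma>sb \<nu> \<phi> x =
            complex_of_real ((k 1)\<^sup>2) *s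
              ccross (cvec (\<nu> x)) (Bmat \<sigma> x *v vec_layer \<sigma> (k 1) \<Gamma>sb \<phi> x)
            + surf_curl \<Gamma>sb \<nu> (scal_layer \<sigma> (k 1) \<Gamma>sb (surf_div \<Gamma>sb \<nu> \<phi>)) x))"
proof -
  interpret stretching \<sigma> "2 * S"
    unfolding sigma by (rule stretching_pml[OF a_pos T_pos S_pos P_ge])
  define b where "b = a + T"
  have lay: "smooth_surface \<Gamma>" "frontier \<Omega>1 = \<Gamma>" "\<Gamma> - box (- a) a = plane h - box (- a) a"
    using layers unfolding layered_def by auto
  have closed: "closed \<Gamma>" using lay(2) frontier_closed by metis
  have \<Gamma>b: "\<Gamma>b = \<Gamma> \<inter> box (- b) b" unfolding b_def by (rule truncated)
  have bounded_\<Gamma>b: "bounded \<Gamma>b" unfolding \<Gamma>b by (rule bounded_subset[OF bounded_box]) auto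
  have o\<Gamma>b: "openin (top_of_set \<Gamma>) \<Gamma>b" unfolding \<Gamma>b by (rule openin_open_Int[OF open_box])
  have nu\<Gamma>b: "unit_normal \<Gamma>b \<nu>" by (rule unit_normal_openin[OF o\<Gamma>b normal(1)])
  have interface: "truncated_interface \<Gamma> a b h \<nu> \<phi> F F' L \<Gamma>b"
    if "tangential \<Gamma>b \<nu> \<phi>" "\<forall>x\<in>edge \<Gamma>b. \<phi> x = 0" "C1_along (closure \<Gamma>b) F F'" "\<And>y. y \<in> closure \<Gamma>b \<Longrightarrow> \<phi> y = F y"
      "L \<ge> 0" "\<And>y l. y \<in> closure \<Gamma>b \<Longrightarrow> norm (F' y (axis l 1)) \<le> L" "\<And>y. y \<in> closure \<Gamma>b \<Longrightarrow> norm (\<phi> y) \<le> L"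
    for \<phi> F F' L
  proof
    show "0 < a $ l" "a $ l < b $ l" for l using a_pos T_pos by (auto simp: b_def)
    show "\<bar>y $ 3\<bar> < a $ 3" if "y \<in> \<Gamma>b" for y using height that by blast
    show "\<phi> y = 0" if "y \<in> edge \<Gamma>b" for y using \<open>\<forall>x\<in>edge \<Gamma>b. \<phi> x = 0\<close> that by blast
  qed (fact closed lay(1) lay(3) \<Gamma>b nu\<Gamma>b that)+
  show ?thesis
  proof (intro conjI[of "\<forall>\<phi>. _ \<phi> \<longrightarrow> _ \<phi>"] allI impI ballI)
    fix \<phi> j x
    assume phi: "C1_up_to_edge \<Gamma>b \<phi> \<and> tangential \<Gamma>b \<nu> \<phi> \<and> (\<forall>x\<in>edge \<Gamma>b. \<phi> x = 0)" and x: "x \<in> \<Gamma>b"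
    obtain F F' L where ext: "C1_along (closure \<Gamma>b) F F'" "\<And>y. y \<in> closure \<Gamma>b \<Longrightarrow> \<phi> y = F y" "(L::real) \<ge> 0"
      "\<And>y l. y \<in> closure \<Gamma>b \<Longrightarrow> norm (F' y (axis l 1)) \<le> L" "\<And>y. y \<in> closure \<Gamma>b \<Longrightarrow> norm (\<phi> y) \<le> L"
    proof (rule C1_up_to_edge_extension[OF conjunct1[OF phi] bounded_\<Gamma>b])
      fix F F' L assume "C1_along (closure \<Gamma>b) F F'" "\<And>y. y \<in> closure \<Gamma>b \<Longrightarrow> \<phi> y = F y" "(L::real) \<ge> 0"
        "\<And>y l. y \<in> closure \<Gamma>b \<Longrightarrow> norm (F' y (axis l 1)) \<le> L" "\<And>y. y \<in> closure \<Gamma>b \<Longrightarrow> norm (\<phi> y) \<le> L"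
      then show thesis by (rule that)
    qed
    interpret truncated_interface \<Gamma> a b h \<nu> \<phi> F F' L \<Gamma>b
      by (rule interface) (use phi ext in auto)
    show "hypersing_converges \<sigma> (k j) \<Gamma>b \<phi> x \<and> layers_converge \<sigma> (k j) \<Gamma>b \<nu> \<phi> x \<and>
          (pv_div \<sigma> (k j) \<Gamma>b \<phi> differentiable (at x within \<Gamma>b) \<longleftrightarrow>
           scal_layer \<sigma> (k j) \<Gamma>b (surf_div \<Gamma>b \<nu> \<phi>) differentiable (at x within \<Gamma>b)) \<and>
          hypersing \<sigma> (k j) \<Gamma>b \<nu> \<phi> x =
            complex_of_real ((k j)\<^sup>2) *s
              ccross (cvec (\<nu> x)) (Bmat \<sigma> x *v vec_layer \<sigma> (k j) \<Gamma>b \<phi> x)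
            + surf_curl \<Gamma>b \<nu> (scal_layer \<sigma> (k j) \<Gamma>b (surf_div \<Gamma>b \<nu> \<phi>)) x"
      by (rule hypersingular_identity[OF borel_\<Gamma>b smooth_\<Gamma>b finite_\<Gamma>b bounded_\<Gamma>b nu\<Gamma>b conjunct1[OF phi] weak_div_\<Gamma>b x])
  next
    fix \<phi> x
    assume phi: "C1_up_to_edge \<Gamma>sb \<phi> \<and> tangential \<Gamma>sb \<nu> \<phi> \<and> (\<forall>x\<in>edge \<Gamma>b. \<phi> x = 0)" and x: "x \<in> \<Gamma>sb"
    let ?U = "frontier U0"
    have cU: "compact ?U" by (rule compact_frontier_bounded[OF obstacle(2)])
    have bounded_\<Gamma>sb: "bounded \<Gamma>sb" unfolding Gamma_star using cU bounded_\<Gamma>b by (simp add: compact_imp_bounded)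
    obtain F F' L where ext: "C1_along (closure \<Gamma>sb) F F'" "\<And>y. y \<in> closure \<Gamma>sb \<Longrightarrow> \<phi> y = F y" "(L::real) \<ge> 0"
      "\<And>y l. y \<in> closure \<Gamma>sb \<Longrightarrow> norm (F' y (axis l 1)) \<le> L" "\<And>y. y \<in> closure \<Gamma>sb \<Longrightarrow> norm (\<phi> y) \<le> L"
    proof (rule C1_up_to_edge_extension[OF conjunct1[OF phi] bounded_\<Gamma>sb])
      fix F F' L assume "C1_along (closure \<Gamma>sb) F F'" "\<And>y. y \<in> closure \<Gamma>sb \<Longrightarrow> \<phi> y = F y" "(L::real) \<ge> 0"
        "\<And>y l. y \<in> closure \<Gamma>sb \<Longrightarrow> norm (F' y (axis l 1)) \<le> L" "\<And>y. y \<in> closure \<Gamma>sb \<Longrightarrow> norm (\<phi> y) \<le> L"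
      then show thesis by (rule that)
    qed
    have sub: "closure \<Gamma>b \<subseteq> closure \<Gamma>sb" "?U \<subseteq> closure \<Gamma>sb"
      unfolding Gamma_star using closure_subset[of "?U \<union> \<Gamma>b"] by (auto intro!: closure_mono)
    have tanc: "tangential \<Gamma>b \<nu> \<phi>" "tangential ?U \<nu> \<phi>" using phi by (auto simp: tangential_def Gamma_star)
    have F\<Gamma>b: "C1_along (closure \<Gamma>b) F F'" and FU: "C1_along ?U F F'"
      by (rule C1_along_subset[OF ext(1) sub(1)], rule C1_along_subset[OF ext(1) sub(2)])
    interpret truncated_interface \<Gamma> a b h \<nu> \<phi> F F' L \<Gamma>b
      by (rule interface) (use phi ext sub tanc F\<Gamma>b in auto)
    have disj: "?U \<inter> \<Gamma> = {}" using obstacle(4) by (auto simp: frontier_def)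
    have disjb: "?U \<inter> \<Gamma>b = {}" using disj by (auto simp: \<Gamma>b)
    have "?U = \<Gamma>sb \<inter> - \<Gamma>" "\<Gamma>b = \<Gamma>sb \<inter> - ?U" unfolding Gamma_star using disj by (auto simp: \<Gamma>b)
    then have o: "openin (top_of_set \<Gamma>sb) ?U" "openin (top_of_set \<Gamma>sb) \<Gamma>b"
      using openin_open_Int[OF open_Compl[OF closed], of \<Gamma>sb] openin_open_Int[OF open_Compl[OF frontier_closed], of \<Gamma>sb U0] by simp_all
    note o' = o[unfolded Gamma_star]
    have bU: "?U \<in> sets borel" using frontier_closed by (rule borel_closed)
    have b\<Gamma>sb: "\<Gamma>sb \<in> sets borel" unfolding Gamma_star using bU borel_\<Gamma>b by (rule sets.Un)
    have s\<Gamma>sb: "smooth_surface \<Gamma>sb" unfolding Gamma_star by (rule union_pieces(1)[OF o' obstacle(3) smooth_\<Gamma>b])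
    have nu\<Gamma>sb: "unit_normal \<Gamma>sb \<nu>" unfolding Gamma_star by (rule union_pieces(2)[OF o' obstacle(5) nu\<Gamma>b])
    have weakU: "weak_div ?U \<nu> \<phi>"
      by (rule weak_div_compact[OF obstacle(3) cU obstacle(5) FU _ tanc(2)]) (use ext(2) sub(2) in auto)
    have weak: "weak_div \<Gamma>sb \<nu> \<phi>" unfolding Gamma_star
      by (rule weak_div_union[OF o' disjb bU borel_\<Gamma>b s\<Gamma>sb[unfolded Gamma_star] weakU weak_div_\<Gamma>b])
    have "emeasure (surface_measure \<Gamma>sb) \<Gamma>sb \<le> emeasure (surface_measure \<Gamma>sb) ?U + emeasure (surface_measure \<Gamma>sb) \<Gamma>b"
      using bU borel_\<Gamma>b by (subst (2) Gamma_star) (intro emeasure_subadditive, auto simp: sets_surface_measure[OF b\<Gamma>sb s\<Gamma>sb])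
    also have "\<dots> = emeasure (surface_measure ?U) ?U + emeasure (surface_measure \<Gamma>b) \<Gamma>b"
      using emeasure_openin[OF b\<Gamma>sb s\<Gamma>sb bU o(1)] emeasure_openin[OF b\<Gamma>sb s\<Gamma>sb borel_\<Gamma>b o(2)] by simp
    also have "\<dots> < \<infinity>"
      using emeasure_compact_finite[OF bU obstacle(3) cU order_refl] finite_\<Gamma>b by simp
    finally have fin: "emeasure (surface_measure \<Gamma>sb) \<Gamma>sb < \<infinity>" .
    show "hypersing_converges \<sigma> (k 1) \<Gamma>sb \<phi> x \<and> layers_converge \<sigma> (k 1) \<Gamma>sb \<nu> \<phi> x \<and>
          (pv_div \<sigma> (k 1) \<Gamma>sb \<phi> differentiable (at x within \<Gamma>sb) \<longleftrightarrow>
           scal_layer \<sigma> (k 1) \<Gamma>sb (surf_div \<Gamma>sb \<nu> \<phi>) differentiable (at x within \<Gamma>sb)) \<and>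
          hypersing \<sigma> (k 1) \<Gamma>sb \<nu> \<phi> x =
            complex_of_real ((k 1)\<^sup>2) *s
              ccross (cvec (\<nu> x)) (Bmat \<sigma> x *v vec_layer \<sigma> (k 1) \<Gamma>sb \<phi> x)
            + surf_curl \<Gamma>sb \<nu> (scal_layer \<sigma> (k 1) \<Gamma>sb (surf_div \<Gamma>sb \<nu> \<phi>)) x"
      by (rule hypersingular_identity[OF b\<Gamma>sb s\<Gamma>sb fin bounded_\<Gamma>sb nu\<Gamma>sb conjunct1[OF phi] weak x])
  qed
qed

end
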